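(* (i) Let $(H,\Delta,\varepsilon)$ be a braided coalgebra and $V$ a braided right $H$-comodule with coaction $\rho_R:V\to V\otimes H$, $\rho_R(v)=v_{(0)}\otimes v_{(1)}$. Let $U\subset H'$ be a non-degenerate unital subalgebra with respect to the product $\underline m$ such that $\Psi_{UU}$, $\Psi_{UH}^\circ$ and $\Psi_{UV}^\circ$ are bijective. Assume that $\Psi_{HV}^{\circ\circ}:H\otimes V\to(V'\otimes U)'$, $\Psi_{HV}^{\circ\circ}(a\otimes v)(e\otimes f):=\langle\langle e\otimes a,(\Psi_{UV}^{\circ})^{-1}(v\otimes f)\rangle\rangle$, is a bijection $H\otimes V\to V\otimes H\subset(V'\otimes U)'$. Consider $\rho_R^{\backprime}:V\to(V'\otimes U)'$, $\rho_R^{\backprime}(v)(e\otimes f):=e(v_{(0)})\,\mathrm{ev}\big((\Psi_{UH}^{\circ})^{-1}(v_{(1)}\otimes f)\big)$, where $\mathrm{ev}:U\otimes H\to\mathbb K$ is evaluation. If $\rho_R^{\backprime}(V)\subset V\otimes H\subset(V'\otimes U)'$, then $\rho_R^{\backprime}$ is a right $H$-coaction that turns $V$ into a braided right $H$-comodule with respect to the braiding $\Psi_{HV}^{\circ\circ}$ and the coproduct $\Delta_{-2}:=\Psi_{HH}^{-2}\Delta$ on $H$. If $H$ is a braided bialgebra, $V$ is a braided right $H$-comodule algebra and $U$ is a standard left dual of $H$, then $\rho_R^{\backprime}$ turns $V$ into a braided right $H^{(2,-2)}$-comodule algebra. (ii) Let $(H,m)$ be a braided unital algebra and $V$ a braided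 left $H$-module with action $\nu_L:H\otimes V\to V$. Let $U$ be a non-degenerate subcoalgebra of $H^{\underline\circ}$ such that $\Psi_{UU}$ and $\Psi_{UV}^\circ$ are bijective, and suppose that the map $\rho_R:V\to(V'\otimes H)'$, $\rho_R(v)(e\otimes a):=e\big(\nu_L(\Psi_{HV}^{-1}(v\otimes a))\big)$, satisfies $\rho_R(V)\subset V\otimes U$. Assume that $\Psi_{HV}^{\circ\circ}$ (defined by the formula in (i)) is a bijection $H\otimes V\to V\otimes H$, and that there is a non-degenerate subspace $W\subset V'$ such that $\Psi_{WH}^{\circ\circ}:W\otimes H\to(U\otimes V)'$, $\Psi_{WH}^{\circ\circ}(e\otimes a)(f\otimes v):=\langle\langle f\otimes e,\Psi_{HV}^{\circ\circ}(a\otimes v)\rangle\rangle$, is a bijection $W\otimes H\to H\otimes W\subset(U\otimes V)'$. Then the map $\nu_L^{\backprime}:H\otimes V\to W'$, $\nu_L^{\backprime}(a\otimes v)(e):=\langle\cdot,\cdot\rangle(\nu_L\otimes\mathrm{id})(\Psi_{HV}^{-1}\otimes\mathrm{id})(\mathrm{id}\otimes\Psi_{WH}^{\circ\circ})(v\otimes e\otimes a)$, turns $V$ (embedded in $W'$) into a braided left $H$-module with respect to the braiding $\Psi_{HV}^{\circ\circ}$ and the multiplication $m_{-2}:=m\Psi_{HH}^{-2}$ on $H$. If $H$ is a braided bialgebra, $V$ is a braided left $H$-module algebra and $U$ is a standard left dual of $H$, then $\nu_L^{\backprime}$ turns $V$ into a braided left $H^{(-2,2)}$-module algebra. The opposite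 versions hold as well: (i') Let $H$ be a braided coalgebra, $V$ a braided left $H$-comodule with $\rho_L(v)=v_{(-1)}\otimes v_{(0)}$, and $U\subset H'$ a non-degenerate unital subalgebra with respect to $\underline m$ such that $\Psi_{UU}$, $\Psi_{HU}^\circ$, $\Psi_{VU}^\circ$ are bijective. Assume that $\Psi_{VH}^{\circ\circ}(v\otimes a)(f\otimes e):=\langle\langle a\otimes e,(\Psi_{VU}^\circ)^{-1}(f\otimes v)\rangle\rangle$ is a bijection $V\otimes H\to H\otimes V\subset(U\otimes V')'$. If $\rho_L^{\backprime}(v)(f\otimes e):=\mathrm{ev}\big((\Psi_{HU}^\circ)^{-1}(f\otimes v_{(-1)})\big)\,e(v_{(0)})$ (with $\mathrm{ev}:H\otimes U\to\mathbb K$ the evaluation) satisfies $\rho_L^{\backprime}(V)\subset H\otimes V$, then it makes $V$ a braided left $H$-comodule with respect to $\Psi_{VH}^{\circ\circ}$ and $\Delta_{-2}$; if $H$ is a braided bialgebra, $V$ a braided left $H$-comodule algebra and $U$ a standard right dual of $H$, then $V$ becomes a braided left $H^{(2,-2)}$-comodule algebra. (ii') Let $H$ be a braided unital algebra, $V$ a braided right $H$-module with action $\nu_R$, and $U$ a non-degenerate subcoalgebra of $H^{\underline\circ}$ such that $\Psi_{UU}$, $\Psi_{VU}^\circ$ are bijective and $\rho_L(v)(a\otimes e):=e(\nu_R(\Psi_{VH}^{-1}(a\otimes v)))$ satisfies $\rho_L(V)\subset U\otimes V\subset(H\otimes V')'$. Assume that $\Psi_{VH}^{\circ\circ}$ (defined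 by the formula in (i')) is a bijection $V\otimes H\to H\otimes V$ and that there is a non-degenerate subspace $W\subset V'$ such that $\Psi_{HW}^{\circ\circ}(a\otimes e)(v\otimes f):=\langle\langle e\otimes f,\Psi_{VH}^{\circ\circ}(v\otimes a)\rangle\rangle$ is a bijection $H\otimes W\to W\otimes H\subset(V\otimes U)'$. Then $\nu_R^{\backprime}(v\otimes a)(e):=\langle\cdot,\cdot\rangle(\mathrm{id}\otimes\nu_R)(\mathrm{id}\otimes\Psi_{VH}^{-1})(\Psi_{HW}^{\circ\circ}\otimes\mathrm{id})(a\otimes e\otimes v)$ turns $V$ into a braided right $H$-module with respect to $\Psi_{VH}^{\circ\circ}$ and $m_{-2}$; if $H$ is a braided bialgebra, $V$ a braided right $H$-module algebra and $U$ a standard right dual of $H$, then $V$ becomes a braided right $H^{(-2,2)}$-module algebra.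
   Context: All vector spaces are over a fixed field $\mathbb K$, $\otimes$ is the algebraic tensor product, $X'$ is the full linear dual of $X$, and composition of maps is written by juxtaposition. A braiding on $V$ is a bijective linear map $\Psi_{VV}:V\otimes V\to V\otimes V$ with $(\Psi_{VV}\otimes\mathrm{id})(\mathrm{id}\otimes\Psi_{VV})(\Psi_{VV}\otimes\mathrm{id})=(\mathrm{id}\otimes\Psi_{VV})(\Psi_{VV}\otimes\mathrm{id})(\mathrm{id}\otimes\Psi_{VV})$; $V$ is then a braided vector space. Let $\Psi_{VW}:V\otimes W\to W\otimes V$ be bijective and linear. If $V$ is braided, $W$ is a left $V$-braided vector space if $(\Psi_{VW}\otimes\mathrm{id})(\mathrm{id}\otimes\Psi_{VW})(\Psi_{VV}\otimes\mathrm{id})=(\mathrm{id}\otimes\Psi_{VV})(\Psi_{VW}\otimes\mathrm{id})(\mathrm{id}\otimes\Psi_{VW})$. If $W$ is braided, $V$ is a right $W$-braided vector space if $(\mathrm{id}\otimes\Psi_{VW})(\Psi_{VW}\otimes\mathrm{id})(\mathrm{id}\otimes\Psi_{WW})=(\Psi_{WW}\otimes\mathrm{id})(\mathrm{id}\otimes\Psi_{VW})(\Psi_{VW}\otimes\mathrm{id})$. Compatibility of $\Psi=\Psi_{VW}$: with the multiplication of an algebra $V$: $\Psi(m_V\otimes\mathrm{id})=(\mathrm{id}\otimes m_V)(\Psi\otimes\mathrm{id})(\mathrm{id}\otimes\Psi)$ and $\Psi(1\otimes w)=w\otimes1$ if $1\in V$; with the multiplication of an algebra $W$: $\Psi(\mathrm{id}\otimes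 m_W)=(m_W\otimes\mathrm{id})(\mathrm{id}\otimes\Psi)(\Psi\otimes\mathrm{id})$ and $\Psi(v\otimes1)=1\otimes v$ if $1\in W$; with the comultiplication of a coalgebra $V$: $(\mathrm{id}\otimes\Delta)\Psi=(\Psi\otimes\mathrm{id})(\mathrm{id}\otimes\Psi)(\Delta\otimes\mathrm{id})$ and $(\mathrm{id}\otimes\varepsilon)\Psi=\varepsilon\otimes\mathrm{id}$; with the comultiplication of a coalgebra $W$: $(\Delta\otimes\mathrm{id})\Psi=(\mathrm{id}\otimes\Psi)(\Psi\otimes\mathrm{id})(\mathrm{id}\otimes\Delta)$ and $(\varepsilon\otimes\mathrm{id})\Psi=\mathrm{id}\otimes\varepsilon$. A braided (co)algebra is a (co)algebra with a braiding satisfying both compatibility conditions with its (co)multiplication. A braided bialgebra is a unital algebra $(H,m)$ with a coalgebra structure $(\Delta,\varepsilon)$ and a braiding $\Psi_{HH}$ making it a braided algebra and a braided coalgebra, such that $\Delta m=(m\otimes m)(\mathrm{id}\otimes\Psi_{HH}\otimes\mathrm{id})(\Delta\otimes\Delta)$, $\Delta(1)=1\otimes1$, and $\varepsilon$ is a unital algebra homomorphism. For $n\in\mathbb Z$, $H^{(n,-n)}$ is the braided bialgebra with the same space, unit, counit and braiding $\Psi_{HH}$, product $m\Psi_{HH}^n$ and coproduct $\Psi_{HH}^{-n}\Delta$. Throughout, $H$ keeps the braiding $\Psi_{HH}$. Braided modules over a braided (unital) algebra $(A,m)$: a braided left $A$-module is a left $A$-braided vector space $W$ with $\Psi_{AW}$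 compatible with $m$ and a map $\nu_L:A\otimes W\to W$ with $\nu_L(\mathrm{id}\otimes\nu_L)=\nu_L(m\otimes\mathrm{id})$, $\nu_L(1\otimes w)=w$, $\Psi_{AW}(\mathrm{id}\otimes\nu_L)=(\nu_L\otimes\mathrm{id})(\mathrm{id}\otimes\Psi_{AW})(\Psi_{AA}\otimes\mathrm{id})$. A braided right $A$-module is a right $A$-braided vector space $V$ with $\Psi_{VA}$ compatible with $m$ and $\nu_R:V\otimes A\to V$ with $\nu_R(\nu_R\otimes\mathrm{id})=\nu_R(\mathrm{id}\otimes m)$, $\nu_R(v\otimes1)=v$, $\Psi_{VA}(\nu_R\otimes\mathrm{id})=(\mathrm{id}\otimes\nu_R)(\Psi_{VA}\otimes\mathrm{id})(\mathrm{id}\otimes\Psi_{AA})$. Braided comodules over a braided coalgebra $H$: a braided right $H$-comodule is a left $H$-braided vector space $V$ with $\Psi_{HV}$ compatible with the comultiplication of $H$ and $\rho_R:V\to V\otimes H$ with $(\rho_R\otimes\mathrm{id})\rho_R=(\mathrm{id}\otimes\Delta)\rho_R$, $(\mathrm{id}\otimes\varepsilon)\rho_R=\mathrm{id}$, $(\rho_R\otimes\mathrm{id})\Psi_{HV}=(\mathrm{id}\otimes\Psi_{HH})(\Psi_{HV}\otimes\mathrm{id})(\mathrm{id}\otimes\rho_R)$. A braided left $H$-comodule is a right $H$-braided vector space $V$ with $\Psi_{VH}$ compatible with the comultiplication of $H$ and $\rho_L:V\to H\otimes V$ with $(\mathrm{id}\otimes\rho_L)\rho_L=(\Delta\otimes\mathrm{id})\rho_L$,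 $(\varepsilon\otimes\mathrm{id})\rho_L=\mathrm{id}$, $(\mathrm{id}\otimes\rho_L)\Psi_{VH}=(\Psi_{HH}\otimes\mathrm{id})(\mathrm{id}\otimes\Psi_{VH})(\rho_L\otimes\mathrm{id})$. (Co)module algebras: let $H$ be a braided bialgebra and $B$ a braided algebra. Suppose $B$ is left $H$-braided with $\Psi_{HB}$ compatible with the multiplications of $H$ and $B$ and the comultiplication of $H$. $B$ is a braided left $H$-module algebra if it is a braided left $H$-module with $\nu_L(\mathrm{id}\otimes m_B)=m_B(\nu_L\otimes\nu_L)(\mathrm{id}\otimes\Psi_{HB}\otimes\mathrm{id})(\Delta\otimes\mathrm{id}\otimes\mathrm{id})$ and, if $1\in B$, $\nu_L(h\otimes1)=\varepsilon(h)1$; a braided right $H$-comodule algebra if it is a braided right $H$-comodule with $\rho_Rm_B=(m_B\otimes m_H)(\mathrm{id}\otimes\Psi_{HB}\otimes\mathrm{id})(\rho_R\otimes\rho_R)$ and, if $1\in B$, $\rho_R(1)=1\otimes1$. Mirror versions: $B$ is right $H$-braided with $\Psi_{BH}$ satisfying the same compatibilities; braided right $H$-module algebra: $\nu_R(m_B\otimes\mathrm{id})=m_B(\nu_R\otimes\nu_R)(\mathrm{id}\otimes\Psi_{BH}\otimes\mathrm{id})(\mathrm{id}\otimes\mathrm{id}\otimes\Delta)$, $\nu_R(1\otimes h)=\varepsilon(h)1$; braided left $H$-comodule algebra: $\rho_Lm_B=(m_H\otimes m_B)(\mathrm{id}\otimes\Psi_{BH}\otimes\mathrm{id})(\rho_L\otimes\rho_L)$,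 $\rho_L(1)=1\otimes1$. Duality notation: $\langle f,a\rangle=\langle a,f\rangle=f(a)$. A subspace of $X'$ is non-degenerate if it separates the points of $X$. $\langle\langle\xi\otimes\eta,x\otimes y\rangle\rangle:=\langle\xi,y\rangle\langle\eta,x\rangle$. Tensor products are embedded into duals by $(\xi\otimes\eta)(x\otimes y)=\langle\xi,x\rangle\langle\eta,y\rangle$. For $f,g\in U$, $a,b\in H$, $v\in V$, $e\in V'$ define $\Psi_{UU}(f\otimes g)(b\otimes a):=\langle\langle f\otimes g,\Psi_{HH}(a\otimes b)\rangle\rangle$ (values in $(H\otimes H)'\supset U\otimes U$); if $V$ is left $H$-braided, $\Psi_{UV}^\circ(f\otimes v)(e\otimes a):=\langle\langle e\otimes f,\Psi_{HV}^{-1}(v\otimes a)\rangle\rangle$ (values in $(V'\otimes H)'\supset V\otimes U$); if $V$ is right $H$-braided, $\Psi_{VU}^\circ(v\otimes f)(a\otimes e):=\langle\langle f\otimes e,\Psi_{VH}^{-1}(a\otimes v)\rangle\rangle$ (values in $(H\otimes V')'\supset U\otimes V$); $\Psi_{UH}^\circ(g\otimes a)(f\otimes b):=\langle\langle f\otimes g,\Psi_{HH}^{-1}(a\otimes b)\rangle\rangle$, $f\in H'$ (values in $(H'\otimes H)'\supset H\otimes U$); $\Psi_{HU}^\circ(b\otimes f)(a\otimes g):=\langle\langle f\otimes g,\Psi_{HH}^{-1}(a\otimes b)\rangle\rangle$, $g\in H'$ (values in $(H\otimes H')'\supset U\otimes H$). Such a map $\Psi_{XY}$ is called bijective if it is a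 bijection $X\otimes Y\to Y\otimes X$. Product and coproduct on duals: $\underline m(f\otimes g)(a):=\langle\langle f\otimes g,\Psi_{HH}^{-1}(\Delta(a))\rangle\rangle$ on $H'$, with unit $\varepsilon$ (for $H$ a braided coalgebra); $\underline\Delta(f)$ is determined by $\langle\langle\underline\Delta(f),a\otimes b\rangle\rangle=f(m\Psi_{HH}(a\otimes b))$ (for $H$ a braided unital algebra). $H^{\underline\circ}$ is the largest coalgebra in $H'$ with coproduct $\underline\Delta$ and counit $f\mapsto f(1)$. A standard left (resp. right) dual of a braided bialgebra $H$ is a non-degenerate subspace $U\subset H'$ containing $\varepsilon$, closed under $\underline m$, with $\underline\Delta(U)\subset U\otimes U$, and such that $\Psi_{UU}$ and $\Psi_{UH}^\circ$ (resp. $\Psi_{UU}$ and $\Psi_{HU}^\circ$) are bijective; $U$ is then regarded as braided bialgebra with product $\underline m$, unit $\varepsilon$, coproduct $\underline\Delta$, counit $f\mapsto f(1)$ and braiding $\Psi_{UU}$. *)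

theory Defs
  imports Complex_Main "HOL-Library.Function_Algebras"
begin

text \<open>
  A vector space over the field \<open>'k\<close> is a linear subspace of the vector space given by a type and
  a scalar multiplication; a full type is the case \<^term>\<open>carr X = UNIV\<close>.  Keeping the carrier
  explicit lets duals, tensor products and subspaces of duals be spaces of the same kind.
\<close>

record ('k, 'a) vs =
  carr :: "'a set"
  scal :: "'k \<Rightarrow> 'a \<Rightarrow> 'a"

definition vspace :: "('k::field, 'a::ab_group_add) vs \<Rightarrow> bool" where
  "vspace X \<longleftrightarrow> vector_space (scal X) \<and> module.subspace (scal X) (carr X)"

definition subspace_of :: "('k::field, 'a::ab_group_add) vs \<Rightarrow> ('k, 'a) vs \<Rightarrow> bool" where
  "subspace_of Y X \<longleftrightarrow> scal Y = scal X \<and> carr Y \<subseteq> carr X \<and> module.subspace (scal X) (carr Y)"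

definition ground :: "('k::field, 'k) vs" where
  "ground = \<lparr>carr = UNIV, scal = (*)\<rparr>"

definition linear_map ::
    "('k::field, 'a::ab_group_add) vs \<Rightarrow> ('k, 'b::ab_group_add) vs \<Rightarrow> ('a \<Rightarrow> 'b) \<Rightarrow> bool" where
  "linear_map X Y f \<longleftrightarrow>
     (\<forall>x\<in>carr X. f x \<in> carr Y) \<and>
     (\<forall>x\<in>carr X. \<forall>y\<in>carr X. f (x + y) = f x + f y) \<and>
     (\<forall>c. \<forall>x\<in>carr X. f (scal X c x) = scal Y c (f x))"

text \<open>
  Linear maps are bundled with their source and target.  The underlying function of a member of
  \<open>Hom X Y\<close> vanishes outside \<^term>\<open>carr X\<close>, so that equality of linear maps is equality in the
  logic.
\<close>

record ('k, 'a, 'b) lmap =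
  src :: "('k, 'a) vs"
  tgt :: "('k, 'b) vs"
  app :: "'a \<Rightarrow> 'b" (infixl "\<cdot>" 90)

definition mk :: "('k, 'a) vs \<Rightarrow> ('k, 'b::zero) vs \<Rightarrow> ('a \<Rightarrow> 'b) \<Rightarrow> ('k, 'a, 'b) lmap" where
  "mk X Y f = \<lparr>src = X, tgt = Y, app = (\<lambda>x. if x \<in> carr X then f x else 0)\<rparr>"

definition Hom ::
    "('k::field, 'a::ab_group_add) vs \<Rightarrow> ('k, 'b::ab_group_add) vs \<Rightarrow> ('k, 'a, 'b) lmap set" where
  "Hom X Y = {f. src f = X \<and> tgt f = Y \<and> linear_map X Y (app f) \<and> (\<forall>x. x \<notin> carr X \<longrightarrow> f\<cdot>x = 0)}"

definition Iso ::
    "('k::field, 'a::ab_group_add) vs \<Rightarrow> ('k, 'b::ab_group_add) vs \<Rightarrow> ('k, 'a, 'b) lmap set" where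
  "Iso X Y = {f \<in> Hom X Y. bij_betw (app f) (carr X) (carr Y)}"

definition Id :: "('k, 'a::zero) vs \<Rightarrow> ('k, 'a, 'a) lmap" where
  "Id X = mk X X (\<lambda>x. x)"

definition comp_lmap ::
    "('k, 'b, 'c::zero) lmap \<Rightarrow> ('k, 'a, 'b) lmap \<Rightarrow> ('k, 'a, 'c) lmap" (infixr "\<odot>" 65) where
  "g \<odot> f = mk (src f) (tgt g) (\<lambda>x. g\<cdot>(f\<cdot>x))"

definition linv :: "('k, 'a::zero, 'b) lmap \<Rightarrow> ('k, 'b, 'a) lmap" where
  "linv f = mk (tgt f) (src f) (inv_into (carr (src f)) (app f))"

definition ipow :: "('k, 'a::zero, 'a) lmap \<Rightarrow> int \<Rightarrow> ('k, 'a, 'a) lmap" where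
  "ipow f n = (if 0 \<le> n then (((\<odot>) f) ^^ nat n) (Id (src f))
               else (((\<odot>) (linv f)) ^^ nat (- n)) (Id (src f)))"

definition dual :: "('k::field, 'a::ab_group_add) vs \<Rightarrow> ('k, 'a \<Rightarrow> 'k) vs" where
  "dual X = \<lparr>carr = {f. linear_map X ground f \<and> (\<forall>x. x \<notin> carr X \<longrightarrow> f x = 0)},
             scal = (\<lambda>c f x. c * f x)\<rparr>"

text \<open>
  The tensor product is realised inside the dual of the space of bilinear forms: \<open>x \<otimes> y\<close> is
  evaluation of bilinear forms at \<open>(x, y)\<close>, and \<open>X \<otimes> Y\<close> is the span of these elements.  Over a
  field this has the universal property of the tensor product; see \<open>tlift_Hom\<close>, \<open>tlift_pure\<close> and
  \<open>tensor_Hom_eqI\<close> below.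
\<close>

type_synonym ('k, 'a, 'b) tensor = "('a \<Rightarrow> 'b \<Rightarrow> 'k) \<Rightarrow> 'k"

definition bilinear_map ::
    "('k::field, 'a::ab_group_add) vs \<Rightarrow> ('k, 'b::ab_group_add) vs \<Rightarrow> ('k, 'c::ab_group_add) vs
      \<Rightarrow> ('a \<Rightarrow> 'b \<Rightarrow> 'c) \<Rightarrow> bool" where
  "bilinear_map X Y Z f \<longleftrightarrow>
     (\<forall>x\<in>carr X. linear_map Y Z (f x)) \<and> (\<forall>y\<in>carr Y. linear_map X Z (\<lambda>x. f x y))"

definition pure ::
    "('k::field, 'a::ab_group_add) vs \<Rightarrow> ('k, 'b::ab_group_add) vs \<Rightarrow> 'a \<Rightarrow> 'b
      \<Rightarrow> ('k, 'a, 'b) tensor" where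
  "pure X Y x y = (\<lambda>\<beta>. if bilinear_map X Y ground \<beta> then \<beta> x y else 0)"

definition tensor ::
    "('k::field, 'a::ab_group_add) vs \<Rightarrow> ('k, 'b::ab_group_add) vs
      \<Rightarrow> ('k, ('k, 'a, 'b) tensor) vs" (infixr "\<otimes>" 75) where
  "X \<otimes> Y = \<lparr>carr = module.span (\<lambda>c t \<beta>. c * t \<beta>) {pure X Y x y | x y. x \<in> carr X \<and> y \<in> carr Y},
            scal = (\<lambda>c t \<beta>. c * t \<beta>)\<rparr>"

text \<open>The linear map \<open>X \<otimes> Y \<rightarrow> Z\<close> with \<open>x \<otimes> y \<mapsto> f x y\<close>, for bilinear \<open>f\<close>.\<close>

definition tlift ::
    "('k::field, 'a::ab_group_add) vs \<Rightarrow> ('k, 'b::ab_group_add) vs \<Rightarrow> ('k, 'c::ab_group_add) vs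
      \<Rightarrow> ('a \<Rightarrow> 'b \<Rightarrow> 'c) \<Rightarrow> ('k, ('k, 'a, 'b) tensor, 'c) lmap" where
  "tlift X Y Z f =
     (THE g. g \<in> Hom (X \<otimes> Y) Z \<and> (\<forall>x\<in>carr X. \<forall>y\<in>carr Y. g\<cdot>(pure X Y x y) = f x y))"

lemma mk_app: "x \<in> carr X \<Longrightarrow> mk X Y f \<cdot> x = f x"
  by (simp add: mk_def)

lemma vector_space_pointwise: "vector_space (\<lambda>(c::'k::field) (t::'i \<Rightarrow> 'k) i. c * t i)"
  by unfold_locales (auto simp: fun_eq_iff algebra_simps)

lemma vspace_dual:
  fixes X :: "('k::field, 'b::ab_group_add) vs"
  assumes "vspace X"
  shows "vspace (dual X)"
proof -
  interpret X: vector_space "scal X" using assms by (simp add: vspace_def)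
  interpret P: vector_space "\<lambda>(c::'k) (t::'b \<Rightarrow> 'k) i. c * t i" by (rule vector_space_pointwise)
  have "X.subspace (carr X)" using assms by (simp add: vspace_def)
  then show ?thesis
    by (auto simp: vspace_def dual_def linear_map_def ground_def vector_space_pointwise
        intro!: P.subspaceI) (auto simp: algebra_simps)
qed

lemma vspace_tensor:
  fixes X :: "('k::field, 'a::ab_group_add) vs" and Y :: "('k, 'b::ab_group_add) vs"
  shows "vspace (X \<otimes> Y)"
proof -
  interpret P: vector_space "\<lambda>(c::'k) (t::('a \<Rightarrow> 'b \<Rightarrow> 'k) \<Rightarrow> 'k) i. c * t i"
    by (rule vector_space_pointwise)
  show ?thesis
    by (simp add: vspace_def tensor_def vector_space_pointwise P.subspace_span)
qed

lemma pure_in_tensor: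
  fixes X :: "('k::field, 'a::ab_group_add) vs" and Y :: "('k, 'b::ab_group_add) vs"
  shows "x \<in> carr X \<Longrightarrow> y \<in> carr Y \<Longrightarrow> pure X Y x y \<in> carr (X \<otimes> Y)"
proof -
  interpret P: vector_space "\<lambda>(c::'k) (t::('a \<Rightarrow> 'b \<Rightarrow> 'k) \<Rightarrow> 'k) i. c * t i"
    by (rule vector_space_pointwise)
  show "x \<in> carr X \<Longrightarrow> y \<in> carr Y \<Longrightarrow> pure X Y x y \<in> carr (X \<otimes> Y)"
    by (auto simp: tensor_def intro!: P.span_base)
qed

lemma bilinear_pure:
  assumes "vspace X" "vspace Y"
  shows "bilinear_map X Y (X \<otimes> Y) (pure X Y)"
proof -
  have "linear_map Y (X \<otimes> Y) (pure X Y x)" if "x \<in> carr X" for x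
    unfolding linear_map_def using that
    by (auto intro: pure_in_tensor)
      (auto simp: pure_def fun_eq_iff tensor_def bilinear_map_def linear_map_def ground_def)
  moreover have "linear_map X (X \<otimes> Y) (\<lambda>x. pure X Y x y)" if "y \<in> carr Y" for y
    unfolding linear_map_def using that
    by (auto intro: pure_in_tensor)
      (auto simp: pure_def fun_eq_iff tensor_def bilinear_map_def linear_map_def ground_def)
  ultimately show ?thesis by (simp add: bilinear_map_def)
qed

lemma tensor_induct [consumes 3, case_names zero pure add]:
  fixes X :: "('k::field, 'a::ab_group_add) vs" and Y :: "('k, 'b::ab_group_add) vs"
  assumes X: "vspace X" and Y: "vspace Y" and t: "t \<in> carr (X \<otimes> Y)"
    and zero: "Q 0"
    and pure: "\<And>x y. x \<in> carr X \<Longrightarrow> y \<in> carr Y \<Longrightarrow> Q (pure X Y x y)"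
    and add: "\<And>s t. s \<in> carr (X \<otimes> Y) \<Longrightarrow> t \<in> carr (X \<otimes> Y) \<Longrightarrow> Q s \<Longrightarrow> Q t \<Longrightarrow> Q (s + t)"
  shows "Q t"
proof -
  interpret P: vector_space "\<lambda>(c::'k) (t::('a \<Rightarrow> 'b \<Rightarrow> 'k) \<Rightarrow> 'k) i. c * t i"
    by (rule vector_space_pointwise)
  interpret X: vector_space "scal X" using X by (simp add: vspace_def)
  have sub: "X.subspace (carr X)" using X by (simp add: vspace_def)
  have "Q t \<and> t \<in> carr (X \<otimes> Y)"
    using t unfolding tensor_def vs.simps
  proof (induction rule: P.span_induct_alt)
    case base
    show ?case using zero P.span_zero by (simp add: zero_fun_def)
  next
    case (step c s t)
    then obtain x y where s: "s = pure X Y x y" "x \<in> carr X" "y \<in> carr Y" by blast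
    have cx: "scal X c x \<in> carr X" using s sub by (auto intro: X.subspace_scale)
    have eq: "(\<lambda>i. c * s i) = pure X Y (scal X c x) y"
      using bilinear_pure[OF X Y] s by (auto simp: bilinear_map_def linear_map_def tensor_def)
    show ?case
      unfolding eq
      using add[OF pure_in_tensor[OF cx s(3)]] pure[OF cx s(3)] step(2)
        P.span_add[OF pure_in_tensor[OF cx s(3), unfolded tensor_def vs.simps]]
      unfolding tensor_def vs.simps by blast
  qed
  then show ?thesis ..
qed

lemma Hom_add: "g \<in> Hom X Y \<Longrightarrow> x \<in> carr X \<Longrightarrow> y \<in> carr X \<Longrightarrow> g\<cdot>(x + y) = g\<cdot>x + g\<cdot>y"
  by (simp add: Hom_def linear_map_def)

lemma Hom_zero:
  assumes "g \<in> Hom X Y" "vspace X"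
  shows "g\<cdot>0 = 0"
proof -
  interpret X: vector_space "scal X" using assms by (simp add: vspace_def)
  have "0 \<in> carr X" using assms by (auto simp: vspace_def intro: X.subspace_0)
  from Hom_add[OF assms(1) this this] show ?thesis by simp
qed

lemma tensor_Hom_eqI:
  assumes X: "vspace X" and Y: "vspace Y" and f: "f \<in> Hom (X \<otimes> Y) Z" and g: "g \<in> Hom (X \<otimes> Y) Z"
    and eq: "\<And>x y. x \<in> carr X \<Longrightarrow> y \<in> carr Y \<Longrightarrow> f\<cdot>(pure X Y x y) = g\<cdot>(pure X Y x y)"
  shows "f = g"
proof -
  have "f\<cdot>t = g\<cdot>t" for t
  proof (cases "t \<in> carr (X \<otimes> Y)")
    case True
    with X Y show ?thesis
    proof (induction t rule: tensor_induct)
      case zero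
      show ?case using Hom_zero[OF f vspace_tensor] Hom_zero[OF g vspace_tensor] by metis
    next
      case (pure x y)
      then show ?case by (rule eq)
    next
      case (add s t)
      then show ?case using Hom_add[OF f] Hom_add[OF g] by metis
    qed
  next
    case False
    then show ?thesis using f g by (simp add: Hom_def)
  qed
  then have "app f = app g" by (rule ext)
  then show ?thesis using f g by (simp add: Hom_def)
qed

lemma separating_functional:
  fixes Z :: "('k::field, 'a::ab_group_add) vs"
  assumes "vspace Z" "z \<noteq> 0"
  shows "\<exists>\<phi>. linear_map Z ground \<phi> \<and> \<phi> z \<noteq> 0"
proof -
  interpret Z: vector_space "scal Z" using assms by (simp add: vspace_def)
  interpret vector_space_pair "scal Z" "(*) :: 'k \<Rightarrow> 'k \<Rightarrow> 'k"
    by unfold_locales (auto simp: algebra_simps)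
  have "\<exists>g. Vector_Spaces.linear (scal Z) (*) g \<and> (\<forall>x\<in>{z}. g x = (\<lambda>_. 1) x)"
    by (rule linear_independent_extend) (use assms(2) in simp)
  then obtain g where g: "Vector_Spaces.linear (scal Z) (*) g" "g z = 1" by auto
  then interpret g: Vector_Spaces.linear "scal Z" "(*)" g by simp
  show ?thesis using g by (intro exI[of _ g]) (auto simp: linear_map_def ground_def g.add g.scale)
qed

lemma tlift_exists:
  fixes X :: "('k::field, 'a::ab_group_add) vs" and Y :: "('k, 'b::ab_group_add) vs"
    and Z :: "('k, 'c::ab_group_add) vs"
  assumes X: "vspace X" and Y: "vspace Y" and Z: "vspace Z" and f: "bilinear_map X Y Z f"
  shows "\<exists>g \<in> Hom (X \<otimes> Y) Z. \<forall>x\<in>carr X. \<forall>y\<in>carr Y. g\<cdot>(pure X Y x y) = f x y"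
proof -
  interpret X: vector_space "scal X" using X by (simp add: vspace_def)
  interpret Z: vector_space "scal Z" using Z by (simp add: vspace_def)
  have sX: "X.subspace (carr X)" and sZ: "Z.subspace (carr Z)"
    using X Z by (simp_all add: vspace_def)
  define L where "L = lists (carr X \<times> carr Y)"
  define S where "S xs = sum_list (map (\<lambda>(x, y). pure X Y x y) xs)" for xs
  define F where "F xs = sum_list (map (\<lambda>(x, y). f x y) xs)" for xs
  define sc where "sc c xs = map (\<lambda>(x, y). (scal X c x, y)) xs" for c and xs :: "('a \<times> 'b) list"
  have fZ: "f x y \<in> carr Z" if "x \<in> carr X" "y \<in> carr Y" for x y
    using f that by (auto simp: bilinear_map_def linear_map_def)
  have FZ: "F xs \<in> carr Z" if "xs \<in> L" for xs
    using that unfolding L_def F_def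
    by (induction xs) (auto intro: Z.subspace_add[OF sZ] Z.subspace_0[OF sZ] fZ)
  have sub_diff: "a - b \<in> carr Z" if "a \<in> carr Z" "b \<in> carr Z" for a b
    using Z.subspace_diff[OF sZ that] .
  have F_add: "F (xs @ ys) = F xs + F ys" and S_add: "S (xs @ ys) = S xs + S ys" for xs ys
    by (simp_all add: F_def S_def)
  have scL: "sc c xs \<in> L" if "xs \<in> L" for c xs
    using that unfolding L_def sc_def by (induction xs) (auto intro: X.subspace_scale[OF sX])
  have F_sc: "F (sc c xs) = scal Z c (F xs)" if "xs \<in> L" for c xs
    using that f unfolding L_def sc_def F_def bilinear_map_def linear_map_def
    by (induction xs) (auto simp: Z.scale_right_distrib)
  have S_sc: "S (sc c xs) = (\<lambda>\<beta>. c * S xs \<beta>)" if "xs \<in> L" for c xs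
    using that bilinear_pure[OF X Y] unfolding L_def sc_def S_def bilinear_map_def linear_map_def
    by (induction xs) (auto simp: fun_eq_iff algebra_simps tensor_def)
  have surj: "\<exists>xs\<in>L. t = S xs" if "t \<in> carr (X \<otimes> Y)" for t
    using X Y that
  proof (induction t rule: tensor_induct)
    case zero
    show ?case by (rule bexI[of _ "[]"]) (auto simp: S_def L_def)
  next
    case (pure x y)
    then show ?case by (intro bexI[of _ "[(x, y)]"]) (auto simp: S_def L_def)
  next
    case (add s t)
    then obtain xs ys where "xs \<in> L" "ys \<in> L" "s = S xs" "t = S ys" by auto
    then show ?case using S_add[of xs ys] by (intro bexI[of _ "xs @ ys"]) (auto simp: L_def)
  qed
  have wd: "F xs = F ys" if xs: "xs \<in> L" and ys: "ys \<in> L" and eq: "S xs = S ys" for xs ys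
  proof (rule ccontr)
    assume "F xs \<noteq> F ys"
    then obtain \<phi> where \<phi>: "linear_map Z ground \<phi>" "\<phi> (F xs - F ys) \<noteq> 0"
      using separating_functional[OF Z] by (metis right_minus_eq)
    have bil: "bilinear_map X Y ground (\<lambda>x y. \<phi> (f x y))"
      using f \<phi>(1) by (auto simp: bilinear_map_def linear_map_def)
    have \<phi>0: "\<phi> 0 = 0"
      using \<phi>(1) Z.subspace_0[OF sZ] by (fastforce simp: linear_map_def ground_def)
    have *: "\<phi> (F zs) = S zs (\<lambda>x y. \<phi> (f x y))" if "zs \<in> L" for zs
      using that
    proof (induction zs)
      case Nil
      show ?case by (simp add: F_def S_def \<phi>0)
    next
      case (Cons p zs)
      then have "zs \<in> L" "p \<in> carr X \<times> carr Y" by (auto simp: L_def)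
      then show ?case
        using Cons.IH FZ[of zs] \<phi>(1) fZ bil
        by (cases p) (auto simp: F_def S_def pure_def linear_map_def)
    qed
    have "\<phi> (F xs) = \<phi> (F xs - F ys) + \<phi> (F ys)"
      using \<phi>(1) FZ[OF xs] FZ[OF ys] sub_diff unfolding linear_map_def
      by (metis diff_add_cancel)
    then show False using *[OF xs] *[OF ys] eq \<phi>(2) by simp
  qed
  define r where "r t = (SOME xs. xs \<in> L \<and> t = S xs)" for t
  have r: "r t \<in> L \<and> t = S (r t)" if "t \<in> carr (X \<otimes> Y)" for t
    unfolding r_def by (rule someI_ex) (use surj[OF that] in blast)
  define g where "g = mk (X \<otimes> Y) Z (\<lambda>t. F (r t))"
  have SL: "S xs \<in> carr (X \<otimes> Y)" if "xs \<in> L" for xs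
  proof -
    interpret T: vector_space "scal (X \<otimes> Y)" using vspace_tensor[of X Y] by (simp add: vspace_def)
    have sT: "T.subspace (carr (X \<otimes> Y))" using vspace_tensor[of X Y] by (simp add: vspace_def)
    show ?thesis
      using that
    proof (induction xs)
      case Nil
      have "S [] = 0" by (simp add: S_def)
      then show ?case using T.subspace_0[OF sT] by metis
    next
      case (Cons p xs)
      then have p: "xs \<in> L" "fst p \<in> carr X" "snd p \<in> carr Y" by (auto simp: L_def)
      have "S (p # xs) = pure X Y (fst p) (snd p) + S xs" by (simp add: S_def case_prod_beta)
      then show ?case
        using T.subspace_add[OF sT pure_in_tensor[OF p(2,3)] Cons.IH[OF p(1)]] by metis
    qed
  qed
  have gS: "g\<cdot>(S xs) = F xs" if "xs \<in> L" for xs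
    using SL[OF that] r wd[OF _ that] by (metis g_def mk_app)
  have "g \<in> Hom (X \<otimes> Y) Z"
  proof -
    have 1: "g\<cdot>t \<in> carr Z" if "t \<in> carr (X \<otimes> Y)" for t
      using surj[OF that] gS FZ by auto
    have 2: "g\<cdot>(s + t) = g\<cdot>s + g\<cdot>t" if st: "s \<in> carr (X \<otimes> Y)" "t \<in> carr (X \<otimes> Y)" for s t
    proof -
      obtain xs ys where xy: "xs \<in> L" "ys \<in> L" "s = S xs" "t = S ys" using surj[OF st(1)] surj[OF st(2)] by blast
      then have "xs @ ys \<in> L" by (auto simp: L_def)
      from gS[OF this] show ?thesis using xy gS by (simp add: S_add F_add)
    qed
    have 3: "g\<cdot>(scal (X \<otimes> Y) c t) = scal Z c (g\<cdot>t)" if st: "t \<in> carr (X \<otimes> Y)" for c t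
    proof -
      obtain xs where xs: "xs \<in> L" "t = S xs" using surj[OF st] by blast
      have "scal (X \<otimes> Y) c t = S (sc c xs)" using S_sc[OF xs(1), of c] xs by (simp add: tensor_def)
      then show ?thesis using gS[OF scL[OF xs(1)], of c] F_sc[OF xs(1)] gS[OF xs(1)] xs by simp
    qed
    show ?thesis using 1 2 3 by (auto simp: Hom_def linear_map_def) (auto simp: g_def mk_def)
  qed
  moreover have "g\<cdot>(pure X Y x y) = f x y" if "x \<in> carr X" "y \<in> carr Y" for x y
    using gS[of "[(x, y)]"] that by (simp add: L_def S_def F_def)
  ultimately show ?thesis by blast
qed

lemma
  assumes X: "vspace X" and Y: "vspace Y" and Z: "vspace Z" and f: "bilinear_map X Y Z f"
  shows tlift_Hom: "tlift X Y Z f \<in> Hom (X \<otimes> Y) Z"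
    and tlift_pure: "x \<in> carr X \<Longrightarrow> y \<in> carr Y \<Longrightarrow> tlift X Y Z f \<cdot> (pure X Y x y) = f x y"
proof -
  have "\<exists>!g. g \<in> Hom (X \<otimes> Y) Z \<and> (\<forall>x\<in>carr X. \<forall>y\<in>carr Y. g\<cdot>(pure X Y x y) = f x y)"
    using tlift_exists[OF X Y Z f] tensor_Hom_eqI[OF X Y] by (metis (no_types, lifting))
  from theI'[OF this]
  have *: "tlift X Y Z f \<in> Hom (X \<otimes> Y) Z \<and>
      (\<forall>x\<in>carr X. \<forall>y\<in>carr Y. tlift X Y Z f \<cdot> (pure X Y x y) = f x y)"
    by (simp add: tlift_def)
  from * show "tlift X Y Z f \<in> Hom (X \<otimes> Y) Z" ..
  from * show "x \<in> carr X \<Longrightarrow> y \<in> carr Y \<Longrightarrow> tlift X Y Z f \<cdot> (pure X Y x y) = f x y" by blast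
qed

definition tensor_lmap ::
    "('k::field, 'a::ab_group_add, 'c::ab_group_add) lmap
      \<Rightarrow> ('k, 'b::ab_group_add, 'd::ab_group_add) lmap
      \<Rightarrow> ('k, ('k, 'a, 'b) tensor, ('k, 'c, 'd) tensor) lmap" (infixr "\<otimes>\<^sub>m" 75) where
  "f \<otimes>\<^sub>m g = tlift (src f) (src g) (tgt f \<otimes> tgt g) (\<lambda>x y. pure (tgt f) (tgt g) (f\<cdot>x) (g\<cdot>y))"

definition assoc where
  "assoc X Y Z = tlift (X \<otimes> Y) Z (X \<otimes> Y \<otimes> Z)
     (\<lambda>t z. tlift X Y (X \<otimes> Y \<otimes> Z) (\<lambda>x y. pure X (Y \<otimes> Z) x (pure Y Z y z)) \<cdot> t)"

abbreviation assoc' where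
  "assoc' X Y Z \<equiv> linv (assoc X Y Z)"

definition lunit :: "('k::field, 'a::ab_group_add) vs \<Rightarrow> ('k, ('k, 'k, 'a) tensor, 'a) lmap" where
  "lunit X = tlift ground X X (\<lambda>c x. scal X c x)"

definition runit :: "('k::field, 'a::ab_group_add) vs \<Rightarrow> ('k, ('k, 'a, 'k) tensor, 'a) lmap" where
  "runit X = tlift X ground X (\<lambda>x c. scal X c x)"

text \<open>
  \<open>(\<Psi>\<^sub>1 \<otimes> id)(id \<otimes> \<Psi>\<^sub>2) : (A \<otimes> B) \<otimes> W \<rightarrow> W \<otimes> (A \<otimes> B)\<close> for \<open>\<Psi>\<^sub>1 : A \<otimes> W \<rightarrow> W \<otimes> A\<close> and
  \<open>\<Psi>\<^sub>2 : B \<otimes> W \<rightarrow> W \<otimes> B\<close>, with the associativity isomorphisms inserted.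
\<close>

definition crossL where
  "crossL A B W \<Psi>\<^sub>1 \<Psi>\<^sub>2 =
     assoc W A B \<odot> (\<Psi>\<^sub>1 \<otimes>\<^sub>m Id B) \<odot> assoc' A W B \<odot> (Id A \<otimes>\<^sub>m \<Psi>\<^sub>2) \<odot> assoc A B W"

text \<open>
  \<open>(id \<otimes> \<Psi>\<^sub>2)(\<Psi>\<^sub>1 \<otimes> id) : V \<otimes> (A \<otimes> B) \<rightarrow> (A \<otimes> B) \<otimes> V\<close> for \<open>\<Psi>\<^sub>1 : V \<otimes> A \<rightarrow> A \<otimes> V\<close> and
  \<open>\<Psi>\<^sub>2 : V \<otimes> B \<rightarrow> B \<otimes> V\<close>.
\<close>

definition crossR where
  "crossR V A B \<Psi>\<^sub>1 \<Psi>\<^sub>2 =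
     assoc' A B V \<odot> (Id A \<otimes>\<^sub>m \<Psi>\<^sub>2) \<odot> assoc A V B \<odot> (\<Psi>\<^sub>1 \<otimes>\<^sub>m Id B) \<odot> assoc' V A B"

text \<open>\<open>id \<otimes> \<Psi> \<otimes> id : (A \<otimes> B) \<otimes> (C \<otimes> D) \<rightarrow> (A \<otimes> C) \<otimes> (B \<otimes> D)\<close> for \<open>\<Psi> : B \<otimes> C \<rightarrow> C \<otimes> B\<close>.\<close>

definition mid where
  "mid A B C D \<Psi> =
     assoc' A C (B \<otimes> D) \<odot> (Id A \<otimes>\<^sub>m (assoc C B D \<odot> (\<Psi> \<otimes>\<^sub>m Id D) \<odot> assoc' B C D))
       \<odot> assoc A B (C \<otimes> D)"

definition braiding where
  "braiding V \<Psi> \<longleftrightarrow> \<Psi> \<in> Iso (V \<otimes> V) (V \<otimes> V) \<and>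
     crossL V V V \<Psi> \<Psi> \<odot> (\<Psi> \<otimes>\<^sub>m Id V) = (Id V \<otimes>\<^sub>m \<Psi>) \<odot> crossL V V V \<Psi> \<Psi>"

definition left_braided where
  "left_braided V \<Psi>\<^sub>V W \<Psi> \<longleftrightarrow> vspace W \<and> \<Psi> \<in> Iso (V \<otimes> W) (W \<otimes> V) \<and>
     crossL V V W \<Psi> \<Psi> \<odot> (\<Psi>\<^sub>V \<otimes>\<^sub>m Id W) = (Id W \<otimes>\<^sub>m \<Psi>\<^sub>V) \<odot> crossL V V W \<Psi> \<Psi>"

definition right_braided where
  "right_braided W \<Psi>\<^sub>W V \<Psi> \<longleftrightarrow> vspace V \<and> \<Psi> \<in> Iso (V \<otimes> W) (W \<otimes> V) \<and>
     crossR V W W \<Psi> \<Psi> \<odot> (Id V \<otimes>\<^sub>m \<Psi>\<^sub>W) = (\<Psi>\<^sub>W \<otimes>\<^sub>m Id V) \<odot> crossR V W W \<Psi> \<Psi>"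

definition is_unit where
  "is_unit A m u \<longleftrightarrow> u \<in> carr A \<and> (\<forall>a\<in>carr A. m\<cdot>(pure A A u a) = a \<and> m\<cdot>(pure A A a u) = a)"

text \<open>
  Algebras are associative but need not have a unit.  Conditions imposed only when \<open>1 \<in> A\<close> are
  stated for every unit element (there is at most one).
\<close>

definition algebra where
  "algebra A m \<longleftrightarrow> vspace A \<and> m \<in> Hom (A \<otimes> A) A \<and>
     m \<odot> (m \<otimes>\<^sub>m Id A) = m \<odot> (Id A \<otimes>\<^sub>m m) \<odot> assoc A A A"

definition coalgebra where
  "coalgebra C \<Delta> \<epsilon> \<longleftrightarrow> vspace C \<and> \<Delta> \<in> Hom C (C \<otimes> C) \<and> \<epsilon> \<in> Hom C ground \<and>
     assoc C C C \<odot> (\<Delta> \<otimes>\<^sub>m Id C) \<odot> \<Delta> = (Id C \<otimes>\<^sub>m \<Delta>) \<odot> \<Delta> \<and>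
     runit C \<odot> (Id C \<otimes>\<^sub>m \<epsilon>) \<odot> \<Delta> = Id C \<and>
     lunit C \<odot> (\<epsilon> \<otimes>\<^sub>m Id C) \<odot> \<Delta> = Id C"

text \<open>
  Compatibility of \<open>\<Psi> : V \<otimes> W \<rightarrow> W \<otimes> V\<close> with a (co)multiplication on the first, respectively second,
  tensor factor.
\<close>

definition compat_mult1 where
  "compat_mult1 V W \<Psi> m \<longleftrightarrow> \<Psi> \<odot> (m \<otimes>\<^sub>m Id W) = (Id W \<otimes>\<^sub>m m) \<odot> crossL V V W \<Psi> \<Psi> \<and>
     (\<forall>u. is_unit V m u \<longrightarrow> (\<forall>w\<in>carr W. \<Psi>\<cdot>(pure V W u w) = pure W V w u))"

definition compat_mult2 where
  "compat_mult2 V W \<Psi> m \<longleftrightarrow> \<Psi> \<odot> (Id V \<otimes>\<^sub>m m) = (m \<otimes>\<^sub>m Id V) \<odot> crossR V W W \<Psi> \<Psi> \<and>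
     (\<forall>u. is_unit W m u \<longrightarrow> (\<forall>v\<in>carr V. \<Psi>\<cdot>(pure V W v u) = pure W V u v))"

definition compat_comult1 where
  "compat_comult1 V W \<Psi> \<Delta> \<epsilon> \<longleftrightarrow>
     (Id W \<otimes>\<^sub>m \<Delta>) \<odot> \<Psi> = crossL V V W \<Psi> \<Psi> \<odot> (\<Delta> \<otimes>\<^sub>m Id W) \<and>
     runit W \<odot> (Id W \<otimes>\<^sub>m \<epsilon>) \<odot> \<Psi> = lunit W \<odot> (\<epsilon> \<otimes>\<^sub>m Id W)"

definition compat_comult2 where
  "compat_comult2 V W \<Psi> \<Delta> \<epsilon> \<longleftrightarrow>
     (\<Delta> \<otimes>\<^sub>m Id V) \<odot> \<Psi> = crossR V W W \<Psi> \<Psi> \<odot> (Id V \<otimes>\<^sub>m \<Delta>) \<and>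
     lunit V \<odot> (\<epsilon> \<otimes>\<^sub>m Id V) \<odot> \<Psi> = runit V \<odot> (Id V \<otimes>\<^sub>m \<epsilon>)"

definition braided_algebra where
  "braided_algebra A m \<Psi> \<longleftrightarrow>
     algebra A m \<and> braiding A \<Psi> \<and> compat_mult1 A A \<Psi> m \<and> compat_mult2 A A \<Psi> m"

definition braided_unital_algebra where
  "braided_unital_algebra A m u \<Psi> \<longleftrightarrow> braided_algebra A m \<Psi> \<and> is_unit A m u"

definition braided_coalgebra where
  "braided_coalgebra C \<Delta> \<epsilon> \<Psi> \<longleftrightarrow>
     coalgebra C \<Delta> \<epsilon> \<and> braiding C \<Psi> \<and> compat_comult1 C C \<Psi> \<Delta> \<epsilon> \<and> compat_comult2 C C \<Psi> \<Delta> \<epsilon>"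

definition braided_bialgebra where
  "braided_bialgebra H m u \<Delta> \<epsilon> \<Psi> \<longleftrightarrow>
     braided_unital_algebra H m u \<Psi> \<and> braided_coalgebra H \<Delta> \<epsilon> \<Psi> \<and>
     \<Delta> \<odot> m = (m \<otimes>\<^sub>m m) \<odot> mid H H H H \<Psi> \<odot> (\<Delta> \<otimes>\<^sub>m \<Delta>) \<and>
     \<Delta>\<cdot>u = pure H H u u \<and>
     (\<forall>a\<in>carr H. \<forall>b\<in>carr H. \<epsilon>\<cdot>(m\<cdot>(pure H H a b)) = \<epsilon>\<cdot>a * \<epsilon>\<cdot>b) \<and> \<epsilon>\<cdot>u = 1"

text \<open>
  The product \<open>m\<Psi>\<^sup>n\<close> and coproduct \<open>\<Psi>\<^sup>n\<Delta>\<close>; thus \<open>H\<^sup>(\<^sup>n\<^sup>,\<^sup>-\<^sup>n\<^sup>)\<close> has product \<open>twist_mult m \<Psi> n\<close> and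
  coproduct \<open>twist_comult \<Delta> \<Psi> (-n)\<close>.
\<close>

definition twist_mult where
  "twist_mult m \<Psi> n = m \<odot> ipow \<Psi> n"

definition twist_comult where
  "twist_comult \<Delta> \<Psi> n = ipow \<Psi> n \<odot> \<Delta>"

definition braided_left_module where
  "braided_left_module A m u \<Psi>\<^sub>A W \<Psi> \<nu> \<longleftrightarrow>
     braided_unital_algebra A m u \<Psi>\<^sub>A \<and> left_braided A \<Psi>\<^sub>A W \<Psi> \<and> compat_mult1 A W \<Psi> m \<and>
     \<nu> \<in> Hom (A \<otimes> W) W \<and>
     \<nu> \<odot> (Id A \<otimes>\<^sub>m \<nu>) \<odot> assoc A A W = \<nu> \<odot> (m \<otimes>\<^sub>m Id W) \<and>
     (\<forall>w\<in>carr W. \<nu>\<cdot>(pure A W u w) = w) \<and>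
     \<Psi> \<odot> (Id A \<otimes>\<^sub>m \<nu>) = (\<nu> \<otimes>\<^sub>m Id A) \<odot> crossR A A W \<Psi>\<^sub>A \<Psi>"

definition braided_right_module where
  "braided_right_module A m u \<Psi>\<^sub>A V \<Psi> \<nu> \<longleftrightarrow>
     braided_unital_algebra A m u \<Psi>\<^sub>A \<and> right_braided A \<Psi>\<^sub>A V \<Psi> \<and> compat_mult2 V A \<Psi> m \<and>
     \<nu> \<in> Hom (V \<otimes> A) V \<and>
     \<nu> \<odot> (\<nu> \<otimes>\<^sub>m Id A) = \<nu> \<odot> (Id V \<otimes>\<^sub>m m) \<odot> assoc V A A \<and>
     (\<forall>v\<in>carr V. \<nu>\<cdot>(pure V A v u) = v) \<and>
     \<Psi> \<odot> (\<nu> \<otimes>\<^sub>m Id A) = (Id A \<otimes>\<^sub>m \<nu>) \<odot> crossL V A A \<Psi> \<Psi>\<^sub>A"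

definition braided_right_comodule where
  "braided_right_comodule H \<Delta> \<epsilon> \<Psi>\<^sub>H V \<Psi> \<rho> \<longleftrightarrow>
     braided_coalgebra H \<Delta> \<epsilon> \<Psi>\<^sub>H \<and> left_braided H \<Psi>\<^sub>H V \<Psi> \<and> compat_comult1 H V \<Psi> \<Delta> \<epsilon> \<and>
     \<rho> \<in> Hom V (V \<otimes> H) \<and>
     assoc V H H \<odot> (\<rho> \<otimes>\<^sub>m Id H) \<odot> \<rho> = (Id V \<otimes>\<^sub>m \<Delta>) \<odot> \<rho> \<and>
     runit V \<odot> (Id V \<otimes>\<^sub>m \<epsilon>) \<odot> \<rho> = Id V \<and>
     (\<rho> \<otimes>\<^sub>m Id H) \<odot> \<Psi> = crossR H V H \<Psi> \<Psi>\<^sub>H \<odot> (Id H \<otimes>\<^sub>m \<rho>)"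

definition braided_left_comodule where
  "braided_left_comodule H \<Delta> \<epsilon> \<Psi>\<^sub>H V \<Psi> \<rho> \<longleftrightarrow>
     braided_coalgebra H \<Delta> \<epsilon> \<Psi>\<^sub>H \<and> right_braided H \<Psi>\<^sub>H V \<Psi> \<and> compat_comult2 V H \<Psi> \<Delta> \<epsilon> \<and>
     \<rho> \<in> Hom V (H \<otimes> V) \<and>
     (Id H \<otimes>\<^sub>m \<rho>) \<odot> \<rho> = assoc H H V \<odot> (\<Delta> \<otimes>\<^sub>m Id V) \<odot> \<rho> \<and>
     lunit V \<odot> (\<epsilon> \<otimes>\<^sub>m Id V) \<odot> \<rho> = Id V \<and>
     (Id H \<otimes>\<^sub>m \<rho>) \<odot> \<Psi> = crossL H V H \<Psi>\<^sub>H \<Psi> \<odot> (\<rho> \<otimes>\<^sub>m Id H)"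

definition braided_left_module_algebra where
  "braided_left_module_algebra H m u \<Delta> \<epsilon> \<Psi>\<^sub>H B m\<^sub>B \<Psi>\<^sub>B \<Psi> \<nu> \<longleftrightarrow>
     braided_bialgebra H m u \<Delta> \<epsilon> \<Psi>\<^sub>H \<and> braided_algebra B m\<^sub>B \<Psi>\<^sub>B \<and> left_braided H \<Psi>\<^sub>H B \<Psi> \<and>
     compat_mult1 H B \<Psi> m \<and> compat_mult2 H B \<Psi> m\<^sub>B \<and> compat_comult1 H B \<Psi> \<Delta> \<epsilon> \<and>
     braided_left_module H m u \<Psi>\<^sub>H B \<Psi> \<nu> \<and>
     \<nu> \<odot> (Id H \<otimes>\<^sub>m m\<^sub>B) = m\<^sub>B \<odot> (\<nu> \<otimes>\<^sub>m \<nu>) \<odot> mid H H B B \<Psi> \<odot> (\<Delta> \<otimes>\<^sub>m Id (B \<otimes> B)) \<and>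
     (\<forall>e. is_unit B m\<^sub>B e \<longrightarrow> (\<forall>h\<in>carr H. \<nu>\<cdot>(pure H B h e) = scal B (\<epsilon>\<cdot>h) e))"

definition braided_right_module_algebra where
  "braided_right_module_algebra H m u \<Delta> \<epsilon> \<Psi>\<^sub>H B m\<^sub>B \<Psi>\<^sub>B \<Psi> \<nu> \<longleftrightarrow>
     braided_bialgebra H m u \<Delta> \<epsilon> \<Psi>\<^sub>H \<and> braided_algebra B m\<^sub>B \<Psi>\<^sub>B \<and> right_braided H \<Psi>\<^sub>H B \<Psi> \<and>
     compat_mult2 B H \<Psi> m \<and> compat_mult1 B H \<Psi> m\<^sub>B \<and> compat_comult2 B H \<Psi> \<Delta> \<epsilon> \<and>
     braided_right_module H m u \<Psi>\<^sub>H B \<Psi> \<nu> \<and>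
     \<nu> \<odot> (m\<^sub>B \<otimes>\<^sub>m Id H) = m\<^sub>B \<odot> (\<nu> \<otimes>\<^sub>m \<nu>) \<odot> mid B B H H \<Psi> \<odot> (Id (B \<otimes> B) \<otimes>\<^sub>m \<Delta>) \<and>
     (\<forall>e. is_unit B m\<^sub>B e \<longrightarrow> (\<forall>h\<in>carr H. \<nu>\<cdot>(pure B H e h) = scal B (\<epsilon>\<cdot>h) e))"

definition braided_right_comodule_algebra where
  "braided_right_comodule_algebra H m u \<Delta> \<epsilon> \<Psi>\<^sub>H B m\<^sub>B \<Psi>\<^sub>B \<Psi> \<rho> \<longleftrightarrow>
     braided_bialgebra H m u \<Delta> \<epsilon> \<Psi>\<^sub>H \<and> braided_algebra B m\<^sub>B \<Psi>\<^sub>B \<and> left_braided H \<Psi>\<^sub>H B \<Psi> \<and>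
     compat_mult1 H B \<Psi> m \<and> compat_mult2 H B \<Psi> m\<^sub>B \<and> compat_comult1 H B \<Psi> \<Delta> \<epsilon> \<and>
     braided_right_comodule H \<Delta> \<epsilon> \<Psi>\<^sub>H B \<Psi> \<rho> \<and>
     \<rho> \<odot> m\<^sub>B = (m\<^sub>B \<otimes>\<^sub>m m) \<odot> mid B H B H \<Psi> \<odot> (\<rho> \<otimes>\<^sub>m \<rho>) \<and>
     (\<forall>e. is_unit B m\<^sub>B e \<longrightarrow> \<rho>\<cdot>e = pure B H e u)"

definition braided_left_comodule_algebra where
  "braided_left_comodule_algebra H m u \<Delta> \<epsilon> \<Psi>\<^sub>H B m\<^sub>B \<Psi>\<^sub>B \<Psi> \<rho> \<longleftrightarrow>
     braided_bialgebra H m u \<Delta> \<epsilon> \<Psi>\<^sub>H \<and> braided_algebra B m\<^sub>B \<Psi>\<^sub>B \<and> right_braided H \<Psi>\<^sub>H B \<Psi> \<and>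
     compat_mult2 B H \<Psi> m \<and> compat_mult1 B H \<Psi> m\<^sub>B \<and> compat_comult2 B H \<Psi> \<Delta> \<epsilon> \<and>
     braided_left_comodule H \<Delta> \<epsilon> \<Psi>\<^sub>H B \<Psi> \<rho> \<and>
     \<rho> \<odot> m\<^sub>B = (m \<otimes>\<^sub>m m\<^sub>B) \<odot> mid H B H B \<Psi> \<odot> (\<rho> \<otimes>\<^sub>m \<rho>) \<and>
     (\<forall>e. is_unit B m\<^sub>B e \<longrightarrow> \<rho>\<cdot>e = pure H B u e)"

definition nondegenerate :: "('k::field, 'a \<Rightarrow> 'k) vs \<Rightarrow> ('k, 'a) vs \<Rightarrow> bool" where
  "nondegenerate U X \<longleftrightarrow> (\<forall>x\<in>carr X. \<forall>y\<in>carr X. (\<forall>f\<in>carr U. f x = f y) \<longrightarrow> x = y)"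

text \<open>
  The constructions below produce maps \<open>F : S \<rightarrow> D'\<close> together with an embedding \<open>E : T \<rightarrow> D'\<close> along
  which \<open>T\<close> is regarded as a subspace of \<open>D'\<close>.  Such data are kept as the pair \<open>(E, F)\<close>; when \<open>F\<close>
  takes values in \<open>T \<subseteq> D'\<close>, it induces the map \<^term>\<open>induced (E, F)\<close> from \<open>S\<close> to \<open>T\<close>.
\<close>

type_synonym ('k, 't, 's, 'd) dmap = "('k, 't, 'd \<Rightarrow> 'k) lmap \<times> ('k, 's, 'd \<Rightarrow> 'k) lmap"

fun lands :: "('k, 't, 's, 'd) dmap \<Rightarrow> bool" where
  "lands (E, F) \<longleftrightarrow> app F ` carr (src F) \<subseteq> app E ` carr (src E)"

fun bijective :: "('k, 't, 's, 'd) dmap \<Rightarrow> bool" where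
  "bijective (E, F) \<longleftrightarrow> bij_betw (app F) (carr (src F)) (app E ` carr (src E))"

fun induced :: "('k, 't::zero, 's, 'd) dmap \<Rightarrow> ('k, 's, 't) lmap" where
  "induced (E, F) = mk (src F) (src E) (\<lambda>s. inv_into (carr (src E)) (app E) (F\<cdot>s))"

text \<open>
  The functional on \<open>X \<otimes> Y\<close> with \<open>x \<otimes> y \<mapsto> \<phi> x \<psi> y\<close>, and the pairing
  \<open>\<langle>\<langle>\<xi> \<otimes> \<eta>, x \<otimes> y\<rangle>\<rangle> = \<xi> y \<eta> x\<close> as a functional of \<open>x \<otimes> y\<close>.
\<close>

definition fpair ::
    "('k::field, 'a::ab_group_add) vs \<Rightarrow> ('k, 'b::ab_group_add) vs \<Rightarrow> ('a \<Rightarrow> 'k) \<Rightarrow> ('b \<Rightarrow> 'k)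
      \<Rightarrow> ('k, 'a, 'b) tensor \<Rightarrow> 'k" where
  "fpair X Y \<phi> \<psi> = app (tlift X Y ground (\<lambda>x y. \<phi> x * \<psi> y))"

definition twpair ::
    "('k::field, 'a::ab_group_add) vs \<Rightarrow> ('k, 'b::ab_group_add) vs \<Rightarrow> ('b \<Rightarrow> 'k) \<Rightarrow> ('a \<Rightarrow> 'k)
      \<Rightarrow> ('k, 'a, 'b) tensor \<Rightarrow> 'k" where
  "twpair X Y \<xi> \<eta> = app (tlift X Y ground (\<lambda>x y. \<xi> y * \<eta> x))"

definition ev_at :: "'a \<Rightarrow> ('a \<Rightarrow> 'k) \<Rightarrow> 'k" where
  "ev_at a = (\<lambda>f. f a)"

definition ev :: "('k::field, 'a::ab_group_add \<Rightarrow> 'k) vs \<Rightarrow> ('k, 'a) vs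
    \<Rightarrow> ('k, ('k, 'a \<Rightarrow> 'k, 'a) tensor, 'k) lmap" where
  "ev U X = tlift U X ground (\<lambda>f a. f a)"

definition ev' :: "('k::field, 'a::ab_group_add) vs \<Rightarrow> ('k, 'a \<Rightarrow> 'k) vs
    \<Rightarrow> ('k, ('k, 'a, 'a \<Rightarrow> 'k) tensor, 'k) lmap" where
  "ev' X U = tlift X U ground (\<lambda>a f. f a)"

text \<open>
  The embedding \<open>X \<otimes> Y \<rightarrow> (A \<otimes> B)'\<close>, where \<open>i x\<close> is \<open>x\<close> regarded as a functional on \<open>A\<close> and \<open>j y\<close>
  is \<open>y\<close> regarded as a functional on \<open>B\<close>.
\<close>

definition temb where
  "temb X Y A B i j = tlift X Y (dual (A \<otimes> B)) (\<lambda>x y. fpair A B (i x) (j y))"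

text \<open>
  \<open>X \<otimes> Y \<rightarrow> (Z \<otimes> W)'\<close>, \<open>(x \<otimes> y)(z \<otimes> w) = \<langle>\<langle>z \<otimes> x, \<Phi>(y \<otimes> w)\<rangle>\<rangle>\<close> for \<open>\<Phi> : Y \<otimes> W \<rightarrow> W \<otimes> Y\<close>, with
  values to be compared with \<open>Y \<otimes> X\<close>; the pairings are \<open>\<langle>x, w\<rangle> = i x w\<close> and \<open>\<langle>y, z\<rangle> = j y z\<close>.
\<close>

definition mateL where
  "mateL X Y Z W i j \<Phi> =
     (temb Y X Z W j i,
      tlift X Y (dual (Z \<otimes> W)) (\<lambda>x y. app (tlift Z W ground (\<lambda>z w.
        twpair W Y (\<lambda>y'. j y' z) (i x) (\<Phi>\<cdot>(pure Y W y w))))))"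

text \<open>
  \<open>X \<otimes> Y \<rightarrow> (Z \<otimes> W)'\<close>, \<open>(x \<otimes> y)(z \<otimes> w) = \<langle>\<langle>y \<otimes> w, \<Phi>(z \<otimes> x)\<rangle>\<rangle>\<close> for \<open>\<Phi> : Z \<otimes> X \<rightarrow> X \<otimes> Z\<close>.
\<close>

definition mateR where
  "mateR X Y Z W i j \<Phi> =
     (temb Y X Z W j i,
      tlift X Y (dual (Z \<otimes> W)) (\<lambda>x y. app (tlift Z W ground (\<lambda>z w.
        twpair X Z (j y) (\<lambda>x'. i x' w) (\<Phi>\<cdot>(pure Z X z x))))))"

definition Psi_UU where
  "Psi_UU H U \<Psi>\<^sub>H\<^sub>H =
     (temb U U H H (\<lambda>f. f) (\<lambda>f. f),
      tlift U U (dual (H \<otimes> H)) (\<lambda>f g. app (tlift H H ground (\<lambda>b a.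
        twpair H H f g (\<Psi>\<^sub>H\<^sub>H\<cdot>(pure H H a b))))))"

text \<open>
  \<open>Psi\<close> with two distinct indices stands for \<open>\<Psi>\<^sup>\<circ>\<close>, and \<open>Psi2\<close> for \<open>\<Psi>\<^sup>\<circ>\<^sup>\<circ>\<close>.  Taking \<open>V = H\<close> and
  \<open>\<Psi>\<^sub>H\<^sub>V = \<Psi>\<^sub>V\<^sub>H = \<Psi>\<^sub>H\<^sub>H\<close> in \<open>\<Psi>\<^sup>\<circ>\<^sub>U\<^sub>V\<close> and \<open>\<Psi>\<^sup>\<circ>\<^sub>V\<^sub>U\<close> gives \<open>\<Psi>\<^sup>\<circ>\<^sub>U\<^sub>H\<close> and \<open>\<Psi>\<^sup>\<circ>\<^sub>H\<^sub>U\<close>.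
\<close>

definition Psi_UV where
  "Psi_UV H V U \<Psi>\<^sub>H\<^sub>V = mateL U V (dual V) H (\<lambda>f. f) ev_at (linv \<Psi>\<^sub>H\<^sub>V)"

definition Psi_VU where
  "Psi_VU H V U \<Psi>\<^sub>V\<^sub>H = mateR V U H (dual V) ev_at (\<lambda>f. f) (linv \<Psi>\<^sub>V\<^sub>H)"

abbreviation Psi_UH where
  "Psi_UH H U \<Psi>\<^sub>H\<^sub>H \<equiv> Psi_UV H H U \<Psi>\<^sub>H\<^sub>H"

abbreviation Psi_HU where
  "Psi_HU H U \<Psi>\<^sub>H\<^sub>H \<equiv> Psi_VU H H U \<Psi>\<^sub>H\<^sub>H"

definition Psi2_HV where
  "Psi2_HV H V U \<Psi>\<^sub>H\<^sub>V = mateL H V (dual V) U ev_at ev_at (linv (induced (Psi_UV H V U \<Psi>\<^sub>H\<^sub>V)))"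

definition Psi2_VH where
  "Psi2_VH H V U \<Psi>\<^sub>V\<^sub>H = mateR V H U (dual V) ev_at ev_at (linv (induced (Psi_VU H V U \<Psi>\<^sub>V\<^sub>H)))"

definition Psi2_WH where
  "Psi2_WH H V U W \<Psi>\<^sub>H\<^sub>V = mateL W H U V (\<lambda>e. e) ev_at (induced (Psi2_HV H V U \<Psi>\<^sub>H\<^sub>V))"

definition Psi2_HW where
  "Psi2_HW H V U W \<Psi>\<^sub>V\<^sub>H = mateR H W V U ev_at (\<lambda>e. e) (induced (Psi2_VH H V U \<Psi>\<^sub>V\<^sub>H))"

definition dual_mult where
  "dual_mult H \<Delta> \<Psi> f g = app (mk H ground (\<lambda>a. twpair H H f g (linv \<Psi> \<cdot> (\<Delta>\<cdot>a))))"

definition unital_dual_subalgebra where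
  "unital_dual_subalgebra H \<Delta> \<epsilon> \<Psi> U \<longleftrightarrow> subspace_of U (dual H) \<and> app \<epsilon> \<in> carr U \<and>
     (\<forall>f\<in>carr U. \<forall>g\<in>carr U. dual_mult H \<Delta> \<Psi> f g \<in> carr U)"

text \<open>
  The dual coproduct on a subspace \<open>C \<subseteq> H'\<close>.  In contrast to \<open>temb\<close>, the embedding
  \<open>C \<otimes> C \<rightarrow> (H \<otimes> H)'\<close> is here the one given by \<open>\<langle>\<langle>_, _\<rangle>\<rangle>\<close>.
\<close>

definition dual_comult where
  "dual_comult H m \<Psi> C =
     (tlift C C (dual (H \<otimes> H)) (twpair H H),
      mk C (dual (H \<otimes> H)) (\<lambda>f. app (mk (H \<otimes> H) ground (\<lambda>t. f (m\<cdot>(\<Psi>\<cdot>t))))))"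

definition dual_coalgebra where
  "dual_coalgebra H m u \<Psi> C \<longleftrightarrow> subspace_of C (dual H) \<and> lands (dual_comult H m \<Psi> C) \<and>
     coalgebra C (induced (dual_comult H m \<Psi> C)) (mk C ground (\<lambda>f. f u))"

text \<open>The largest coalgebra in \<open>H'\<close>, as the sum of all coalgebras in \<open>H'\<close>.\<close>

definition circ_dual where
  "circ_dual H m u \<Psi> =
     \<lparr>carr = module.span (scal (dual H)) (\<Union>{carr C | C. dual_coalgebra H m u \<Psi> C}),
      scal = scal (dual H)\<rparr>"

definition circ_subcoalgebra where
  "circ_subcoalgebra H m u \<Psi> U \<longleftrightarrow>
     subspace_of U (circ_dual H m u \<Psi>) \<and> lands (dual_comult H m \<Psi> U)"

definition standard_left_dual where
  "standard_left_dual H m u \<Delta> \<epsilon> \<Psi> U \<longleftrightarrow>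
     braided_bialgebra H m u \<Delta> \<epsilon> \<Psi> \<and> nondegenerate U H \<and> unital_dual_subalgebra H \<Delta> \<epsilon> \<Psi> U \<and>
     lands (dual_comult H m \<Psi> U) \<and> bijective (Psi_UU H U \<Psi>) \<and> bijective (Psi_UH H U \<Psi>)"

definition standard_right_dual where
  "standard_right_dual H m u \<Delta> \<epsilon> \<Psi> U \<longleftrightarrow>
     braided_bialgebra H m u \<Delta> \<epsilon> \<Psi> \<and> nondegenerate U H \<and> unital_dual_subalgebra H \<Delta> \<epsilon> \<Psi> U \<and>
     lands (dual_comult H m \<Psi> U) \<and> bijective (Psi_UU H U \<Psi>) \<and> bijective (Psi_HU H U \<Psi>)"

text \<open>
  The suffix \<open>bq\<close> is the backquote: \<open>\<rho>\<^sub>R\<^sup>` : V \<rightarrow> (V' \<otimes> U)' \<supseteq> V \<otimes> H\<close> and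
  \<open>\<rho>\<^sub>L\<^sup>` : V \<rightarrow> (U \<otimes> V')' \<supseteq> H \<otimes> V\<close>.
\<close>

definition rhoR_bq where
  "rhoR_bq H V U \<Psi>\<^sub>H\<^sub>H \<rho> =
     (temb V H (dual V) U ev_at ev_at,
      mk V (dual (dual V \<otimes> U)) (\<lambda>v. app (tlift (dual V) U ground (\<lambda>e f.
        fpair V H e (\<lambda>h. ev U H \<cdot> (linv (induced (Psi_UH H U \<Psi>\<^sub>H\<^sub>H)) \<cdot> (pure H U h f))) (\<rho>\<cdot>v)))))"

definition rhoL_bq where
  "rhoL_bq H V U \<Psi>\<^sub>H\<^sub>H \<rho> =
     (temb H V U (dual V) ev_at ev_at,
      mk V (dual (U \<otimes> dual V)) (\<lambda>v. app (tlift U (dual V) ground (\<lambda>f e.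
        fpair H V (\<lambda>h. ev' H U \<cdot> (linv (induced (Psi_HU H U \<Psi>\<^sub>H\<^sub>H)) \<cdot> (pure U H f h))) e (\<rho>\<cdot>v)))))"

text \<open>The coactions \<open>V \<rightarrow> (V' \<otimes> H)' \<supseteq> V \<otimes> U\<close> and \<open>V \<rightarrow> (H \<otimes> V')' \<supseteq> U \<otimes> V\<close> obtained from an action\<close>

definition rhoR_of where
  "rhoR_of H V U \<Psi>\<^sub>H\<^sub>V \<nu> =
     (temb V U (dual V) H ev_at (\<lambda>f. f),
      mk V (dual (dual V \<otimes> H)) (\<lambda>v. app (tlift (dual V) H ground (\<lambda>e a.
        e (\<nu>\<cdot>(linv \<Psi>\<^sub>H\<^sub>V \<cdot> (pure V H v a)))))))"

definition rhoL_of where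
  "rhoL_of H V U \<Psi>\<^sub>V\<^sub>H \<nu> =
     (temb U V H (dual V) (\<lambda>f. f) ev_at,
      mk V (dual (H \<otimes> dual V)) (\<lambda>v. app (tlift H (dual V) ground (\<lambda>a e.
        e (\<nu>\<cdot>(linv \<Psi>\<^sub>V\<^sub>H \<cdot> (pure H V a v)))))))"

text \<open>\<open>\<nu>\<^sub>L\<^sup>` : H \<otimes> V \<rightarrow> W' \<supseteq> V\<close> and \<open>\<nu>\<^sub>R\<^sup>` : V \<otimes> H \<rightarrow> W' \<supseteq> V\<close>\<close>

definition nuL_bq where
  "nuL_bq H V U W \<Psi>\<^sub>H\<^sub>V \<nu> =
     (mk V (dual W) (\<lambda>v. app (mk W ground (\<lambda>e. e v))),
      tlift H V (dual W) (\<lambda>a v. app (mk W ground (\<lambda>e.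
        (ev' V W \<odot> (\<nu> \<otimes>\<^sub>m Id W) \<odot> (linv \<Psi>\<^sub>H\<^sub>V \<otimes>\<^sub>m Id W) \<odot> assoc' V H W
          \<odot> (Id V \<otimes>\<^sub>m induced (Psi2_WH H V U W \<Psi>\<^sub>H\<^sub>V)))
        \<cdot> (pure V (W \<otimes> H) v (pure W H e a))))))"

definition nuR_bq where
  "nuR_bq H V U W \<Psi>\<^sub>V\<^sub>H \<nu> =
     (mk V (dual W) (\<lambda>v. app (mk W ground (\<lambda>e. e v))),
      tlift V H (dual W) (\<lambda>v a. app (mk W ground (\<lambda>e.
        (ev W V \<odot> (Id W \<otimes>\<^sub>m \<nu>) \<odot> (Id W \<otimes>\<^sub>m linv \<Psi>\<^sub>V\<^sub>H) \<odot> assoc W H V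
          \<odot> (induced (Psi2_HW H V U W \<Psi>\<^sub>V\<^sub>H) \<otimes>\<^sub>m Id V))
        \<cdot> (pure (H \<otimes> W) V (pure H W a e) v)))))"

end

theory Submission
 imports Defs "HOL-Library.Product_Plus"
begin

text \<open>Tensors are handled through the multilinear forms on them. A linear map between tensor products is
replaced by the arrow that pulls forms back along it; a tensor product then is a word of sorts,
associativity and units disappear, and every axiom becomes an equation between whiskered arrows. A
word may be read in either direction. The axioms of a left comodule over a right H-braided space,
read backwards, are the same arrow equations as those of a right comodule over a left H-braided
space, and likewise for modules, so one proof on arrows serves both a statement and its opposite version.

The idea on arrows is duality. As U and H separate each other, an arrow into a word ending in U is
known once it is contracted with H (\<open>separation\<close>). The braiding of U with V is the mate of the
inverse of the braiding of H with V: evaluation slides past V by the one or by the other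
(\<open>mate_pair\<close>), and all compatibilities pass to mates. Contracting the H-leg of a coaction turns it
into an action of U, and an action of H becomes a coaction of U; the axioms again pass over
(\<open>comodule_mate\<close>, \<open>module_mate\<close>). Doing this twice returns to H: coaction, action, coaction
gives the statement on comodules (\<open>double_comodule\<close>), and action, coaction, action the one on modules
(\<open>double_module\<close>). The structure does not return unchanged: the product of U is the transpose of the coproduct of H twisted
by the inverse braiding, so each passage adds one twist, and two passages give the coproduct twisted
by -2. Since a twist of a braided bialgebra is again one (\<open>braided_twist\<close>), the statements make sense
for the twisted H. The space W only provides functionals that detect the values of the new action.

What remains is to compute on elements the maps that the statement defines by functionals, and to
see that they are the arrows above.\<close>

notation tensor_lmap (infixr "**" 75)
notation tensor (infixr "><" 75)
notation comp_lmap (infixr "oo" 65)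
notation app (infixl "$" 90)
abbreviation (input) eqv (infixr "<->" 25) where "eqv A B == (A::bool) = B"
abbreviation "linf X == linear_map X ground"
lemmas vT = vspace_tensor and pT = pure_in_tensor

section \<open>Multilinear forms and whiskered arrows\<close>

text \<open>A formal finite sum of weighted points, applied to a form. Points of a word stand for pure tensors,
so a tensor is such a sum up to forms that cannot tell it apart.\<close>

definition comb :: "('k::field \<times> 'x) list => ('x => 'k) => 'k" where
 "comb L T = (\<Sum>(c, x)\<leftarrow>L. c * T x)"

lemma comb_Nil [simp]: "comb [] T = 0"
 and comb_Cons [simp]: "comb ((c, x)#L) T = c * T x + comb L T"
 and comb_append [simp]: "comb (L @ L') T = comb L T + comb L' T" by (simp_all add: comb_def)

lemma comb_cong: "(!!c x. (c, x) : set L ==> T x = T' x) ==> comb L T = comb L T'"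
 unfolding comb_def by (intro arg_cong[of _ _ sum_list] map_cong) auto

lemma comb_add: "comb L (%x. T x + T' x) = comb L T + comb L T'" by (induction L) (auto simp: algebra_simps)

lemma comb_scale: "comb L (%x. a * T x) = a * comb L T" by (induction L) (auto simp: algebra_simps)

lemma comb_swap: "comb L (%x. comb L' (%y. T x y)) = comb L' (%y. comb L (%x. T x y))"
proof (induction L)
 case Nil
 show ?case by (induction L') auto
next
 case (Cons a L)
 then show ?case by (cases a) (simp add: comb_add comb_scale)
qed

lemma comb_map: "comb (map (%(c, x). (c, g x)) L) T = comb L (%x. T (g x))" by (induction L) auto

lemma linear_ground_iff:
 "linf X g <-> (\<forall>x\<in>carr X. \<forall>y\<in>carr X. g (x + y) = g x + g y) &
   (\<forall>c. \<forall>x\<in>carr X. g (scal X c x) = c * g x)" by (simp add: linear_map_def ground_def)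

lemma vspace_ground: "vspace (ground :: ('k::field, 'k) vs)"
proof -
 interpret vector_space "(*) :: 'k => 'k => 'k" by unfold_locales (auto simp: algebra_simps)
 show ?thesis by (simp add: vspace_def ground_def vector_space_axioms subspace_UNIV)
qed

lemma vspace_closed:
 assumes "vspace X"
 shows vspace_zero: "0 : carr X"
  and vspace_add: "x : carr X ==> y : carr X ==> x + y : carr X"
  and vspace_scal: "x : carr X ==> scal X c x : carr X"
  and vspace_diff: "x : carr X ==> y : carr X ==> x - y : carr X"
proof -
 interpret vector_space "scal X" using assms by (simp add: vspace_def)
 have s: "subspace (carr X)" using assms by (simp add: vspace_def)
 show "0 : carr X" "x : carr X ==> y : carr X ==> x + y : carr X"
  "x : carr X ==> scal X c x : carr X" "x : carr X ==> y : carr X ==> x - y : carr X"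
  using subspace_0[OF s] subspace_add[OF s] subspace_scale[OF s] subspace_diff[OF s] by auto
qed

lemma linear_ground_cong:
 assumes "vspace X" "!!x. x : carr X ==> g x = h x"
 shows "linf X g = linf X h" using assms vspace_closed[OF assms(1)] by (simp add: linear_ground_iff)

lemma linear_ground_zero: "linf X (%_. 0)" by (simp add: linear_ground_iff)

lemma linear_ground_comb:
 assumes "!!c y. (c, y) : set L ==> linf X (%x. g y x)"
 shows "linf X (%x. comb L (%y. g y x))" using assms
proof (induction L)
 case Nil
 show ?case by (simp add: linear_ground_zero)
next
 case (Cons a L)
 have "linf X (%x. comb L (%y. g y x))" using Cons.prems by (intro Cons.IH) auto
 moreover have "linf X (g (snd a))" using Cons.prems[of "fst a" "snd a"] by simp
 ultimately show ?case by (cases a) (simp add: linear_ground_iff algebra_simps)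
qed

record ('s, 'z, 'k) arr =
 adom :: "'s list"
 acod :: "'s list"
 afn :: "('z list => 'k) => 'z list => 'k"

locale tensor_words =
 fixes S :: "'s => ('k::field, 'z::ab_group_add) vs"
 assumes vspace_S: "vspace (S s)"
begin

definition points :: "'s list => 'z list set" where
 "points w = {xs. list_all2 (%s x. x : carr (S s)) w xs}"

definition forms :: "'s list => ('z list => 'k) set" where
 "forms w = {T. (\<forall>xs. xs ~: points w --> T xs = 0) &
   (\<forall>xs\<in>points w. \<forall>i<length w. linf (S (w ! i)) (%z. T (xs[i := z])))}"

lemma points_length: "xs : points w ==> length xs = length w" by (auto simp: points_def list_all2_lengthD)

lemma points_Nil [simp]: "xs : points [] <-> xs = []" by (simp add: points_def)

lemma points_Cons [simp]: "x#xs : points (s#w) <-> x : carr (S s) & xs : points w" by (simp add: points_def)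

lemma points_ConsD: "zs : points (s#w) ==> \<exists>x xs. zs = x#xs & x : carr (S s) & xs : points w" by (cases zs) (auto simp: points_def)

lemma points_append: "length xs = length w ==> xs @ ys : points (w @ w') <-> xs : points w & ys : points w'"
 by (simp add: points_def list_all2_append)

lemma points_appendI: "xs : points w ==> ys : points w' ==> xs @ ys : points (w @ w')" by (simp add: points_append points_length)

lemma points_appendD:
 assumes "zs : points (w @ w')"
 shows "\<exists>xs ys. zs = xs @ ys & xs : points w & ys : points w'"
proof -
 have "zs = take (length w) zs @ drop (length w) zs" by simp
 moreover have "length (take (length w) zs) = length w" using points_length[OF assms] by simp
 ultimately show ?thesis using assms points_append by metis
qed

lemma points_append3D:
 assumes "zs : points (u @ v @ w)"
 obtains a b c where "zs = a @ b @ c" "a : points u" "b : points v" "c : points w" using points_appendD[OF assms] points_appendD by blast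

lemma points_update: "xs : points w ==> z : carr (S (w ! i)) ==> xs[i := z] : points w"
 unfolding points_def list_all2_conv_all_nth mem_Collect_eq length_list_update by (intro conjI allI impI, simp, case_tac "ia = i") simp_all

lemma forms_ext:
 assumes "T : forms w" "T' : forms w" "!!xs. xs : points w ==> T xs = T' xs"
 shows "T = T'"
proof
 fix xs
 show "T xs = T' xs" using assms unfolding forms_def by (cases "xs : points w") simp_all
qed

lemma forms_out: "T : forms w ==> xs ~: points w ==> T xs = 0" by (simp add: forms_def)

lemma forms_lin: "T : forms w ==> xs : points w ==> i < length w ==>
  linf (S (w ! i)) (%z. T (xs[i := z]))" by (simp add: forms_def)

lemma zero_forms [simp]: "(%_. 0) : forms w" by (simp add: forms_def linear_ground_zero)

lemma forms_slice:
 assumes T: "T : forms (p @ w @ q)" and a: "a : points p" and c: "c : points q"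
 shows "(%xs. T (a @ xs @ c)) : forms w"
proof -
 have "T (a @ xs @ c) = 0" if "xs ~: points w" for xs
 proof (rule forms_out[OF T])
  show "a @ xs @ c ~: points (p @ w @ q)" using that points_length[OF a] points_length[OF c] points_length[of "a @ xs @ c" "p @ w @ q"]
   by (auto simp: points_append)
 qed
 moreover have "linf (S (w ! i)) (%z. T (a @ xs[i := z] @ c))"
  if xs: "xs : points w" and i: "i < length w" for xs i
 proof -
  have "linf (S ((p @ w @ q) ! (length p + i)))
    (%z. T ((a @ xs @ c)[length p + i := z]))" using i by (intro forms_lin[OF T] points_appendI a c xs) simp
  then show ?thesis using i points_length[OF a] points_length[OF xs] by (simp add: nth_append list_update_append)
 qed
 ultimately show ?thesis by (simp add: forms_def)
qed

text \<open>An arrow sends forms on its codomain to forms on its domain, and pointwise it is a finite sum of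
evaluations. This finiteness keeps out transposes of maps into a completed tensor product.\<close>

definition arrow :: "('s, 'z, 'k) arr => bool" where
 "arrow f <-> (\<forall>T. T ~: forms (acod f) --> afn f T = (%_. 0)) &
   (\<forall>T \<in> forms (acod f). afn f T : forms (adom f)) &
   (\<forall>xs \<in> points (adom f). \<exists>L. (\<forall>(c, ys) \<in> set L. ys : points (acod f)) &
    (\<forall>T \<in> forms (acod f). afn f T xs = comb L T))"

lemma arrow_form: "arrow f ==> afn f T : forms (adom f)" by (cases "T : forms (acod f)") (auto simp: arrow_def)

lemma arrow_comb:
 assumes "arrow f" "xs : points (adom f)"
 obtains L where "!!c ys. (c, ys) : set L ==> ys : points (acod f)"
  "!!T. T : forms (acod f) ==> afn f T xs = comb L T" using assms unfolding arrow_def by fast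

lemma arrow_zero: "arrow f ==> xs : points (adom f) ==> afn f (%_. 0) xs = 0" by (erule (1) arrow_comb) (use comb_scale[of _ 0 "%_. 0"] in simp)

lemma arrow_eqI:
 assumes "arrow f" "arrow g" "adom f = adom g" "acod f = acod g"
  and "!!T xs. T : forms (acod f) ==> xs : points (adom f) ==> afn f T xs = afn g T xs"
 shows "f = (g :: ('s, 'z, 'k) arr)"
proof -
 have "afn f T = afn g T" for T
 proof (cases "T : forms (acod f)")
  case True
  then show ?thesis using assms arrow_form by (metis forms_ext)
 next
  case False
  then show ?thesis using assms by (simp add: arrow_def)
 qed
 then show ?thesis using assms by (intro arr.equality) auto
qed

text \<open>The arrow f with identities on its left and right. The left context p is stored in reverse, so that
its sort next to f is the head of the list and an open tail p stands for any further context.\<close>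

definition W :: "('s, 'z, 'k) arr => 's list => 's list => ('z list => 'k) => 'z list => 'k" where
 "W f p q T = (%xs. if T : forms (rev p @ acod f @ q) & xs : points (rev p @ adom f @ q)
   then afn f (%ys. T (take (length p) xs @ ys @ drop (length p + length (adom f)) xs))
      (take (length (adom f)) (drop (length p) xs)) else 0)"

lemma W_out: "T ~: forms (rev p @ acod f @ q) ==> W f p q T = (%_. 0)" by (simp add: W_def)

lemma W_app:
 assumes "T : forms (rev p @ acod f @ q)" "a : points (rev p)" "b : points (adom f)" "c : points q"
 shows "W f p q T (a @ b @ c) = afn f (%ys. T (a @ ys @ c)) b"
proof -
 have "a @ b @ c : points (rev p @ adom f @ q)" using assms by (intro points_appendI)
 then show ?thesis using assms points_length[OF assms(2)] points_length[OF assms(3)] by (simp add: W_def)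
qed

lemma W_form:
 assumes f: "arrow f"
 shows "W f p q T : forms (rev p @ adom f @ q)"
proof (cases "T : forms (rev p @ acod f @ q)")
 case T: True
 have "linf (S ((rev p @ adom f @ q) ! i)) (%z. W f p q T (xs[i := z]))"
  if xs: "xs : points (rev p @ adom f @ q)" and i: "i < length (rev p @ adom f @ q)" for xs i
 proof -
  obtain a b c where abc: "xs = a @ b @ c" "a : points (rev p)" "b : points (adom f)" "c : points q" using points_append3D[OF xs] by blast
  have la: "length a = length p" "length b = length (adom f)" "length c = length q" using abc points_length by fastforce+
  obtain L where L: "!!c ys. (c, ys) : set L ==> ys : points (acod f)"
   "!!T. T : forms (acod f) ==> afn f T b = comb L T" using arrow_comb[OF f abc(3)] by blast
  consider (l) "i < length p" | (m) "length p \<le> i" "i < length p + length (adom f)"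
   | (r) "length p + length (adom f) \<le> i" by linarith
  then show ?thesis
  proof cases
   case l
   have "W f p q T (xs[i := z]) = comb L (%ys. T ((a @ ys @ c)[i := z]))"
    if z: "z : carr (S ((rev p @ adom f @ q) ! i))" for z
   proof -
    have "z : carr (S (rev p ! i))" using z l by (simp add: nth_append)
    then have a': "a[i := z] : points (rev p)" using abc points_update by blast
    have "W f p q T (xs[i := z]) = W f p q T (a[i := z] @ b @ c)" using abc la l by (simp add: list_update_append)
    also have "... = comb L (%ys. T (a[i := z] @ ys @ c))" using abc a' T by (simp add: W_app L(2) forms_slice)
    finally show ?thesis using la l by (simp add: list_update_append)
   qed
   moreover have "linf (S ((rev p @ adom f @ q) ! i))
     (%z. comb L (%ys. T ((a @ ys @ c)[i := z])))"
   proof (rule linear_ground_comb)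
    fix d ys assume "(d, ys) : set L"
    then have "ys : points (acod f)" by (rule L)
    then have "linf (S ((rev p @ acod f @ q) ! i)) (%z. T ((a @ ys @ c)[i := z]))" using l by (intro forms_lin[OF T] points_appendI abc) auto
    then show "linf (S ((rev p @ adom f @ q) ! i)) (%z. T ((a @ ys @ c)[i := z]))" using l by (simp add: nth_append)
   qed
   ultimately show ?thesis by (subst linear_ground_cong[OF vspace_S]) auto
  next
   case m
   have "W f p q T (xs[i := z]) = afn f (%ys. T (a @ ys @ c)) (b[i - length p := z])"
    if z: "z : carr (S ((rev p @ adom f @ q) ! i))" for z
   proof -
    have "z : carr (S (adom f ! (i - length p)))" using z m by (simp add: nth_append split: if_splits)
    then have b': "b[i - length p := z] : points (adom f)" using abc points_update by blast
    have "W f p q T (xs[i := z]) = W f p q T (a @ b[i - length p := z] @ c)" using abc la m le_diff_conv2[of "length p" i "length (adom f)"]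
     by (simp add: list_update_append less_diff_conv2)
    also have "... = afn f (%ys. T (a @ ys @ c)) (b[i - length p := z])" using abc b' T by (simp add: W_app)
    finally show ?thesis .
   qed
   moreover have "linf (S ((rev p @ adom f @ q) ! i))
     (%z. afn f (%ys. T (a @ ys @ c)) (b[i - length p := z]))" using forms_lin[OF arrow_form[OF f] abc(3), of "i - length p"] m
    by (simp add: nth_append not_less less_diff_conv2)
   ultimately show ?thesis by (subst linear_ground_cong[OF vspace_S]) auto
  next
   case r
   then obtain j where j: "i = length p + length (adom f) + j" using le_Suc_ex by blast
   have "W f p q T (xs[i := z]) = comb L (%ys. T (a @ ys @ c[j := z]))"
    if z: "z : carr (S ((rev p @ adom f @ q) ! i))" for z
   proof -
    have "z : carr (S (q ! j))" using z by (simp add: nth_append j)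
    then have c': "c[j := z] : points q" using abc points_update by blast
    have "W f p q T (xs[i := z]) = W f p q T (a @ b @ c[j := z])" using abc la by (simp add: list_update_append j)
    also have "... = comb L (%ys. T (a @ ys @ c[j := z]))" using abc c' T by (simp add: W_app L(2) forms_slice)
    finally show ?thesis .
   qed
   moreover have "linf (S ((rev p @ adom f @ q) ! i))
     (%z. comb L (%ys. T (a @ ys @ c[j := z])))"
   proof (rule linear_ground_comb)
    fix d ys assume "(d, ys) : set L"
    then have ys: "ys : points (acod f)" by (rule L)
    have "linear_map (S ((rev p @ acod f @ q) ! (length p + length (acod f) + j))) ground
      (%z. T ((a @ ys @ c)[length p + length (acod f) + j := z]))" using i j by (intro forms_lin[OF T] points_appendI abc ys) auto
    then show "linf (S ((rev p @ adom f @ q) ! i)) (%z. T (a @ ys @ c[j := z]))"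
     using la points_length[OF ys] by (simp add: nth_append list_update_append j)
   qed
   ultimately show ?thesis by (subst linear_ground_cong[OF vspace_S]) auto
  qed
 qed
 then show ?thesis by (auto simp: forms_def W_def)
qed (simp add: W_out)

lemma W_slice:
 assumes T: "T : forms (rev p' @ (rev p @ acod f @ q) @ q')"
  and a: "a : points (rev p')" and c: "c : points q'" and f: "arrow f"
 shows "(%xs. W f (p @ p') (q @ q') T (a @ xs @ c)) = W f p q (%xs. T (a @ xs @ c))"
proof (rule forms_ext[of _ "rev p @ adom f @ q"])
 have T': "T : forms (rev (p @ p') @ acod f @ q @ q')" using T by simp
 show "(%xs. W f (p @ p') (q @ q') T (a @ xs @ c)) : forms (rev p @ adom f @ q)"
  by (rule forms_slice[OF _ a c]) (use W_form[OF f, of "p @ p'" "q @ q'" T] in simp)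
 show "W f p q (%xs. T (a @ xs @ c)) : forms (rev p @ adom f @ q)" by (rule W_form[OF f])
 fix xs assume "xs : points (rev p @ adom f @ q)"
 then obtain x y z where xs: "xs = x @ y @ z" "x : points (rev p)" "y : points (adom f)" "z : points q" using points_append3D by blast
 have "W f (p @ p') (q @ q') T ((a @ x) @ y @ (z @ c)) = afn f (%ys. T ((a @ x) @ ys @ z @ c)) y"
  by (rule W_app[OF T']) (use xs a c points_appendI in auto)
 moreover have "W f p q (%xs. T (a @ xs @ c)) (x @ y @ z) = afn f (%ys. T (a @ (x @ ys @ z) @ c)) y"
  by (rule W_app) (use xs forms_slice[OF T a c] in auto)
 ultimately show "W f (p @ p') (q @ q') T (a @ xs @ c) = W f p q (%xs. T (a @ xs @ c)) xs" unfolding xs(1) by (simp only: append_assoc)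
qed

definition Idw :: "'s list => ('z list => 'k) => 'z list => 'k" where
 "Idw w T = (if T : forms w then T else (%_. 0))"

lemma Idw_form: "Idw w T : forms w" by (simp add: Idw_def)

lemma Idw_id: "T : forms w ==> Idw w T = T" by (simp add: Idw_def)

lemma W_zero [simp]:
 assumes f: "arrow f"
 shows "W f p q (%_. 0) = (%_. 0)"
proof (rule forms_ext[OF W_form[OF f] zero_forms])
 fix xs assume "xs : points (rev p @ adom f @ q)"
 then obtain x y z where xs: "xs = x @ y @ z" "x : points (rev p)" "y : points (adom f)" "z : points q" using points_append3D by blast
 then show "W f p q (%_. 0) xs = 0" using f by (simp add: W_app arrow_zero)
qed

lemma W_Idw: "arrow f ==> w = rev p @ acod f @ q ==> W f p q (Idw w T) = W f p q T" by (simp add: Idw_def W_out)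

lemma Idw_W: "arrow f ==> w = rev p @ adom f @ q ==> Idw w (W f p q T) = W f p q T" by (simp add: Idw_id W_form)

lemma Idw_Idw: "Idw w (Idw w T) = Idw w T" by (simp add: Idw_id Idw_form)

definition ida :: "'s list => ('s, 'z, 'k) arr" where
 "ida w = \<lparr>adom = w, acod = w, afn = Idw w\<rparr>"

definition comp :: "('s, 'z, 'k) arr => ('s, 'z, 'k) arr => ('s, 'z, 'k) arr" (infixr ">>" 70) where
 "f >> g = \<lparr>adom = adom f, acod = acod g, afn = (%T. afn f (afn g T))\<rparr>"

definition wh :: "'s list => ('s, 'z, 'k) arr => 's list => ('s, 'z, 'k) arr" where
 "wh p f q = \<lparr>adom = rev p @ adom f @ q, acod = rev p @ acod f @ q, afn = W f p q\<rparr>"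

lemma dom_cod [simp]:
 "adom (ida w) = w" "acod (ida w) = w" "adom (f >> g) = adom f" "acod (f >> g) = acod g"
 "adom (wh p f q) = rev p @ adom f @ q" "acod (wh p f q) = rev p @ acod f @ q" by (simp_all add: ida_def comp_def wh_def)

lemma ida_arrow [simp]: "arrow (ida w)"
proof -
 have "\<exists>L. (\<forall>(c, ys)\<in>set L. ys : points w) & (\<forall>T\<in>forms w. T xs = comb L T)"
  if "xs : points w" for xs using that by (intro exI[of _ "[(1, xs)]"]) simp
 then show ?thesis by (simp add: arrow_def ida_def Idw_def)
qed

lemma comb_list_ex:
 assumes "!!c y. (c, y) : set L ==> \<exists>L'. (\<forall>(d, z) \<in> set L'. z : P) & (\<forall>T\<in>A. g T y = comb L' T)"
 shows "\<exists>L'. (\<forall>(d, z) \<in> set L'. z : P) & (\<forall>T\<in>A. comb L (g T) = comb L' T)" using assms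
proof (induction L)
 case Nil
 show ?case by (intro exI[of _ "[]"]) simp
next
 case (Cons a L)
 obtain c y where a: "a = (c, y)" by force
 obtain L1 where L1: "\<forall>(d, z) \<in> set L1. z : P" "\<forall>T\<in>A. comb L (g T) = comb L1 T"
  using Cons.IH Cons.prems by (metis list.set_intros(2))
 obtain L2 where L2: "\<forall>(d, z) \<in> set L2. z : P" "\<forall>T\<in>A. g T y = comb L2 T" using Cons.prems[of c y] a by auto
 have sc: "comb (map (%(d, z). (c * d, z)) L2) T = c * comb L2 T" for T by (induction L2) (auto simp: algebra_simps)
 show ?case using L1 L2 a sc by (intro exI[of _ "map (%(d, z). (c * d, z)) L2 @ L1"]) auto
qed

lemma comp_arrow [simp]:
 assumes f: "arrow f" and g: "arrow g" and fg: "acod f = adom g"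
 shows "arrow (f >> g)"
proof -
 have "\<exists>L. (\<forall>(c, ys) \<in> set L. ys : points (acod g)) &
   (\<forall>T\<in>forms (acod g). afn f (afn g T) xs = comb L T)" if xs: "xs : points (adom f)" for xs
 proof -
  obtain L where L: "!!c ys. (c, ys) : set L ==> ys : points (acod f)"
   "!!T. T : forms (acod f) ==> afn f T xs = comb L T" using arrow_comb[OF f xs] by blast
  have "\<exists>L'. (\<forall>(c, ys) \<in> set L'. ys : points (acod g)) &
    (\<forall>T\<in>forms (acod g). comb L (afn g T) = comb L' T)"
  proof (rule comb_list_ex)
   fix c y assume "(c, y) : set L"
   then have "y : points (adom g)" using L(1) fg by simp
   then show "\<exists>L'. (\<forall>(d, z)\<in>set L'. z : points (acod g)) &
     (\<forall>T\<in>forms (acod g). afn g T y = comb L' T)" using g by (simp add: arrow_def)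
  qed
  then show ?thesis using L(2) arrow_form[OF g] fg by simp
 qed
 moreover have "afn f (afn g T) = (%_. 0)" if "T ~: forms (acod g)" for T
 proof (rule forms_ext[of _ "adom f"])
  have gT: "afn g T = (%_. 0)" using g that by (simp add: arrow_def)
  show "afn f (afn g T) : forms (adom f)" using f by (rule arrow_form)
  fix xs assume xs: "xs : points (adom f)"
  show "afn f (afn g T) xs = 0" using arrow_zero[OF f xs] gT by simp
 qed simp
 ultimately show ?thesis using arrow_form[OF f] by (simp add: arrow_def comp_def)
qed

lemma wh_arrow [simp]:
 assumes f: "arrow f"
 shows "arrow (wh p f q)"
proof -
 have "\<exists>L. (\<forall>(c, ys) \<in> set L. ys : points (rev p @ acod f @ q)) &
   (\<forall>T\<in>forms (rev p @ acod f @ q). W f p q T xs = comb L T)"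
  if "xs : points (rev p @ adom f @ q)" for xs
 proof -
  obtain a b c where xs: "xs = a @ b @ c" "a : points (rev p)" "b : points (adom f)" "c : points q"
   by (rule points_append3D[OF \<open>xs : points (rev p @ adom f @ q)\<close>])
  obtain L where L: "!!c ys. (c, ys) : set L ==> ys : points (acod f)"
   "!!T. T : forms (acod f) ==> afn f T b = comb L T" using arrow_comb[OF f xs(3)] by blast
  show ?thesis
  proof (intro exI[of _ "map (%(d, ys). (d, a @ ys @ c)) L"] conjI ballI)
   fix T assume T: "T : forms (rev p @ acod f @ q)"
   show "W f p q T xs = comb (map (%(d, ys). (d, a @ ys @ c)) L) T" using xs T by (simp add: W_app L(2) forms_slice comb_map)
  qed (use L(1) xs points_appendI in auto)
 qed
 then show ?thesis using W_form[OF f] by (simp add: arrow_def wh_def W_out)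
qed

lemma W_ida: "W (ida w) p q T = Idw (rev p @ w @ q) T"
proof (cases "T : forms (rev p @ w @ q)")
 case T: True
 show ?thesis
 proof (rule forms_ext[of _ "rev p @ w @ q"])
  fix xs assume "xs : points (rev p @ w @ q)"
  then obtain a b c where xs: "xs = a @ b @ c" "a : points (rev p)" "b : points w" "c : points q" using points_append3D by blast
  have "W (ida w) p q T (a @ b @ c) = afn (ida w) (%ys. T (a @ ys @ c)) b" by (rule W_app) (use xs T in auto)
  then show "W (ida w) p q T xs = Idw (rev p @ w @ q) T xs" using xs T forms_slice[OF T xs(2,4)] by (simp add: ida_def Idw_id)
 qed (use W_form[of "ida w" p q T] Idw_form in auto)
qed (simp add: W_out Idw_def)

lemma W_comp:
 assumes f: "arrow f" and g: "arrow g" and fg: "acod f = adom g"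
 shows "W (f >> g) p q T = W f p q (W g p q T)"
proof (cases "T : forms (rev p @ acod g @ q)")
 case T: True
 show ?thesis
 proof (rule forms_ext[of _ "rev p @ adom f @ q"])
  show "W (f >> g) p q T : forms (rev p @ adom f @ q)" using W_form[of "f >> g" p q T] f g fg by simp
  show "W f p q (W g p q T) : forms (rev p @ adom f @ q)" using f by (rule W_form)
  fix xs assume "xs : points (rev p @ adom f @ q)"
  then obtain a b c where xs: "xs = a @ b @ c" "a : points (rev p)" "b : points (adom f)" "c : points q" using points_append3D by blast
  have 1: "W (f >> g) p q T (a @ b @ c) = afn f (afn g (%ys. T (a @ ys @ c))) b" using xs T by (subst W_app) (auto simp: comp_def)
  have 2: "W f p q (W g p q T) (a @ b @ c) = afn f (%ys. W g p q T (a @ ys @ c)) b" using xs W_form[OF g, of p q T] fg by (subst W_app) auto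
  have "(%ys. W g p q T (a @ ys @ c)) = afn g (%ys. T (a @ ys @ c))"
  proof (rule forms_ext[of _ "adom g"])
   show "(%ys. W g p q T (a @ ys @ c)) : forms (adom g)" using W_form[OF g, of p q T] xs by (intro forms_slice) auto
   show "afn g (%ys. T (a @ ys @ c)) : forms (adom g)" using g by (rule arrow_form)
   show "W g p q T (a @ ys @ c) = afn g (%ys. T (a @ ys @ c)) ys" if "ys : points (adom g)" for ys using T xs that by (intro W_app) auto
  qed
  then show "W (f >> g) p q T xs = W f p q (W g p q T) xs" using 1 2 xs by simp
 qed
next
 case False
 then show ?thesis using f by (simp add: W_out)
qed

lemma W_wh:
 assumes f: "arrow f"
 shows "W (wh p f q) p' q' T = W f (p @ p') (q @ q') T"
proof (cases "T : forms (rev p' @ (rev p @ acod f @ q) @ q')")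
 case T: True
 show ?thesis
 proof (rule forms_ext[of _ "rev p' @ (rev p @ adom f @ q) @ q'"])
  show "W (wh p f q) p' q' T : forms (rev p' @ (rev p @ adom f @ q) @ q')" using W_form[OF wh_arrow[OF f], of p q p' q' T] by simp
  show "W f (p @ p') (q @ q') T : forms (rev p' @ (rev p @ adom f @ q) @ q')" using W_form[OF f, of "p @ p'" "q @ q'" T] by simp
  fix xs assume "xs : points (rev p' @ (rev p @ adom f @ q) @ q')"
  then obtain a b c where xs: "xs = a @ b @ c" "a : points (rev p')" "b : points (rev p @ adom f @ q)" "c : points q'" using points_append3D by blast
  have "W (wh p f q) p' q' T (a @ b @ c) = afn (wh p f q) (%ys. T (a @ ys @ c)) b" using xs T by (intro W_app) auto
  also have "... = W f p q (%ys. T (a @ ys @ c)) b" by (simp add: wh_def)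
  also have "... = W f (p @ p') (q @ q') T (a @ b @ c)" using fun_cong[OF W_slice[OF T xs(2,4) f], of b] by simp
  finally show "W (wh p f q) p' q' T xs = W f (p @ p') (q @ q') T xs" using xs by simp
 qed
qed (simp add: W_out)

lemma interchange:
 assumes f: "arrow f" and g: "arrow g"
 shows "W g (rev m @ rev (adom f) @ p) q (W f p (m @ acod g @ q) T) =
   W f p (m @ adom g @ q) (W g (rev m @ rev (acod f) @ p) q T)"
proof (cases "T : forms (rev p @ acod f @ m @ acod g @ q)")
 case T: True
 have gT: "W g (rev m @ rev (acod f) @ p) q T : forms (rev p @ acod f @ m @ adom g @ q)" using W_form[OF g, of "rev m @ rev (acod f) @ p" q T] by simp
 have fT: "W f p (m @ acod g @ q) T : forms (rev p @ adom f @ m @ acod g @ q)" using W_form[OF f, of p "m @ acod g @ q" T] by simp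
 show ?thesis
 proof (rule forms_ext[of _ "rev p @ adom f @ m @ adom g @ q"])
  show "W g (rev m @ rev (adom f) @ p) q (W f p (m @ acod g @ q) T)
    : forms (rev p @ adom f @ m @ adom g @ q)" using W_form[OF g, of "rev m @ rev (adom f) @ p" q] by simp
  show "W f p (m @ adom g @ q) (W g (rev m @ rev (acod f) @ p) q T)
    : forms (rev p @ adom f @ m @ adom g @ q)" using W_form[OF f, of p "m @ adom g @ q"] by simp
  fix zs assume "zs : points (rev p @ adom f @ m @ adom g @ q)"
  then obtain a b r where 1: "zs = a @ b @ r" "a : points (rev p)" "b : points (adom f)"
   "r : points (m @ adom g @ q)" by (rule points_append3D)
  obtain c d e where "r = c @ d @ e" "c : points m" "d : points (adom g)" "e : points q" using 1(4) by (rule points_append3D)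
  with 1 have zs: "zs = a @ b @ c @ d @ e" "a : points (rev p)"
   "b : points (adom f)" "c : points m" "d : points (adom g)" "e : points q" by auto
  obtain L where L: "!!c ys. (c, ys) : set L ==> ys : points (acod f)"
   "!!T. T : forms (acod f) ==> afn f T b = comb L T" using arrow_comb[OF f zs(3)] by blast
  obtain K where K: "!!c ys. (c, ys) : set K ==> ys : points (acod g)"
   "!!T. T : forms (acod g) ==> afn g T d = comb K T" using arrow_comb[OF g zs(5)] by blast
  have cde: "c @ d @ e : points (m @ adom g @ q)" using zs by (intro points_appendI)
  have abc: "a @ b @ c : points (rev (rev m @ rev (adom f) @ p))" using zs by (simp add: points_appendI)
  have 1: "W g (rev m @ rev (acod f) @ p) q T (a @ xs @ c @ d @ e) =
    comb K (%ys. T (a @ xs @ c @ ys @ e))" if "xs : points (acod f)" for xs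
  proof -
   have axc: "a @ xs @ c : points (rev (rev m @ rev (acod f) @ p))" using zs that by (simp add: points_appendI)
   have "W g (rev m @ rev (acod f) @ p) q T ((a @ xs @ c) @ d @ e) =
     afn g (%ys. T ((a @ xs @ c) @ ys @ e)) d" using T by (intro W_app axc zs) simp
   also have "... = comb K (%ys. T ((a @ xs @ c) @ ys @ e))" using T by (intro K(2) forms_slice[OF _ axc zs(6)]) simp
   finally show ?thesis by simp
  qed
  have 2: "W f p (m @ acod g @ q) T (a @ b @ c @ ys @ e) = comb L (%xs. T (a @ xs @ c @ ys @ e))"
   if "ys : points (acod g)" for ys
  proof -
   have cye: "c @ ys @ e : points (m @ acod g @ q)" using zs that by (simp add: points_appendI)
   have "W f p (m @ acod g @ q) T (a @ b @ (c @ ys @ e)) = afn f (%xs. T (a @ xs @ c @ ys @ e)) b" using T by (intro W_app cye zs) simp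
   also have "... = comb L (%xs. T (a @ xs @ c @ ys @ e))" using T by (intro L(2) forms_slice[OF _ zs(2) cye]) simp
   finally show ?thesis by simp
  qed
  have "W f p (m @ adom g @ q) (W g (rev m @ rev (acod f) @ p) q T) (a @ b @ (c @ d @ e)) =
    afn f (%xs. W g (rev m @ rev (acod f) @ p) q T (a @ xs @ c @ d @ e)) b" using gT by (intro W_app zs cde) simp
  also have "... = comb L (%xs. W g (rev m @ rev (acod f) @ p) q T (a @ xs @ c @ d @ e))" by (intro L(2) forms_slice[OF gT zs(2) cde])
  also have "... = comb L (%xs. comb K (%ys. T (a @ xs @ c @ ys @ e)))" using L(1) 1 by (intro comb_cong) auto
  also have "... = comb K (%ys. comb L (%xs. T (a @ xs @ c @ ys @ e)))" by (rule comb_swap)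
  also have "... = comb K (%ys. W f p (m @ acod g @ q) T ((a @ b @ c) @ ys @ e))" using K(1) 2 by (intro comb_cong) auto
  also have "... = afn g (%ys. W f p (m @ acod g @ q) T ((a @ b @ c) @ ys @ e)) d"
   using fT by (intro K(2)[symmetric] forms_slice[OF _ abc zs(6)]) simp
  also have "... = W g (rev m @ rev (adom f) @ p) q (W f p (m @ acod g @ q) T) ((a @ b @ c) @ d @ e)" using fT by (intro W_app[symmetric] zs abc) simp
  finally show "W g (rev m @ rev (adom f) @ p) q (W f p (m @ acod g @ q) T) zs =
    W f p (m @ adom g @ q) (W g (rev m @ rev (acod f) @ p) q T) zs" using zs by simp
 qed
qed (use f g in \<open>simp add: W_out\<close>)

lemma slide:
 assumes f: "arrow f" and g: "arrow g"
  and "length p' + length (adom f) \<le> length p"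
  and "drop (length p - length p' - length (adom f)) p = rev (adom f) @ p'"
  and "q' = rev (take (length p - length p' - length (adom f)) p) @ acod g @ q"
 shows "W g p q (W f p' q' T) =
   W f p' (rev (take (length p - length p' - length (adom f)) p) @ adom g @ q)
    (W g (take (length p - length p' - length (adom f)) p @ rev (acod f) @ p') q T)"
proof -
 have "p = take (length p - length p' - length (adom f)) p @ rev (adom f) @ p'" using assms(4) by (metis append_take_drop_id)
 then show ?thesis using interchange[OF f g, of "rev (take (length p - length p' - length (adom f)) p)" p' q T] assms(5) by simp
qed

lemma chain_cong: "f = g ==> W f p q T = W g p q T" by simp

lemma chain_eqI:
 assumes "arrow f" "arrow g" "adom f = adom g" "acod f = acod g"
  and "!!T. W f [] [] T = W g [] [] T"
 shows "f = g"
proof (rule arrow_eqI)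
 fix T xs assume T: "T : forms (acod f)" and xs: "xs : points (adom f)"
 have "W f [] [] T ([] @ xs @ []) = afn f T xs" using T xs by (subst W_app) auto
 moreover have "W g [] [] T ([] @ xs @ []) = afn g T xs" using T xs assms by (subst W_app) auto
 ultimately show "afn f T xs = afn g T xs" using assms(5)[of T] by simp
qed (use assms in auto)

end

section \<open>Dual pairs of sorts\<close>

lemma linear_ground_simps:
 assumes "linf X g"
 shows "x : carr X ==> y : carr X ==> g (x + y) = g x + g y"
  and "x : carr X ==> g (scal X c x) = c * g x" using assms by (simp_all add: linear_ground_iff)

lemma linear_ground_diff:
 assumes X: "vspace X" and g: "linf X g" and x: "x : carr X" and y: "y : carr X"
 shows "g (x - scal X c y) = g x - c * g y"
proof -
 have y': "scal X c y : carr X" by (rule vspace_scal[OF X y])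
 have "g ((x - scal X c y) + scal X c y) = g (x - scal X c y) + g (scal X c y)" by (rule linear_ground_simps(1)[OF g vspace_diff[OF X x y'] y'])
 then show ?thesis using linear_ground_simps(2)[OF g y, of c] by simp
qed

lemma linear_ground_0: "vspace X ==> linf X g ==> g 0 = 0"
 using linear_ground_simps(1)[of X g 0 0] vspace_zero[of X] by (metis add.right_neutral add_left_cancel)

lemma vspace_scal_zero:
 assumes "vspace X"
 shows "scal X c 0 = 0"
proof -
 interpret vector_space "scal X" using assms by (simp add: vspace_def)
 show ?thesis by simp
qed

locale paired_words = tensor_words S for S :: "'s => ('k::field, 'z::ab_group_add) vs" +
 fixes pr :: "'z => 'z => 'k"
 assumes pr_sym: "pr a b = pr b a"
begin

definition dual_sorts :: "'s => 's => bool" where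
 "dual_sorts x y <-> (\<forall>a\<in>carr (S x). linf (S y) (pr a)) &
   (\<forall>b\<in>carr (S y). linf (S x) (pr b)) &
   (\<forall>a\<in>carr (S x). (\<forall>b\<in>carr (S y). pr a b = 0) --> a = 0) &
   (\<forall>b\<in>carr (S y). (\<forall>a\<in>carr (S x). pr b a = 0) --> b = 0)"

lemma dual_sorts_sym: "dual_sorts x y ==> dual_sorts y x" by (auto simp: dual_sorts_def)

lemma forms_last_diff:
 assumes T: "T : forms (w @ [x])" and ys: "ys : points w" and u: "u : carr (S x)" and v: "v : carr (S x)"
 shows "T (ys @ [u - scal (S x) c v]) = T (ys @ [u]) - c * T (ys @ [v])"
proof -
 have lin: "linf (S x) (%z. T (ys @ [z]))" using forms_lin[OF T, of "ys @ [u]" "length w"] points_length[OF ys] ys u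
  by (simp add: points_append nth_append list_update_append)
 show ?thesis using linear_ground_diff[OF vspace_S lin u v] .
qed

lemma forms_snoc: "T : forms (w @ [x]) ==> u : carr (S x) ==> (%ys. T (ys @ [u])) : forms w" using forms_slice[of T "[]" w "[x]" "[]" "[u]"] by simp

text \<open>If the last factors are linearly dependent, one of them is eliminated and the sum gets shorter. If
the sum cannot be shortened, the functionals from the dual sort still separate, hence the induction
on the number of terms.\<close>

lemma separation_comb:
 assumes d: "dual_sorts x y"
  and K: "!!c ys u. (c, ys, u) : set K ==> ys : points w & u : carr (S x)"
  and zero: "!!T h. T : forms w ==> h : carr (S y) ==> comb K (%(ys, u). T ys * pr u h) = 0"
  and T: "T : forms (w @ [x])"
 shows "comb K (%(ys, u). T (ys @ [u])) = 0" using K zero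
proof (induction "length K" arbitrary: K)
 case 0
 then show ?case by simp
next
 case (Suc n)
 then obtain c ys u K' where K: "K = (c, ys, u)#K'" "length K' = n" by (cases K) auto
 have ys: "ys : points w" and u: "u : carr (S x)" using Suc.prems(1) K by auto
 have K': "!!c ys u. (c, ys, u) : set K' ==> ys : points w & u : carr (S x)" using Suc.prems(1) K by auto
 have T0: "T (ys @ [0]) = 0" using forms_last_diff[OF T ys vspace_zero[OF vspace_S] vspace_zero[OF vspace_S], of 1]
   vspace_scal_zero[OF vspace_S] by simp
 show ?case
 proof (cases "c = 0 \<or> u = 0")
  case True
  have pr0: "pr 0 h = 0" if "h : carr (S y)" for h using d that linear_ground_0[OF vspace_S[of x], of "pr h"] by (simp add: dual_sorts_def pr_sym)
  have "comb K' (%(ys, u). T (ys @ [u])) = 0" using K K' Suc.prems(2) True pr0 by (intro Suc.hyps(1)) fastforce+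
  then show ?thesis using True K T0 by auto
 next
  case False
  then obtain h where h: "h : carr (S y)" "pr u h ~= 0" using d u unfolding dual_sorts_def by blast
  define r where "r t = pr t h / pr u h" for t
  define K2 where "K2 = map (%(d, p). (d, (fst p, snd p - scal (S x) (r (snd p)) u))) K'"
  have comb_K2: "comb K2 G = comb K' (%(zs, t). G (zs, t - scal (S x) (r t) u))" for G unfolding K2_def comb_map by (rule comb_cong) auto
  have lin: "linf (S x) (pr h)" if "h : carr (S y)" for h using d that by (simp add: dual_sorts_def)
  have c: "c * T' ys = - comb K' (%(zs, t). r t * T' zs)" if "T' : forms w" for T'
  proof -
   have "c * (T' ys * pr u h) + comb K' (%(zs, t). T' zs * pr t h) = 0" using Suc.prems(2)[OF that h(1)] K by simp
   moreover have "comb K' (%(zs, t). T' zs * pr t h) = pr u h * comb K' (%(zs, t). r t * T' zs)"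
    unfolding comb_scale[symmetric] using h by (intro comb_cong) (auto simp: r_def)
   ultimately have "pr u h * (c * T' ys + comb K' (%(zs, t). r t * T' zs)) = 0" by (simp add: algebra_simps)
   then show ?thesis using h by (simp add: eq_neg_iff_add_eq_0)
  qed
  have "comb K2 (%(ys, u). T (ys @ [u])) = 0"
  proof (rule Suc.hyps(1))
   show "n = length K2" using K by (simp add: K2_def)
   fix d zs t assume "(d, zs, t) : set K2"
   then show "zs : points w & t : carr (S x)" using K' vspace_diff[OF vspace_S _ vspace_scal[OF vspace_S u]] by (auto simp: K2_def)
  next
   fix T' h' assume T': "T' : forms w" and h': "h' : carr (S y)"
   have "comb K2 (%(zs, t). T' zs * pr t h') =
     comb K' (%(zs, t). T' zs * pr (t - scal (S x) (r t) u) h')" by (simp add: comb_K2)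
   also have "... = comb K' (%p. (case p of (zs, t) => T' zs * pr t h') +
     - pr u h' * (case p of (zs, t) => r t * T' zs))"
   proof (intro comb_cong, clarify)
    fix d zs t assume "(d, zs, t) : set K'"
    then have "pr (t - scal (S x) (r t) u) h' = pr t h' - r t * pr u h'"
     using K' u linear_ground_diff[OF vspace_S lin[OF h'], of t u "r t"] by (simp add: pr_sym[of _ h'])
    then show "T' zs * pr (t - scal (S x) (r t) u) h' = T' zs * pr t h' + - pr u h' * (r t * T' zs)" by (simp only:) (simp add: algebra_simps)
   qed
   also have "... = 0"
   proof -
    have "comb K' (%(zs, t). r t * T' zs) = - (c * T' ys)" using c[OF T'] by simp
    then show ?thesis unfolding comb_add comb_scale using Suc.prems(2)[OF T' h'] K by (simp add: mult.left_commute mult.commute add.commute)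
   qed
   finally show "comb K2 (%(zs, t). T' zs * pr t h') = 0" .
  qed
  also have "comb K2 (%(ys, u). T (ys @ [u])) = comb K' (%(zs, t). T (zs @ [t - scal (S x) (r t) u]))" by (simp add: comb_K2)
  also have "... = comb K' (%p. (case p of (zs, t) => T (zs @ [t])) +
    - 1 * (case p of (zs, t) => r t * T (zs @ [u])))" using K' u by (intro comb_cong) (auto simp: forms_last_diff[OF T])
  finally show ?thesis using c[OF forms_snoc[OF T u]] K unfolding comb_add comb_scale by simp
 qed
qed

definition ev :: "'s => 's => ('s, 'z, 'k) arr" where
 "ev x y = \<lparr>adom = [x, y], acod = [],
   afn = (%T xs. if T : forms [] & xs : points [x, y] then pr (xs ! 0) (xs ! 1) * T [] else 0)\<rparr>"

lemma ev_arrow: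
 assumes d: "dual_sorts x y"
 shows "arrow (ev x y)"
proof -
 have "(%xs. if T : forms [] & xs : points [x, y] then pr (xs ! 0) (xs ! 1) * T [] else 0) : forms [x, y]"
  for T
 proof -
  have "linf (S ([x, y] ! i))
   (%z. if T : forms [] & xs[i := z] : points [x, y] then pr (xs[i := z] ! 0) (xs[i := z] ! 1) * T [] else 0)"
   if xs: "xs : points [x, y]" and i: "i < length [x, y]" for xs i
  proof -
   obtain a b where ab: "xs = [a, b]" "a : carr (S x)" "b : carr (S y)" using xs by (auto dest!: points_ConsD)
   have l: "linf (S y) (pr a)" "linf (S x) (pr b)" using d ab by (auto simp: dual_sorts_def)
   show ?thesis
   proof (cases "i = 0")
    case True
    then show ?thesis using ab l(2) vspace_closed[OF vspace_S[of x]] by (simp add: linear_ground_iff pr_sym[of _ b] algebra_simps)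
   next
    case False
    then have "i = 1" using i by simp
    then show ?thesis using ab l(1) vspace_closed[OF vspace_S[of y]] by (simp add: linear_ground_iff algebra_simps)
   qed
  qed
  then show ?thesis by (simp add: forms_def)
 qed
 then have 1: "afn (ev x y) T : forms [x, y]" for T by (simp only: ev_def arr.simps)
 have 2: "\<exists>L. (\<forall>(c, ys)\<in>set L. ys : points []) & (\<forall>T\<in>forms []. afn (ev x y) T xs = comb L T)"
  if "xs : points [x, y]" for xs using that by (intro exI[of _ "[(pr (xs ! 0) (xs ! 1), [])]"]) (simp add: ev_def)
 have 3: "afn (ev x y) T = (%_. 0)" if "T ~: forms []" for T using that by (simp add: ev_def)
 have "adom (ev x y) = [x, y]" "acod (ev x y) = []" by (simp_all add: ev_def)
 with 1 2 3 show ?thesis unfolding arrow_def by (simp only: simp_thms) blast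
qed

lemma ev_dom_cod [simp]: "adom (ev x y) = [x, y]" "acod (ev x y) = []" by (simp_all add: ev_def)

lemma W_ev_app:
 assumes "T : forms (rev p @ q)" "a : points (rev p)" "b : carr (S x)" "c : carr (S y)" "e : points q"
 shows "W (ev x y) p q T (a @ b#c#e) = pr b c * T (a @ e)"
proof -
 have "W (ev x y) p q T (a @ [b, c] @ e) = afn (ev x y) (%ys. T (a @ ys @ e)) [b, c]" using assms by (intro W_app) auto
 then show ?thesis using assms forms_slice[of T "rev p" "[]" q a e] by (simp add: ev_def)
qed

lemma separation:
 assumes d: "dual_sorts x y" and f: "arrow f" and g: "arrow g" and fg: "adom f = adom g"
  and fx: "acod f = w @ [x]" and gx: "acod g = w @ [x]"
  and eq: "!!T. W f [] [y] (W (ev x y) (rev w) [] T) = W g [] [y] (W (ev x y) (rev w) [] T)"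
 shows "f = g"
proof (rule arrow_eqI[OF f g fg])
 fix T xs assume T: "T : forms (acod f)" and xs: "xs : points (adom f)"
 obtain L where L: "!!c ys. (c, ys) : set L ==> ys : points (acod f)"
  "!!T. T : forms (acod f) ==> afn f T xs = comb L T" using arrow_comb[OF f xs] by blast
 obtain K where K: "!!c ys. (c, ys) : set K ==> ys : points (acod g)"
  "!!T. T : forms (acod g) ==> afn g T xs = comb K T" using arrow_comb[OF g] xs fg by metis
 define N where "N = map (%(c, ys). (c, butlast ys, last ys)) L @ map (%(c, ys). (- c, butlast ys, last ys)) K"
 have snoc: "butlast ys : points w & last ys : carr (S x) & butlast ys @ [last ys] = ys"
  if "ys : points (w @ [x])" for ys using points_appendD[OF that] by (auto dest!: points_ConsD)
 have pos: "comb (map (%(c, ys). (c, butlast ys, last ys)) L) G = comb L (%ys. G (butlast ys, last ys))" for G by (induction L) auto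
 have neg: "comb (map (%(c, ys). (- c, butlast ys, last ys)) K) G = - comb K (%ys. G (butlast ys, last ys))" for G by (induction K) auto
 have N: "comb N G = comb L (%ys. G (butlast ys, last ys)) - comb K (%ys. G (butlast ys, last ys))" for G unfolding N_def comb_append neg pos by simp
 have "comb N (%(ys, u). T (ys @ [u])) = 0"
 proof (rule separation_comb[OF d])
  fix c ys u assume "(c, ys, u) : set N"
  then show "ys : points w & u : carr (S x)" using L(1) K(1) fx gx snoc by (fastforce simp: N_def)
 next
  fix T' h assume T': "T' : forms w" and h: "h : carr (S y)"
  let ?E = "W (ev x y) (rev w) [] T'"
  have E: "?E : forms (w @ [x] @ [y])" using W_form[OF ev_arrow[OF d], of "rev w" "[]" T'] by simp
  have Ey: "(%ys. ?E (ys @ [h])) : forms (w @ [x])" using forms_slice[of ?E "[]" "w @ [x]" "[y]" "[]" "[h]"] E h by simp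
  have val: "?E (ys @ [h]) = T' (butlast ys) * pr (last ys) h" if "ys : points (w @ [x])" for ys
  proof -
   have "ys @ [h] = butlast ys @ last ys#h#[]" using snoc[OF that] by (metis append.assoc append_Cons append_Nil)
   then have "?E (ys @ [h]) = ?E (butlast ys @ last ys#h#[])" by (rule arg_cong)
   then show ?thesis using W_ev_app[of T' "rev w" "[]" "butlast ys" "last ys" x h y "[]"] T' h snoc[OF that]
    by (simp only: rev_rev_ident append_Nil2 points_Nil mult.commute)
  qed
  have 1: "W f [] [y] ?E ([] @ xs @ [h]) = afn f (%ys. ?E ([] @ ys @ [h])) xs" using E xs h fx by (intro W_app) auto
  have 2: "W g [] [y] ?E ([] @ xs @ [h]) = afn g (%ys. ?E ([] @ ys @ [h])) xs" using E xs h gx fg by (intro W_app) auto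
  have "afn f (%ys. ?E (ys @ [h])) xs = afn g (%ys. ?E (ys @ [h])) xs" using 1 2 eq[of T'] by simp
  then have "comb L (%ys. ?E (ys @ [h])) = comb K (%ys. ?E (ys @ [h]))" using L(2) K(2) Ey fx gx by simp
  moreover have "comb L (%ys. ?E (ys @ [h])) = comb L (%ys. T' (butlast ys) * pr (last ys) h)" by (rule comb_cong) (use L(1) fx val in auto)
  moreover have "comb K (%ys. ?E (ys @ [h])) = comb K (%ys. T' (butlast ys) * pr (last ys) h)" by (rule comb_cong) (use K(1) gx val in auto)
  ultimately show "comb N (%(ys, u). T' ys * pr u h) = 0" by (simp add: N)
 qed (use T fx in simp)
 moreover have "comb L (%ys. T (butlast ys @ [last ys])) = comb L T" by (rule comb_cong) (use L(1) fx snoc in auto)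
 moreover have "comb K (%ys. T (butlast ys @ [last ys])) = comb K T" by (rule comb_cong) (use K(1) gx snoc in auto)
 ultimately show "afn f T xs = afn g T xs" using L(2) K(2) T fx gx by (simp add: N)
qed (use fx gx in simp)

end

section \<open>Mates of braidings, coactions and actions\<close>

context tensor_words begin

text \<open>The axioms as arrow equations. In the first group, an arrow slides through the
crossing of its sort with another one.\<close>

abbreviation "comult_slides a b c d p q T ==
 W a p q (W b (c#p) q T) = W b p (c#q) (W a (d#p) q (W a p (d#q) T))"
abbreviation "mult_slides a b c d p q T ==
 W a p (b#q) (W c p q T) = W c (d#p) q (W c p (d#q) (W a (b#p) q T))"
abbreviation "multV_slides a b c d p q T ==
 W a (b#p) q (W c p q T) = W c p (d#q) (W c (d#p) q (W a p (b#q) T))"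
abbreviation "act_multiplicative a b c d e f p q T ==
 W a (b#p) q (W c p q T) = W d p (e#e#q) (W f (b#p) (e#q) (W c (e#b#p) q (W c p (e#q) (W a p q T))))"
abbreviation "coact_multiplicative a b c d e f p q T ==
 W a p q (W b p q T) = W b p (c#q) (W b (d#c#p) q (W e (c#p) (d#q) (W f (c#c#p) q (W a p (d#q) T))))"
abbreviation "braid_slides a b c d p q T ==
 W a p (b#q) (W c (d#p) q (W c p (d#q) T)) = W c (d#p) q (W c p (d#q) (W a (b#p) q T))"
abbreviation "counit_slides a b c p q T ==
 W a p q (W b (c#p) q T) = W b p (c#q) T"
abbreviation "unit_slides a b c p q T ==
 W a p (b#q) (W c p q T) = W a (b#p) q T"
abbreviation "act_braids a b c d e p q T ==
 W a (b#p) q (W c p q T) = W d p (e#q) (W c (b#p) q (W a p (b#q) T))"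
abbreviation "unitV_slides a b c p q T ==
 W a (b#p) q (W c p q T) = W a p (b#q) T"
abbreviation "are_mates a b c d e f p q T ==
 W a p (b#q) (W c (d#p) q T) = W e (f#p) q (W c p (d#q) T)"
abbreviation "coact_braids a b c d e p q T ==
 W a p q (W b p (c#q) T) = W b (c#p) q (W a p (c#q) (W d (e#p) q T))"
abbreviation "act_assoc a b c d p q T ==
 W a (b#p) q (W a p q T) = W c p (d#q) (W a p q T)"
abbreviation "coact_coassoc a b c d p q T ==
 W a p q (W a p (b#q) T) = W a p q (W c (d#p) q T)"
abbreviation "act_unital a b c p q T ==
 W a p (b#q) (W c p q T) = Idw (rev p @ b#q) T"
abbreviation "coact_counital a b c p q T ==
 W a p q (W b (c#p) q T) = Idw (rev p @ c#q) T"
abbreviation "transported a b c d e f g p q T ==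
 W a p (b#q) (W c (d#p) q T) = W e p (b#q) (W f (d#p) q (W g (d#p) q T))"

definition hom :: "('s, 'z, 'k) arr => 's list => 's list => bool" where
 "hom f a b <-> arrow f & adom f = a & acod f = b"

lemmas chain = W_comp W_wh W_ida W_Idw Idw_W Idw_Idw

lemma hom_comp: "hom f a b ==> hom g b c ==> hom (f >> g) a c" by (simp add: hom_def)

lemma hom_wh: "hom f a b ==> hom (wh p f q) (rev p @ a @ q) (rev p @ b @ q)" by (simp add: hom_def)

end

context paired_words begin

lemma separation2:
 assumes d: "dual_sorts x y" and f: "hom f w (w' @ [x, x])" and g: "hom g w (w' @ [x, x])"
  and eq: "!!T. W f [] [y, y] (W (ev x y) (x#rev w') [y] (W (ev x y) (rev w') [] T)) =
   W g [] [y, y] (W (ev x y) (x#rev w') [y] (W (ev x y) (rev w') [] T))"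
 shows "f = g"
proof (rule separation[OF d, of _ _ "w' @ [x]"])
 note [simp] = ev_arrow[OF d] f[unfolded hom_def] g[unfolded hom_def]
 let ?F = "%f. wh [] f [y] >> wh (rev (w' @ [x])) (ev x y) []"
 have "?F f = ?F g" by (rule separation[OF d, of _ _ w']) (use eq in \<open>simp_all add: chain\<close>)
 from chain_cong[OF this, of "[]" "[]"]
 show "W f [] [y] (W (ev x y) (rev (w' @ [x])) [] T) = W g [] [y] (W (ev x y) (rev (w' @ [x])) [] T)" for T by (simp add: chain)
qed (use f g in \<open>simp_all add: hom_def\<close>)

lemma separation1:
 assumes d: "dual_sorts x y" and f: "hom f w (w' @ [x])" and g: "hom g w (w' @ [x])"
  and eq: "!!T. W f [] [y] (W (ev x y) (rev w') [] T) = W g [] [y] (W (ev x y) (rev w') [] T)"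
 shows "f = g" using assms by (intro separation[OF d, of _ _ w']) (simp_all add: hom_def)

end

text \<open>The sorts x and y are dual, y crosses v by an invertible arrow, and the crossing of x with v is
the mate of its inverse. This equation and separation carry axioms from y to x.\<close>

locale mate_pair = paired_words S pr for S :: "'s => ('k::field, 'z::ab_group_add) vs" and pr +
 fixes x y v :: 's and al ali ta tai Psy Psyi Psx Psxi :: "('s, 'z, 'k) arr"
 assumes dual: "dual_sorts x y"
  and homs: "hom al [y, v] [v, y]" "hom ali [v, y] [y, v]" "hom ta [x, v] [v, x]" "hom tai [v, x] [x, v]"
   "hom Psx [x, x] [x, x]" "hom Psxi [x, x] [x, x]" "hom Psy [y, y] [y, y]" "hom Psyi [y, y] [y, y]"
  and inverses: "al >> ali = ida [y, v]" "ali >> al = ida [v, y]"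
   "ta >> tai = ida [x, v]" "tai >> ta = ida [v, x]"
   "Psx >> Psxi = ida [x, x]" "Psxi >> Psx = ida [x, x]"
   "Psy >> Psyi = ida [y, y]" "Psyi >> Psy = ida [y, y]"
  and mate: "!!p q T. are_mates ta y (ev x y) v ali x p q T"
  and transp: "!!p q T. W Psx p (y#y#q) (W (ev x y) (x#p) (y#q) (W (ev x y) p q T)) = W Psy (x#x#p) q (W (ev x y) (x#p) (y#q) (W (ev x y) p q T))"
  and braid: "!!p q T. braid_slides Psy v al y p q T"
begin

abbreviation e where "e == ev x y"

lemma ev_arrow' [simp]: "arrow e" by (rule ev_arrow[OF dual])

lemmas [simp] = homs[unfolded hom_def]

lemma cancel [simp]:
 "W al p q (W ali p q T) = Idw (rev p @ y#v#q) T"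
 "W ali p q (W al p q T) = Idw (rev p @ v#y#q) T"
 "W ta p q (W tai p q T) = Idw (rev p @ x#v#q) T"
 "W tai p q (W ta p q T) = Idw (rev p @ v#x#q) T"
 "W Psx p q (W Psxi p q T) = Idw (rev p @ x#x#q) T"
 "W Psxi p q (W Psx p q T) = Idw (rev p @ x#x#q) T"
 "W Psy p q (W Psyi p q T) = Idw (rev p @ y#y#q) T"
 "W Psyi p q (W Psy p q T) = Idw (rev p @ y#y#q) T" using inverses[THEN chain_cong, of p q T] by (simp_all add: chain)

lemma braid_inv: "W ali p (y#q) (W ali (y#p) q (W Psy p (v#q) T)) = W Psy (v#p) q (W ali p (y#q) (W ali (y#p) q T))"
proof -
 have "W ali p (y#q) (W ali (y#p) q (W Psy p (v#q) T)) =
  W ali p (y#q) (W ali (y#p) q (W Psy p (v#q) (W al (y#p) q (W al p (y#q) (W ali p (y#q) (W ali (y#p) q T))))))" by (simp add: chain)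
 also have "... = W Psy (v#p) q (W ali p (y#q) (W ali (y#p) q T))" by (subst braid, simp add: chain)
 finally show ?thesis .
qed

lemma mate2: "W ta (x#p) (y#y#q) (W ta p (x#y#y#q) (W e (x#v#p) (y#q) (W e (v#p) q T))) = W ali (x#x#p) (y#q) (W ali (y#x#x#p) q (W e (x#p) (y#v#q) (W e p (v#q) T)))"
proof -
 have "W ta (x#p) (y#y#q) (W ta p (x#y#y#q) (W e (x#v#p) (y#q) (W e (v#p) q T))) =
  W ta (x#p) (y#y#q) (W e (v#x#p) (y#q) (W ta p (y#q) (W e (v#p) q T)))" by (simp add: slide)
 also have "... = W ali (x#x#p) (y#q) (W ali (y#x#x#p) q (W e (x#p) (y#v#q) (W e p (v#q) T)))" by (simp add: mate slide)
 finally show ?thesis .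
qed

lemma braid_inv': "W ali p (y#q) (W ali (y#p) q (W Psyi p (v#q) T)) = W Psyi (v#p) q (W ali p (y#q) (W ali (y#p) q T))"
proof -
 have "W ali p (y#q) (W ali (y#p) q (W Psyi p (v#q) T)) =
  W Psyi (v#p) q (W ali p (y#q) (W ali (y#p) q (W Psy p (v#q) (W Psyi p (v#q) T))))" by (subst braid_inv, simp add: chain)
 also have "... = W Psyi (v#p) q (W ali p (y#q) (W ali (y#p) q T))" by (simp add: chain)
 finally show ?thesis .
qed

lemma braid_x: "braid_slides Psx v ta x p q T"
proof -
 have "wh [] Psx [v] >> wh [x] ta [] >> wh [] ta [x] = wh [x] ta [] >> wh [] ta [x] >> wh [v] Psx []"
 proof (rule separation2[OF dual, of _ "[x, x, v]" "[v]"])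
  fix T
  have "W Psx [] [v, y, y] (W ta [x] [y, y] (W ta [] [x, y, y] (W e [x, v] [y] (W e [v] [] T)))) =
  W ali [x, x] [y] (W ali [y, x, x] [] (W Psx [] [y, y, v] (W e [x] [y, v] (W e [] [v] T))))" by (simp add: mate2 slide)
 also have "... = W Psy [v, x, x] [] (W ta [x] [y, y] (W ta [] [x, y, y] (W e [x, v] [y] (W e [v] [] T))))" by (simp only: transp braid_inv mate2)
 also have "... = W ta [x] [y, y] (W ta [] [x, y, y] (W Psx [v] [y, y] (W e [x, v] [y] (W e [v] [] T))))" by (simp add: slide transp)
  finally show "W (wh [] Psx [v] >> wh [x] ta [] >> wh [] ta [x]) [] [y, y] (W e (x#rev [v]) [y] (W e (rev [v]) [] T)) =
    W (wh [x] ta [] >> wh [] ta [x] >> wh [v] Psx []) [] [y, y] (W e (x#rev [v]) [y] (W e (rev [v]) [] T))" by (simp add: chain)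
 qed (simp_all add: hom_def)
 from chain_cong[OF this, of p q T] show ?thesis by (simp add: chain)
qed

lemma comult_inv:
 assumes "hom De [y] [y, y]" and comp: "!!p q T. comult_slides al De v y p q T"
 shows "W ali p q (W De p (v#q) T) = W De (v#p) q (W ali p (y#q) (W ali (y#p) q T))"
proof -
 note [simp] = assms(1)[unfolded hom_def]
 have "W ali p q (W De p (v#q) T) =
  W ali p q (W al p q (W De (v#p) q (W ali p (y#q) (W ali (y#p) q T))))" by (subst comp, simp add: chain)
 also have "... = W De (v#p) q (W ali p (y#q) (W ali (y#p) q T))" by (simp add: chain)
 finally show ?thesis .
qed

lemma mult_inv:
 assumes "hom m [y, y] [y]" and comp: "!!p q T. mult_slides m v al y p q T"
 shows "multV_slides m v ali y p q T"
proof -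
 note [simp] = assms(1)[unfolded hom_def]
 have "W m (v#p) q (W ali p q T) =
  W ali p (y#q) (W ali (y#p) q (W m p (v#q) (W al p q (W ali p q T))))" by (subst comp, simp add: chain)
 also have "... = W ali p (y#q) (W ali (y#p) q (W m p (v#q) T))" by (simp add: chain)
 finally show ?thesis .
qed

lemma multV_inv:
 assumes "hom n [v, v] [v]" and comp: "!!p q T. multV_slides n y al v p q T"
 shows "mult_slides n y ali v p q T"
proof -
 note [simp] = assms(1)[unfolded hom_def]
 have "W n p (y#q) (W ali p q T) =
  W ali (v#p) q (W ali p (v#q) (W n (y#p) q (W al p q (W ali p q T))))" by (subst comp, simp add: chain)
 also have "... = W ali (v#p) q (W ali p (v#q) (W n (y#p) q T))" by (simp add: chain)
 finally show ?thesis .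
qed

lemma counit_inv:
 assumes "hom epy [y] []" and comp: "!!p q T. counit_slides al epy v p q T"
 shows "W ali p q (W epy p (v#q) T) = W epy (v#p) q T"
proof -
 note [simp] = assms(1)[unfolded hom_def]
 have "W ali p q (W epy p (v#q) T) =
  W epy (v#p) q T" by (simp add: comp[symmetric] chain)
  then show ?thesis .
qed

lemma unit_inv:
 assumes "hom etay [] [y]" and comp: "!!p q T. unit_slides etay v al p q T"
 shows "unitV_slides etay v ali p q T"
proof -
 note [simp] = assms(1)[unfolded hom_def]
 have "unitV_slides etay v ali p q T" by (simp add: comp[symmetric] chain)
  then show ?thesis .
qed

lemma unitV_inv:
 assumes "hom j [] [v]" and comp: "!!p q T. unitV_slides j y al p q T"
 shows "unit_slides j y ali p q T"
proof -
 note [simp] = assms(1)[unfolded hom_def]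
 have "unit_slides j y ali p q T" by (simp add: comp[symmetric] chain)
  then show ?thesis .
qed

lemma mult_x:
 assumes h: "hom De [y] [y, y]" "hom my [x, x] [x]"
  and comp: "!!p q T. comult_slides al De v y p q T"
  and tr: "!!p q T. W my p (y#q) (W e p q T) = W De (x#x#p) q (W e (x#p) (y#q) (W e p q T))"
 shows "mult_slides my v ta x p q T"
proof -
 note [simp] = h[unfolded hom_def]
 have "wh [] my [v] >> wh [] ta [] = wh [x] ta [] >> wh [] ta [x] >> wh [v] my []"
 proof (rule separation1[OF dual, of _ "[x, x, v]" "[v]"])
  fix T
  have "W my [] [v, y] (W ta [] [y] (W e [v] [] T)) =
  W ali [x, x] [] (W my [] [y, v] (W e [] [v] T))" by (simp add: mate slide)
 also have "... = W De [v, x, x] [] (W ta [x] [y, y] (W ta [] [x, y, y] (W e [x, v] [y] (W e [v] [] T))))"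
  by (simp only: tr comult_inv[OF h(1) comp] mate2)
 also have "... = W ta [x] [y] (W ta [] [x, y] (W my [v] [y] (W e [v] [] T)))" by (simp add: slide tr)
  finally show "W (wh [] my [v] >> wh [] ta []) [] [y] (W e (rev [v]) [] T) =
    W (wh [x] ta [] >> wh [] ta [x] >> wh [v] my []) [] [y] (W e (rev [v]) [] T)" by (simp add: chain)
 qed (simp_all add: hom_def)
 from chain_cong[OF this, of p q T] show ?thesis by (simp add: chain)
qed

lemma comult_x:
 assumes h: "hom m [y, y] [y]" "hom de [x] [x, x]"
  and comp: "!!p q T. mult_slides m v al y p q T"
  and tr: "!!p q T. W de p (y#y#q) (W e (x#p) (y#q) (W e p q T)) = W m (x#p) q (W e p q T)"
 shows "comult_slides ta de v x p q T"
proof -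
 note [simp] = h[unfolded hom_def]
 have "wh [] ta [] >> wh [v] de [] = wh [] de [v] >> wh [x] ta [] >> wh [] ta [x]"
 proof (rule separation2[OF dual, of _ "[x, v]" "[v]"])
  fix T
  have "W ta [] [y, y] (W de [v] [y, y] (W e [x, v] [y] (W e [v] [] T))) =
  W m [v, x] [] (W ta [] [y] (W e [v] [] T))" by (simp add: tr slide)
 also have "... = W de [] [v, y, y] (W ta [x] [y, y] (W ta [] [x, y, y] (W e [x, v] [y] (W e [v] [] T))))"
  by (simp add: mate mult_inv[OF h(1) comp] tr[symmetric] slide mate2)
  finally show "W (wh [] ta [] >> wh [v] de []) [] [y, y] (W e (x#rev [v]) [y] (W e (rev [v]) [] T)) =
    W (wh [] de [v] >> wh [x] ta [] >> wh [] ta [x]) [] [y, y] (W e (x#rev [v]) [y] (W e (rev [v]) [] T))" by (simp add: chain)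
 qed (simp_all add: hom_def)
 from chain_cong[OF this, of p q T] show ?thesis by (simp add: chain)
qed

lemma unit_x:
 assumes h: "hom epy [y] []" "hom etax [] [x]"
  and comp: "!!p q T. counit_slides al epy v p q T"
  and tr: "!!p q T. W etax p (y#q) (W e p q T) = W epy p q T"
 shows "unit_slides etax v ta p q T"
proof -
 note [simp] = h[unfolded hom_def]
 have "wh [] etax [v] >> wh [] ta [] = wh [v] etax []"
 proof (rule separation1[OF dual, of _ "[v]" "[v]"])
  fix T
  have "W etax [] [v, y] (W ta [] [y] (W e [v] [] T)) =
  W etax [v] [y] (W e [v] [] T)" by (subst mate, subst tr, subst counit_inv[OF h(1) comp, symmetric], subst tr[symmetric], simp add: slide)
  then show "W (wh [] etax [v] >> wh [] ta []) [] [y] (W e (rev [v]) [] T) =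
    W (wh [v] etax []) [] [y] (W e (rev [v]) [] T)" by (simp add: chain)
 qed (simp_all add: hom_def)
 from chain_cong[OF this, of p q T] show ?thesis by (simp add: chain)
qed

lemma counit_x:
 assumes h: "hom etay [] [y]" "hom epx [x] []"
  and comp: "!!p q T. unit_slides etay v al p q T"
  and tr: "!!p q T. W etay (x#p) q (W e p q T) = W epx p q T"
 shows "counit_slides ta epx v p q T"
proof -
 note [simp] = h[unfolded hom_def]
 have "counit_slides ta epx v p q T"
  by (subst tr[symmetric], subst tr[symmetric], subst unit_inv[OF h(1) comp, symmetric], subst mate[symmetric], simp add: slide)
  then show ?thesis .
qed

lemma multV_x:
 assumes h: "hom n [v, v] [v]"
  and comp: "!!p q T. multV_slides n y al v p q T"
 shows "multV_slides n x ta v p q T"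
proof -
 note [simp] = h[unfolded hom_def]
 have "wh [x] n [] >> wh [] ta [] = wh [] ta [v] >> wh [v] ta [] >> wh [] n [x]"
 proof (rule separation1[OF dual, of _ "[x, v, v]" "[v]"])
  fix T
  have "W n [x] [y] (W ta [] [y] (W e [v] [] T)) =
  W ta [] [v, y] (W ta [v] [y] (W n [] [x, y] (W e [v] [] T)))"
  by (subst mate, subst multV_inv[OF h comp], simp add: slide, subst mate[symmetric], simp add: slide, subst mate[symmetric], simp add: slide)
  then show "W (wh [x] n [] >> wh [] ta []) [] [y] (W e (rev [v]) [] T) =
    W (wh [] ta [v] >> wh [v] ta [] >> wh [] n [x]) [] [y] (W e (rev [v]) [] T)" by (simp add: chain)
 qed (simp_all add: hom_def)
 from chain_cong[OF this, of p q T] show ?thesis by (simp add: chain)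
qed

lemma unitV_x:
 assumes h: "hom j [] [v]"
  and comp: "!!p q T. unitV_slides j y al p q T"
 shows "unitV_slides j x ta p q T"
proof -
 note [simp] = h[unfolded hom_def]
 have "wh [x] j [] >> wh [] ta [] = wh [] j [x]"
 proof (rule separation1[OF dual, of _ "[x]" "[v]"])
  fix T
  have "W j [x] [y] (W ta [] [y] (W e [v] [] T)) =
  W j [] [x, y] (W e [v] [] T)" by (simp add: mate unitV_inv[OF h comp] slide)
  then show "W (wh [x] j [] >> wh [] ta []) [] [y] (W e (rev [v]) [] T) =
    W (wh [] j [x]) [] [y] (W e (rev [v]) [] T)" by (simp add: chain)
 qed (simp_all add: hom_def)
 from chain_cong[OF this, of p q T] show ?thesis by (simp add: chain)
qed

end

text \<open>A coaction of y is moved to the other side of v by the inverse crossing; evaluating it against x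
gives an action of x.\<close>

locale comodule_mate = mate_pair +
 fixes rh
 assumes coact_hom: "hom rh [v] [v, y]"
  and coact_braid: "!!p q T. coact_braids al rh y Psy v p q T"
begin

lemmas [simp] = coact_hom[unfolded hom_def]

definition lco where "lco = rh >> ali"

definition act where "act = wh [x] lco [] >> wh [] e [v]"

lemma lco_hom: "hom lco [v] [y, v]" by (simp add: hom_def lco_def)

lemmas [simp] = lco_hom[unfolded hom_def]

lemma act_hom: "hom act [x, v] [v]" by (simp add: hom_def act_def)

lemmas [simp] = act_hom[unfolded hom_def]

lemma lco: "W lco p q T = W rh p q (W ali p q T)" by (simp add: lco_def chain)

lemma act: "W act p q T = W lco (x#p) q (W e p (v#q) T)" by (simp add: act_def chain)

lemma coact_inv: "W ali p q (W rh (y#p) q T) = W rh p (y#q) (W Psyi (v#p) q (W ali p (y#q) T))"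
proof -
 have "W ali p q (W rh (y#p) q T) =
  W ali p q (W al p q (W rh p (y#q) (W Psyi (v#p) q (W ali p (y#q) T))))" by (subst coact_braid, simp add: chain)
 also have "... = W rh p (y#q) (W Psyi (v#p) q (W ali p (y#q) T))" by (simp add: chain)
 finally show ?thesis .
qed

lemma lco_braid: "W lco p (y#q) (W ali (y#p) q T) = W ali p q (W lco (y#p) q (W Psy p (v#q) T))"
proof -
 have "W ali p q (W lco (y#p) q (W Psy p (v#q) T)) =
  W lco p (y#q) (W ali (y#p) q T)" by (simp add: lco coact_inv braid_inv chain)
  then show ?thesis ..
qed

lemma act_braid: "act_braids act x ta Psx v p q T"
proof -
 have "wh [x] act [] >> wh [] ta [] = wh [] Psx [v] >> wh [x] ta [] >> wh [] act [x]"
 proof (rule separation1[OF dual, of _ "[x, x, v]" "[v]"])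
  fix T
  have "W act [x] [y] (W ta [] [y] (W e [v] [] T)) =
  W ali [x, x] [] (W lco [y, x, x] [] (W Psx [] [y, y, v] (W e [x] [y, v] (W e [] [v] T))))"
  by (subst mate, subst act, subst transp, subst lco_braid[symmetric], simp add: slide)
 also have "... = W Psx [] [v, y] (W ta [x] [y] (W act [] [x, y] (W e [v] [] T)))" by (simp add: slide mate[symmetric] act[symmetric])
  finally show "W (wh [x] act [] >> wh [] ta []) [] [y] (W e (rev [v]) [] T) =
    W (wh [] Psx [v] >> wh [x] ta [] >> wh [] act [x]) [] [y] (W e (rev [v]) [] T)" by (simp add: chain)
 qed (simp_all add: hom_def)
 from chain_cong[OF this, of p q T] show ?thesis by (simp add: chain)
qed

lemma lco_coassoc:
 assumes h: "hom De [y] [y, y]"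
  and comp: "!!p q T. comult_slides al De v y p q T"
  and coassoc: "!!p q T. coact_coassoc rh y De v p q T"
 shows "W lco p q (W lco (y#p) q T) = W lco p q (W De p (v#q) (W Psyi p (v#q) T))"
proof -
 note [simp] = h[unfolded hom_def]
 have "W lco p q (W lco (y#p) q T) =
  W lco p q (W De p (v#q) (W Psyi p (v#q) T))" by (simp only: lco coact_inv coassoc braid_inv'[symmetric] comult_inv[OF h comp])
  then show ?thesis .
qed

lemma act_mult:
 assumes h: "hom De [y] [y, y]" "hom my [x, x] [x]"
  and comp: "!!p q T. comult_slides al De v y p q T"
  and coassoc: "!!p q T. coact_coassoc rh y De v p q T"
  and tr: "!!p q T. W my p (y#q) (W e p q T) = W De (x#x#p) q (W Psyi (x#x#p) q (W e (x#p) (y#q) (W e p q T)))"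
 shows "act_assoc act x my v p q T"
proof -
 note [simp] = h[unfolded hom_def]
 have "W act (x#p) q (W act p q T) =
  W lco (x#x#p) q (W my p (y#v#q) (W e p (v#q) T))" by (simp only: lco_coassoc[OF h(1) comp coassoc, symmetric] tr, simp add: act slide)
 also have "... = W my p (v#q) (W act p q T)" by (simp add: slide act)
 finally show ?thesis .
qed

lemma act_unit:
 assumes h: "hom epy [y] []" "hom etax [] [x]"
  and comp: "!!p q T. counit_slides al epy v p q T"
  and counit: "!!p q T. coact_counital rh epy v p q T"
  and tr: "!!p q T. W etax p (y#q) (W e p q T) = W epy p q T"
 shows "act_unital etax v act p q T"
proof -
 note [simp] = h[unfolded hom_def]
 have "act_unital etax v act p q T"
  by (subst act, subst counit[symmetric], subst counit_inv[OF h(1) comp, symmetric], subst lco[symmetric], subst tr[symmetric], simp add: slide)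
  then show ?thesis .
qed

lemma lco_multV:
 assumes h: "hom n [v, v] [v]" "hom m [y, y] [y]"
  and compV: "!!p q T. multV_slides n y al v p q T"
  and comp: "!!p q T. mult_slides m v al y p q T"
  and multV: "!!p q T. coact_multiplicative n rh v y al m p q T"
 shows "W n p q (W lco p q T) = W lco (v#p) q (W ali p (v#q) (W lco (y#p) (v#q) (W Psy p (v#v#q) (W m p (v#v#q) (W n (y#p) q T)))))"
proof -
 note [simp] = h[unfolded hom_def]
 have "W n p q (W lco p q T) =
  W lco (v#p) q (W ali p (v#q) (W lco (y#p) (v#q) (W Psy p (v#v#q) (W m p (v#v#q) (W n (y#p) q T)))))"
  by (simp add: lco multV multV_inv[OF h(1) compV] mult_inv[OF h(2) comp] chain slide braid_inv coact_inv)
  then show ?thesis .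
qed

lemma act_multV:
 assumes h: "hom n [v, v] [v]" "hom m [y, y] [y]" "hom de [x] [x, x]"
  and compV: "!!p q T. multV_slides n y al v p q T"
  and comp: "!!p q T. mult_slides m v al y p q T"
  and multV: "!!p q T. coact_multiplicative n rh v y al m p q T"
  and tr: "!!p q T. W de p (y#y#q) (W e (x#p) (y#q) (W e p q T)) = W Psy (x#p) q (W m (x#p) q (W e p q T))"
 shows "act_multiplicative n x act de v ta p q T"
proof -
 note [simp] = h[unfolded hom_def]
 have "act_multiplicative n x act de v ta p q T" by (simp add: act lco_multV[OF h(1,2) compV comp multV] slide tr[symmetric] mate[symmetric])
  then show ?thesis .
qed

lemma act_unitV:
 assumes h: "hom j [] [v]" "hom etay [] [y]" "hom epx [x] []"
  and comp: "!!p q T. unit_slides etay v al p q T"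
  and unitV: "!!p q T. W j p q (W rh p q T) = W j p q (W etay (v#p) q T)"
  and tr: "!!p q T. W etay (x#p) q (W e p q T) = W epx p q T"
 shows "W j (x#p) q (W act p q T) = W epx p q (W j p q T)"
proof -
 note [simp] = h[unfolded hom_def]
 have "W j (x#p) q (W act p q T) =
  W epx p q (W j p q T)" by (simp add: act lco unitV unit_inv[OF h(2) comp] slide tr)
  then show ?thesis .
qed

end

text \<open>Conversely, the coaction of x is determined by its contraction with y, which is to be the action of y
after the inverse crossing.\<close>

locale module_mate = mate_pair +
 fixes nv rh
 assumes mod_homs: "hom nv [y, v] [v]" "hom rh [v] [v, x]"
  and act_braid: "!!p q T. act_braids nv y al Psy v p q T"
  and coact: "!!p q T. W rh p (y#q) (W (ev x y) (v#p) q T) = W ali p q (W nv p q T)"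
begin

lemmas [simp] = mod_homs[unfolded hom_def]

lemma act_inv: "W nv p (y#q) (W ali p q T) = W ali (y#p) q (W Psyi p (v#q) (W nv (y#p) q T))"
proof -
 have "W ali (y#p) q (W Psyi p (v#q) (W nv (y#p) q T)) =
  W ali (y#p) q (W Psyi p (v#q) (W nv (y#p) q (W al p q (W ali p q T))))" by (simp add: chain)
 also have "... = W nv p (y#q) (W ali p q T)" by (subst act_braid, simp add: chain)
 finally show ?thesis ..
qed

lemma act_inv2: "W Psy (v#p) q (W ali p (y#q) (W nv p (y#q) (W ali p q T))) = W ali p (y#q) (W ali (y#p) q (W nv (y#p) q T))"
proof -
 have "W Psy (v#p) q (W ali p (y#q) (W nv p (y#q) (W ali p q T))) =
  W ali p (y#q) (W ali (y#p) q (W nv (y#p) q T))" by (simp add: act_inv braid_inv[symmetric] chain)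
  then show ?thesis .
qed

lemma coact_braid: "coact_braids ta rh x Psx v p q T"
proof -
 have "wh [] ta [] >> wh [] rh [x] = wh [x] rh [] >> wh [] ta [x] >> wh [v] Psx []"
 proof (rule separation2[OF dual, of _ "[x, v]" "[v]"])
  fix T
  have "W ta [] [y, y] (W rh [] [x, y, y] (W e [x, v] [y] (W e [v] [] T))) =
  W ta [] [y, y] (W e [v] [y] (W rh [] [y] (W e [v] [] T)))" by (simp add: slide)
 also have "... = W Psy [v, x] [] (W rh [x] [y, y] (W e [v, x] [y] (W ta [] [y] (W e [v] [] T))))"
  by (subst coact, subst mate, subst act_inv2, simp only: mate coact, simp add: slide)
 also have "... = W rh [x] [y, y] (W ta [] [x, y, y] (W Psx [v] [y, y] (W e [x, v] [y] (W e [v] [] T))))" by (simp add: slide transp)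
  finally show "W (wh [] ta [] >> wh [] rh [x]) [] [y, y] (W e (x#rev [v]) [y] (W e (rev [v]) [] T)) =
    W (wh [x] rh [] >> wh [] ta [x] >> wh [v] Psx []) [] [y, y] (W e (x#rev [v]) [y] (W e (rev [v]) [] T))" by (simp add: chain)
 qed (simp_all add: hom_def)
 from chain_cong[OF this, of p q T] show ?thesis by (simp add: chain)
qed

lemma coact_coassoc:
 assumes h: "hom m [y, y] [y]" "hom de [x] [x, x]"
  and comp: "!!p q T. mult_slides m v al y p q T"
  and act: "!!p q T. act_assoc nv y m v p q T"
  and tr: "!!p q T. W de p (y#y#q) (W e (x#p) (y#q) (W e p q T)) = W Psyi (x#p) q (W m (x#p) q (W e p q T))"
 shows "coact_coassoc rh x de v p q T"
proof -
 note [simp] = h[unfolded hom_def]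
 have "wh [] rh [] >> wh [] rh [x] = wh [] rh [] >> wh [v] de []"
 proof (rule separation2[OF dual, of _ "[v]" "[v]"])
  fix T
  have "W rh [] [y, y] (W rh [] [x, y, y] (W e [x, v] [y] (W e [v] [] T))) =
  W rh [] [y, y] (W e [v] [y] (W rh [] [y] (W e [v] [] T)))" by (simp add: slide)
 also have "... = W rh [] [y, y] (W de [v] [y, y] (W e [x, v] [y] (W e [v] [] T)))"
  by (simp only: coact act_inv act braid_inv' mult_inv[OF h(1) comp, symmetric], simp add: coact[symmetric] slide tr)
  finally show "W (wh [] rh [] >> wh [] rh [x]) [] [y, y] (W e (x#rev [v]) [y] (W e (rev [v]) [] T)) =
    W (wh [] rh [] >> wh [v] de []) [] [y, y] (W e (x#rev [v]) [y] (W e (rev [v]) [] T))" by (simp add: chain)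
 qed (simp_all add: hom_def)
 from chain_cong[OF this, of p q T] show ?thesis by (simp add: chain)
qed

lemma coact_counit:
 assumes h: "hom etay [] [y]" "hom epx [x] []"
  and comp: "!!p q T. unit_slides etay v al p q T"
  and unit: "!!p q T. act_unital etay v nv p q T"
  and tr: "!!p q T. W etay (x#p) q (W e p q T) = W epx p q T"
 shows "coact_counital rh epx v p q T"
proof -
 note [simp] = h[unfolded hom_def]
 have "coact_counital rh epx v p q T"
  by (subst tr[symmetric], subst unit[symmetric], subst unit_inv[OF h(1) comp, symmetric], subst coact[symmetric], simp add: slide)
  then show ?thesis .
qed

lemma coact_multV:
 assumes h: "hom n [v, v] [v]" "hom De [y] [y, y]" "hom my [x, x] [x]"
  and compV: "!!p q T. multV_slides n y al v p q T"
  and comp: "!!p q T. comult_slides al De v y p q T"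
  and multV: "!!p q T. act_multiplicative n y nv De v al p q T"
  and tr: "!!p q T. W my p (y#q) (W e p q T) = W De (x#x#p) q (W Psy (x#x#p) q (W e (x#p) (y#q) (W e p q T)))"
 shows "coact_multiplicative n rh v x ta my p q T"
proof -
 note [simp] = h[unfolded hom_def]
 have "wh [] n [] >> wh [] rh [] = wh [] rh [v] >> wh [x, v] rh [] >> wh [v] ta [x] >> wh [v, v] my [] >> wh [] n [x]"
 proof (rule separation1[OF dual, of _ "[v, v]" "[v]"])
  fix T
  have "W n [] [y] (W rh [] [y] (W e [v] [] T)) =
  W De [v, v] [] (W ali [v] [y] (W ali [y, v] [] (W ali [] [y, v] (W nv [v, y] [] (W nv [] [v] (W n [] [] T))))))"
  by (simp add: coact multV_inv[OF h(1) compV] multV comult_inv[OF h(2) comp] chain)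
 also have "... = W De [v, v] [] (W Psy [v, v] [] (W ali [v] [y] (W nv [v] [y] (W ali [v] [] (W ali [] [v] (W nv [] [v] (W n [] [] T)))))))"
  by (subst act_inv2, simp add: slide)
 also have "... = W rh [] [v, y] (W rh [x, v] [y] (W ta [v] [x, y] (W my [v, v] [y] (W n [] [x, y] (W e [v] [] T)))))"
  by (simp add: coact[symmetric] slide mate[symmetric] tr)
  finally show "W (wh [] n [] >> wh [] rh []) [] [y] (W e (rev [v]) [] T) =
    W (wh [] rh [v] >> wh [x, v] rh [] >> wh [v] ta [x] >> wh [v, v] my [] >> wh [] n [x]) [] [y] (W e (rev [v]) [] T)" by (simp add: chain)
 qed (simp_all add: hom_def)
 from chain_cong[OF this, of p q T] show ?thesis by (simp add: chain)
qed

lemma coact_unitV: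
 assumes h: "hom j [] [v]" "hom epy [y] []" "hom etax [] [x]"
  and comp: "!!p q T. unitV_slides j y al p q T"
  and unitV: "!!p q T. W j (y#p) q (W nv p q T) = W epy p q (W j p q T)"
  and tr: "!!p q T. W etax p (y#q) (W e p q T) = W epy p q T"
 shows "W j p q (W rh p q T) = W j p q (W etax (v#p) q T)"
proof -
 note [simp] = h[unfolded hom_def]
 have "wh [] j [] >> wh [] rh [] = wh [] j [] >> wh [v] etax []"
 proof (rule separation1[OF dual, of _ "[]" "[v]"])
  fix T
  have "W j [] [y] (W rh [] [y] (W e [v] [] T)) =
  W j [] [y] (W etax [v] [y] (W e [v] [] T))" by (simp add: coact unitV_inv[OF h(1) comp] unitV tr[symmetric] slide)
  then show "W (wh [] j [] >> wh [] rh []) [] [y] (W e (rev [v]) [] T) =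
    W (wh [] j [] >> wh [v] etax []) [] [y] (W e (rev [v]) [] T)" by (simp add: chain)
 qed (simp_all add: hom_def)
 from chain_cong[OF this, of p q T] show ?thesis by (simp add: chain)
qed

end

section \<open>Tensor products as words\<close>

record ('k, 'a, 's, 'z) frame =
 sp :: "('k, 'a) vs"
 wd :: "'s list"
 pt :: "'z list => 'a"

lemma Hom_in: "f : Hom X Y ==> x : carr X ==> f$x : carr Y" by (simp add: Hom_def linear_map_def)

lemma Hom_scal: "f : Hom X Y ==> x : carr X ==> f$(scal X c x) = scal Y c (f$x)" by (simp add: Hom_def linear_map_def)

lemma Hom_src: "f : Hom X Y ==> src f = X"
 and Hom_tgt: "f : Hom X Y ==> tgt f = Y"
 and Hom_out: "f : Hom X Y ==> x ~: carr X ==> f$x = 0" by (simp_all add: Hom_def)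

lemma Hom_eqI:
 assumes "f : Hom X Y" "g : Hom X Y" "!!x. x : carr X ==> f$x = g$x"
 shows "f = g"
proof -
 have "app f = app g" using assms by (intro ext) (metis Hom_out)
 then show ?thesis using assms by (intro lmap.equality) (simp_all add: Hom_src Hom_tgt)
qed

lemma mk_Hom: "vspace X ==> linear_map X Y f ==> mk X Y f : Hom X Y"
 using vspace_add[of X] vspace_scal[of X] by (simp add: Hom_def linear_map_def mk_def)

lemma mk_linear_cong:
 assumes "vspace X" "!!x. x : carr X ==> f x = g x" "linear_map X Y f"
 shows "linear_map X Y g" using assms vspace_add[of X] vspace_scal[of X] by (simp add: linear_map_def)

lemma Hom_linear: "f : Hom X Y ==> linear_map X Y (app f)" by (simp add: Hom_def)

lemma linear_comp: "linear_map X Y f ==> linear_map Y Z g ==> linear_map X Z (%x. g (f x))" by (simp add: linear_map_def)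

lemma comp_Hom: "vspace X ==> f : Hom X Y ==> g : Hom Y Z ==> g oo f : Hom X Z"
 unfolding comp_lmap_def by (simp add: Hom_src Hom_tgt mk_Hom linear_comp[OF Hom_linear Hom_linear])

lemma comp_app: "f : Hom X Y ==> x : carr X ==> (g oo f)$x = g$(f$x)" by (simp add: comp_lmap_def Hom_src mk_app)

lemma Id_Hom: "vspace X ==> Id X : Hom X X" unfolding Id_def by (rule mk_Hom) (simp_all add: linear_map_def)

lemma Id_app: "x : carr X ==> Id X $ x = x" by (simp add: Id_def mk_app)

lemma Iso_Hom: "f : Iso X Y ==> f : Hom X Y" by (simp add: Iso_def)

lemma linv_Iso:
 assumes X: "vspace X" and f: "f : Iso X Y"
 shows "linv f : Iso Y X" "!!x. x : carr X ==> linv f$(f$x) = x"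
  "!!y. y : carr Y ==> f$(linv f$y) = y" "linv f oo f = Id X" "f oo linv f = Id Y"
proof -
 have h: "f : Hom X Y" and b: "bij_betw (app f) (carr X) (carr Y)" using f by (auto simp: Iso_def)
 have app: "linv f$y = inv_into (carr X) (app f) y" if "y : carr Y" for y using that h by (simp add: linv_def Hom_src Hom_tgt mk_app)
 show 1: "linv f$(f$x) = x" if "x : carr X" for x using that b Hom_in[OF h that] by (simp add: app bij_betw_inv_into_left)
 show 2: "f$(linv f$y) = y" if "y : carr Y" for y using that b by (simp add: app bij_betw_inv_into_right)
 have in': "linv f$y : carr X" if "y : carr Y" for y using that b by (metis app bij_betwE bij_betw_inv_into)
 have obt: "\<exists>x\<in>carr X. y = f$x" if "y : carr Y" for y using 2[OF that] in'[OF that] by metis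
 have "linear_map Y X (app (linv f))" unfolding linear_map_def
 proof (intro conjI ballI allI)
  fix y y' c assume y: "y : carr Y" and y': "y' : carr Y"
  obtain x x' where x: "x : carr X" "y = f$x" "x' : carr X" "y' = f$x'" using obt y y' by meson
  then show "linv f$(y + y') = linv f$y + linv f$y'" using 1 Hom_add[OF h x(1,3)] vspace_add[OF X x(1,3)] by metis
 next
  fix c y assume y: "y : carr Y"
  obtain x where x: "x : carr X" "y = f$x" using obt y by meson
  then show "linv f$(scal Y c y) = scal X c (linv f$y)" using 1 Hom_scal[OF h x(1)] vspace_scal[OF X x(1)] by metis
 qed (rule in')
 then have li: "linv f : Hom Y X" using h by (simp add: Hom_def) (simp add: linv_def mk_def Hom_def)
 moreover have "bij_betw (app (linv f)) (carr Y) (carr X)"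
  using bij_betw_inv_into[OF b] app by (subst bij_betw_cong[of _ _ "inv_into (carr X) (app f)"]) auto
 ultimately show "linv f : Iso Y X" by (simp add: Iso_def)
 show "linv f oo f = Id X" by (rule Hom_eqI[OF comp_Hom[OF X h li] Id_Hom[OF X]]) (simp add: comp_app[OF h] 1 Id_app)
 have Y: "vspace Y" if "vspace Y" using that .
 show "f oo linv f = Id Y"
 proof -
  have "(f oo linv f)$y = Id Y$y" for y using 2 li h by (cases "y : carr Y") (simp_all add: comp_lmap_def mk_def Id_def Hom_src)
  then have "app (f oo linv f) = app (Id Y)" by (rule ext)
  then show ?thesis using li h by (intro lmap.equality) (simp_all add: comp_lmap_def mk_def Id_def Hom_src Hom_tgt)
 qed
qed

lemma pure_linear1: "vspace X ==> vspace Y ==> y : carr Y ==> linear_map X (X >< Y) (%x. pure X Y x y)"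
 and pure_linear2: "vspace X ==> vspace Y ==> x : carr X ==> linear_map Y (X >< Y) (pure X Y x)" using bilinear_pure by (auto simp: bilinear_map_def)

lemma tensor_lmap_Hom:
 assumes X: "vspace X" and Y: "vspace Y" and X': "vspace X'" and Y': "vspace Y'"
  and f: "f : Hom X X'" and g: "g : Hom Y Y'"
 shows "f ** g : Hom (X >< Y) (X' >< Y')"
  and "x : carr X ==> y : carr Y ==> (f ** g)$(pure X Y x y) = pure X' Y' (f$x) (g$y)"
proof -
 have b: "bilinear_map X Y (X' >< Y') (%x y. pure X' Y' (f$x) (g$y))" unfolding bilinear_map_def
  by (intro conjI ballI linear_comp[OF Hom_linear[OF g] pure_linear2[OF X' Y']]
    linear_comp[OF Hom_linear[OF f] pure_linear1[OF X' Y']] Hom_in[OF f] Hom_in[OF g])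
 show "f ** g : Hom (X >< Y) (X' >< Y')"
  using tlift_Hom[OF X Y vT b] by (simp add: tensor_lmap_def Hom_src[OF f] Hom_src[OF g] Hom_tgt[OF f] Hom_tgt[OF g])
 show "x : carr X ==> y : carr Y ==> (f ** g)$(pure X Y x y) = pure X' Y' (f$x) (g$y)"
  using tlift_pure[OF X Y vT b] by (simp add: tensor_lmap_def Hom_src[OF f] Hom_src[OF g] Hom_tgt[OF f] Hom_tgt[OF g])
qed

lemma tensor_lmap_split:
 assumes X: "vspace X" and Y: "vspace Y" and X': "vspace X'" and Y': "vspace Y'"
  and f: "f : Hom X X'" and g: "g : Hom Y Y'"
 shows "f ** g = (f ** Id Y') oo (Id X ** g)"
proof (rule tensor_Hom_eqI[OF X Y])
 note i = tensor_lmap_Hom[OF X Y X Y' Id_Hom[OF X] g] and ii = tensor_lmap_Hom[OF X Y' X' Y' f Id_Hom[OF Y']]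
 show "f ** g : Hom (X >< Y) (X' >< Y')" by (rule tensor_lmap_Hom[OF X Y X' Y' f g])
 show "(f ** Id Y') oo (Id X ** g) : Hom (X >< Y) (X' >< Y')" by (rule comp_Hom[OF vT i(1) ii(1)])
 show "(f ** g)$(pure X Y x y) = ((f ** Id Y') oo (Id X ** g))$(pure X Y x y)"
  if "x : carr X" "y : carr Y" for x y
  using that by (simp add: comp_app[OF i(1)] pT i(2) ii(2) Id_app Hom_in[OF g] tensor_lmap_Hom(2)[OF X Y X' Y' f g])
qed

lemma tensor_linear_eqI:
 assumes X: "vspace X" and Y: "vspace Y" and f: "linear_map (X >< Y) Z f" and g: "linear_map (X >< Y) Z g"
  and eq: "!!x y. x : carr X ==> y : carr Y ==> f (pure X Y x y) = g (pure X Y x y)"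
  and t: "t : carr (X >< Y)"
 shows "f t = g t"
proof -
 have "mk (X >< Y) Z f = mk (X >< Y) Z g" by (rule tensor_Hom_eqI[OF X Y, of _ Z]) (simp_all add: mk_Hom vT f g mk_app pT eq)
 from arg_cong[OF this, of "%h. h$t"] show ?thesis using t by (simp add: mk_app)
qed

lemma linear_zero_map: "vspace Z ==> linear_map X Z (%_. 0)" using vspace_zero[of Z] vspace_scal_zero[of Z] by (simp add: linear_map_def)

lemma linear_add_map:
 assumes Z: "vspace Z" and f: "linear_map X Z f" and g: "linear_map X Z g"
 shows "linear_map X Z (%x. f x + g x)"
proof -
 interpret vector_space "scal Z" using Z by (simp add: vspace_def)
 show ?thesis using f g vspace_add[OF Z] by (simp add: linear_map_def algebra_simps scale_right_distrib)
qed

lemma bilinear_tlift1: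
 assumes X: "vspace X" and Y: "vspace Y" and Z: "vspace Z" and W: "vspace W"
  and b: "!!z. z : carr Z ==> bilinear_map X Y W (%x y. g x y z)"
  and l: "!!x y. x : carr X ==> y : carr Y ==> linear_map Z W (g x y)"
 shows "bilinear_map (X >< Y) Z W (%t z. tlift X Y W (%x y. g x y z)$t)"
proof -
 have 1: "linear_map (X >< Y) W (%t. tlift X Y W (%x y. g x y z)$t)" if "z : carr Z" for z using Hom_linear[OF tlift_Hom[OF X Y W b[OF that]]] .
 have "linear_map Z W (%z. tlift X Y W (%x y. g x y z)$t)" if "t : carr (X >< Y)" for t using X Y that
 proof (induction t rule: tensor_induct)
  case zero
  have "tlift X Y W (%x y. g x y z)$0 = 0" if "z : carr Z" for z using Hom_zero[OF tlift_Hom[OF X Y W b[OF that]] vT] .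
  from this[symmetric] show ?case by (rule mk_linear_cong[OF Z _ linear_zero_map[OF W]])
 next
  case (pure x y)
  show ?case by (rule mk_linear_cong[OF Z _ l[OF pure]]) (simp add: tlift_pure[OF X Y W b pure])
 next
  case (add s t)
  show ?case by (rule mk_linear_cong[OF Z _ linear_add_map[OF W add.IH]])
    (rule Hom_add[OF tlift_Hom[OF X Y W b] add.hyps, symmetric])
 qed
 with 1 show ?thesis by (simp add: bilinear_map_def)
qed

lemma bilinear_swap: "bilinear_map X Y Z f <-> bilinear_map Y X Z (%y x. f x y)" by (auto simp: bilinear_map_def)

lemma bilinear_tlift2:
 assumes "vspace X" "vspace Y" "vspace Z" "vspace W"
  and "!!z. z : carr Z ==> bilinear_map X Y W (%x y. g z x y)"
  and "!!x y. x : carr X ==> y : carr Y ==> linear_map Z W (%z. g z x y)"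
 shows "bilinear_map Z (X >< Y) W (%z t. tlift X Y W (%x y. g z x y)$t)"
 using bilinear_tlift1[of X Y Z W "%x y z. g z x y"] assms by (subst bilinear_swap) simp

lemma functionals_separate:
 assumes X: "vspace X" and x: "x : carr X" "y : carr X"
  and eq: "!!xi. linf X xi ==> xi x = xi y"
 shows "x = y"
proof (rule ccontr)
 assume "x ~= y"
 then obtain xi where xi: "linf X xi" "xi (x - y) ~= 0" using separating_functional[OF X, of "x - y"] by auto
 have "xi ((x - y) + y) = xi (x - y) + xi y" by (rule linear_ground_simps(1)[OF xi(1) vspace_diff[OF X x] x(2)])
 then show False using eq[OF xi(1)] xi(2) by simp
qed

lemma assoc_Hom:
 assumes X: "vspace X" and Y: "vspace Y" and Z: "vspace Z"
 shows "assoc X Y Z : Hom ((X >< Y) >< Z) (X >< Y >< Z)"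
  and "x : carr X ==> y : carr Y ==> z : carr Z ==>
   assoc X Y Z$(pure (X >< Y) Z (pure X Y x y) z) = pure X (Y >< Z) x (pure Y Z y z)"
proof -
 have b: "bilinear_map X Y (X >< Y >< Z) (%x y. pure X (Y >< Z) x (pure Y Z y z))" if z: "z : carr Z" for z unfolding bilinear_map_def
  by (intro conjI ballI pure_linear1[OF X vT] pT z
    linear_comp[OF pure_linear1[OF Y Z z] pure_linear2[OF X vT]])
 have l: "linear_map Z (X >< Y >< Z) (%z. pure X (Y >< Z) x (pure Y Z y z))"
  if "x : carr X" "y : carr Y" for x y by (rule linear_comp[OF pure_linear2[OF Y Z that(2)] pure_linear2[OF X vT that(1)]])
 note bb = bilinear_tlift1[OF X Y Z vT b l]
 show "assoc X Y Z : Hom ((X >< Y) >< Z) (X >< Y >< Z)" unfolding assoc_def by (rule tlift_Hom[OF vT Z vT bb])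
 show "assoc X Y Z$(pure (X >< Y) Z (pure X Y x y) z) = pure X (Y >< Z) x (pure Y Z y z)"
  if "x : carr X" "y : carr Y" "z : carr Z" unfolding assoc_def using that by (simp add: tlift_pure[OF vT Z vT bb] pT tlift_pure[OF X Y vT b])
qed

lemma assoc_inverse_ex:
 assumes X: "vspace X" and Y: "vspace Y" and Z: "vspace Z"
 shows "\<exists>g \<in> Hom (X >< Y >< Z) ((X >< Y) >< Z). \<forall>x\<in>carr X. \<forall>y\<in>carr Y. \<forall>z\<in>carr Z.
   g$(pure X (Y >< Z) x (pure Y Z y z)) = pure (X >< Y) Z (pure X Y x y) z"
proof -
 have b: "bilinear_map Y Z ((X >< Y) >< Z) (%y z. pure (X >< Y) Z (pure X Y x y) z)" if x: "x : carr X" for x unfolding bilinear_map_def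
  by (intro conjI ballI pure_linear2[OF vT Z] pT x
    linear_comp[OF pure_linear2[OF X Y x] pure_linear1[OF vT Z]])
 have l: "linear_map X ((X >< Y) >< Z) (%x. pure (X >< Y) Z (pure X Y x y) z)"
  if "y : carr Y" "z : carr Z" for y z by (rule linear_comp[OF pure_linear1[OF X Y that(1)] pure_linear1[OF vT Z that(2)]])
 note bb = bilinear_tlift2[OF Y Z X vT b l]
 show ?thesis by (rule bexI[OF _ tlift_Hom[OF X vT vT bb]])
   (simp add: tlift_pure[OF X vT vT bb] pT tlift_pure[OF Y Z vT b])
qed

lemma unit_bilinear:
 assumes "vspace X"
 shows "bilinear_map ground X X (%c x. scal X c x)" "bilinear_map X ground X (%x c. scal X c x)"
proof -
 interpret vector_space "scal X" using assms by (simp add: vspace_def)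
 show "bilinear_map ground X X (%c x. scal X c x)" "bilinear_map X ground X (%x c. scal X c x)" using vspace_scal[OF assms]
  by (auto simp: bilinear_map_def linear_map_def ground_def scale_right_distrib scale_left_distrib mult.commute)
qed

lemma lunit_Hom: "vspace X ==> lunit X : Hom (ground >< X) X"
 and lunit_pure: "vspace X ==> x : carr X ==> lunit X$(pure ground X c x) = scal X c x"
 and runit_Hom: "vspace X ==> runit X : Hom (X >< ground) X"
 and runit_pure: "vspace X ==> x : carr X ==> runit X$(pure X ground x c) = scal X c x" unfolding lunit_def runit_def
 using tlift_Hom[OF vspace_ground _ _ unit_bilinear(1)] tlift_pure[OF vspace_ground _ _ unit_bilinear(1)]
  tlift_Hom[OF _ vspace_ground _ unit_bilinear(2)] tlift_pure[OF _ vspace_ground _ unit_bilinear(2)] by (auto simp: ground_def)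

context tensor_words begin

definition pull :: "('k, 'a, 's, 'z) frame => ('a => 'k) => 'z list => 'k" where
 "pull A xi = (%xs. if xs : points (wd A) then xi (pt A xs) else 0)"

text \<open>A frame presents a space by a word: linear functionals on the space are the same as multilinear forms
on the word, and the points of the word span.\<close>

definition tp :: "('k, 'a::ab_group_add, 's, 'z) frame => bool" where
 "tp A <-> vspace (sp A) & (\<forall>xs\<in>points (wd A). pt A xs : carr (sp A)) &
   (\<forall>xi. linf (sp A) xi --> pull A xi : forms (wd A)) &
   (\<forall>x\<in>carr (sp A). \<exists>L. (\<forall>(c, ys) \<in> set L. ys : points (wd A)) &
    (\<forall>xi. linf (sp A) xi --> xi x = comb L (%ys. xi (pt A ys)))) &
   (\<forall>T\<in>forms (wd A). \<exists>xi. linf (sp A) xi & (\<forall>xs\<in>points (wd A). xi (pt A xs) = T xs))"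

lemma tpD:
 assumes "tp A"
 shows tp_vs: "vspace (sp A)" and tp_pt: "xs : points (wd A) ==> pt A xs : carr (sp A)"
  and tp_pull: "linf (sp A) xi ==> pull A xi : forms (wd A)" using assms by (auto simp: tp_def)

lemma tp_comb:
 assumes "tp A" "x : carr (sp A)"
 obtains L where "!!c ys. (c, ys) : set L ==> ys : points (wd A)"
  "!!xi. linf (sp A) xi ==> xi x = comb L (%ys. xi (pt A ys))" using assms unfolding tp_def by fast

definition exf :: "('k, 'a::ab_group_add, 's, 'z) frame => ('z list => 'k) => 'a => 'k" where
 "exf A T = (SOME xi. linf (sp A) xi & (\<forall>xs\<in>points (wd A). xi (pt A xs) = T xs))"

lemma exf:
 assumes "tp A" "T : forms (wd A)"
 shows exf_linear: "linf (sp A) (exf A T)"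
  and exf_pt: "xs : points (wd A) ==> exf A T (pt A xs) = T xs"
proof -
 have "\<exists>xi. linf (sp A) xi & (\<forall>xs\<in>points (wd A). xi (pt A xs) = T xs)" using assms by (simp add: tp_def)
 from someI_ex[OF this] show "linf (sp A) (exf A T)"
  "xs : points (wd A) ==> exf A T (pt A xs) = T xs" by (auto simp: exf_def)
qed

lemma pull_exf: "tp A ==> T : forms (wd A) ==> pull A (exf A T) = T" by (rule ext) (simp add: pull_def exf_pt forms_out)

lemma linear_pt_eqI:
 assumes A: "tp A" and "linf (sp A) xi" "linf (sp A) \<zeta>"
  and "!!xs. xs : points (wd A) ==> xi (pt A xs) = \<zeta> (pt A xs)" and x: "x : carr (sp A)"
 shows "xi x = \<zeta> x"
proof -
 obtain L where L: "!!c ys. (c, ys) : set L ==> ys : points (wd A)"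
  "!!xi. linf (sp A) xi ==> xi x = comb L (%ys. xi (pt A ys))" using tp_comb[OF A x] by blast
 show ?thesis unfolding L(2)[OF assms(2)] L(2)[OF assms(3)] by (rule comb_cong) (use assms(4) L(1) in blast)
qed

lemma forms_comb:
 assumes "!!c y. (c, y) : set L ==> g y : forms w"
 shows "(%xs. comb L (%y. g y xs)) : forms w"
proof -
 have "comb L (%y. g y xs) = 0" if "xs ~: points w" for xs
 proof -
  have "comb L (%y. g y xs) = comb L (%y. 0)" using that forms_out[OF assms] by (intro comb_cong) blast
  then show ?thesis using comb_scale[of L 0 "%_. 0"] by simp
 qed
 moreover have "linf (S (w ! i)) (%z. comb L (%y. g y (xs[i := z])))"
  if "xs : points w" "i < length w" for xs i by (rule linear_ground_comb) (rule forms_lin[OF assms that])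
 ultimately show ?thesis by (simp add: forms_def)
qed

lemma forms_appendI:
 assumes "!!xs. xs ~: points (w @ w') ==> T xs = 0"
  and l: "!!b. b : points w' ==> (%a. T (a @ b)) : forms w"
  and r: "!!a. a : points w ==> (%b. T (a @ b)) : forms w'"
 shows "T : forms (w @ w')"
proof -
 have "linf (S ((w @ w') ! i)) (%z. T (xs[i := z]))"
  if xs: "xs : points (w @ w')" and i: "i < length (w @ w')" for xs i
 proof -
  obtain a b where ab: "xs = a @ b" "a : points w" "b : points w'" using points_appendD[OF xs] by blast
  have la: "length a = length w" using points_length[OF ab(2)] .
  show ?thesis
  proof (cases "i < length w")
   case True
   then show ?thesis using forms_lin[OF l[OF ab(3)] ab(2) True] la ab(1) by (simp add: nth_append list_update_append1)
  next
   case False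
   then obtain j where j: "i = length w + j" using le_Suc_ex[of "length w" i] by auto
   then show ?thesis using forms_lin[OF r[OF ab(2)] ab(3), of j] la ab(1) i by (simp add: nth_append list_update_append)
  qed
 qed
 with assms(1) show ?thesis by (simp add: forms_def)
qed

definition jn :: "bool => 'x list => 'x list => 'x list" where
 "jn o' a b = (if o' then a @ b else b @ a)"

text \<open>The flag chooses the reading direction: the word of a tensor product is the word of its factors in
the given order, or in the opposite order.\<close>

definition tens :: "bool => ('k, 'a::ab_group_add, 's, 'z) frame => ('k, 'b::ab_group_add, 's, 'z) frame
  => ('k, ('k, 'a, 'b) tensor, 's, 'z) frame" where
 "tens o' A B = \<lparr>sp = sp A >< sp B, wd = jn o' (wd A) (wd B),
   pt = (%xs. if o' then pure (sp A) (sp B) (pt A (take (length (wd A)) xs)) (pt B (drop (length (wd A)) xs))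
    else pure (sp A) (sp B) (pt A (drop (length (wd B)) xs)) (pt B (take (length (wd B)) xs)))\<rparr>"

lemma sp_tens [simp]: "sp (tens o' A B) = sp A >< sp B"
 and wd_tens: "wd (tens o' A B) = jn o' (wd A) (wd B)" by (simp_all add: tens_def)

lemma pt_tens: "a : points (wd A) ==> b : points (wd B) ==>
  pt (tens o' A B) (jn o' a b) = pure (sp A) (sp B) (pt A a) (pt B b)" by (auto simp: tens_def jn_def dest: points_length)

lemma points_jn: "a : points w ==> b : points w' ==> jn o' a b : points (jn o' w w')" by (simp add: jn_def points_appendI)

lemma points_jnD: "xs : points (jn o' w w') ==> \<exists>a b. xs = jn o' a b & a : points w & b : points w'"
 unfolding jn_def by (cases o') (auto dest!: points_appendD)

lemma points_append_iff1: "b : points w' ==> a @ b : points (w @ w') <-> a : points w"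
 using points_length[of b w'] points_length[of "a @ b" "w @ w'"] by (auto simp: points_append points_appendI)

lemma points_append_iff2: "a : points w ==> a @ b : points (w @ w') <-> b : points w'" using points_length[of a w] by (auto simp: points_append)

lemma points_jn_iff1: "b : points w' ==> jn o' a b : points (jn o' w w') <-> a : points w" by (simp add: jn_def points_append_iff1 points_append_iff2)

lemma points_jn_iff2: "a : points w ==> jn o' a b : points (jn o' w w') <-> b : points w'" by (simp add: jn_def points_append_iff1 points_append_iff2)

lemma forms_jnI:
 assumes "!!xs. xs ~: points (jn o' w w') ==> T xs = 0"
  and "!!b. b : points w' ==> (%a. T (jn o' a b)) : forms w"
  and "!!a. a : points w ==> (%b. T (jn o' a b)) : forms w'"
 shows "T : forms (jn o' w w')" using assms unfolding jn_def by (cases o') (auto intro: forms_appendI)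

lemma forms_jn_slice:
 assumes T: "T : forms (jn o' w w')"
 shows "b : points w' ==> (%a. T (jn o' a b)) : forms w"
  and "a : points w ==> (%b. T (jn o' a b)) : forms w'" using T forms_slice[of T "[]" w w' "[]"] forms_slice[of T w' w "[]" _ "[]"]
  forms_slice[of T "[]" w' w "[]"] forms_slice[of T w w' "[]" _ "[]"] by (auto simp: jn_def split: if_splits)

lemma pull_tens:
 assumes "tp A" "tp B"
 shows "b : points (wd B) ==> (%a. pull (tens o' A B) xi (jn o' a b)) = pull A (%x. xi (pure (sp A) (sp B) x (pt B b)))"
  and "a : points (wd A) ==> (%b. pull (tens o' A B) xi (jn o' a b)) = pull B (%y. xi (pure (sp A) (sp B) (pt A a) y))"
 by (auto simp: pull_def wd_tens points_jn_iff1 points_jn_iff2 pt_tens fun_eq_iff)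

lemma lin_pure1: "tp A ==> tp B ==> linf (sp A >< sp B) xi ==> y : carr (sp B) ==>
  linf (sp A) (%x. xi (pure (sp A) (sp B) x y))" by (rule linear_comp[OF pure_linear1[OF tp_vs tp_vs]])

lemma lin_pure2: "tp A ==> tp B ==> linf (sp A >< sp B) xi ==> x : carr (sp A) ==>
  linf (sp B) (%y. xi (pure (sp A) (sp B) x y))" by (rule linear_comp[OF pure_linear2[OF tp_vs tp_vs]])

lemma tp_tens:
 assumes A: "tp A" and B: "tp B"
 shows "tp (tens o' A B)" unfolding tp_def
proof (intro conjI ballI allI impI)
 show "vspace (sp (tens o' A B))" by (simp add: vT)
next
 fix xs assume "xs : points (wd (tens o' A B))"
 then obtain a b where "xs = jn o' a b" "a : points (wd A)" "b : points (wd B)" unfolding wd_tens using points_jnD by blast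
 then show "pt (tens o' A B) xs : carr (sp (tens o' A B))" by (simp add: pt_tens pT tp_pt A B)
next
 fix xi assume "linf (sp (tens o' A B)) xi"
 then have xi: "linf (sp A >< sp B) xi" by simp
 show "pull (tens o' A B) xi : forms (wd (tens o' A B))" unfolding wd_tens
 proof (rule forms_jnI)
  show "pull (tens o' A B) xi xs = 0" if "xs ~: points (jn o' (wd A) (wd B))" for xs using that by (simp add: pull_def wd_tens)
 qed (simp_all add: pull_tens A B tp_pull lin_pure1 lin_pure2 xi tp_pt)
next
 fix t assume "t : carr (sp (tens o' A B))"
 then have "t : carr (sp A >< sp B)" by simp
 from tp_vs[OF A] tp_vs[OF B] this
 have "\<exists>L. (\<forall>(c, ys) \<in> set L. ys : points (wd (tens o' A B))) &
   (\<forall>xi\<in>Collect (linf (sp A >< sp B)). xi t = comb L (%ys. xi (pt (tens o' A B) ys)))"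
 proof (induction t rule: tensor_induct)
  case zero
  then show ?case by (intro exI[of _ "[]"]) (simp add: linear_ground_0[OF vT, unfolded zero_fun_def] zero_fun_def)
 next
  case (pure x y)
  obtain L where L: "!!c ys. (c, ys) : set L ==> ys : points (wd A)"
   "!!xi. linf (sp A) xi ==> xi x = comb L (%ys. xi (pt A ys))" using tp_comb[OF A pure(1)] by blast
  obtain K where K: "!!c ys. (c, ys) : set K ==> ys : points (wd B)"
   "!!xi. linf (sp B) xi ==> xi y = comb K (%ys. xi (pt B ys))" using tp_comb[OF B pure(2)] by blast
  have "\<exists>L'. (\<forall>(d, z) \<in> set L'. z : points (wd (tens o' A B))) &
    (\<forall>xi\<in>Collect (linf (sp A >< sp B)).
      comb L (%a. xi (pure (sp A) (sp B) (pt A a) y)) = comb L' (%ys. xi (pt (tens o' A B) ys)))"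
  proof -
   let ?g = "%xi a. xi (pure (sp A) (sp B) (pt A a) y)"
   have "\<exists>L'. (\<forall>(d, z) \<in> set L'. z : pt (tens o' A B) ` points (wd (tens o' A B))) &
    (\<forall>xi\<in>Collect (linf (sp A >< sp B)). comb L (?g xi) = comb L' xi)"
   proof (rule comb_list_ex)
    fix c a assume "(c, a) : set L"
    then have a: "a : points (wd A)" by (rule L)
    show "\<exists>L'. (\<forall>(d, z) \<in> set L'. z : pt (tens o' A B) ` points (wd (tens o' A B))) &
     (\<forall>xi\<in>Collect (linf (sp A >< sp B)). ?g xi a = comb L' xi)"
    proof (intro exI[of _ "map (%(c, b). (c, pt (tens o' A B) (jn o' a b))) K"] conjI ballI)
     fix xi assume "xi : Collect (linf (sp A >< sp B))"
     then have xi: "linf (sp A >< sp B) xi" by simp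
     have "?g xi a = comb K (%b. xi (pure (sp A) (sp B) (pt A a) (pt B b)))" by (rule K(2)[OF lin_pure2[OF A B xi tp_pt[OF A a]]])
     also have "... = comb K (%b. xi (pt (tens o' A B) (jn o' a b)))" by (rule comb_cong) (simp add: pt_tens a K(1))
     finally show "?g xi a = comb (map (%(c, b). (c, pt (tens o' A B) (jn o' a b))) K) xi" by (simp add: comb_map)
    qed (use K(1) a points_jn[of a "wd A" _ "wd B"] in \<open>auto simp: wd_tens\<close>)
   qed
   then obtain L' where L': "\<forall>(d, z) \<in> set L'. z : pt (tens o' A B) ` points (wd (tens o' A B))"
    "\<forall>xi\<in>Collect (linf (sp A >< sp B)). comb L (?g xi) = comb L' xi" by blast
   define inv where "inv z = (SOME xs. xs : points (wd (tens o' A B)) & z = pt (tens o' A B) xs)" for z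
   have inv: "inv z : points (wd (tens o' A B)) & z = pt (tens o' A B) (inv z)"
    if "z : pt (tens o' A B) ` points (wd (tens o' A B))" for z unfolding inv_def by (rule someI_ex) (use that in blast)
   show ?thesis
   proof (intro exI[of _ "map (%(c, z). (c, inv z)) L'"] conjI ballI)
    fix xi assume "xi : Collect (linf (sp A >< sp B))"
    then have "comb L (?g xi) = comb L' xi" using L' by blast
    also have "... = comb L' (%z. xi (pt (tens o' A B) (inv z)))" by (rule comb_cong) (use inv L'(1) in fastforce)
    finally show "comb L (?g xi) = comb (map (%(c, z). (c, inv z)) L') (%ys. xi (pt (tens o' A B) ys))" by (simp add: comb_map)
   qed (use inv L'(1) in fastforce)
  qed
  moreover have "xi (pure (sp A) (sp B) x y) = comb L (%a. xi (pure (sp A) (sp B) (pt A a) y))"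
   if "linf (sp A >< sp B) xi" for xi by (rule L(2)[OF lin_pure1[OF A B that pure(2)]])
  ultimately show ?case by auto
 next
  case (add s t)
  then obtain L K where "\<forall>(c, ys) \<in> set L. ys : points (wd (tens o' A B))"
   "\<forall>(c, ys) \<in> set K. ys : points (wd (tens o' A B))"
   "\<forall>xi\<in>Collect (linf (sp A >< sp B)). xi s = comb L (%ys. xi (pt (tens o' A B) ys))"
   "\<forall>xi\<in>Collect (linf (sp A >< sp B)). xi t = comb K (%ys. xi (pt (tens o' A B) ys))" by blast
  then show ?case using linear_ground_simps(1)[OF _ add.hyps] by (intro exI[of _ "L @ K"]) (auto simp: plus_fun_def)
 qed
 then show "\<exists>L. (\<forall>(c, ys) \<in> set L. ys : points (wd (tens o' A B))) &
   (\<forall>xi. linf (sp (tens o' A B)) xi --> xi t = comb L (%ys. xi (pt (tens o' A B) ys)))" by auto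
next
 fix T assume "T : forms (wd (tens o' A B))"
 then have T: "T : forms (jn o' (wd A) (wd B))" by (simp add: wd_tens)
 let ?g = "%a. exf B (%b. T (jn o' a b))"
 have g0: "(%b. T (jn o' a b)) : forms (wd B)" if "a : points (wd A)" for a using forms_jn_slice(2)[OF T that] .
 define G where "G y a = (if a : points (wd A) then ?g a y else 0)" for y a
 have G: "G y : forms (wd A)" if y: "y : carr (sp B)" for y
 proof -
  obtain K where K: "!!c ys. (c, ys) : set K ==> ys : points (wd B)"
   "!!xi. linf (sp B) xi ==> xi y = comb K (%ys. xi (pt B ys))" using tp_comb[OF B y] by blast
  have "G y = (%a. comb K (%b. T (jn o' a b)))"
  proof
   fix a
   show "G y a = comb K (%b. T (jn o' a b))"
   proof (cases "a : points (wd A)")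
    case True
    have "?g a y = comb K (%b. ?g a (pt B b))" by (rule K(2)[OF exf_linear[OF B g0[OF True]]])
    also have "... = comb K (%b. T (jn o' a b))" by (rule comb_cong) (simp add: exf_pt[OF B g0[OF True]] K(1))
    finally show ?thesis using True by (simp add: G_def)
   next
    case False
    have "comb K (%b. T (jn o' a b)) = comb K (%b. 0)" by (rule comb_cong) (use K(1) False in \<open>simp add: forms_out[OF T] points_jn_iff1\<close>)
    then show ?thesis using False comb_scale[of K 0 "%_. 0"] by (simp add: G_def)
   qed
  qed
  also have "... : forms (wd A)" by (rule forms_comb) (use K(1) forms_jn_slice(1)[OF T] in blast)
  finally show ?thesis .
 qed
 define be where "be x y = exf A (G y) x" for x y
 have "bilinear_map (sp A) (sp B) ground be" unfolding bilinear_map_def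
 proof (intro conjI ballI)
  fix y assume "y : carr (sp B)"
  then show "linf (sp A) (%x. be x y)" unfolding be_def by (intro exf_linear[OF A] G)
 next
  fix x assume x: "x : carr (sp A)"
  obtain L where L: "!!c ys. (c, ys) : set L ==> ys : points (wd A)"
   "!!xi. linf (sp A) xi ==> xi x = comb L (%ys. xi (pt A ys))" using tp_comb[OF A x] by blast
  have "comb L (%a. ?g a y) = be x y" if y: "y : carr (sp B)" for y
  proof -
   have "be x y = comb L (%a. exf A (G y) (pt A a))" unfolding be_def by (rule L(2)[OF exf_linear[OF A G[OF y]]])
   also have "... = comb L (%a. ?g a y)" by (rule comb_cong) (simp add: exf_pt[OF A G[OF y]] L(1) G_def)
   finally show ?thesis ..
  qed
  moreover have "linf (sp B) (%y. comb L (%a. ?g a y))" by (rule linear_ground_comb) (rule exf_linear[OF B g0[OF L(1)]])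
  ultimately show "linf (sp B) (be x)" by (rule mk_linear_cong[OF tp_vs[OF B]])
 qed
 note b = this
 have "tlift (sp A) (sp B) ground be$(pt (tens o' A B) xs) = T xs" if xs: "xs : points (wd (tens o' A B))" for xs
 proof -
  obtain a b where ab: "xs = jn o' a b" "a : points (wd A)" "b : points (wd B)" using points_jnD[OF xs[unfolded wd_tens]] by blast
  have "tlift (sp A) (sp B) ground be$(pt (tens o' A B) xs) = be (pt A a) (pt B b)"
   using ab by (simp add: pt_tens tlift_pure[OF tp_vs[OF A] tp_vs[OF B] vspace_ground b] tp_pt A B)
  also have "... = T xs" using ab unfolding be_def exf_pt[OF A G[OF tp_pt[OF B ab(3)]] ab(2)] by (simp add: G_def exf_pt[OF B g0])
  finally show ?thesis .
 qed
 moreover have "linf (sp (tens o' A B)) (app (tlift (sp A) (sp B) ground be))"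
  using Hom_linear[OF tlift_Hom[OF tp_vs[OF A] tp_vs[OF B] vspace_ground b]] by simp
 ultimately show "\<exists>xi. linf (sp (tens o' A B)) xi &
   (\<forall>xs\<in>points (wd (tens o' A B)). xi (pt (tens o' A B) xs) = T xs)" by blast
qed

end

section \<open>Linear maps as arrows\<close>

context tensor_words begin

text \<open>F represents f when pulling functionals back along f is F. Representation is faithful
(\<open>rp_inj\<close>) and compatible with composition and tensor products, which reduces equations between
linear maps to equations between arrows.\<close>

definition rp :: "('k, 'a::ab_group_add, 's, 'z) frame => ('k, 'b::ab_group_add, 's, 'z) frame
  => ('k, 'a, 'b) lmap => ('s, 'z, 'k) arr => bool" where
 "rp A B f F <-> tp A & tp B & f : Hom (sp A) (sp B) & hom F (wd A) (wd B) &
   (\<forall>xi. linf (sp B) xi --> (\<forall>xs\<in>points (wd A). xi (f$(pt A xs)) = afn F (pull B xi) xs))"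

lemma rpD:
 assumes "rp A B f F"
 shows rp_tp1: "tp A" and rp_tp2: "tp B" and rp_Hom: "f : Hom (sp A) (sp B)"
  and rp_hom: "hom F (wd A) (wd B)"
  and rp_app: "linf (sp B) xi ==> xs : points (wd A) ==> xi (f$(pt A xs)) = afn F (pull B xi) xs" using assms by (auto simp: rp_def)

lemma rp_ex:
 assumes A: "tp A" and B: "tp B" and f: "f : Hom (sp A) (sp B)"
 shows "\<exists>F. rp A B f F"
proof -
 define F :: "('s, 'z, 'k) arr" where
  "F = \<lparr>adom = wd A, acod = wd B, afn = (%T. if T : forms (wd B) then pull A (%x. exf B T (f$x)) else (%_. 0))\<rparr>"
 have lin: "linf (sp A) (%x. exf B T (f$x))" if "T : forms (wd B)" for T by (rule linear_comp[OF Hom_linear[OF f] exf_linear[OF B that]])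
 have "\<exists>L. (\<forall>(c, ys)\<in>set L. ys : points (wd B)) & (\<forall>T\<in>forms (wd B). afn F T xs = comb L T)"
  if xs: "xs : points (wd A)" for xs
 proof -
  obtain L where L: "!!c ys. (c, ys) : set L ==> ys : points (wd B)"
   "!!xi. linf (sp B) xi ==> xi (f$(pt A xs)) = comb L (%ys. xi (pt B ys))" using tp_comb[OF B Hom_in[OF f tp_pt[OF A xs]]] by blast
  show ?thesis
  proof (intro exI[of _ L] conjI ballI)
   fix T assume T: "T : forms (wd B)"
   have "afn F T xs = comb L (%ys. exf B T (pt B ys))" using T xs L(2)[OF exf_linear[OF B T]] by (simp add: F_def pull_def)
   also have "... = comb L T" by (rule comb_cong) (simp add: exf_pt[OF B T] L(1))
   finally show "afn F T xs = comb L T" .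
  qed (use L(1) in blast)
 qed
 moreover have "afn F T : forms (wd A)" for T by (simp add: F_def tp_pull[OF A lin])
 moreover have "adom F = wd A" "acod F = wd B" "!!T. T ~: forms (wd B) ==> afn F T = (%_. 0)" by (simp_all add: F_def)
 ultimately have "arrow F" unfolding arrow_def by (simp only: simp_thms) blast
 moreover have "xi (f$(pt A xs)) = afn F (pull B xi) xs"
  if xi: "linf (sp B) xi" and xs: "xs : points (wd A)" for xi xs
 proof -
  have p: "pull B xi : forms (wd B)" by (rule tp_pull[OF B xi])
  have "exf B (pull B xi) (f$(pt A xs)) = xi (f$(pt A xs))" by (rule linear_pt_eqI[OF B exf_linear[OF B p] xi _ Hom_in[OF f tp_pt[OF A xs]]])
    (simp add: exf_pt[OF B p], simp add: pull_def)
  then show ?thesis using p xs by (simp add: F_def pull_def)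
 qed
 ultimately show ?thesis by (intro exI[of _ F]) (simp add: rp_def A B f hom_def, simp add: F_def)
qed

lemma rp_unique:
 assumes F: "rp A B f F" and G: "rp A B f G"
 shows "F = G"
proof (rule arrow_eqI)
 show "arrow F" "arrow G" "adom F = adom G" "acod F = acod G" using rp_hom[OF F] rp_hom[OF G] by (simp_all add: hom_def)
 fix T xs assume "T : forms (acod F)" "xs : points (adom F)"
 then have T: "T : forms (wd B)" and xs: "xs : points (wd A)" using rp_hom[OF F] by (simp_all add: hom_def)
 show "afn F T xs = afn G T xs" using rp_app[OF F exf_linear[OF rp_tp2[OF F] T] xs] rp_app[OF G exf_linear[OF rp_tp2[OF F] T] xs]
  by (simp add: pull_exf[OF rp_tp2[OF F] T])
qed

lemma rp_inj:
 assumes f: "rp A B f F" and g: "rp A B g F"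
 shows "f = g"
proof (rule Hom_eqI[OF rp_Hom[OF f] rp_Hom[OF g]])
 fix x assume x: "x : carr (sp A)"
 show "f$x = g$x"
 proof (rule functionals_separate[OF tp_vs[OF rp_tp2[OF f]] Hom_in[OF rp_Hom[OF f] x] Hom_in[OF rp_Hom[OF g] x]])
  fix xi assume xi: "linf (sp B) xi"
  show "xi (f$x) = xi (g$x)"
   by (rule linear_pt_eqI[OF rp_tp1[OF f] linear_comp[OF Hom_linear[OF rp_Hom[OF f]] xi] linear_comp[OF Hom_linear[OF rp_Hom[OF g]] xi] _ x])
    (simp add: rp_app[OF f xi] rp_app[OF g xi])
 qed
qed

lemma hom_W_eqI:
 assumes "hom F a b" "hom G a b"
 shows "F = G <-> (\<forall>p q T. W F p q T = W G p q T)" using assms chain_eqI[of F G] by (auto simp: hom_def)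

lemma rp_eq_iff:
 assumes F: "rp A B f F" and G: "rp A B g G"
 shows "f = g <-> (\<forall>p q T. W F p q T = W G p q T)" using rp_unique[OF F] rp_inj[OF F] G hom_W_eqI[OF rp_hom[OF F] rp_hom[OF G]] by blast

lemma rp_Id: "tp A ==> rp A A (Id (sp A)) (ida (wd A))" by (simp add: rp_def Id_Hom tp_vs hom_def Id_app tp_pt)
  (simp add: ida_def Idw_id tp_pull, simp add: pull_def)

lemma rp_comp:
 assumes g: "rp B C g G" and f: "rp A B f F"
 shows "rp A C (g oo f) (F >> G)"
proof -
 have "xi ((g oo f)$(pt A xs)) = afn (F >> G) (pull C xi) xs"
  if xi: "linf (sp C) xi" and xs: "xs : points (wd A)" for xi xs
 proof -
  let ?\<zeta> = "%y. xi (g$y)"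
  have \<zeta>: "linf (sp B) ?\<zeta>" by (rule linear_comp[OF Hom_linear[OF rp_Hom[OF g]] xi])
  have "pull B ?\<zeta> = afn G (pull C xi)"
  proof (rule forms_ext[OF tp_pull[OF rp_tp1[OF g] \<zeta>]])
   show "afn G (pull C xi) : forms (wd B)" using arrow_form[of G] rp_hom[OF g] by (auto simp: hom_def)
   show "pull B ?\<zeta> ys = afn G (pull C xi) ys" if "ys : points (wd B)" for ys using rp_app[OF g xi that] that by (simp add: pull_def)
  qed
  then show ?thesis using rp_app[OF f \<zeta> xs] xs by (simp add: comp_app[OF rp_Hom[OF f] tp_pt[OF rp_tp1[OF f]]] comp_def)
 qed
 moreover have "g oo f : Hom (sp A) (sp C)" by (rule comp_Hom[OF tp_vs[OF rp_tp1[OF f]] rp_Hom[OF f] rp_Hom[OF g]])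
 ultimately show ?thesis using rp_tp1[OF f] rp_tp2[OF g] hom_comp[OF rp_hom[OF f] rp_hom[OF g]] by (simp add: rp_def)
qed

definition whR :: "bool => ('s, 'z, 'k) arr => 's list => ('s, 'z, 'k) arr" where
 "whR o' F w = (if o' then wh [] F w else wh (rev w) F [])"

definition whL :: "bool => 's list => ('s, 'z, 'k) arr => ('s, 'z, 'k) arr" where
 "whL o' w F = (if o' then wh (rev w) F [] else wh [] F w)"

lemma whR_app:
 assumes "hom F w w'" "T : forms (jn o' w' v)" "a : points w" "b : points v"
 shows "afn (whR o' F v) T (jn o' a b) = afn F (%x. T (jn o' x b)) a"
proof (cases o')
 case True
 have "W F [] v T ([] @ a @ b) = afn F (%ys. T ([] @ ys @ b)) a" using assms True by (intro W_app) (auto simp: hom_def jn_def)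
 then show ?thesis using True by (simp add: whR_def wh_def jn_def)
next
 case False
 have "W F (rev v) [] T (b @ a @ []) = afn F (%ys. T (b @ ys @ [])) a" using assms False by (intro W_app) (auto simp: hom_def jn_def)
 then show ?thesis using False by (simp add: whR_def wh_def jn_def)
qed

lemma jn_Not: "jn (\<not> o') a b = jn o' b a" by (simp add: jn_def)

lemma whL_app:
 assumes "hom F w w'" "T : forms (jn o' v w')" "a : points w" "b : points v"
 shows "afn (whL o' v F) T (jn o' b a) = afn F (%x. T (jn o' b x)) a"
proof -
 have "whL o' v F = whR (\<not> o') F v" by (simp add: whL_def whR_def)
 then show ?thesis using whR_app[of F w w' T "\<not> o'" v a b] assms by (simp only: jn_Not)
qed

lemma whR_hom: "hom F w w' ==> hom (whR o' F v) (jn o' w v) (jn o' w' v)" by (auto simp: whR_def hom_def jn_def)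

lemma whL_hom: "hom F w w' ==> hom (whL o' v F) (jn o' v w) (jn o' v w')" by (auto simp: whL_def hom_def jn_def)

lemma rp_tensR:
 assumes f: "rp A A' f F" and B: "tp B"
 shows "rp (tens o' A B) (tens o' A' B) (f ** Id (sp B)) (whR o' F (wd B))"
proof -
 note A = rp_tp1[OF f] and A' = rp_tp2[OF f]
 note h = tensor_lmap_Hom[OF tp_vs[OF A] tp_vs[OF B] tp_vs[OF A'] tp_vs[OF B] rp_Hom[OF f] Id_Hom[OF tp_vs[OF B]]]
 have "xi ((f ** Id (sp B))$(pt (tens o' A B) xs)) = afn (whR o' F (wd B)) (pull (tens o' A' B) xi) xs"
  if xi: "linf (sp A' >< sp B) xi" and xs: "xs : points (wd (tens o' A B))" for xi xs
 proof -
  obtain a b where ab: "xs = jn o' a b" "a : points (wd A)" "b : points (wd B)" using points_jnD[OF xs[unfolded wd_tens]] by blast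
  have "xi ((f ** Id (sp B))$(pt (tens o' A B) xs)) = xi (pure (sp A') (sp B) (f$(pt A a)) (pt B b))"
   using ab by (simp add: pt_tens h(2) tp_pt A B Id_app)
  also have "... = afn F (pull A' (%x. xi (pure (sp A') (sp B) x (pt B b)))) a" by (rule rp_app[OF f lin_pure1[OF A' B xi tp_pt[OF B ab(3)]] ab(2)])
  also have "... = afn (whR o' F (wd B)) (pull (tens o' A' B) xi) xs"
  proof -
   have "pull (tens o' A' B) xi : forms (jn o' (wd A') (wd B))" using tp_pull[OF tp_tens[OF A' B], of o' xi] xi by (simp add: wd_tens)
   from whR_app[OF rp_hom[OF f] this ab(2,3)] show ?thesis using ab by (simp add: pull_tens[OF A' B])
  qed
  finally show ?thesis .
 qed
 then show ?thesis using tp_tens[OF A B] tp_tens[OF A' B] h(1) whR_hom[OF rp_hom[OF f]] by (simp add: rp_def wd_tens)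
qed

lemma rp_tensL:
 assumes f: "rp A A' f F" and B: "tp B"
 shows "rp (tens o' B A) (tens o' B A') (Id (sp B) ** f) (whL o' (wd B) F)"
proof -
 note A = rp_tp1[OF f] and A' = rp_tp2[OF f]
 note h = tensor_lmap_Hom[OF tp_vs[OF B] tp_vs[OF A] tp_vs[OF B] tp_vs[OF A'] Id_Hom[OF tp_vs[OF B]] rp_Hom[OF f]]
 have "xi ((Id (sp B) ** f)$(pt (tens o' B A) xs)) = afn (whL o' (wd B) F) (pull (tens o' B A') xi) xs"
  if xi: "linf (sp B >< sp A') xi" and xs: "xs : points (wd (tens o' B A))" for xi xs
 proof -
  obtain b a where ab: "xs = jn o' b a" "b : points (wd B)" "a : points (wd A)" using points_jnD[OF xs[unfolded wd_tens]] by blast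
  have "xi ((Id (sp B) ** f)$(pt (tens o' B A) xs)) = xi (pure (sp B) (sp A') (pt B b) (f$(pt A a)))"
   using ab by (simp add: pt_tens h(2) tp_pt A B Id_app)
  also have "... = afn F (pull A' (%x. xi (pure (sp B) (sp A') (pt B b) x))) a" by (rule rp_app[OF f lin_pure2[OF B A' xi tp_pt[OF B ab(2)]] ab(3)])
  also have "... = afn (whL o' (wd B) F) (pull (tens o' B A') xi) xs"
  proof -
   have "pull (tens o' B A') xi : forms (jn o' (wd B) (wd A'))" using tp_pull[OF tp_tens[OF B A'], of o' xi] xi by (simp add: wd_tens)
   from whL_app[OF rp_hom[OF f] this ab(3,2)] show ?thesis using ab by (simp add: pull_tens[OF B A'])
  qed
  finally show ?thesis .
 qed
 then show ?thesis using tp_tens[OF B A] tp_tens[OF B A'] h(1) whL_hom[OF rp_hom[OF f]] by (simp add: rp_def wd_tens)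
qed

lemma rp_tens:
 assumes f: "rp A A' f F" and g: "rp B B' g G"
 shows "rp (tens o' A B) (tens o' A' B') (f ** g) (whL o' (wd A) G >> whR o' F (wd B'))"
 unfolding tensor_lmap_split[OF tp_vs[OF rp_tp1[OF f]] tp_vs[OF rp_tp1[OF g]] tp_vs[OF rp_tp2[OF f]] tp_vs[OF rp_tp2[OF g]] rp_Hom[OF f] rp_Hom[OF g]]
 by (rule rp_comp[OF rp_tensR[OF f rp_tp2[OF g]] rp_tensL[OF g rp_tp1[OF f]]])

lemma rp_idaI:
 assumes "tp A" "tp B" "f : Hom (sp A) (sp B)" "wd A = wd B"
  and "!!xs. xs : points (wd A) ==> f$(pt A xs) = pt B xs"
 shows "rp A B f (ida (wd A))" using assms by (simp add: rp_def hom_def) (simp add: ida_def Idw_id tp_pull, simp add: pull_def)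

lemma rp_ida_Iso:
 assumes f: "rp A B f (ida w)" and g: "rp B A g (ida w)"
 shows "f : Iso (sp A) (sp B)" and "rp B A (linv f) (ida w)"
proof -
 note A = tp_vs[OF rp_tp1[OF f]]
 have w: "wd A = w" "wd B = w" using rp_hom[OF f] by (auto simp: hom_def)
 have ii: "ida w >> ida w = ida w" by (intro arr.equality) (simp_all add: comp_def ida_def Idw_Idw fun_eq_iff)
 have gf: "g oo f = Id (sp A)" by (rule rp_inj[OF rp_comp[OF g f]]) (use rp_Id[OF rp_tp1[OF f]] w in \<open>simp add: ii\<close>)
 have fg: "f oo g = Id (sp B)" by (rule rp_inj[OF rp_comp[OF f g]]) (use rp_Id[OF rp_tp2[OF f]] w in \<open>simp add: ii\<close>)
 have gf': "g$(f$x) = x" if "x : carr (sp A)" for x using arg_cong[OF gf, of "%h. h$x"] that by (simp add: comp_app[OF rp_Hom[OF f]] Id_app)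
 have fg': "f$(g$x) = x" if "x : carr (sp B)" for x using arg_cong[OF fg, of "%h. h$x"] that by (simp add: comp_app[OF rp_Hom[OF g]] Id_app)
 show i: "f : Iso (sp A) (sp B)" unfolding Iso_def using rp_Hom[OF f] gf' fg' Hom_in[OF rp_Hom[OF f]] Hom_in[OF rp_Hom[OF g]]
  by (auto intro!: bij_betw_byWitness[where f' = "app g"])
 have "linv f = g"
 proof (rule Hom_eqI[OF Iso_Hom[OF linv_Iso(1)[OF A i]] rp_Hom[OF g]])
  fix x assume x: "x : carr (sp B)"
  show "linv f$x = g$x" using linv_Iso(2)[OF A i, of "g$x"] fg'[OF x] Hom_in[OF rp_Hom[OF g] x] by simp
 qed
 then show "rp B A (linv f) (ida w)" using g by simp
qed

lemma rp_assoc: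
 assumes A: "tp A" and B: "tp B" and C: "tp C"
 shows "rp (tens o' (tens o' A B) C) (tens o' A (tens o' B C)) (assoc (sp A) (sp B) (sp C))
   (ida (jn o' (jn o' (wd A) (wd B)) (wd C)))" (is ?P)
  and "rp (tens o' A (tens o' B C)) (tens o' (tens o' A B) C) (assoc' (sp A) (sp B) (sp C))
   (ida (jn o' (jn o' (wd A) (wd B)) (wd C)))"
proof -
 let ?L = "tens o' (tens o' A B) C" and ?R = "tens o' A (tens o' B C)"
 note vs = tp_vs[OF A] tp_vs[OF B] tp_vs[OF C]
 have jn3: "jn o' (jn o' a b) c = jn o' a (jn o' b c)" for a b c :: "'x list" by (simp add: jn_def)
 have dec: "\<exists>a b c. xs = jn o' (jn o' a b) c & a : points (wd A) & b : points (wd B) & c : points (wd C)"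
  if "xs : points (jn o' (jn o' (wd A) (wd B)) (wd C))" for xs using points_jnD[OF that] points_jnD by blast
 have ptL: "pt ?L (jn o' (jn o' a b) c) = pure (sp A >< sp B) (sp C) (pure (sp A) (sp B) (pt A a) (pt B b)) (pt C c)"
  and ptR: "pt ?R (jn o' (jn o' a b) c) = pure (sp A) (sp B >< sp C) (pt A a) (pure (sp B) (sp C) (pt B b) (pt C c))"
  if "a : points (wd A)" "b : points (wd B)" "c : points (wd C)" for a b c
  using that by (simp_all add: pt_tens wd_tens points_jn, simp add: jn3 pt_tens wd_tens points_jn)
 have wd: "wd ?L = jn o' (jn o' (wd A) (wd B)) (wd C)" "wd ?R = jn o' (jn o' (wd A) (wd B)) (wd C)" by (simp_all add: wd_tens jn3)
 have 1: ?P unfolding wd(1)[symmetric]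
 proof (rule rp_idaI)
  fix xs assume "xs : points (wd ?L)"
  then obtain a b c where x: "xs = jn o' (jn o' a b) c" "a : points (wd A)" "b : points (wd B)" "c : points (wd C)" using dec unfolding wd by blast
  show "assoc (sp A) (sp B) (sp C)$(pt ?L xs) = pt ?R xs" unfolding x(1) ptL[OF x(2-4)] ptR[OF x(2-4)]
   by (rule assoc_Hom(2)[OF vs]) (simp_all add: tp_pt A B C x)
 qed (simp_all add: tp_tens A B C wd assoc_Hom(1)[OF vs])
 obtain g where g: "g : Hom (sp A >< sp B >< sp C) ((sp A >< sp B) >< sp C)"
  "!!x y z. x : carr (sp A) ==> y : carr (sp B) ==> z : carr (sp C) ==>
   g$(pure (sp A) (sp B >< sp C) x (pure (sp B) (sp C) y z)) = pure (sp A >< sp B) (sp C) (pure (sp A) (sp B) x y) z"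
  using assoc_inverse_ex[OF vs] by blast
 have 2: "rp ?R ?L g (ida (jn o' (jn o' (wd A) (wd B)) (wd C)))" unfolding wd(2)[symmetric]
 proof (rule rp_idaI)
  fix xs assume "xs : points (wd ?R)"
  then obtain a b c where x: "xs = jn o' (jn o' a b) c" "a : points (wd A)" "b : points (wd B)" "c : points (wd C)" using dec unfolding wd by blast
  show "g$(pt ?R xs) = pt ?L xs" unfolding x(1) ptL[OF x(2-4)] ptR[OF x(2-4)] by (rule g(2)) (simp_all add: tp_pt A B C x)
 qed (simp_all add: tp_tens A B C wd g(1))
 show ?P by (rule 1)
 show "rp ?R ?L (assoc' (sp A) (sp B) (sp C)) (ida (jn o' (jn o' (wd A) (wd B)) (wd C)))" by (rule rp_ida_Iso(2)[OF 1 2])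
qed

lemma rp_linv:
 assumes f: "rp A B f F" and i: "f : Iso (sp A) (sp B)"
 shows "\<exists>G. rp B A (linv f) G & hom G (wd B) (wd A) & F >> G = ida (wd A) & G >> F = ida (wd B)"
proof -
 note A = rp_tp1[OF f] and B = rp_tp2[OF f]
 note l = linv_Iso[OF tp_vs[OF A] i]
 obtain G where G: "rp B A (linv f) G" using rp_ex[OF B A Iso_Hom[OF l(1)]] by blast
 have "F >> G = ida (wd A)" by (rule rp_unique[OF rp_comp[OF G f]]) (simp add: l(4) rp_Id[OF A])
 moreover have "G >> F = ida (wd B)" by (rule rp_unique[OF rp_comp[OF f G]]) (simp add: l(5) rp_Id[OF B])
 ultimately show ?thesis using G rp_hom[OF G] by blast
qed

definition fG :: "('k, 'k, 's, 'z) frame" where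
 "fG = \<lparr>sp = ground, wd = [], pt = (%_. 1)\<rparr>"

lemma fG_simps [simp]: "sp fG = ground" "wd fG = []" "pt fG xs = 1" by (simp_all add: fG_def)

lemma ground_simps [simp]: "carr ground = UNIV" "scal ground = (*)"
 by (simp_all add: ground_def)

lemma tp_fG: "tp fG"
proof -
 have "\<exists>L. (\<forall>(c, ys)\<in>set L. ys : points []) & (\<forall>xi. linf ground xi --> xi x = comb L (%ys. xi (1::'k)))" for x :: 'k
  by (intro exI[of _ "[(x, [])]"]) (use linear_ground_simps(2)[of ground _ 1 x] in simp)
 moreover have "\<exists>xi. linf (ground :: ('k, 'k) vs) xi & xi 1 = T []" for T :: "'z list => 'k"
  by (intro exI[of _ "%c. c * T []"]) (simp add: linear_ground_iff algebra_simps)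
 moreover have "points [] = {[]}" by auto
 ultimately show ?thesis by (simp add: tp_def vspace_ground pull_def forms_def)
qed

definition pto :: "('k, 'a::ab_group_add) vs => 'a => ('k, 'k, 'a) lmap" where
 "pto X x = mk ground X (%c. scal X c x)"

lemma pto_Hom:
 assumes "vspace X" "x : carr X"
 shows "pto X x : Hom ground X" unfolding pto_def using unit_bilinear(1)[OF assms(1)] assms(2)
 by (intro mk_Hom[OF vspace_ground]) (simp add: bilinear_map_def)

lemma pto_app: "pto X x$c = scal X c x" by (simp add: pto_def mk_app)

lemma scal_one: "vspace X ==> scal X 1 x = x" by (simp add: vspace_def vector_space_def)

lemma pto_inj: "vspace X ==> pto X x = pto X y <-> x = y" by (metis pto_app scal_one)

lemma comp_pto: "f : Hom X Y ==> vspace X ==> vspace Y ==> x : carr X ==> f oo pto X x = pto Y (f$x)"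
 by (rule Hom_eqI[OF comp_Hom[OF vspace_ground pto_Hom] pto_Hom])
  (auto simp: comp_app[OF pto_Hom] pto_app Hom_scal Hom_in)

lemma rp_lunit:
 assumes A: "tp A"
 shows "rp (tens o' fG A) A (lunit (sp A)) (ida (wd A))" "rp A (tens o' fG A) (linv (lunit (sp A))) (ida (wd A))"
  "rp (tens o' A fG) A (runit (sp A)) (ida (wd A))" "rp A (tens o' A fG) (linv (runit (sp A))) (ida (wd A))"
proof -
 note vs = tp_vs[OF A]
 have jnN: "jn o' [] w = w" "jn o' w [] = w" for w :: "'x list" by (simp_all add: jn_def)
 have w: "wd (tens o' fG A) = wd A" "wd (tens o' A fG) = wd A" by (simp_all add: wd_tens jnN)
 have p: "pt (tens o' fG A) xs = pure ground (sp A) 1 (pt A xs)" "pt (tens o' A fG) xs = pure (sp A) ground (pt A xs) 1"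
  if "xs : points (wd A)" for xs using pt_tens[of "[]" fG xs A o'] pt_tens[of xs A "[]" fG o'] that by (simp_all add: jnN)
 have l: "rp (tens o' fG A) A (lunit (sp A)) (ida (wd (tens o' fG A)))"
  by (rule rp_idaI) (simp_all add: tp_tens A tp_fG lunit_Hom vs w p lunit_pure tp_pt scal_one)
 have r: "rp (tens o' A fG) A (runit (sp A)) (ida (wd (tens o' A fG)))"
  by (rule rp_idaI) (simp_all add: tp_tens A tp_fG runit_Hom vs w p runit_pure tp_pt scal_one)
 have li: "rp A (tens o' fG A) (mk (sp A) (ground >< sp A) (pure ground (sp A) 1)) (ida (wd A))"
  by (rule rp_idaI) (simp_all add: tp_tens A tp_fG mk_Hom[OF vs pure_linear2[OF vspace_ground vs]] w p mk_app tp_pt)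
 have ri: "rp A (tens o' A fG) (mk (sp A) (sp A >< ground) (%x. pure (sp A) ground x 1)) (ida (wd A))"
  by (rule rp_idaI) (simp_all add: tp_tens A tp_fG mk_Hom[OF vs pure_linear1[OF vs vspace_ground]] w p mk_app tp_pt)
 show 1: "rp (tens o' fG A) A (lunit (sp A)) (ida (wd A))" using l by (simp add: w)
 show "rp A (tens o' fG A) (linv (lunit (sp A))) (ida (wd A))" by (rule rp_ida_Iso(2)[OF 1 li])
 show 2: "rp (tens o' A fG) A (runit (sp A)) (ida (wd A))" using r by (simp add: w)
 show "rp A (tens o' A fG) (linv (runit (sp A))) (ida (wd A))" by (rule rp_ida_Iso(2)[OF 2 ri])
qed

lemma insert_left_iff:
 assumes U: "vspace X" "u : carr X" and Y: "vspace Y" and Z: "vspace Z" and k: "k : Hom (X >< Y) Z" and g: "g : Hom Y Z"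
 shows "(\<forall>y\<in>carr Y. k$(pure X Y u y) = g$y) <-> k oo (pto X u ** Id Y) = g oo lunit Y" (is "?l <-> ?r")
proof -
 note t = tensor_lmap_Hom[OF vspace_ground Y U(1) Y pto_Hom[OF U] Id_Hom[OF Y]]
 have L: "(k oo (pto X u ** Id Y))$(pure ground Y c y) = scal Z c (k$(pure X Y u y))" if y: "y : carr Y" for c y
 proof -
  have "pure X Y (scal X c u) y = scal (X >< Y) c (pure X Y u y)" using pure_linear1[OF U(1) Y y] U(2) by (simp add: linear_map_def)
  then show ?thesis using y by (simp add: comp_app[OF t(1)] pT t(2) pto_app Id_app Hom_scal[OF k] U)
 qed
 have R: "(g oo lunit Y)$(pure ground Y c y) = scal Z c (g$y)" if y: "y : carr Y" for c y
  using y by (simp add: comp_app[OF lunit_Hom[OF Y]] pT lunit_pure[OF Y] Hom_scal[OF g])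
 show ?thesis
 proof
  assume ?l
  then show ?r by (intro tensor_Hom_eqI[OF vspace_ground Y comp_Hom[OF vT t(1) k] comp_Hom[OF vT lunit_Hom[OF Y] g]])
    (simp add: L R)
 next
  assume r: ?r
  show ?l
  proof
   fix y assume "y : carr Y"
   then show "k$(pure X Y u y) = g$y" using L[of y 1] R[of y 1] r by (simp add: scal_one[OF Z])
  qed
 qed
qed

lemma insert_right_iff:
 assumes U: "vspace X" "u : carr X" and Y: "vspace Y" and Z: "vspace Z" and k: "k : Hom (Y >< X) Z" and g: "g : Hom Y Z"
 shows "(\<forall>y\<in>carr Y. k$(pure Y X y u) = g$y) <-> k oo (Id Y ** pto X u) = g oo runit Y" (is "?l <-> ?r")
proof -
 note t = tensor_lmap_Hom[OF Y vspace_ground Y U(1) Id_Hom[OF Y] pto_Hom[OF U]]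
 have L: "(k oo (Id Y ** pto X u))$(pure Y ground y c) = scal Z c (k$(pure Y X y u))" if y: "y : carr Y" for c y
 proof -
  have "pure Y X y (scal X c u) = scal (Y >< X) c (pure Y X y u)" using pure_linear2[OF Y U(1) y] U(2) by (simp add: linear_map_def)
  then show ?thesis using y by (simp add: comp_app[OF t(1)] pT t(2) pto_app Id_app Hom_scal[OF k] U)
 qed
 have R: "(g oo runit Y)$(pure Y ground y c) = scal Z c (g$y)" if y: "y : carr Y" for c y
  using y by (simp add: comp_app[OF runit_Hom[OF Y]] pT runit_pure[OF Y] Hom_scal[OF g])
 show ?thesis
 proof
  assume ?l
  then show ?r by (intro tensor_Hom_eqI[OF Y vspace_ground comp_Hom[OF vT t(1) k] comp_Hom[OF vT runit_Hom[OF Y] g]])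
    (simp add: L R)
 next
  assume r: ?r
  show ?l
  proof
   fix y assume "y : carr Y"
   then show "k$(pure Y X y u) = g$y" using L[of y 1] R[of y 1] r by (simp add: scal_one[OF Z])
  qed
 qed
qed

end

section \<open>The axioms as equations of arrows\<close>

context tensor_words begin

definition tpx :: "('k, 'a::ab_group_add, 's, 'z) frame => ('k, 'a) vs => bool" where
 "tpx A X <-> tp A & sp A = X"

lemma tpx_tens: "tpx A X ==> tpx B Y ==> tpx (tens o' A B) (X >< Y)" by (auto simp: tpx_def tp_tens)

lemma tpx_fG: "tpx fG ground" by (simp add: tpx_def tp_fG)

lemma rpx:
 shows rpx_Id: "tpx A X ==> rp A A (Id X) (ida (wd A))"
  and rpx_tensR: "rp A A' f F ==> tpx B Y ==> rp (tens o' A B) (tens o' A' B) (f ** Id Y) (whR o' F (wd B))"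
  and rpx_tensL: "rp A A' f F ==> tpx B Y ==> rp (tens o' B A) (tens o' B A') (Id Y ** f) (whL o' (wd B) F)"
  and rpx_assoc: "tpx A X ==> tpx B Y ==> tpx C Z ==> rp (tens o' (tens o' A B) C) (tens o' A (tens o' B C))
    (assoc X Y Z) (ida (jn o' (jn o' (wd A) (wd B)) (wd C)))"
  and rpx_assoc': "tpx A X ==> tpx B Y ==> tpx C Z ==> rp (tens o' A (tens o' B C)) (tens o' (tens o' A B) C)
    (assoc' X Y Z) (ida (jn o' (jn o' (wd A) (wd B)) (wd C)))"
  and rpx_lunit: "tpx A X ==> rp (tens o' fG A) A (lunit X) (ida (wd A))"
  and rpx_lunit': "tpx A X ==> rp A (tens o' fG A) (linv (lunit X)) (ida (wd A))"
  and rpx_runit: "tpx A X ==> rp (tens o' A fG) A (runit X) (ida (wd A))"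
  and rpx_runit': "tpx A X ==> rp A (tens o' A fG) (linv (runit X)) (ida (wd A))" by (auto simp: tpx_def rp_Id rp_tensR rp_tensL rp_assoc rp_lunit)

lemma rp_eqI: "rp A B f F ==> rp A B g G ==> (\<forall>p q T. W F p q T = W G p q T) = R ==> (f = g) = R" using rp_eq_iff by blast

lemmas rulesT = rp_comp rpx_tensR[where o' = True] rpx_tensL[where o' = True] rp_tens[where o' = True]
 rpx_assoc[where o' = True] rpx_assoc'[where o' = True] rpx_lunit[where o' = True] rpx_lunit'[where o' = True]
 rpx_runit[where o' = True] rpx_runit'[where o' = True] rpx_Id tpx_tens[where o' = True] tpx_fG

lemmas rulesF = rp_comp rpx_tensR[where o' = False] rpx_tensL[where o' = False] rp_tens[where o' = False]
 rpx_assoc[where o' = False] rpx_assoc'[where o' = False] rpx_lunit[where o' = False] rpx_lunit'[where o' = False]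
 rpx_runit[where o' = False] rpx_runit'[where o' = False] rpx_Id tpx_tens[where o' = False] tpx_fG

lemmas rp_hom' = rp_hom[unfolded hom_def]

lemmas tr_simps = chain whR_def whL_def jn_def wd_tens

end

locale trans = tensor_words S for S :: "'s => ('k::field, 'z::ab_group_add) vs" +
 fixes H :: "('k, 'h::ab_group_add) vs" and V :: "('k, 'v::ab_group_add) vs"
  and hf :: "('k, 'h, 's, 'z) frame" and vf :: "('k, 'v, 's, 'z) frame" and y v :: 's
 assumes frames: "tpx hf H" "tpx vf V" and words: "wd hf = [y]" "wd vf = [v]"
begin

lemmas [simp] = words

lemma sps: "sp (tens o' A B) = sp A >< sp B" "sp hf = H" "sp vf = V" "sp fG = ground" using frames by (simp_all add: sp_tens tpx_def)

lemma vspaces: "vspace H" "vspace V" using frames by (auto simp: tpx_def tp_vs)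

abbreviation "lT A B == tens True A B"
abbreviation "lF A B == tens False A B"

text \<open>A tensor in the product with the ground field is a pure tensor, so the unit maps are invertible.\<close>

lemma unit_isos:
 assumes X: "vspace X"
 shows runit_Iso: "runit X : Iso (X >< ground) X" and lunit_Iso: "lunit X : Iso (ground >< X) X"
proof -
 have r: "pure X ground (runit X$t) 1 = t" if "t : carr (X >< ground)" for t
 proof -
  have l: "linear_map (X >< ground) (X >< ground) (%t. pure X ground (runit X$t) 1)"
   by (rule linear_comp[OF Hom_linear[OF runit_Hom[OF X]] pure_linear1[OF X vspace_ground]]) simp
  have i: "linear_map (X >< ground) (X >< ground) (%t. t)" by (simp add: linear_map_def)
  show ?thesis
  proof (rule tensor_linear_eqI[OF X vspace_ground l i _ that])
   fix x c assume x: "x : carr X"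
   have "pure X ground (scal X c x) 1 = scal (X >< ground) c (pure X ground x 1)"
    using pure_linear1[OF X vspace_ground, of 1] x by (simp add: linear_map_def)
   also have "... = pure X ground x (scal ground c 1)"
    using pure_linear2[OF X vspace_ground x] unfolding linear_map_def by (metis UNIV_I ground_simps(1))
   finally show "pure X ground (runit X$(pure X ground x c)) 1 = pure X ground x c" by (simp add: runit_pure[OF X x])
  qed
 qed
 have r1: "runit X$(pure X ground x 1) = x" if "x : carr X" for x using that X by (simp add: runit_pure scal_one)
 show "runit X : Iso (X >< ground) X" unfolding Iso_def using runit_Hom[OF X] r r1 Hom_in[OF runit_Hom[OF X]]
  by (auto intro!: bij_betw_byWitness[where f' = "%x. pure X ground x 1"] pT)
 have l: "pure ground X 1 (lunit X$t) = t" if "t : carr (ground >< X)" for t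
 proof -
  have l: "linear_map (ground >< X) (ground >< X) (%t. pure ground X 1 (lunit X$t))"
   by (rule linear_comp[OF Hom_linear[OF lunit_Hom[OF X]] pure_linear2[OF vspace_ground X]]) simp
  have i: "linear_map (ground >< X) (ground >< X) (%t. t)" by (simp add: linear_map_def)
  show ?thesis
  proof (rule tensor_linear_eqI[OF vspace_ground X l i _ that])
   fix c x assume x: "x : carr X"
   have "pure ground X 1 (scal X c x) = scal (ground >< X) c (pure ground X 1 x)"
    using pure_linear2[OF vspace_ground X, of 1] x by (simp add: linear_map_def)
   also have "... = pure ground X (scal ground c 1) x"
    using pure_linear1[OF vspace_ground X x] unfolding linear_map_def by (metis UNIV_I ground_simps(1))
   finally show "pure ground X 1 (lunit X$(pure ground X c x)) = pure ground X c x" by (simp add: lunit_pure[OF X x])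
  qed
 qed
 have l1: "lunit X$(pure ground X 1 x) = x" if "x : carr X" for x using that X by (simp add: lunit_pure scal_one)
 show "lunit X : Iso (ground >< X) X" unfolding Iso_def using lunit_Hom[OF X] l l1 Hom_in[OF lunit_Hom[OF X]]
  by (auto intro!: bij_betw_byWitness[where f' = "%x. pure ground X 1 x"] pT)
qed

lemma unit_inverse:
 assumes X: "vspace X" and x: "x : carr X"
 shows "linv (runit X)$x = pure X ground x 1" "linv (lunit X)$x = pure ground X 1 x" using linv_Iso(2)[OF vT runit_Iso[OF X], of "pure X ground x 1"]
  linv_Iso(2)[OF vT lunit_Iso[OF X], of "pure ground X 1 x"] x by (simp_all add: pT runit_pure lunit_pure X scal_one)

lemma insR:
 assumes X: "vspace X" and u: "u : carr X" and Y: "vspace Y"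
 shows insR_Hom: "(Id Y ** pto X u) oo linv (runit Y) : Hom Y (Y >< X)"
  and insR_app: "w : carr Y ==> ((Id Y ** pto X u) oo linv (runit Y))$w = pure Y X w u"
proof -
 note l = Iso_Hom[OF linv_Iso(1)[OF vT runit_Iso[OF Y]]]
 note t = tensor_lmap_Hom[OF Y vspace_ground Y X Id_Hom[OF Y] pto_Hom[OF X u]]
 show "(Id Y ** pto X u) oo linv (runit Y) : Hom Y (Y >< X)" by (rule comp_Hom[OF Y l t(1)])
 show "w : carr Y ==> ((Id Y ** pto X u) oo linv (runit Y))$w = pure Y X w u"
  by (simp add: comp_app[OF l] unit_inverse[OF Y] t(2) pto_app Id_app scal_one[OF X])
qed

lemma insL:
 assumes X: "vspace X" and u: "u : carr X" and Y: "vspace Y"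
 shows insL_Hom: "(pto X u ** Id Y) oo linv (lunit Y) : Hom Y (X >< Y)"
  and insL_app: "w : carr Y ==> ((pto X u ** Id Y) oo linv (lunit Y))$w = pure X Y u w"
proof -
 note l = Iso_Hom[OF linv_Iso(1)[OF vT lunit_Iso[OF Y]]]
 note t = tensor_lmap_Hom[OF vspace_ground Y X Y pto_Hom[OF X u] Id_Hom[OF Y]]
 show "(pto X u ** Id Y) oo linv (lunit Y) : Hom Y (X >< Y)" by (rule comp_Hom[OF Y l t(1)])
 show "w : carr Y ==> ((pto X u ** Id Y) oo linv (lunit Y))$w = pure X Y u w"
  by (simp add: comp_app[OF l] unit_inverse[OF Y] t(2) pto_app Id_app scal_one[OF X])
qed

text \<open>In what follows the suffix T belongs to words read forwards, for a left H-braided V, and F to words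
read backwards, for a right H-braided V. The right-hand sides of both agree.\<close>

lemma braid_T:
 assumes r: "rp (lT hf hf) (lT hf hf) Ps s" "rp (lT hf vf) (lT vf hf) ph a"
 shows "crossL H H V ph ph oo (Ps ** Id V) = (Id V ** Ps) oo crossL H H V ph ph <->
  (\<forall>p q T. braid_slides s v a y p q T)" unfolding crossL_def by (rule rp_eqI, (rule r frames rulesT)+, simp add: tr_simps r[THEN rp_hom'])

lemma braid_F:
 assumes r: "rp (lF hf hf) (lF hf hf) Ps s" "rp (lF vf hf) (lF hf vf) ph a"
 shows "crossR V H H ph ph oo (Id V ** Ps) = (Ps ** Id V) oo crossR V H H ph ph <->
  (\<forall>p q T. braid_slides s v a y p q T)" unfolding crossR_def by (rule rp_eqI, (rule r frames rulesF)+, simp add: tr_simps r[THEN rp_hom'])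

lemma mult_T:
 assumes r: "rp (lT hf hf) hf m mu" "rp (lT hf vf) (lT vf hf) ph a"
 shows "ph oo (m ** Id V) = (Id V ** m) oo crossL H H V ph ph <->
  (\<forall>p q T. mult_slides mu v a y p q T)" unfolding crossL_def by (rule rp_eqI, (rule r frames rulesT)+, simp add: tr_simps r[THEN rp_hom'])

lemma mult_F:
 assumes r: "rp (lF hf hf) hf m mu" "rp (lF vf hf) (lF hf vf) ph a"
 shows "ph oo (Id V ** m) = (m ** Id V) oo crossR V H H ph ph <->
  (\<forall>p q T. mult_slides mu v a y p q T)" unfolding crossR_def by (rule rp_eqI, (rule r frames rulesF)+, simp add: tr_simps r[THEN rp_hom'])

lemma multV_T:
 assumes r: "rp (lT vf vf) vf mV n" "rp (lT hf vf) (lT vf hf) ph a"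
 shows "ph oo (Id H ** mV) = (mV ** Id H) oo crossR H V V ph ph <->
  (\<forall>p q T. multV_slides n y a v p q T)" unfolding crossR_def by (rule rp_eqI, (rule r frames rulesT)+, simp add: tr_simps r[THEN rp_hom'])

lemma multV_F:
 assumes r: "rp (lF vf vf) vf mV n" "rp (lF vf hf) (lF hf vf) ph a"
 shows "ph oo (mV ** Id H) = (Id H ** mV) oo crossL V V H ph ph <->
  (\<forall>p q T. multV_slides n y a v p q T)" unfolding crossL_def by (rule rp_eqI, (rule r frames rulesF)+, simp add: tr_simps r[THEN rp_hom'])

lemma comult_T:
 assumes r: "rp hf (lT hf hf) De d" "rp (lT hf vf) (lT vf hf) ph a"
 shows "(Id V ** De) oo ph = crossL H H V ph ph oo (De ** Id V) <->
  (\<forall>p q T. comult_slides a d v y p q T)" unfolding crossL_def by (rule rp_eqI, (rule r frames rulesT)+, simp add: tr_simps r[THEN rp_hom'])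

lemma comult_F:
 assumes r: "rp hf (lF hf hf) De d" "rp (lF vf hf) (lF hf vf) ph a"
 shows "(De ** Id V) oo ph = crossR V H H ph ph oo (Id V ** De) <->
  (\<forall>p q T. comult_slides a d v y p q T)" unfolding crossR_def by (rule rp_eqI, (rule r frames rulesF)+, simp add: tr_simps r[THEN rp_hom'])

lemma counit_T:
 assumes r: "rp hf fG ep c" "rp (lT hf vf) (lT vf hf) ph a"
 shows "runit V oo (Id V ** ep) oo ph = lunit V oo (ep ** Id V) <->
  (\<forall>p q T. counit_slides a c v p q T)" by (rule rp_eqI, (rule r frames rulesT)+, simp add: tr_simps r[THEN rp_hom'])

lemma counit_F:
 assumes r: "rp hf fG ep c" "rp (lF vf hf) (lF hf vf) ph a"
 shows "lunit V oo (ep ** Id V) oo ph = runit V oo (Id V ** ep) <->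
  (\<forall>p q T. counit_slides a c v p q T)" by (rule rp_eqI, (rule r frames rulesF)+, simp add: tr_simps r[THEN rp_hom'])

lemma coassoc_T:
 assumes r: "rp hf (lT hf hf) De d" "rp vf (lT vf hf) rh r"
 shows "assoc V H H oo (rh ** Id H) oo rh = (Id V ** De) oo rh <->
  (\<forall>p q T. coact_coassoc r y d v p q T)" by (rule rp_eqI, (rule r frames rulesT)+, simp add: tr_simps r[THEN rp_hom'])

lemma coassoc_F:
 assumes r: "rp hf (lF hf hf) De d" "rp vf (lF hf vf) rh r"
 shows "(Id H ** rh) oo rh = assoc H H V oo (De ** Id V) oo rh <->
  (\<forall>p q T. coact_coassoc r y d v p q T)" by (rule rp_eqI, (rule r frames rulesF)+, simp add: tr_simps r[THEN rp_hom'])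

lemma coact_counit_T:
 assumes r: "rp hf fG ep c" "rp vf (lT vf hf) rh r"
 shows "runit V oo (Id V ** ep) oo rh = Id V <->
  (\<forall>p q T. coact_counital r c v p q T)" by (rule rp_eqI, (rule r frames rulesT)+, simp add: tr_simps r[THEN rp_hom'])

lemma coact_counit_F:
 assumes r: "rp hf fG ep c" "rp vf (lF hf vf) rh r"
 shows "lunit V oo (ep ** Id V) oo rh = Id V <->
  (\<forall>p q T. coact_counital r c v p q T)" by (rule rp_eqI, (rule r frames rulesF)+, simp add: tr_simps r[THEN rp_hom'])

lemma coact_braid_T:
 assumes r: "rp (lT hf hf) (lT hf hf) Ps s" "rp (lT hf vf) (lT vf hf) ph a" "rp vf (lT vf hf) rh r"
 shows "(rh ** Id H) oo ph = crossR H V H ph Ps oo (Id H ** rh) <->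
  (\<forall>p q T. coact_braids a r y s v p q T)" unfolding crossR_def by (rule rp_eqI, (rule r frames rulesT)+, simp add: tr_simps r[THEN rp_hom'])

lemma coact_braid_F:
 assumes r: "rp (lF hf hf) (lF hf hf) Ps s" "rp (lF vf hf) (lF hf vf) ph a" "rp vf (lF hf vf) rh r"
 shows "(Id H ** rh) oo ph = crossL H V H Ps ph oo (rh ** Id H) <->
  (\<forall>p q T. coact_braids a r y s v p q T)" unfolding crossL_def by (rule rp_eqI, (rule r frames rulesF)+, simp add: tr_simps r[THEN rp_hom'])

lemma act_assoc_T:
 assumes r: "rp (lT hf hf) hf m mu" "rp (lT hf vf) vf nv nu"
 shows "nv oo (Id H ** nv) oo assoc H H V = nv oo (m ** Id V) <->
  (\<forall>p q T. act_assoc nu y mu v p q T)" by (rule rp_eqI, (rule r frames rulesT)+, simp add: tr_simps r[THEN rp_hom'])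

lemma act_assoc_F:
 assumes r: "rp (lF hf hf) hf m mu" "rp (lF vf hf) vf nv nu"
 shows "nv oo (nv ** Id H) = nv oo (Id V ** m) oo assoc V H H <->
  (\<forall>p q T. act_assoc nu y mu v p q T)" by (rule rp_eqI, (rule r frames rulesF)+, simp add: tr_simps r[THEN rp_hom'])

lemma act_braid_T:
 assumes r: "rp (lT hf hf) (lT hf hf) Ps s" "rp (lT hf vf) (lT vf hf) ph a" "rp (lT hf vf) vf nv nu"
 shows "ph oo (Id H ** nv) = (nv ** Id H) oo crossR H H V Ps ph <->
  (\<forall>p q T. act_braids nu y a s v p q T)" unfolding crossR_def by (rule rp_eqI, (rule r frames rulesT)+, simp add: tr_simps r[THEN rp_hom'])

lemma act_braid_F:
 assumes r: "rp (lF hf hf) (lF hf hf) Ps s" "rp (lF vf hf) (lF hf vf) ph a" "rp (lF vf hf) vf nv nu"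
 shows "ph oo (nv ** Id H) = (Id H ** nv) oo crossL V H H ph Ps <->
  (\<forall>p q T. act_braids nu y a s v p q T)" unfolding crossL_def by (rule rp_eqI, (rule r frames rulesF)+, simp add: tr_simps r[THEN rp_hom'])

lemma coact_mult_T:
 assumes r: "rp (lT hf hf) hf m mu" "rp (lT hf vf) (lT vf hf) ph a" "rp (lT vf vf) vf mV n" "rp vf (lT vf hf) rh r"
 shows "rh oo mV = (mV ** m) oo mid V H V H ph oo (rh ** rh) <->
  (\<forall>p q T. coact_multiplicative n r v y a mu p q T)"
 unfolding mid_def by (rule rp_eqI, (rule r frames rulesT)+, simp add: tr_simps slide r[THEN rp_hom'])

lemma coact_mult_F:
 assumes r: "rp (lF hf hf) hf m mu" "rp (lF vf hf) (lF hf vf) ph a" "rp (lF vf vf) vf mV n" "rp vf (lF hf vf) rh r"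
 shows "rh oo mV = (m ** mV) oo mid H V H V ph oo (rh ** rh) <->
  (\<forall>p q T. coact_multiplicative n r v y a mu p q T)"
 unfolding mid_def by (rule rp_eqI, (rule r frames rulesF)+, simp add: tr_simps slide r[THEN rp_hom'])

lemma act_mult_T:
 assumes r: "rp hf (lT hf hf) De d" "rp (lT hf vf) (lT vf hf) ph a" "rp (lT vf vf) vf mV n" "rp (lT hf vf) vf nv nu"
 shows "nv oo (Id H ** mV) = mV oo (nv ** nv) oo mid H H V V ph oo (De ** Id (V >< V)) <->
  (\<forall>p q T. act_multiplicative n y nu d v a p q T)"
 unfolding mid_def by (rule rp_eqI, (rule r frames rulesT)+, simp add: tr_simps slide r[THEN rp_hom'])

lemma act_mult_F:
 assumes r: "rp hf (lF hf hf) De d" "rp (lF vf hf) (lF hf vf) ph a" "rp (lF vf vf) vf mV n" "rp (lF vf hf) vf nv nu"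
 shows "nv oo (mV ** Id H) = mV oo (nv ** nv) oo mid V V H H ph oo (Id (V >< V) ** De) <->
  (\<forall>p q T. act_multiplicative n y nu d v a p q T)"
 unfolding mid_def by (rule rp_eqI, (rule r frames rulesF)+, simp add: tr_simps slide r[THEN rp_hom'])

lemma slide_left_iff:
 assumes u: "u : carr X" and X: "vspace X" and Y: "vspace Y" and k: "k : Hom (X >< Y) (Y >< X)"
 shows "(\<forall>w\<in>carr Y. k$(pure X Y u w) = pure Y X w u) <->
  k oo (pto X u ** Id Y) = ((Id Y ** pto X u) oo linv (runit Y)) oo lunit Y"
 by (subst insert_left_iff[symmetric, OF X u Y vT k insR_Hom[OF X u Y]]) (simp add: insR_app X Y u)

lemma slide_right_iff:
 assumes u: "u : carr X" and X: "vspace X" and Y: "vspace Y" and k: "k : Hom (Y >< X) (X >< Y)"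
 shows "(\<forall>w\<in>carr Y. k$(pure Y X w u) = pure X Y u w) <->
  k oo (Id Y ** pto X u) = ((pto X u ** Id Y) oo linv (lunit Y)) oo runit Y"
 by (subst insert_right_iff[symmetric, OF X u Y vT k insL_Hom[OF X u Y]]) (simp add: insL_app X Y u)

lemma unit_T:
 assumes u: "u : carr H" and r: "rp fG hf (pto H u) un" "rp (lT hf vf) (lT vf hf) ph a"
 shows "(\<forall>w\<in>carr V. ph$(pure H V u w) = (pure V H w u)) <->
  (\<forall>p q T. unit_slides un v a p q T)" unfolding slide_left_iff[OF u vspaces rp_Hom[OF r(2), unfolded sps]]
 by (rule rp_eqI, (rule r frames rulesT)+, simp add: tr_simps slide r[THEN rp_hom'])

lemma unitV_T:
 assumes e: "e : carr V" and r: "rp fG vf (pto V e) j" "rp (lT hf vf) (lT vf hf) ph a"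
 shows "(\<forall>w\<in>carr H. ph$(pure H V w e) = (pure V H e w)) <->
  (\<forall>p q T. unitV_slides j y a p q T)" unfolding slide_right_iff[OF e vspaces(2,1) rp_Hom[OF r(2), unfolded sps]]
 by (rule rp_eqI, (rule r frames rulesT)+, simp add: tr_simps slide r[THEN rp_hom'])

lemma act_unit_T:
 assumes u: "u : carr H" and r: "rp fG hf (pto H u) un" "rp (lT hf vf) vf nv nu"
 shows "(\<forall>w\<in>carr V. nv$(pure H V u w) = w) <->
  (\<forall>p q T. act_unital un v nu p q T)" (is "?L = ?R")
proof -
 have "?L <-> (\<forall>w\<in>carr V. nv$(pure H V u w) = Id V$w)" by (simp add: Id_app)
 also have "... <-> ?R" unfolding insert_left_iff[OF vspaces(1) u vspaces(2,2) rp_Hom[OF r(2), unfolded sps] Id_Hom[OF vspaces(2)]]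
  by (rule rp_eqI, (rule r frames rulesT)+, simp add: tr_simps slide r[THEN rp_hom'])
 finally show ?thesis .
qed

lemma act_unitV_T:
 assumes e: "e : carr V" and r: "rp fG vf (pto V e) j" "rp (lT hf vf) vf nv nu" "rp hf fG ep c"
 shows "(\<forall>w\<in>carr H. nv$(pure H V w e) = scal V (ep$w) e) <->
  (\<forall>p q T. W j (y#p) q (W nu p q T) = W c p q (W j p q T))" (is "?L = ?R")
proof -
 note c = rp_Hom[OF r(3), unfolded sps]
 have "?L <-> (\<forall>w\<in>carr H. nv$(pure H V w e) = (pto V e oo ep)$w)" by (simp add: comp_app[OF c] pto_app)
 also have "... <-> ?R"
  unfolding insert_right_iff[OF vspaces(2) e vspaces rp_Hom[OF r(2), unfolded sps] comp_Hom[OF vspaces(1) c pto_Hom[OF vspaces(2) e]]]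
  by (rule rp_eqI, (rule r frames rulesT)+, simp add: tr_simps slide r[THEN rp_hom'])
 finally show ?thesis .
qed

lemma coact_unit_T:
 assumes u: "u : carr H" and e: "e : carr V" and r: "rp fG hf (pto H u) un" "rp fG vf (pto V e) j" "rp vf (lT vf hf) rh r"
 shows "rh$e = (pure V H e u) <->
  (\<forall>p q T. W j p q (W r p q T) = W j p q (W un (v#p) q T))" (is "?L = ?R")
proof -
 note g = insL_Hom[OF vspaces(2) e vspaces(1)]
 have "?L <-> rh oo pto V e = ((pto V e ** Id H) oo linv (lunit H)) oo pto H u"
  unfolding comp_pto[OF rp_Hom[OF r(3), unfolded sps] vspaces(2) vT e] comp_pto[OF g vspaces(1) vT u]
   pto_inj[OF vT] by (simp add: insL_app vspaces e u)
 also have "... <-> ?R" by (rule rp_eqI, (rule r frames rulesT)+, simp add: tr_simps slide r[THEN rp_hom'])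
 finally show ?thesis .
qed

lemma unit_F:
 assumes u: "u : carr H" and r: "rp fG hf (pto H u) un" "rp (lF vf hf) (lF hf vf) ph a"
 shows "(\<forall>w\<in>carr V. ph$(pure V H w u) = (pure H V u w)) <->
  (\<forall>p q T. unit_slides un v a p q T)" unfolding slide_right_iff[OF u vspaces rp_Hom[OF r(2), unfolded sps]]
 by (rule rp_eqI, (rule r frames rulesF)+, simp add: tr_simps slide r[THEN rp_hom'])

lemma unitV_F:
 assumes e: "e : carr V" and r: "rp fG vf (pto V e) j" "rp (lF vf hf) (lF hf vf) ph a"
 shows "(\<forall>w\<in>carr H. ph$(pure V H e w) = (pure H V w e)) <->
  (\<forall>p q T. unitV_slides j y a p q T)" unfolding slide_left_iff[OF e vspaces(2,1) rp_Hom[OF r(2), unfolded sps]]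
 by (rule rp_eqI, (rule r frames rulesF)+, simp add: tr_simps slide r[THEN rp_hom'])

lemma act_unit_F:
 assumes u: "u : carr H" and r: "rp fG hf (pto H u) un" "rp (lF vf hf) vf nv nu"
 shows "(\<forall>w\<in>carr V. nv$(pure V H w u) = w) <->
  (\<forall>p q T. act_unital un v nu p q T)" (is "?L = ?R")
proof -
 have "?L <-> (\<forall>w\<in>carr V. nv$(pure V H w u) = Id V$w)" by (simp add: Id_app)
 also have "... <-> ?R" unfolding insert_right_iff[OF vspaces(1) u vspaces(2,2) rp_Hom[OF r(2), unfolded sps] Id_Hom[OF vspaces(2)]]
  by (rule rp_eqI, (rule r frames rulesF)+, simp add: tr_simps slide r[THEN rp_hom'])
 finally show ?thesis .
qed

lemma act_unitV_F:
 assumes e: "e : carr V" and r: "rp fG vf (pto V e) j" "rp (lF vf hf) vf nv nu" "rp hf fG ep c"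
 shows "(\<forall>w\<in>carr H. nv$(pure V H e w) = scal V (ep$w) e) <->
  (\<forall>p q T. W j (y#p) q (W nu p q T) = W c p q (W j p q T))" (is "?L = ?R")
proof -
 note c = rp_Hom[OF r(3), unfolded sps]
 have "?L <-> (\<forall>w\<in>carr H. nv$(pure V H e w) = (pto V e oo ep)$w)" by (simp add: comp_app[OF c] pto_app)
 also have "... <-> ?R"
  unfolding insert_left_iff[OF vspaces(2) e vspaces rp_Hom[OF r(2), unfolded sps] comp_Hom[OF vspaces(1) c pto_Hom[OF vspaces(2) e]]]
  by (rule rp_eqI, (rule r frames rulesF)+, simp add: tr_simps slide r[THEN rp_hom'])
 finally show ?thesis .
qed

lemma coact_unit_F:
 assumes u: "u : carr H" and e: "e : carr V" and r: "rp fG hf (pto H u) un" "rp fG vf (pto V e) j" "rp vf (lF hf vf) rh r"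
 shows "rh$e = (pure H V u e) <->
  (\<forall>p q T. W j p q (W r p q T) = W j p q (W un (v#p) q T))" (is "?L = ?R")
proof -
 note g = insR_Hom[OF vspaces(2) e vspaces(1)]
 have "?L <-> rh oo pto V e = ((Id H ** pto V e) oo linv (runit H)) oo pto H u"
  unfolding comp_pto[OF rp_Hom[OF r(3), unfolded sps] vspaces(2) vT e] comp_pto[OF g vspaces(1) vT u]
   pto_inj[OF vT] by (simp add: insR_app vspaces e u)
 also have "... <-> ?R" by (rule rp_eqI, (rule r frames rulesF)+, simp add: tr_simps slide r[THEN rp_hom'])
 finally show ?thesis .
qed

end

section \<open>Twisting by the braiding\<close>

locale braid_words = tensor_words S for S :: "'s => ('k::field, 'z::ab_group_add) vs" +
 fixes y :: 's and s si :: "('s, 'z, 'k) arr"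
 assumes s_homs: "hom s [y, y] [y, y]" "hom si [y, y] [y, y]"
  and s_inv: "s >> si = ida [y, y]" "si >> s = ida [y, y]"
  and s_braid: "!!p q T. W s p (y#q) (W s (y#p) q (W s p (y#q) T)) = W s (y#p) q (W s p (y#q) (W s (y#p) q T))"
begin

lemmas [simp] = s_homs[unfolded hom_def]

lemma s_cancel [simp]:
 "W s p q (W si p q T) = Idw (rev p @ y#y#q) T"
 "W si p q (W s p q T) = Idw (rev p @ y#y#q) T" using s_inv[THEN chain_cong, of p q T] by (simp_all add: chain)

lemma s_braid1: "W s p (y#q) (W s (y#p) q (W si p (y#q) T)) = W si (y#p) q (W s p (y#q) (W s (y#p) q T))"
proof -
 have "W s p (y#q) (W s (y#p) q (W si p (y#q) T)) =
  W si (y#p) q (W s p (y#q) (W s (y#p) q (W s p (y#q) (W si p (y#q) T))))" by (subst s_braid, simp add: chain)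
 also have "... = W si (y#p) q (W s p (y#q) (W s (y#p) q T))" by (simp add: chain)
 finally show ?thesis .
qed

lemma s_braid2: "W si p (y#q) (W s (y#p) q (W s p (y#q) T)) = W s (y#p) q (W s p (y#q) (W si (y#p) q T))"
proof -
 have "W si p (y#q) (W s (y#p) q (W s p (y#q) T)) =
  W si p (y#q) (W s p (y#q) (W s (y#p) q (W s p (y#q) (W si (y#p) q T))))" by (subst s_braid, simp add: chain)
 also have "... = W s (y#p) q (W s p (y#q) (W si (y#p) q T))" by (simp add: chain)
 finally show ?thesis .
qed

lemma si_braid: "W si p (y#q) (W si (y#p) q (W si p (y#q) T)) = W si (y#p) q (W si p (y#q) (W si (y#p) q T))"
proof -
 have "W si p (y#q) (W si (y#p) q (W si p (y#q) T)) =
  W si (y#p) q (W si p (y#q) (W s p (y#q) (W s (y#p) q (W si p (y#q) (W si (y#p) q (W si p (y#q) T))))))" by (simp add: chain)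
 also have "... = W si (y#p) q (W si p (y#q) (W si (y#p) q T))" by (simp add: s_braid1 chain)
 finally show ?thesis .
qed

definition is_alg where
 "is_alg m u <-> hom m [y, y] [y] & hom u [] [y] &
   (\<forall>p q T. W m p (y#q) (W m p q T) = W m (y#p) q (W m p q T)) &
   (\<forall>p q T. W m p (y#q) (W s p q T) = W s (y#p) q (W s p (y#q) (W m (y#p) q T))) & (\<forall>p q T. W m (y#p) q (W s p q T) = W s p (y#q) (W s (y#p) q (W m p (y#q) T))) &
   (\<forall>p q T. act_unital u y m p q T) & (\<forall>p q T. W u (y#p) q (W m p q T) = Idw (rev p @ y#q) T) &
   (\<forall>p q T. unit_slides u y s p q T) & (\<forall>p q T. unitV_slides u y s p q T)"

definition is_coalg where
 "is_coalg d c <-> hom d [y] [y, y] & hom c [y] [] &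
   (\<forall>p q T. W d p q (W d p (y#q) T) = W d p q (W d (y#p) q T)) &
   (\<forall>p q T. W s p q (W d (y#p) q T) = W d p (y#q) (W s (y#p) q (W s p (y#q) T))) & (\<forall>p q T. W s p q (W d p (y#q) T) = W d (y#p) q (W s p (y#q) (W s (y#p) q T))) &
   (\<forall>p q T. coact_counital d c y p q T) & (\<forall>p q T. W d p q (W c p (y#q) T) = Idw (rev p @ y#q) T) &
   (\<forall>p q T. counit_slides s c y p q T) & (\<forall>p q T. W s p q (W c p (y#q) T) = W c (y#p) q T)"

definition is_bialg where
 "is_bialg m u d c <-> is_alg m u & is_coalg d c &
   (\<forall>p q T. W m p q (W d p q T) = W d p (y#q) (W d (y#y#p) q (W s (y#p) (y#q) (W m (y#y#p) q (W m p (y#q) T))))) &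
   (\<forall>p q T. W u p q (W d p q T) = W u p q (W u (y#p) q T)) & (\<forall>p q T. W m p q (W c p q T) = W c p (y#q) (W c p q T)) &
   (\<forall>p q T. W u p q (W c p q T) = Idw (rev p @ q) T)"

lemma is_algD:
 assumes "is_alg m u"
 shows "hom m [y, y] [y]" "hom u [] [y]"
  and "W m p (y#q) (W m p q T) = W m (y#p) q (W m p q T)"
  and "W m p (y#q) (W s p q T) = W s (y#p) q (W s p (y#q) (W m (y#p) q T))" and "W m (y#p) q (W s p q T) = W s p (y#q) (W s (y#p) q (W m p (y#q) T))"
  and "act_unital u y m p q T" and "W u (y#p) q (W m p q T) = Idw (rev p @ y#q) T"
  and "unit_slides u y s p q T" and "unitV_slides u y s p q T" using assms by (simp_all only: is_alg_def)

lemma is_coalgD: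
 assumes "is_coalg d c"
 shows "hom d [y] [y, y]" "hom c [y] []"
  and "W d p q (W d p (y#q) T) = W d p q (W d (y#p) q T)"
  and "W s p q (W d (y#p) q T) = W d p (y#q) (W s (y#p) q (W s p (y#q) T))" and "W s p q (W d p (y#q) T) = W d (y#p) q (W s p (y#q) (W s (y#p) q T))"
  and "coact_counital d c y p q T" and "W d p q (W c p (y#q) T) = Idw (rev p @ y#q) T"
  and "counit_slides s c y p q T" and "W s p q (W c p (y#q) T) = W c (y#p) q T" using assms by (simp_all only: is_coalg_def)

lemma alg_inv:
 assumes "is_alg m u"
 shows "W m p (y#q) (W si p q T) = W si (y#p) q (W si p (y#q) (W m (y#p) q T))" (is ?a) and "W m (y#p) q (W si p q T) = W si p (y#q) (W si (y#p) q (W m p (y#q) T))" (is ?b)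
  and "unit_slides u y si p q T" (is ?c) and "unitV_slides u y si p q T" (is ?d)
proof -
 note D = is_algD[OF assms]
 note [simp] = D(1,2)[unfolded hom_def]
 have "W m p (y#q) (W si p q T) =
  W si (y#p) q (W si p (y#q) (W m (y#p) q (W s p q (W si p q T))))" by (subst D(5), simp add: chain)
 also have "... = W si (y#p) q (W si p (y#q) (W m (y#p) q T))" by (simp add: chain)
 finally show ?a .
 have "W m (y#p) q (W si p q T) =
  W si p (y#q) (W si (y#p) q (W m p (y#q) (W s p q (W si p q T))))" by (subst D(4), simp add: chain)
 also have "... = W si p (y#q) (W si (y#p) q (W m p (y#q) T))" by (simp add: chain)
 finally show ?b .
 have "unit_slides u y si p q T" by (simp add: D(9)[symmetric] chain)
  then show ?c .
 have "unitV_slides u y si p q T" by (simp add: D(8)[symmetric] chain)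
  then show ?d .
qed

lemma coalg_inv:
 assumes "is_coalg d c"
 shows "W si p q (W d p (y#q) T) = W d (y#p) q (W si p (y#q) (W si (y#p) q T))" (is ?a) and "W si p q (W d (y#p) q T) = W d p (y#q) (W si (y#p) q (W si p (y#q) T))" (is ?b)
  and "W si p q (W c p (y#q) T) = W c (y#p) q T" (is ?c) and "counit_slides si c y p q T" (is ?d)
proof -
 note D = is_coalgD[OF assms]
 note [simp] = D(1,2)[unfolded hom_def]
 have "W si p q (W d p (y#q) T) =
  W si p q (W s p q (W d (y#p) q (W si p (y#q) (W si (y#p) q T))))" by (subst D(4), simp add: chain)
 also have "... = W d (y#p) q (W si p (y#q) (W si (y#p) q T))" by (simp add: chain)
 finally show ?a .
 have "W si p q (W d (y#p) q T) =
  W si p q (W s p q (W d p (y#q) (W si (y#p) q (W si p (y#q) T))))" by (subst D(5), simp add: chain)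
 also have "... = W d p (y#q) (W si (y#p) q (W si p (y#q) T))" by (simp add: chain)
 finally show ?b .
 have "W si p q (W c p (y#q) T) =
  W c (y#p) q T" by (simp add: D(8)[symmetric] chain)
  then show ?c .
 have "counit_slides si c y p q T" by (simp add: D(9)[symmetric] chain)
  then show ?d .
qed

lemma alg_twist:
 assumes "is_alg m u"
 shows "is_alg (s >> m) u" and "is_alg (si >> m) u"
proof -
 note D = is_algD[OF assms] and I = alg_inv[OF assms]
 note [simp] = D(1,2)[unfolded hom_def]
 have hs: "hom (s >> m) [y, y] [y]" "hom (si >> m) [y, y] [y]" by (simp_all add: hom_def)
 have 1: "W s p (y#q) (W m p (y#q) (W s p q (W m p q T))) = W s (y#p) q (W m (y#p) q (W s p q (W m p q T)))" for p q T
 proof -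
  have "W s p (y#q) (W m p (y#q) (W s p q (W m p q T))) =
  W s (y#p) q (W m (y#p) q (W s p q (W m p q T)))" by (simp only: D(4) s_braid D(3)[symmetric] D(5)[symmetric])
  then show ?thesis .
 qed
 have 2: "W si p (y#q) (W m p (y#q) (W si p q (W m p q T))) = W si (y#p) q (W m (y#p) q (W si p q (W m p q T)))" for p q T
 proof -
  have "W si p (y#q) (W m p (y#q) (W si p q (W m p q T))) =
  W si (y#p) q (W m (y#p) q (W si p q (W m p q T)))" by (simp only: I(1) si_braid D(3)[symmetric] I(2)[symmetric])
  then show ?thesis .
 qed
 show "is_alg (s >> m) u" unfolding is_alg_def using hs 1 by (intro conjI allI) (simp_all add: chain D(2,4-9) s_braid)
 show "is_alg (si >> m) u" unfolding is_alg_def using hs 2 by (intro conjI allI) (simp_all add: chain D(2,4-9) I(3,4) s_braid2 s_braid1)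
qed

lemma coalg_twist:
 assumes "is_coalg d c"
 shows "is_coalg (d >> s) c" and "is_coalg (d >> si) c"
proof -
 note D = is_coalgD[OF assms] and I = coalg_inv[OF assms]
 note [simp] = D(1,2)[unfolded hom_def]
 have hs: "hom (d >> s) [y] [y, y]" "hom (d >> si) [y] [y, y]" by (simp_all add: hom_def)
 have 1: "W d p q (W s p q (W d p (y#q) (W s p (y#q) T))) = W d p q (W s p q (W d (y#p) q (W s (y#p) q T)))" for p q T
 proof -
  have "W d p q (W s p q (W d p (y#q) (W s p (y#q) T))) =
  W d p q (W s p q (W d (y#p) q (W s (y#p) q T)))" by (simp only: D(5) s_braid D(3)[symmetric] D(4)[symmetric])
  then show ?thesis .
 qed
 have 2: "W d p q (W si p q (W d p (y#q) (W si p (y#q) T))) = W d p q (W si p q (W d (y#p) q (W si (y#p) q T)))" for p q T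
 proof -
  have "W d p q (W si p q (W d p (y#q) (W si p (y#q) T))) =
  W d p q (W si p q (W d (y#p) q (W si (y#p) q T)))" by (simp only: I(1) si_braid D(3)[symmetric] I(2)[symmetric])
  then show ?thesis .
 qed
 show "is_coalg (d >> s) c" unfolding is_coalg_def using hs 1 by (intro conjI allI) (simp_all add: chain D(2,4-9) s_braid)
 show "is_coalg (d >> si) c" unfolding is_coalg_def using hs 2 by (intro conjI allI) (simp_all add: chain D(2,4-9) I(3,4) s_braid2 s_braid1)
qed

text \<open>Sliding the product and coproduct through the braiding brings all copies of the braiding next to each
other, where the braid relation cancels them.\<close>

lemma bialg_twist:
 assumes "is_bialg m u d c"
 shows "is_bialg (s >> m) u (d >> si) c" and "is_bialg (si >> m) u (d >> s) c"
proof -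
 have a: "is_alg m u" and c: "is_coalg d c"
  and B: "!!p q T. W m p q (W d p q T) = W d p (y#q) (W d (y#y#p) q (W s (y#p) (y#q) (W m (y#y#p) q (W m p (y#q) T))))"
  and B2: "!!p q T. W u p q (W d p q T) = W u p q (W u (y#p) q T)" and B3: "!!p q T. W m p q (W c p q T) = W c p (y#q) (W c p q T)"
  and B4: "!!p q T. W u p q (W c p q T) = Idw (rev p @ q) T" using assms unfolding is_bialg_def by blast+
 note A = is_algD[OF a] and AI = alg_inv[OF a] and D = is_coalgD[OF c] and DI = coalg_inv[OF c]
 note [simp] = A(1,2)[unfolded hom_def] D(1,2)[unfolded hom_def]
 have 1: "W s p q (W m p q (W d p q (W si p q T))) = W d p (y#q) (W si p (y#q) (W d (y#y#p) q (W si (y#y#p) q (W s (y#p) (y#q) (W s (y#y#p) q (W m (y#y#p) q (W s p (y#q) (W m p (y#q) T))))))))" for p q T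
 proof -
  have "W s p q (W m p q (W d p q (W si p q T))) =
  W d p (y#q) (W si p (y#q) (W d (y#y#p) q (W si (y#y#p) q (W s (y#p) (y#q) (W s (y#y#p) q (W m (y#y#p) q (W s p (y#q) (W m p (y#q) T))))))))"
  by (simp add: B AI(1) AI(2) chain D(5) D(4) s_braid2[symmetric] slide s_braid1)
  then show ?thesis .
 qed
 have 2: "W si p q (W m p q (W d p q (W s p q T))) = W d p (y#q) (W s p (y#q) (W d (y#y#p) q (W s (y#y#p) q (W s (y#p) (y#q) (W si (y#y#p) q (W m (y#y#p) q (W si p (y#q) (W m p (y#q) T))))))))" for p q T
 proof -
  have "W si p q (W m p q (W d p q (W s p q T))) =
  W d (y#p) q (W d p (y#y#q) (W si (y#p) (y#q) (W si p (y#y#q) (W s (y#p) (y#q) (W s (y#y#p) q (W s p (y#y#q) (W s (y#p) (y#q) (W si p (y#y#q) (W m p (y#y#q) (W m (y#p) q T))))))))))"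
  by (simp add: B A(4) A(5) DI(1) DI(2) chain s_braid1[symmetric])
 also have "... = W d p (y#q) (W s p (y#q) (W d (y#y#p) q (W s (y#y#p) q (W s (y#p) (y#q) (W si (y#y#p) q (W m (y#y#p) q (W si p (y#q) (W m p (y#q) T))))))))"
  by (simp add: slide s_braid2 chain)
  finally show ?thesis .
 qed
 have 3: "W u p q (W u (y#p) q (W s p q T)) = W u p q (W u (y#p) q T)" "W u p q (W u (y#p) q (W si p q T)) = W u p q (W u (y#p) q T)" for p q T
  by (simp_all only: A(9) AI(4)) (simp_all add: slide)
 have 4: "W c (y#p) q (W c p q T) = W c p (y#q) (W c p q T)" for p q T by (simp add: slide)
 show "is_bialg (s >> m) u (d >> si) c" unfolding is_bialg_def using alg_twist(1)[OF a] coalg_twist(2)[OF c] 1 3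
  by (intro conjI allI) (simp_all add: chain B2 B3 B4 D(8,9) 4)
 show "is_bialg (si >> m) u (d >> s) c" unfolding is_bialg_def using alg_twist(2)[OF a] coalg_twist(1)[OF c] 2 3
  by (intro conjI allI) (simp_all add: chain B2 B3 B4 DI(3,4) 4)
qed

end

lemma is_unit_unique: "is_unit A m u ==> is_unit A m u' ==> u' = u" unfolding is_unit_def by metis

context tensor_words begin

lemma tp_base:
 assumes X: "vspace X" and b: "bij_betw \<pi> (carr (S s)) (carr X)" and l: "linear_map (S s) X \<pi>"
 shows "tp \<lparr>sp = X, wd = [s], pt = (%xs. \<pi> (hd xs))\<rparr>"
proof -
 let ?A = "\<lparr>sp = X, wd = [s], pt = (%xs. \<pi> (hd xs))\<rparr>"
 have pin: "\<pi> z : carr X" if "z : carr (S s)" for z using bij_betwE[OF b] that by blast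
 have pts: "xs : points [s] <-> (\<exists>z\<in>carr (S s). xs = [z])" for xs by (auto dest!: points_ConsD)
 let ?i = "inv_into (carr (S s)) \<pi>"
 have i1: "?i x : carr (S s)" if "x : carr X" for x using bij_betwE[OF bij_betw_inv_into[OF b]] that by blast
 have i2: "\<pi> (?i x) = x" if "x : carr X" for x using b that by (simp add: bij_betw_inv_into_right)
 have i3: "?i (\<pi> z) = z" if "z : carr (S s)" for z using b that by (simp add: bij_betw_inv_into_left)
 have ia: "?i (x + x') = ?i x + ?i x'" if "x : carr X" "x' : carr X" for x x'
 proof -
  have "\<pi> (?i x + ?i x') = x + x'" using l i1 i2 that by (simp add: linear_map_def)
  then show ?thesis using i3[OF vspace_add[OF vspace_S i1[OF that(1)] i1[OF that(2)]]] by simp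
 qed
 have isc: "?i (scal X c x) = scal (S s) c (?i x)" if "x : carr X" for x c
 proof -
  have "\<pi> (scal (S s) c (?i x)) = scal X c x" using l i1 i2 that by (simp add: linear_map_def)
  then show ?thesis using i3[OF vspace_scal[OF vspace_S i1[OF that]]] by metis
 qed
 have "pull ?A xi : forms [s]" if xi: "linf X xi" for xi
 proof -
  have "linf (S s) (%z. pull ?A xi ([x][0 := z]))" for x by (rule mk_linear_cong[OF vspace_S _ linear_comp[OF l xi]]) (simp add: pull_def)
  moreover have "pull ?A xi xs = 0" if "xs ~: points [s]" for xs using that by (simp add: pull_def)
  ultimately show ?thesis unfolding forms_def by (auto simp: pts)
 qed
 moreover have "\<exists>L. (\<forall>(c, ys)\<in>set L. ys : points [s]) &
   (\<forall>xi. linf X xi --> xi x = comb L (%ys. xi (\<pi> (hd ys))))" if "x : carr X" for x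
  by (intro exI[of _ "[(1, [?i x])]"]) (simp add: i1 i2 that)
 moreover have "\<exists>xi. linf X xi & (\<forall>xs\<in>points [s]. xi (\<pi> (hd xs)) = T xs)" if T: "T : forms [s]" for T
 proof (intro exI[of _ "%x. T [?i x]"] conjI)
  have "linf (S s) (%z. T ([0][0 := z]))" using forms_lin[OF T, of "[0]" 0] vspace_zero[OF vspace_S] by simp
  then show "linf X (%x. T [?i x])" by (simp add: linear_ground_iff ia isc i1)
 qed (auto simp: pts i3)
 ultimately show ?thesis using X pin by (auto simp: tp_def pts)
qed

end

locale self_trans = trans S H H hf hf y y for S :: "'s => ('k::field, 'z::ab_group_add) vs"
 and H :: "('k, 'h::ab_group_add) vs" and hf :: "('k, 'h, 's, 'z) frame" and y
begin

lemma right_unit_T: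
 assumes u: "u : carr H" and r: "rp fG hf (pto H u) un" "rp (lT hf hf) hf m mu"
 shows "(\<forall>a\<in>carr H. m$(pure H H a u) = a) <-> (\<forall>p q T. W un (y#p) q (W mu p q T) = Idw (rev p @ y#q) T)"
proof -
 note [simp] = r[THEN rp_hom, unfolded hom_def wd_tens jn_def]
 have k: "m : Hom (H >< H) H" using rp_Hom[OF r(2)] frames by (simp add: tpx_def)
 have "(\<forall>a\<in>carr H. m$(pure H H a u) = a) <-> m oo (Id H ** pto H u) = Id H oo runit H"
  by (subst insert_right_iff[symmetric, OF vspaces(1) u vspaces(1) vspaces(1) k Id_Hom[OF vspaces(1)]]) (simp add: Id_app)
 then show ?thesis by (simp only:) (rule rp_eqI, (rule r frames rulesT)+, simp add: tr_simps)
qed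

lemma left_counit_T:
 assumes r: "rp hf (lT hf hf) De d" "rp hf fG ep c"
 shows "lunit H oo (ep ** Id H) oo De = Id H <-> (\<forall>p q T. W d p q (W c p (y#q) T) = Idw (rev p @ y#q) T)"
proof -
 note [simp] = r[THEN rp_hom, unfolded hom_def wd_tens jn_def]
 show ?thesis by (rule rp_eqI, (rule r frames rulesT)+, simp add: tr_simps)
qed

lemma counit2_T:
 assumes r: "rp (lT hf hf) (lT hf hf) Ps s" "rp hf fG ep c"
 shows "lunit H oo (ep ** Id H) oo Ps = runit H oo (Id H ** ep) <-> (\<forall>p q T. W s p q (W c p (y#q) T) = W c (y#p) q T)"
proof -
 note [simp] = r[THEN rp_hom, unfolded hom_def wd_tens jn_def]
 show ?thesis by (rule rp_eqI, (rule r frames rulesT)+, simp add: tr_simps)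
qed

lemma counit_mult_T:
 assumes r: "rp (lT hf hf) hf m mu" "rp hf fG ep c"
 shows "(\<forall>a\<in>carr H. \<forall>b\<in>carr H. ep$(m$(pure H H a b)) = ep$a * ep$b) <->
  (\<forall>p q T. W mu p q (W c p q T) = W c p (y#q) (W c p q T))"
proof -
 note [simp] = r[THEN rp_hom, unfolded hom_def wd_tens jn_def]
 have m: "m : Hom (H >< H) H" and c: "ep : Hom H ground" using rp_Hom[OF r(1)] rp_Hom[OF r(2)] frames by (simp_all add: tpx_def)
 note t = tensor_lmap_Hom[OF vspaces(1) vspaces(1) vspace_ground vspace_ground c c]
 have L: "(ep oo m)$(pure H H a b) = ep$(m$(pure H H a b))"
  and R: "(lunit ground oo (ep ** ep))$(pure H H a b) = ep$a * ep$b" if "a : carr H" "b : carr H" for a b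
  using that by (simp_all add: comp_app[OF m] comp_app[OF t(1)] pT t(2) lunit_pure vspace_ground)
 have "(\<forall>a\<in>carr H. \<forall>b\<in>carr H. ep$(m$(pure H H a b)) = ep$a * ep$b) <-> ep oo m = lunit ground oo (ep ** ep)" (is "?l <-> ?r")
 proof
  assume ?l
  then show ?r by (intro tensor_Hom_eqI[OF vspaces(1) vspaces(1) comp_Hom[OF vT m c]
     comp_Hom[OF vT t(1) lunit_Hom[OF vspace_ground]]]) (simp add: L R)
 next
  assume ?r
  then show ?l using L R by metis
 qed
 then show ?thesis by (simp only:) (rule rp_eqI, (rule r frames rulesT)+, simp add: tr_simps slide)
qed

lemma counit_unit_T:
 assumes u: "u : carr H" and r: "rp fG hf (pto H u) un" "rp hf fG ep c"
 shows "ep$u = 1 <-> (\<forall>p q T. W un p q (W c p q T) = Idw (rev p @ q) T)"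
proof -
 note [simp] = r[THEN rp_hom, unfolded hom_def wd_tens jn_def]
 have c: "ep : Hom H ground" using rp_Hom[OF r(2)] frames by (simp_all add: tpx_def)
 have 1: "Id ground = pto ground 1" by (rule Hom_eqI[OF Id_Hom[OF vspace_ground] pto_Hom[OF vspace_ground]]) (simp_all add: Id_app pto_app)
 have "ep$u = 1 <-> ep oo pto H u = Id ground" unfolding 1 comp_pto[OF c vspaces(1) vspace_ground u] by (simp add: pto_inj[OF vspace_ground])
 then show ?thesis by (simp only:) (rule rp_eqI, (rule r frames rulesT)+, simp add: tr_simps)
qed

lemma braiding_iff:
 assumes r: "rp (lT hf hf) (lT hf hf) Ps s" and i: "Ps : Iso (H >< H) (H >< H)"
  and si: "hom si [y, y] [y, y]" "s >> si = ida [y, y]" "si >> s = ida [y, y]"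
 shows "braiding H Ps <-> braid_words S y s si"
proof -
 have "hom s [y, y] [y, y]" using rp_hom[OF r] by (simp add: wd_tens jn_def)
 then show ?thesis using braid_T[OF r r] i si unfolding braiding_def braid_words_def braid_words_axioms_def using tensor_words_axioms by simp
qed

lemma braided_unital_algebra_iff:
 assumes r: "rp (lT hf hf) (lT hf hf) Ps s" "rp (lT hf hf) hf m mu" "rp fG hf (pto H u) un"
  and u: "u : carr H" and b: "braiding H Ps"
 shows "braided_unital_algebra H m u Ps <-> braid_words.is_alg S y s mu un" (is "_ <-> ?R")
proof -
 have i: "Ps : Iso (H >< H) (H >< H)" using b by (simp add: braiding_def)
 obtain si where si: "hom si [y, y] [y, y]" "s >> si = ida [y, y]" "si >> s = ida [y, y]"
  using rp_linv[OF r(1)] i frames by (auto simp: tpx_def wd_tens jn_def)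
 interpret b: braid_words S y s si using braiding_iff[OF r(1) i si] b by simp
 have hs: "hom mu [y, y] [y]" "hom un [] [y]" using rp_hom[OF r(2)] rp_hom[OF r(3)] by (simp_all add: wd_tens jn_def)
 have m: "m : Hom (H >< H) H" using rp_Hom[OF r(2)] frames by (simp add: tpx_def)
 have un: "(\<forall>u'. is_unit H m u' --> P u') <-> P u" if "is_unit H m u" for P using that is_unit_unique by blast
 have U: "is_unit H m u <-> (\<forall>p q T. act_unital un y mu p q T) & (\<forall>p q T. W un (y#p) q (W mu p q T) = Idw (rev p @ y#q) T)"
  using act_unit_T[OF u r(3) r(2)] right_unit_T[OF u r(3) r(2)] u unfolding is_unit_def by blast
 have A: "m oo (m ** Id H) = m oo (Id H ** m) oo assoc H H H <-> (\<forall>p q T. W mu p (y#q) (W mu p q T) = W mu (y#p) q (W mu p q T))"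
  using act_assoc_T[OF r(2) r(2)] by (simp only: eq_commute[of "m oo (m ** Id H)"]) (simp only: eq_commute)
 have C1: "(\<forall>u'. is_unit H m u' --> (\<forall>w\<in>carr H. Ps$(pure H H u' w) = pure H H w u')) <->
   (\<forall>p q T. unit_slides un y s p q T)"
  and C2: "(\<forall>u'. is_unit H m u' --> (\<forall>w\<in>carr H. Ps$(pure H H w u') = pure H H u' w)) <->
   (\<forall>p q T. unitV_slides un y s p q T)" if "is_unit H m u"
  using un[OF that, of "%u'. \<forall>w\<in>carr H. Ps$(pure H H u' w) = pure H H w u'"] unit_T[OF u r(3) r(1)]
   un[OF that, of "%u'. \<forall>w\<in>carr H. Ps$(pure H H w u') = pure H H u' w"] unitV_T[OF u r(3) r(1)] by simp_all
 show ?thesis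
 proof (cases "is_unit H m u")
  case True
  then have E: "\<forall>p q T. act_unital un y mu p q T" "\<forall>p q T. W un (y#p) q (W mu p q T) = Idw (rev p @ y#q) T" using U by blast+
  show ?thesis unfolding braided_unital_algebra_def braided_algebra_def algebra_def compat_mult1_def compat_mult2_def b.is_alg_def
    mult_T[OF r(2) r(1)] multV_T[OF r(2) r(1)] A C1[OF True] C2[OF True] using True E b hs m vspaces(1)
   by (intro iffI) (elim conjE, intro conjI, assumption+)+
 next
  case False
  moreover have "is_unit H m u" if a: "b.is_alg mu un" unfolding U by (intro conjI allI b.is_algD(6)[OF a] b.is_algD(7)[OF a])
  ultimately show ?thesis unfolding braided_unital_algebra_def by blast
 qed
qed

lemma braided_coalgebra_iff:
 assumes r: "rp (lT hf hf) (lT hf hf) Ps s" "rp hf (lT hf hf) De d" "rp hf fG ep c" and b: "braiding H Ps"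
 shows "braided_coalgebra H De ep Ps <-> braid_words.is_coalg S y s d c"
proof -
 have i: "Ps : Iso (H >< H) (H >< H)" using b by (simp add: braiding_def)
 obtain si where si: "hom si [y, y] [y, y]" "s >> si = ida [y, y]" "si >> s = ida [y, y]"
  using rp_linv[OF r(1)] i frames by (auto simp: tpx_def wd_tens jn_def)
 interpret b: braid_words S y s si using braiding_iff[OF r(1) i si] b by simp
 have hs: "hom d [y] [y, y]" "hom c [y] []" using rp_hom[OF r(2)] rp_hom[OF r(3)] by (simp_all add: wd_tens jn_def)
 have m: "De : Hom H (H >< H)" "ep : Hom H ground" using rp_Hom[OF r(2)] rp_Hom[OF r(3)] frames by (simp_all add: tpx_def)
 show ?thesis unfolding braided_coalgebra_def coalgebra_def compat_comult1_def compat_comult2_def b.is_coalg_def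
   coassoc_T[OF r(2) r(2)] coact_counit_T[OF r(3) r(2)] left_counit_T[OF r(2,3)] comult_T[OF r(2) r(1)]
   coact_braid_T[OF r(1) r(1) r(2)] counit_T[OF r(3) r(1)] counit2_T[OF r(1,3)] using b hs m vspaces(1) by (auto simp only: simp_thms)
qed

lemma braided_bialgebra_iff:
 assumes r: "rp (lT hf hf) (lT hf hf) Ps s" "rp (lT hf hf) hf m mu" "rp fG hf (pto H u) un"
   "rp hf (lT hf hf) De d" "rp hf fG ep c"
  and u: "u : carr H" and b: "braiding H Ps"
 shows "braided_bialgebra H m u De ep Ps <-> braid_words.is_bialg S y s mu un d c"
proof -
 have i: "Ps : Iso (H >< H) (H >< H)" using b by (simp add: braiding_def)
 obtain si where si: "hom si [y, y] [y, y]" "s >> si = ida [y, y]" "si >> s = ida [y, y]"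
  using rp_linv[OF r(1)] i frames by (auto simp: tpx_def wd_tens jn_def)
 interpret b: braid_words S y s si using braiding_iff[OF r(1) i si] b by simp
 show ?thesis unfolding braided_bialgebra_def b.is_bialg_def braided_unital_algebra_iff[OF r(1-3) u b] braided_coalgebra_iff[OF r(1,4,5) b]
   coact_mult_T[OF r(2) r(1) r(2) r(4)] coact_unit_T[OF u u r(3) r(3) r(4)] counit_mult_T[OF r(2,5)] counit_unit_T[OF u r(3,5)]
  by (simp only: conj_assoc)
qed

end

lemma self_trans_ex:
 fixes H :: "('k::field, 'h::ab_group_add) vs"
 assumes "vspace H"
 shows "self_trans (%_::unit. H) H \<lparr>sp = H, wd = [()], pt = (%xs. hd xs)\<rparr> ()"
proof -
 interpret tensor_words "%_::unit. H" using assms by unfold_locales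
 have "tp \<lparr>sp = H, wd = [()], pt = (%xs. (%x. x) (hd xs))\<rparr>" using assms vspace_add[of H] vspace_scal[of H] bij_betw_id[of "carr H"]
  by (intro tp_base) (auto simp: linear_map_def id_def)
 then show ?thesis by unfold_locales (simp_all add: tpx_def)
qed

lemma braided_twist:
 fixes H :: "('k::field, 'h::ab_group_add) vs"
 shows braided_coalgebra_twist: "braided_coalgebra H De ep Ps ==>
   braided_coalgebra H (linv Ps oo De) ep Ps & braided_coalgebra H (Ps oo De) ep Ps"
  and braided_unital_algebra_twist: "braided_unital_algebra H m u Ps ==>
   braided_unital_algebra H (m oo linv Ps) u Ps & braided_unital_algebra H (m oo Ps) u Ps"
  and braided_bialgebra_twist: "braided_bialgebra H m u De ep Ps ==>
   braided_bialgebra H (m oo linv Ps) u (Ps oo De) ep Ps & braided_bialgebra H (m oo Ps) u (linv Ps oo De) ep Ps"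
proof -
 have main: "(De : Hom H (H >< H) --> ep : Hom H ground --> braided_coalgebra H De ep Ps -->
   braided_coalgebra H (linv Ps oo De) ep Ps & braided_coalgebra H (Ps oo De) ep Ps) &
  (m : Hom (H >< H) H --> u : carr H --> braided_unital_algebra H m u Ps -->
   braided_unital_algebra H (m oo linv Ps) u Ps & braided_unital_algebra H (m oo Ps) u Ps) &
  (De : Hom H (H >< H) --> ep : Hom H ground --> m : Hom (H >< H) H --> u : carr H -->
   braided_bialgebra H m u De ep Ps -->
   braided_bialgebra H (m oo linv Ps) u (Ps oo De) ep Ps & braided_bialgebra H (m oo Ps) u (linv Ps oo De) ep Ps)"
  if H: "vspace H" and b: "braiding H Ps"
 proof -
  define hf :: "('k, 'h, unit, 'h) frame" where "hf = \<lparr>sp = H, wd = [()], pt = (%xs. hd xs)\<rparr>"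
  interpret self_trans "%_::unit. H" H hf "()" unfolding hf_def by (rule self_trans_ex[OF H])
  have i: "Ps : Iso (H >< H) (H >< H)" using b by (simp add: braiding_def)
  have sph: "sp hf = H" "tp hf" using frames by (simp_all add: tpx_def)
  obtain s where s: "rp (lT hf hf) (lT hf hf) Ps s" using rp_ex[OF tp_tens tp_tens, of hf hf hf hf Ps] Iso_Hom[OF i] sph by auto
  obtain si where si: "rp (lT hf hf) (lT hf hf) (linv Ps) si" "hom si [(), ()] [(), ()]" "s >> si = ida [(), ()]" "si >> s = ida [(), ()]"
   using rp_linv[OF s] i sph by (auto simp: wd_tens jn_def)
  interpret b: braid_words "%_. H" "()" s si using braiding_iff[OF s i si(2-4)] b by simp
  have rps: "\<exists>mu. rp (lT hf hf) hf m mu" if "m : Hom (H >< H) H" using rp_ex[OF tp_tens[of hf hf] sph(2)] sph that by simp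
  have rpu: "\<exists>un. rp fG hf (pto H u) un" if "u : carr H" using rp_ex[OF tp_fG sph(2), of "pto H u"] sph pto_Hom[OF H that] by simp
  have rpd: "\<exists>d. rp hf (lT hf hf) De d" if "De : Hom H (H >< H)" using rp_ex[OF sph(2) tp_tens[of hf hf]] sph that by simp
  have rpc: "\<exists>c. rp hf fG ep c" if "ep : Hom H ground" using rp_ex[OF sph(2) tp_fG] sph that by simp
  show ?thesis
  proof (intro conjI impI)
   assume "De : Hom H (H >< H)" "ep : Hom H ground" and bc: "braided_coalgebra H De ep Ps"
   then obtain d c where d: "rp hf (lT hf hf) De d" and c: "rp hf fG ep c" using rpd rpc by blast
   note k = bc[unfolded braided_coalgebra_iff[OF s d c b]]
   show "braided_coalgebra H (linv Ps oo De) ep Ps" "braided_coalgebra H (Ps oo De) ep Ps"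
    using b.coalg_twist[OF k] braided_coalgebra_iff[OF s rp_comp[OF si(1) d] c b] braided_coalgebra_iff[OF s rp_comp[OF s d] c b] by simp_all
  next
   assume "m : Hom (H >< H) H" and u: "u : carr H" and bc: "braided_unital_algebra H m u Ps"
   then obtain mu un where m: "rp (lT hf hf) hf m mu" and un: "rp fG hf (pto H u) un" using rps rpu by blast
   note k = bc[unfolded braided_unital_algebra_iff[OF s m un u b]]
   show "braided_unital_algebra H (m oo linv Ps) u Ps" "braided_unital_algebra H (m oo Ps) u Ps"
    using b.alg_twist[OF k] braided_unital_algebra_iff[OF s rp_comp[OF m si(1)] un u b] braided_unital_algebra_iff[OF s rp_comp[OF m s] un u b]
    by simp_all
  next
   assume "De : Hom H (H >< H)" "ep : Hom H ground" "m : Hom (H >< H) H" and u: "u : carr H" and bc: "braided_bialgebra H m u De ep Ps"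
   then obtain mu un d c where m: "rp (lT hf hf) hf m mu" and un: "rp fG hf (pto H u) un"
    and d: "rp hf (lT hf hf) De d" and c: "rp hf fG ep c" using rps rpu rpd rpc by blast
   note k = bc[unfolded braided_bialgebra_iff[OF s m un d c u b]]
   show "braided_bialgebra H (m oo linv Ps) u (Ps oo De) ep Ps" "braided_bialgebra H (m oo Ps) u (linv Ps oo De) ep Ps"
    using b.bialg_twist[OF k] braided_bialgebra_iff[OF s rp_comp[OF m si(1)] un rp_comp[OF s d] c u b]
     braided_bialgebra_iff[OF s rp_comp[OF m s] un rp_comp[OF si(1) d] c u b] by simp_all
  qed
 qed
 show "braided_coalgebra H De ep Ps ==>
   braided_coalgebra H (linv Ps oo De) ep Ps & braided_coalgebra H (Ps oo De) ep Ps" using main by (simp add: braided_coalgebra_def coalgebra_def)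
 show "braided_unital_algebra H m u Ps ==>
   braided_unital_algebra H (m oo linv Ps) u Ps & braided_unital_algebra H (m oo Ps) u Ps"
  using main by (simp add: braided_unital_algebra_def braided_algebra_def algebra_def is_unit_def)
 show "braided_bialgebra H m u De ep Ps ==>
   braided_bialgebra H (m oo linv Ps) u (Ps oo De) ep Ps & braided_bialgebra H (m oo Ps) u (linv Ps oo De) ep Ps"
  using main by (simp add: braided_bialgebra_def braided_unital_algebra_def braided_algebra_def algebra_def is_unit_def
    braided_coalgebra_def coalgebra_def)
qed

lemma comp_assoc3: "f : Hom X Y ==> vspace X ==> g : Hom Y Z ==> h : Hom Z W ==> (h oo g) oo f = h oo (g oo f)"
 by (simp add: comp_lmap_def mk_def Hom_src Hom_tgt Hom_in fun_eq_iff)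

lemma comp_Id: "f : Hom X Y ==> vspace X ==> f oo Id X = f" by (rule Hom_eqI[OF comp_Hom[OF _ Id_Hom]]) (simp_all add: comp_app[OF Id_Hom] Id_app)

lemma twist_by_two:
 assumes X: "vspace X" and i: "Ps : Iso X X"
 shows "De : Hom Y X ==> vspace Y ==> twist_comult De Ps (-2) = linv Ps oo linv Ps oo De"
  and "De : Hom Y X ==> vspace Y ==> twist_comult De Ps 2 = Ps oo Ps oo De"
  and "m : Hom X Y ==> twist_mult m Ps (-2) = (m oo linv Ps) oo linv Ps"
  and "m : Hom X Y ==> twist_mult m Ps 2 = (m oo Ps) oo Ps"
proof -
 note h = Iso_Hom[OF i] and l = Iso_Hom[OF linv_Iso(1)[OF X i]]
 have p: "ipow Ps 2 = Ps oo Ps" "ipow Ps (-2) = linv Ps oo linv Ps"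
  by (simp_all add: ipow_def numeral_2_eq_2 Hom_src[OF h] comp_Id[OF h X] comp_Id[OF l X])
 show "De : Hom Y X ==> vspace Y ==> twist_comult De Ps (-2) = linv Ps oo linv Ps oo De"
  "De : Hom Y X ==> vspace Y ==> twist_comult De Ps 2 = Ps oo Ps oo De" by (simp_all add: twist_comult_def p comp_assoc3[of De Y X _ X _ X] h l)
 show "m : Hom X Y ==> twist_mult m Ps (-2) = (m oo linv Ps) oo linv Ps"
  "m : Hom X Y ==> twist_mult m Ps 2 = (m oo Ps) oo Ps" by (simp_all add: twist_mult_def p comp_assoc3[OF h X h] comp_assoc3[OF l X l])
qed

section \<open>Transposes and the double dual\<close>

context paired_words begin

definition nest :: "'z list => 'z list => 'k" where
 "nest xs ys = prod_list (map2 pr (rev xs) ys)"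

lemma nest_sym: "length xs = length ys ==> nest xs ys = nest ys xs"
proof -
 assume l: "length xs = length ys"
 have "map2 pr (rev xs) ys = rev (map2 pr xs (rev ys))" using zip_rev[of xs "rev ys"] l by (simp add: rev_map)
 also have "map2 pr xs (rev ys) = map2 pr (rev ys) xs" using l by (intro nth_equalityI) (simp_all add: pr_sym)
 finally have "map2 pr (rev xs) ys = rev (map2 pr (rev ys) xs)" .
 then show ?thesis by (simp add: nest_def prod_list.rev)
qed

lemma nest_snoc: "nest (as @ [a]) (b#bs) = pr a b * nest as bs" by (simp add: nest_def)

fun evs :: "'s => 's => nat => ('s, 'z, 'k) arr" where
 "evs x y 0 = ida []"
| "evs x y (Suc n) = wh (replicate n x) (ev x y) (replicate n y) >> evs x y n"

lemma evs_hom: "dual_sorts x y ==> hom (evs x y n) (replicate n x @ replicate n y) []"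
proof (induction n)
 case (Suc n)
 have "replicate n x @ x#y#replicate n y = x#replicate n x @ y#replicate n y" by (simp add: replicate_app_Cons_same)
 then have "hom (wh (replicate n x) (ev x y) (replicate n y)) (replicate (Suc n) x @ replicate (Suc n) y) (replicate n x @ replicate n y)"
  using hom_wh[of "ev x y" "[x, y]" "[]" "replicate n x" "replicate n y"] ev_arrow[OF Suc.prems] by (simp add: hom_def)
 from hom_comp[OF this Suc.IH[OF Suc.prems]] show ?case by simp
qed (simp add: hom_def)

lemma evs_app:
 assumes d: "dual_sorts x y" and T: "T : forms []"
 shows "xs : points (replicate n x) ==> ys : points (replicate n y) ==> afn (evs x y n) T (xs @ ys) = nest xs ys * T []"
proof (induction n arbitrary: xs ys)
 case 0
 then show ?case using T by (simp add: ida_def Idw_id nest_def)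
next
 case (Suc n)
 have "xs : points (replicate n x @ [x])" using Suc.prems(1) by (simp add: replicate_append_same)
 then obtain as a where xs: "xs = as @ [a]" "as : points (replicate n x)" "a : carr (S x)" by (auto dest!: points_appendD points_ConsD)
 obtain b bs where ys: "ys = b#bs" "b : carr (S y)" "bs : points (replicate n y)" using Suc.prems(2) by (auto dest!: points_ConsD)
 have f: "afn (evs x y n) T : forms (rev (replicate n x) @ replicate n y)"
  using arrow_form[of "evs x y n" T] evs_hom[OF d, of n] by (simp add: hom_def)
 have "afn (evs x y (Suc n)) T (xs @ ys) = W (ev x y) (replicate n x) (replicate n y) (afn (evs x y n) T) (as @ a#b#bs)"
  using xs ys by (simp add: comp_def wh_def)
 also have "... = pr a b * afn (evs x y n) T (as @ bs)" by (rule W_ev_app[OF f]) (use xs ys in simp_all)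
 also have "... = nest xs ys * T []" using Suc.IH[OF xs(2) ys(3)] xs ys by (simp add: nest_snoc)
 finally show ?case .
qed

definition nestL where "nestL x n ys = (%xs. if xs : points (replicate n x) then nest xs ys else 0)"

lemma nestL_form:
 assumes d: "dual_sorts x y" and ys: "ys : points (replicate n y)"
 shows "nestL x n ys : forms (replicate n x)"
proof -
 let ?one = "%xs. if xs = [] then 1 else (0::'k)"
 have one: "?one : forms []" by (simp add: forms_def)
 have e: "afn (evs x y n) ?one : forms ([] @ replicate n x @ replicate n y)"
  using arrow_form[of "evs x y n" ?one] evs_hom[OF d, of n] by (simp add: hom_def)
 have "(%xs. afn (evs x y n) ?one ([] @ xs @ ys)) : forms (replicate n x)" by (rule forms_slice[OF e]) (use ys in simp_all)
 moreover have "(%xs. afn (evs x y n) ?one ([] @ xs @ ys)) = nestL x n ys"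
 proof
  fix xs
  show "afn (evs x y n) ?one ([] @ xs @ ys) = nestL x n ys xs" using evs_app[OF d one _ ys, of xs] forms_out[OF e[simplified], of "xs @ ys"] ys
   by (cases "xs : points (replicate n x)") (simp_all add: nestL_def points_append_iff1)
 qed
 ultimately show ?thesis by simp
qed

text \<open>Two arrows are transposes of each other for the nested pairing
\<open>\<langle>\<langle>f \<otimes> g, a \<otimes> b\<rangle>\<rangle>\<close>, in which the inner factors are evaluated first. Both evaluations are
required, with x on the left and with y on the left, which makes the notion symmetric.\<close>

definition transp :: "'s => 's => ('s, 'z, 'k) arr => ('s, 'z, 'k) arr => bool" where
 "transp x y f g <-> dual_sorts x y & (\<exists>m n. hom f (replicate m x) (replicate n x) & hom g (replicate n y) (replicate m y) &
   (\<forall>T. W f [] (replicate n y) (W (evs x y n) [] [] T) = W g (replicate m x) [] (W (evs x y m) [] [] T)) &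
   (\<forall>T. W g [] (replicate m x) (W (evs y x m) [] [] T) = W f (replicate n y) [] (W (evs y x n) [] [] T)))"

lemma transp_sym: "transp x y f g ==> transp y x g f" unfolding transp_def using dual_sorts_sym by blast

lemma transp_comp:
 assumes "transp x y f g" "transp x y f' g'" "acod f = adom f'"
 shows "transp x y (f >> f') (g' >> g)"
proof -
 obtain m n where t: "dual_sorts x y" "hom f (replicate m x) (replicate n x)" "hom g (replicate n y) (replicate m y)"
  "!!T. W f [] (replicate n y) (W (evs x y n) [] [] T) = W g (replicate m x) [] (W (evs x y m) [] [] T)"
  "!!T. W g [] (replicate m x) (W (evs y x m) [] [] T) = W f (replicate n y) [] (W (evs y x n) [] [] T)" using assms(1) unfolding transp_def by blast
 obtain n' k where t': "hom f' (replicate n' x) (replicate k x)" "hom g' (replicate k y) (replicate n' y)"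
  "!!T. W f' [] (replicate k y) (W (evs x y k) [] [] T) = W g' (replicate n' x) [] (W (evs x y n') [] [] T)"
  "!!T. W g' [] (replicate n' x) (W (evs y x n') [] [] T) = W f' (replicate k y) [] (W (evs y x k) [] [] T)"
  using assms(2) unfolding transp_def by blast
 have n: "n' = n" using assms(3) t(2) t'(1) unfolding hom_def by (metis length_replicate)
 note [simp] = t(2,3)[unfolded hom_def] t'(1,2)[unfolded hom_def n]
 show ?thesis unfolding transp_def
 proof (rule conjI[OF t(1)], rule exI[of _ m], rule exI[of _ k], intro conjI allI)
  show "W (f >> f') [] (replicate k y) (W (evs x y k) [] [] T) = W (g' >> g) (replicate m x) [] (W (evs x y m) [] [] T)" for T
   using interchange[of f g' "[]" "[]" "[]" "W (evs x y n) [] [] T"] by (simp add: W_comp t t'[unfolded n])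
  show "W (g' >> g) [] (replicate m x) (W (evs y x m) [] [] T) = W (f >> f') (replicate k y) [] (W (evs y x k) [] [] T)" for T
   using interchange[of g' f "[]" "[]" "[]" "W (evs y x n) [] [] T"] by (simp add: W_comp t t'[unfolded n])
 qed (simp_all add: hom_def)
qed

lemma transp_inverse:
 assumes "transp x y f g" and ff: "adom f = replicate n x" "acod f = replicate n x"
  and fi: "hom fi (replicate n x) (replicate n x)" "f >> fi = ida (replicate n x)" "fi >> f = ida (replicate n x)"
  and gi: "hom gi (replicate n y) (replicate n y)" "g >> gi = ida (replicate n y)" "gi >> g = ida (replicate n y)"
 shows "transp x y fi gi"
proof -
 obtain m k where t: "dual_sorts x y" "hom f (replicate m x) (replicate k x)" "hom g (replicate k y) (replicate m y)"
  "!!T. W f [] (replicate k y) (W (evs x y k) [] [] T) = W g (replicate m x) [] (W (evs x y m) [] [] T)"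
  "!!T. W g [] (replicate m x) (W (evs y x m) [] [] T) = W f (replicate k y) [] (W (evs y x k) [] [] T)" using assms(1) unfolding transp_def by blast
 have n: "m = n" "k = n" using ff t(2) unfolding hom_def by (metis length_replicate)+
 have e: "hom (evs x y n) (replicate n x @ replicate n y) []" "hom (evs y x n) (replicate n y @ replicate n x) []"
  using evs_hom t(1) dual_sorts_sym by blast+
 note [simp] = t(2,3)[unfolded hom_def n] fi(1)[unfolded hom_def] gi(1)[unfolded hom_def] e[unfolded hom_def]
 note i = fi(2,3)[THEN chain_cong] gi(2,3)[THEN chain_cong]
 have c: "W f p q (W fi p q T) = Idw (rev p @ replicate n x @ q) T" "W fi p q (W f p q T) = Idw (rev p @ replicate n x @ q) T"
  "W g p q (W gi p q T) = Idw (rev p @ replicate n y @ q) T" "W gi p q (W g p q T) = Idw (rev p @ replicate n y @ q) T" for p q T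
  using i(1)[of p q T] i(2)[of p q T] i(3)[of p q T] i(4)[of p q T] by (simp_all add: chain)
 show ?thesis unfolding transp_def
 proof (rule conjI[OF t(1)], rule exI[of _ n], rule exI[of _ n], intro conjI allI)
  show "W fi [] (replicate n y) (W (evs x y n) [] [] T) = W gi (replicate n x) [] (W (evs x y n) [] [] T)" for T
  proof -
   have "W fi [] (replicate n y) (W (evs x y n) [] [] T) = W fi [] (replicate n y) (W gi (replicate n x) [] (W f [] (replicate n y) (W (evs x y n) [] [] T)))"
    by (simp add: t(4)[unfolded n] c Idw_W)
   also have "... = W gi (replicate n x) [] (W fi [] (replicate n y) (W f [] (replicate n y) (W (evs x y n) [] [] T)))"
    using interchange[of fi gi "[]" "[]" "[]" "W f [] (replicate n y) (W (evs x y n) [] [] T)"] by simp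
   finally show ?thesis by (simp add: c Idw_W)
  qed
  show "W gi [] (replicate n x) (W (evs y x n) [] [] T) = W fi (replicate n y) [] (W (evs y x n) [] [] T)" for T
  proof -
   have "W gi [] (replicate n x) (W (evs y x n) [] [] T) = W gi [] (replicate n x) (W fi (replicate n y) [] (W g [] (replicate n x) (W (evs y x n) [] [] T)))"
    by (simp add: t(5)[unfolded n] c Idw_W)
   also have "... = W fi (replicate n y) [] (W gi [] (replicate n x) (W g [] (replicate n x) (W (evs y x n) [] [] T)))"
    using interchange[of gi fi "[]" "[]" "[]" "W g [] (replicate n x) (W (evs y x n) [] [] T)"] by simp
   finally show ?thesis by (simp add: c Idw_W)
  qed
 qed (simp_all add: fi gi)
qed

lemma nestL_nest: "xs : points (replicate n x) ==> ys : points (replicate n y) ==> nestL x n ys xs = nestL y n xs ys"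
 using nest_sym[of xs ys] points_length[of xs "replicate n x"] points_length[of ys "replicate n y"] by (simp add: nestL_def)

lemma transpI_half:
 assumes d: "dual_sorts x y" and f: "hom f (replicate m x) (replicate n x)" and g: "hom g (replicate n y) (replicate m y)"
  and eq: "!!xs ys. xs : points (replicate m x) ==> ys : points (replicate n y) ==> afn f (nestL x n ys) xs = afn g (nestL y m xs) ys"
 shows "W f [] (replicate n y) (W (evs x y n) [] [] T) = W g (replicate m x) [] (W (evs x y m) [] [] T)"
proof -
 note F = f g eq d
 have h1: "hom (wh [] f (replicate n y) >> evs x y n) (replicate m x @ replicate n y) []"
  using hom_comp[OF hom_wh[OF F(1), of "[]" "replicate n y"]] evs_hom[OF F(4), of n] by simp
 have h2: "hom (wh (replicate m x) g [] >> evs x y m) (replicate m x @ replicate n y) []"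
  using hom_comp[OF hom_wh[OF F(2), of "replicate m x" "[]"]] evs_hom[OF F(4), of m] by simp
 have "wh [] f (replicate n y) >> evs x y n = wh (replicate m x) g [] >> evs x y m"
 proof (rule arrow_eqI)
  fix T zs assume "T : forms (acod (wh [] f (replicate n y) >> evs x y n))"
   "zs : points (adom (wh [] f (replicate n y) >> evs x y n))"
  then have T: "T : forms []" and "zs : points (replicate m x @ replicate n y)" using h1 by (simp_all add: hom_def)
  then obtain xs ys where zs: "zs = xs @ ys" and xs: "xs : points (replicate m x)" and ys: "ys : points (replicate n y)" using points_appendD by blast
  have T1: "afn (evs x y k) T : forms (replicate k x @ replicate k y)" for k
   using arrow_form[of "evs x y k" T] evs_hom[OF F(4), of k] by (simp add: hom_def)
  have sc: "afn h (%zs. c * U zs) = (%zs. c * afn h U zs)" if hh: "hom h a b" and hU: "U : forms b" for h a b U and c :: 'k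
  proof (rule forms_ext[of _ a])
   have cU: "(%zs. c * U zs) : forms b" using forms_comb[of "[(c, ())]" "%_. U" b] hh hU by simp
   have "afn h U : forms a" using arrow_form[of h U] hh hU by (auto simp: hom_def)
   then show "(%zs. c * afn h U zs) : forms a" using forms_comb[of "[(c, ())]" "%_. afn h U" a] by simp
   show "afn h (%zs. c * U zs) : forms a" using arrow_form[of h] hh hU by (auto simp: hom_def)
   fix zs assume zs: "zs : points a"
   obtain L where L: "!!c ys. (c, ys) : set L ==> ys : points (acod h)"
    "!!T. T : forms (acod h) ==> afn h T zs = comb L T" using arrow_comb[of h zs] hh zs unfolding hom_def by metis
   show "afn h (%zs. c * U zs) zs = c * afn h U zs" using L(2)[of U] L(2)[of "%zs. c * U zs"] cU hh hU by (simp add: hom_def comb_scale)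
  qed
  have "afn (wh [] f (replicate n y) >> evs x y n) T zs = W f [] (replicate n y) (afn (evs x y n) T) ([] @ xs @ ys)" by (simp add: comp_def wh_def zs)
  also have "... = afn f (%us. afn (evs x y n) T ([] @ us @ ys)) xs" by (rule W_app) (use T1[of n] F(1) xs ys in \<open>simp_all add: hom_def\<close>)
  also have "(%us. afn (evs x y n) T ([] @ us @ ys)) = (%us. T [] * nestL x n ys us)"
  proof
   fix us
   show "afn (evs x y n) T ([] @ us @ ys) = T [] * nestL x n ys us" using evs_app[OF F(4) T _ ys, of us] forms_out[OF T1, of "us @ ys" n] ys
    by (cases "us : points (replicate n x)") (simp_all add: nestL_def points_append_iff1)
  qed
  also have "afn f (%us. T [] * nestL x n ys us) xs = T [] * afn g (nestL y m xs) ys" using sc[OF F(1) nestL_form[OF F(4) ys]] F(3)[OF xs ys] by simp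
  also have "... = afn g (%us. T [] * nestL y m xs us) ys" using sc[OF F(2) nestL_form[OF dual_sorts_sym[OF F(4)] xs]] by simp
  also have "(%us. T [] * nestL y m xs us) = (%us. afn (evs x y m) T (xs @ us @ []))"
  proof
   fix us
   show "T [] * nestL y m xs us = afn (evs x y m) T (xs @ us @ [])"
    using evs_app[OF F(4) T xs, of us] forms_out[OF T1, of "xs @ us" m] xs nestL_nest[OF xs, of us y]
    by (cases "us : points (replicate m y)") (simp_all add: nestL_def points_append_iff2)
  qed
  also have "afn g (%us. afn (evs x y m) T (xs @ us @ [])) ys = W g (replicate m x) [] (afn (evs x y m) T) (xs @ ys @ [])"
   by (rule W_app[symmetric]) (use T1[of m] F(2) xs ys in \<open>simp_all add: hom_def\<close>)
  also have "... = afn (wh (replicate m x) g [] >> evs x y m) T zs" by (simp add: comp_def wh_def zs)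
  finally show "afn (wh [] f (replicate n y) >> evs x y n) T zs = afn (wh (replicate m x) g [] >> evs x y m) T zs" .
 qed (use h1 h2 in \<open>simp_all add: hom_def\<close>)
 from chain_cong[OF this, of "[]" "[]" T] f g evs_hom[OF d, of n] evs_hom[OF d, of m]
 show ?thesis by (simp add: chain hom_def)
qed

lemma transpI:
 assumes "dual_sorts x y" "hom f (replicate m x) (replicate n x)" "hom g (replicate n y) (replicate m y)"
  and eq: "!!xs ys. xs : points (replicate m x) ==> ys : points (replicate n y) ==> afn f (nestL x n ys) xs = afn g (nestL y m xs) ys"
 shows "transp x y f g" unfolding transp_def
 using transpI_half[OF assms] transpI_half[OF dual_sorts_sym[OF assms(1)] assms(3,2), of T for T] assms by metis

lemma transp_W:
 assumes t: "transp x y f g"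
 shows "hom f [x, x] [x, x] ==> W f p (y#y#q) (W (ev x y) (x#p) (y#q) (W (ev x y) p q T)) =
   W g (x#x#p) q (W (ev x y) (x#p) (y#q) (W (ev x y) p q T))"
  and "hom f [x, x] [x] ==> W f p (y#q) (W (ev x y) p q T) =
   W g (x#x#p) q (W (ev x y) (x#p) (y#q) (W (ev x y) p q T))"
  and "hom f [x] [x, x] ==> W f p (y#y#q) (W (ev x y) (x#p) (y#q) (W (ev x y) p q T)) =
   W g (x#p) q (W (ev x y) p q T)"
  and "hom f [] [x] ==> W f p (y#q) (W (ev x y) p q T) = W g p q T"
  and "hom f [x] [] ==> W f p q T = W g (x#p) q (W (ev x y) p q T)"
proof -
 obtain m n where t': "dual_sorts x y" "hom f (replicate m x) (replicate n x)" "hom g (replicate n y) (replicate m y)"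
  and tt: "!!T. W f [] (replicate n y) (W (evs x y n) [] [] T) = W g (replicate m x) [] (W (evs x y m) [] [] T)" using t unfolding transp_def by blast
 note [simp] = ev_arrow[OF t'(1)] evs_hom[OF t'(1), unfolded hom_def]
 have mn: "hom f (replicate m' x) (replicate n' x) ==> m' = m & n' = n" for m' n' using t'(2) unfolding hom_def by (metis length_replicate)
 have "wh [] f (replicate n y) >> evs x y n = wh (replicate m x) g [] >> evs x y m"
  by (rule chain_eqI) (use t' tt in \<open>simp_all add: hom_def chain\<close>)
 note tw = chain_cong[OF this, of p q T]
 show "hom f [x, x] [x, x] ==> W f p (y#y#q) (W (ev x y) (x#p) (y#q) (W (ev x y) p q T)) =
   W g (x#x#p) q (W (ev x y) (x#p) (y#q) (W (ev x y) p q T))" using mn[of 2 2] tw t'(3) by (auto simp: hom_def numeral_2_eq_2 chain)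
 show "hom f [x, x] [x] ==> W f p (y#q) (W (ev x y) p q T) =
   W g (x#x#p) q (W (ev x y) (x#p) (y#q) (W (ev x y) p q T))" using mn[of 2 1] tw t'(3) by (auto simp: hom_def numeral_2_eq_2 chain)
 show "hom f [x] [x, x] ==> W f p (y#y#q) (W (ev x y) (x#p) (y#q) (W (ev x y) p q T)) =
   W g (x#p) q (W (ev x y) p q T)" using mn[of 1 2] tw t'(3) by (auto simp: hom_def numeral_2_eq_2 chain)
 show "hom f [] [x] ==> W f p (y#q) (W (ev x y) p q T) = W g p q T" using mn[of 0 1] tw t'(3) by (auto simp: hom_def numeral_2_eq_2 chain)
 show "hom f [x] [] ==> W f p q T = W g (x#p) q (W (ev x y) p q T)" using mn[of 1 0] tw t'(3) by (auto simp: hom_def numeral_2_eq_2 chain)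
qed

end

context mate_pair begin

lemma braid_inv_x: "braid_slides Psyi v al y p q T"
proof -
 have "W Psyi p (v#q) (W al (y#p) q (W al p (y#q) T)) =
  W Psyi p (v#q) (W Psy p (v#q) (W al (y#p) q (W al p (y#q) (W Psyi (v#p) q T))))" by (subst braid, simp add: chain)
 also have "... = W al (y#p) q (W al p (y#q) (W Psyi (v#p) q T))" by (simp add: chain)
 finally show ?thesis .
qed

lemma comult_twist:
 assumes h: "hom De [y] [y, y]"
  and comp: "!!p q T. comult_slides al De v y p q T"
 shows "comult_slides al (De >> Psy) v y p q T"
  and "comult_slides al (De >> Psyi) v y p q T"
proof -
 note [simp] = h[unfolded hom_def]
 show "comult_slides al (De >> Psy) v y p q T" by (simp add: chain comp braid)
 show "comult_slides al (De >> Psyi) v y p q T" by (simp add: chain comp braid_inv_x)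
qed

lemma mult_twist:
 assumes h: "hom m [y, y] [y]"
  and comp: "!!p q T. mult_slides m v al y p q T"
 shows "mult_slides (Psy >> m) v al y p q T"
  and "mult_slides (Psyi >> m) v al y p q T"
proof -
 note [simp] = h[unfolded hom_def]
 show "mult_slides (Psy >> m) v al y p q T" by (simp add: chain comp braid)
 show "mult_slides (Psyi >> m) v al y p q T" by (simp add: chain comp braid_inv_x)
qed

end

context comodule_mate begin

text \<open>The twisted coaction of the statement, which evaluates the H-leg against U after the inverse of the
braiding of U with H, contracts to the action of U. This identifies it with the coaction obtained by
dualising twice.\<close>

lemma coact_mate:
 assumes h: "hom be [x, y] [y, x]" "hom bei [y, x] [x, y]"
  and inv: "be >> bei = ida [x, y]"
  and bmate: "!!p q T. W be p (y#q) (W e (y#p) q T) = W Psyi (x#p) q (W e p (y#q) T)"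
 shows "W tai p q (W act p q T) = W rh p (x#q) (W bei (v#p) q (W e (v#p) q T))"
proof -
 note [simp] = h[unfolded hom_def]
 have 1: "W ta p q (W rh p (x#q) T) = W rh (x#p) q (W ta p (y#q) (W be (v#p) q T))" for p q T
 proof -
 have "wh [] ta [] >> wh [] rh [x] = wh [x] rh [] >> wh [] ta [y] >> wh [v] be []"
 proof (rule separation1[OF dual, of _ "[x, v]" "[v, y]"])
  fix T
  have "W ta [] [y] (W rh [] [x, y] (W e [y, v] [] T)) =
  W ta [] [y] (W e [v] [] (W rh [] [] T))" by (simp add: slide)
 also have "... = W ali [x] [] (W rh [y, x] [] (W e [] [v, y] T))" by (subst mate, simp add: slide)
 also have "... = W rh [x] [y] (W ta [] [y, y] (W be [v] [y] (W e [y, v] [] T)))"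
  by (subst coact_inv, subst mate[symmetric], subst bmate, simp add: slide)
  finally show "W (wh [] ta [] >> wh [] rh [x]) [] [y] (W e (rev [v, y]) [] T) =
    W (wh [x] rh [] >> wh [] ta [y] >> wh [v] be []) [] [y] (W e (rev [v, y]) [] T)" by (simp add: chain)
 qed (simp_all add: hom_def)
 from chain_cong[OF this, of p q T] show ?thesis by (simp add: chain)
qed
 have bb: "W be p q (W bei p q T) = Idw (rev p @ x#y#q) T" for p q T using chain_cong[OF inv, of p q T] by (simp add: chain)
 have "W tai p q (W act p q T) =
  W tai p q (W ta p q (W rh p (x#q) (W bei (v#p) q (W e (v#p) q T))))" by (subst act, subst lco, subst mate[symmetric], subst 1, simp add: chain bb)
 also have "... = W rh p (x#q) (W bei (v#p) q (W e (v#p) q T))" by (simp add: chain)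
 finally show ?thesis .
qed

end

text \<open>The mate of the mate: first from y to x, then back from x to y.\<close>

locale double_mate = paired_words S pr for S :: "'s => ('k::field, 'z::ab_group_add) vs" and pr +
 fixes x y v :: 's and al ali ta tai ch chi Psy Psyi Psx Psxi :: "('s, 'z, 'k) arr"
 assumes dual: "dual_sorts x y"
  and homs: "hom al [y, v] [v, y]" "hom ali [v, y] [y, v]" "hom ta [x, v] [v, x]" "hom tai [v, x] [x, v]"
   "hom ch [y, v] [v, y]" "hom chi [v, y] [y, v]"
   "hom Psx [x, x] [x, x]" "hom Psxi [x, x] [x, x]" "hom Psy [y, y] [y, y]" "hom Psyi [y, y] [y, y]"
  and inverses: "al >> ali = ida [y, v]" "ali >> al = ida [v, y]"
   "ta >> tai = ida [x, v]" "tai >> ta = ida [v, x]" "ch >> chi = ida [y, v]" "chi >> ch = ida [v, y]"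
   "Psx >> Psxi = ida [x, x]" "Psxi >> Psx = ida [x, x]"
   "Psy >> Psyi = ida [y, y]" "Psyi >> Psy = ida [y, y]"
  and mate: "!!p q T. are_mates ta y (ev x y) v ali x p q T"
  and mate': "!!p q T. are_mates ch x (ev y x) v tai y p q T"
  and transp_Psi: "transp x y Psx Psy"
  and braid: "!!p q T. braid_slides Psy v al y p q T"
begin

sublocale M1: mate_pair S pr x y v al ali ta tai Psy Psyi Psx Psxi
 by unfold_locales (use dual homs inverses mate braid transp_W(1)[OF transp_Psi homs(7)] in simp_all)

sublocale M2: mate_pair S pr y x v ta tai ch chi Psx Psxi Psy Psyi
 by unfold_locales (use dual_sorts_sym[OF dual] homs inverses mate' M1.braid_x transp_W(1)[OF transp_sym[OF transp_Psi] homs(9)] in simp_all)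

lemma transp_Psii: "transp x y Psxi Psyi"
 by (rule transp_inverse[OF transp_Psi, of 2]) (use homs inverses in \<open>simp_all add: hom_def numeral_2_eq_2\<close>)

lemmas braid'' = M2.braid_x

lemma braid_inv'': "braid_slides Psyi v ch y p q T"
proof -
 have "W Psyi p (v#q) (W ch (y#p) q (W ch p (y#q) T)) =
  W Psyi p (v#q) (W Psy p (v#q) (W ch (y#p) q (W ch p (y#q) (W Psyi (v#p) q T))))" by (simp add: chain braid'')
  then show ?thesis by (simp add: chain)
qed

lemma comult_twist'':
 assumes h: "hom De [y] [y, y]"
  and comp: "!!p q T. comult_slides ch De v y p q T"
 shows "comult_slides ch (De >> Psy) v y p q T"
  and "comult_slides ch (De >> Psyi) v y p q T"
proof -
 note [simp] = h[unfolded hom_def]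
 show "comult_slides ch (De >> Psy) v y p q T" by (simp add: chain comp braid'')
 show "comult_slides ch (De >> Psyi) v y p q T" by (simp add: chain comp braid_inv'')
qed

lemma mult_twist'':
 assumes h: "hom m [y, y] [y]"
  and comp: "!!p q T. mult_slides m v ch y p q T"
 shows "mult_slides (Psy >> m) v ch y p q T"
  and "mult_slides (Psyi >> m) v ch y p q T"
proof -
 note [simp] = h[unfolded hom_def]
 show "mult_slides (Psy >> m) v ch y p q T" by (simp add: chain comp braid'')
 show "mult_slides (Psyi >> m) v ch y p q T" by (simp add: chain comp braid_inv'')
qed

end

locale double_comodule = double_mate +
 fixes rh rh' De ep my eta be bei
 assumes cohoms: "hom rh [v] [v, y]" "hom rh' [v] [v, y]" "hom De [y] [y, y]" "hom ep [y] []" "hom be [x, y] [y, x]" "hom bei [y, x] [x, y]"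
  and comp: "!!p q T. comult_slides al De v y p q T"
  and compu: "!!p q T. counit_slides al ep v p q T"
  and coassoc: "!!p q T. coact_coassoc rh y De v p q T"
  and counit: "!!p q T. coact_counital rh ep v p q T"
  and coact_braid: "!!p q T. coact_braids al rh y Psy v p q T"
  and beta_inv: "be >> bei = ida [x, y]"
  and beta_mate: "!!p q T. W be p (y#q) (W (ev x y) (y#p) q T) = W Psyi (x#p) q (W (ev x y) p (y#q) T)"
  and rho': "!!p q T. transported rh' x (ev y x) v rh bei (ev x y) p q T"
  and transp_mu: "transp x y my (De >> Psyi)" and transp_eta: "transp x y eta ep"
  and dualhoms: "hom my [x, x] [x]" "hom eta [] [x]"
begin

sublocale A: comodule_mate S pr x y v al ali ta tai Psy Psyi Psx Psxi rh by unfold_locales (use cohoms coact_braid in simp_all)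

sublocale B: module_mate S pr y x v ta tai ch chi Psx Psxi Psy Psyi A.act rh'
 by unfold_locales (use cohoms A.act_hom A.act_braid A.coact_mate[OF cohoms(5,6) beta_inv beta_mate] rho' in simp_all)

lemma hom_D: "hom (De >> Psyi) [y] [y, y]" "hom ((De >> Psyi) >> Psyi) [y] [y, y]" using cohoms homs by (auto intro: hom_comp)

lemma mu_compat: "mult_slides my v ta x p q T"
 by (rule M1.mult_x[OF hom_D(1) dualhoms(1) M1.comult_twist(2)[OF cohoms(3) comp] transp_W(2)[OF transp_mu dualhoms(1)]])

lemma comult'': "comult_slides ch ((De >> Psyi) >> Psyi) v y p q T" by (rule comult_twist''(2)[OF hom_D(1)])
  (rule M2.comult_x[OF dualhoms(1) hom_D(1) mu_compat transp_W(3)[OF transp_sym[OF transp_mu] hom_D(1)]])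

lemma counit'': "counit_slides ch ep v p q T"
 by (rule M2.counit_x[OF dualhoms(2) cohoms(4) M1.unit_x[OF cohoms(4) dualhoms(2) compu transp_W(4)[OF transp_eta dualhoms(2)]]
    transp_W(5)[OF transp_sym[OF transp_eta] cohoms(4), symmetric]])

lemma coassoc'': "coact_coassoc rh' y ((De >> Psyi) >> Psyi) v p q T"
proof (rule B.coact_coassoc[OF dualhoms(1) hom_D(2) mu_compat])
 show "act_assoc A.act x my v p q T" for p q T by (rule A.act_mult[OF cohoms(3) dualhoms(1) comp coassoc])
   (use transp_W(2)[OF transp_mu dualhoms(1)] cohoms in \<open>simp add: W_comp hom_def\<close>)
 have "transp y x ((De >> Psyi) >> Psyi) (Psxi >> my)"
  by (rule transp_comp[OF transp_sym[OF transp_mu] transp_sym[OF transp_Psii]]) (use homs in \<open>simp add: hom_def\<close>)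
 from transp_W(3)[OF this hom_D(2)] dualhoms
 show "W ((De >> Psyi) >> Psyi) p (x#x#q) (W (ev y x) (y#p) (x#q) (W (ev y x) p q T)) =
   W Psxi (y#p) q (W my (y#p) q (W (ev y x) p q T))" for p q T by (simp add: W_comp hom_def)
qed

lemma act_unit: "act_unital eta v A.act p q T" by (rule A.act_unit[OF cohoms(4) dualhoms(2) compu counit transp_W(4)[OF transp_eta dualhoms(2)]])

lemma coact_counit'': "coact_counital rh' ep v p q T"
 by (rule B.coact_counit[OF dualhoms(2) cohoms(4) M1.unit_x[OF cohoms(4) dualhoms(2) compu transp_W(4)[OF transp_eta dualhoms(2)]]
    act_unit transp_W(5)[OF transp_sym[OF transp_eta] cohoms(4), symmetric]])

lemmas coact_braid'' = B.coact_braid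

end

locale double_comodule_algebra = double_comodule +
 fixes m u n de epx
 assumes alghoms: "hom m [y, y] [y]" "hom u [] [y]" "hom n [v, v] [v]" "hom de [x] [x, x]" "hom epx [x] []"
  and compm: "!!p q T. mult_slides m v al y p q T"
  and compun: "!!p q T. unit_slides u v al p q T"
  and compV: "!!p q T. multV_slides n y al v p q T"
  and multV: "!!p q T. coact_multiplicative n rh v y al m p q T"
  and transp_delta: "transp x y de (Psy >> m)" and transp_counit: "transp x y epx u"
begin

lemma hom_m: "hom (Psy >> m) [y, y] [y]" "hom (Psy >> (Psy >> m)) [y, y] [y]" using alghoms homs by (auto intro: hom_comp)

lemma delta_compat: "comult_slides ta de v x p q T"
 by (rule M1.comult_x[OF hom_m(1) alghoms(4) M1.mult_twist(1)[OF alghoms(1) compm] transp_W(3)[OF transp_delta alghoms(4)]])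

lemma mult'': "mult_slides (Psy >> (Psy >> m)) v ch y p q T" by (rule mult_twist''(1)[OF hom_m(1)])
  (rule M2.mult_x[OF alghoms(4) hom_m(1) delta_compat transp_W(2)[OF transp_sym[OF transp_delta] hom_m(1)]])

lemma counit_compat: "counit_slides ta epx v p q T" by (rule M1.counit_x[OF alghoms(2,5) compun transp_W(5)[OF transp_counit alghoms(5), symmetric]])

lemma unit'': "unit_slides u v ch p q T" by (rule M2.unit_x[OF alghoms(5,2) counit_compat transp_W(4)[OF transp_sym[OF transp_counit] alghoms(2)]])

lemma multV_compat: "multV_slides n x ta v p q T" by (rule M1.multV_x[OF alghoms(3) compV])

lemma multV'': "multV_slides n y ch v p q T" by (rule M2.multV_x[OF alghoms(3) multV_compat])

lemma act_multV: "act_multiplicative n x A.act de v ta p q T" by (rule A.act_multV[OF alghoms(3,1,4) compV compm multV])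
  (use transp_W(3)[OF transp_delta alghoms(4)] alghoms homs in \<open>simp add: W_comp hom_def\<close>)

lemma coact_mult'': "coact_multiplicative n rh' v y ch (Psy >> (Psy >> m)) p q T"
proof (rule B.coact_multV[OF alghoms(3,4) hom_m(2) multV_compat delta_compat act_multV])
 have "transp y x (Psy >> (Psy >> m)) (de >> Psx)"
  by (rule transp_comp[OF transp_sym[OF transp_Psi] transp_sym[OF transp_delta]]) (use homs in \<open>simp add: hom_def\<close>)
 from transp_W(2)[OF this hom_m(2)] alghoms homs
 show "W (Psy >> (Psy >> m)) p (x#q) (W (ev y x) p q T) =
   W de (y#y#p) q (W Psx (y#y#p) q (W (ev y x) (y#p) (x#q) (W (ev y x) p q T)))" for p q T by (simp add: W_comp hom_def)
qed

lemma unitV'':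
 assumes j: "hom j [] [v]" and comp: "!!p q T. unitV_slides j y al p q T"
 shows "unitV_slides j y ch p q T" by (rule M2.unitV_x[OF j M1.unitV_x[OF j comp]])

lemma coact_unit'':
 assumes j: "hom j [] [v]" and comp: "!!p q T. unitV_slides j y al p q T"
  and unit: "!!p q T. W j p q (W rh p q T) = W j p q (W u (v#p) q T)"
 shows "W j p q (W rh' p q T) = W j p q (W u (v#p) q T)"
 by (rule B.coact_unitV[OF j alghoms(5,2) M1.unitV_x[OF j comp] _ transp_W(4)[OF transp_sym[OF transp_counit] alghoms(2)]])
  (rule A.act_unitV[OF j alghoms(2,5) compun unit transp_W(5)[OF transp_counit alghoms(5), symmetric]])

end

locale double_module = double_mate +
 fixes nv rh m u de epx
 assumes modhoms: "hom nv [y, v] [v]" "hom rh [v] [v, x]" "hom m [y, y] [y]" "hom u [] [y]" "hom de [x] [x, x]" "hom epx [x] []"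
  and act_braid: "!!p q T. act_braids nv y al Psy v p q T"
  and compm: "!!p q T. mult_slides m v al y p q T"
  and compun: "!!p q T. unit_slides u v al p q T"
  and act_assoc: "!!p q T. act_assoc nv y m v p q T"
  and act_unit: "!!p q T. act_unital u v nv p q T"
  and rho: "!!p q T. W rh p (y#q) (W (ev x y) (v#p) q T) = W ali p q (W nv p q T)"
  and transp_delta: "transp x y de (Psy >> m)" and transp_counit: "transp x y epx u"
begin

sublocale B: module_mate S pr x y v al ali ta tai Psy Psyi Psx Psxi nv rh by unfold_locales (use modhoms act_braid rho in simp_all)

sublocale A: comodule_mate S pr y x v ta tai ch chi Psx Psxi Psy Psyi rh by unfold_locales (use modhoms B.coact_braid in simp_all)

lemma act_formula: "W A.act p q T = W rh (y#p) q (W ch p (x#q) (W (ev y x) (v#p) q T))" by (simp only: A.act A.lco mate')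

abbreviation "de0 == de >> Psxi"
abbreviation "de1 == de0 >> Psxi"

lemma hom_m: "hom (Psyi >> m) [y, y] [y]" "hom (Psyi >> (Psyi >> m)) [y, y] [y]"
 "hom de0 [x] [x, x]" "hom de1 [x] [x, x]" using modhoms homs by (auto intro: hom_comp)

lemma transp_d0: "transp x y de0 m"
proof -
 have "transp x y de0 (Psyi >> (Psy >> m))" by (rule transp_comp[OF transp_delta transp_Psii]) (use homs modhoms in \<open>simp add: hom_def\<close>)
 moreover have "Psyi >> (Psy >> m) = m" by (rule chain_eqI) (use homs modhoms in \<open>simp_all add: hom_def chain\<close>)
 ultimately show ?thesis by simp
qed

lemma transp_d1: "transp x y de1 (Psyi >> m)" by (rule transp_comp[OF transp_d0 transp_Psii]) (use homs modhoms in \<open>simp add: hom_def\<close>)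

lemma transp_d2: "transp y x (Psyi >> (Psyi >> m)) (de1 >> Psxi)"
 by (rule transp_comp[OF transp_sym[OF transp_Psii] transp_sym[OF transp_d1]]) (use homs modhoms in \<open>simp add: hom_def\<close>)

lemma delta_compat: "comult_slides ta de1 v x p q T" by (rule M2.comult_twist(2)[OF hom_m(3)])
  (rule M1.comult_x[OF modhoms(3) hom_m(3) compm transp_W(3)[OF transp_d0 hom_m(3)]])

lemma counit_compat: "counit_slides ta epx v p q T" by (rule M1.counit_x[OF modhoms(4,6) compun transp_W(5)[OF transp_counit modhoms(6), symmetric]])

lemma coassoc: "coact_coassoc rh x de1 v p q T" by (rule B.coact_coassoc[OF modhoms(3) hom_m(4) compm act_assoc])
  (use transp_W(3)[OF transp_d1 hom_m(4)] modhoms homs in \<open>simp add: W_comp hom_def\<close>)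

lemma counit: "coact_counital rh epx v p q T"
 by (rule B.coact_counit[OF modhoms(4,6) compun act_unit transp_W(5)[OF transp_counit modhoms(6), symmetric]])

lemma mult'': "mult_slides (Psyi >> (Psyi >> m)) v ch y p q T" by (rule mult_twist''(2)[OF hom_m(1)])
  (rule M2.mult_x[OF hom_m(4,1) delta_compat transp_W(2)[OF transp_sym[OF transp_d1] hom_m(1)]])

lemma unit'': "unit_slides u v ch p q T" by (rule M2.unit_x[OF modhoms(6,4) counit_compat transp_W(4)[OF transp_sym[OF transp_counit] modhoms(4)]])

lemma act_assoc'': "act_assoc A.act y (Psyi >> (Psyi >> m)) v p q T" by (rule A.act_mult[OF hom_m(4,2) delta_compat coassoc])
  (use transp_W(2)[OF transp_d2 hom_m(2)] hom_m(4) homs in \<open>simp add: W_comp[of de1] hom_def\<close>)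

lemma act_unit'': "act_unital u v A.act p q T"
 by (rule A.act_unit[OF modhoms(6,4) counit_compat counit transp_W(4)[OF transp_sym[OF transp_counit] modhoms(4)]])

lemmas act_braid'' = A.act_braid

end

locale double_module_algebra = double_module +
 fixes De ep n my eta
 assumes alghoms: "hom De [y] [y, y]" "hom ep [y] []" "hom n [v, v] [v]" "hom my [x, x] [x]" "hom eta [] [x]"
  and compD: "!!p q T. comult_slides al De v y p q T"
  and compu: "!!p q T. counit_slides al ep v p q T"
  and compV: "!!p q T. multV_slides n y al v p q T"
  and multV: "!!p q T. act_multiplicative n y nv De v al p q T"
  and transp_mu: "transp x y my (De >> Psyi)" and transp_eta: "transp x y eta ep"
begin

abbreviation "my1 == Psx >> my"
abbreviation "my2 == Psx >> my1"

lemma hom_D: "hom (De >> Psy) [y] [y, y]" "hom ((De >> Psy) >> Psy) [y] [y, y]" "hom my1 [x, x] [x]" "hom my2 [x, x] [x]"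
 using alghoms homs by (auto intro: hom_comp)

lemma transp_mu1: "transp x y my1 De"
proof -
 have "transp x y my1 ((De >> Psyi) >> Psy)" by (rule transp_comp[OF transp_Psi transp_mu]) (use homs alghoms in \<open>simp add: hom_def\<close>)
 moreover have "(De >> Psyi) >> Psy = De" by (rule chain_eqI) (use homs alghoms in \<open>simp_all add: hom_def chain\<close>)
 ultimately show ?thesis by simp
qed

lemma transp_mu2: "transp x y my2 (De >> Psy)" by (rule transp_comp[OF transp_Psi transp_mu1]) (use homs alghoms in \<open>simp add: hom_def\<close>)

lemma transp_mu3: "transp y x ((De >> Psy) >> Psy) (Psx >> my2)"
 by (rule transp_comp[OF transp_sym[OF transp_mu2] transp_sym[OF transp_Psi]]) (use homs alghoms in \<open>simp add: hom_def\<close>)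

lemma mu_compat: "mult_slides my2 v ta x p q T"
 by (rule M1.mult_x[OF hom_D(1,4) M1.comult_twist(1)[OF alghoms(1) compD] transp_W(2)[OF transp_mu2 hom_D(4)]])

lemma comult'': "comult_slides ch ((De >> Psy) >> Psy) v y p q T" by (rule comult_twist''(1)[OF hom_D(1)])
  (rule M2.comult_x[OF hom_D(4,1) mu_compat transp_W(3)[OF transp_sym[OF transp_mu2] hom_D(1)]])

lemma eta_compat: "unit_slides eta v ta p q T" by (rule M1.unit_x[OF alghoms(2,5) compu transp_W(4)[OF transp_eta alghoms(5)]])

lemma counit'': "counit_slides ch ep v p q T"
 by (rule M2.counit_x[OF alghoms(5,2) eta_compat transp_W(5)[OF transp_sym[OF transp_eta] alghoms(2), symmetric]])

lemma multV_compat: "multV_slides n x ta v p q T" by (rule M1.multV_x[OF alghoms(3) compV])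

lemma multV'': "multV_slides n y ch v p q T" by (rule M2.multV_x[OF alghoms(3) multV_compat])

lemma coact_multV: "coact_multiplicative n rh v x ta my2 p q T" by (rule B.coact_multV[OF alghoms(3,1) hom_D(4) compV compD multV])
  (use transp_W(2)[OF transp_mu2 hom_D(4)] alghoms homs in \<open>simp add: W_comp[of De] hom_def\<close>)

lemma act_mult'': "act_multiplicative n y A.act ((De >> Psy) >> Psy) v ch p q T"
 by (rule A.act_multV[OF alghoms(3) hom_D(4,2) multV_compat mu_compat coact_multV])
  (use transp_W(3)[OF transp_mu3 hom_D(2)] hom_D(4) homs in \<open>simp add: W_comp[of _ my2] hom_def\<close>)

lemma unitV'':
 assumes j: "hom j [] [v]" and comp: "!!p q T. unitV_slides j y al p q T"
 shows "unitV_slides j y ch p q T" by (rule M2.unitV_x[OF j M1.unitV_x[OF j comp]])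

lemma act_unitV'':
 assumes j: "hom j [] [v]" and comp: "!!p q T. unitV_slides j y al p q T"
  and unit: "!!p q T. W j (y#p) q (W nv p q T) = W ep p q (W j p q T)"
 shows "W j (y#p) q (W A.act p q T) = W ep p q (W j p q T)"
 by (rule A.act_unitV[OF j alghoms(5,2) eta_compat _ transp_W(5)[OF transp_sym[OF transp_eta] alghoms(2), symmetric]])
  (rule B.coact_unitV[OF j alghoms(2,5) comp unit transp_W(4)[OF transp_eta alghoms(5)]])

end

section \<open>Tensors as functionals\<close>

lemma dual_carr: "f : carr (dual X) <-> linf X f & (\<forall>x. x ~: carr X --> f x = 0)" by (simp add: dual_def)

lemma dual_eqI: "f : carr (dual X) ==> g : carr (dual X) ==> (!!x. x : carr X ==> f x = g x) ==> f = g" by (rule ext) (metis dual_carr)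

lemma Hom_dual: "f : Hom X ground ==> app f : carr (dual X)" by (simp add: Hom_def dual_carr)

lemma bilinear_mult:
 "linf X ph ==> linf Y ps ==> bilinear_map X Y ground (%x y. ph x * ps y)" by (simp add: bilinear_map_def linear_ground_iff algebra_simps)

lemma fpair:
 assumes X: "vspace X" and Y: "vspace Y" and l: "linf X ph" "linf Y ps"
 shows fpair_dual: "fpair X Y ph ps : carr (dual (X >< Y))"
  and fpair_linear: "linf (X >< Y) (fpair X Y ph ps)"
  and fpair_pure: "x : carr X ==> y : carr Y ==> fpair X Y ph ps (pure X Y x y) = ph x * ps y"
 using tlift_Hom[OF X Y vspace_ground bilinear_mult[OF l]] tlift_pure[OF X Y vspace_ground bilinear_mult[OF l]]
 by (auto simp: fpair_def Hom_dual Hom_linear)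

lemma twpair_fpair: "twpair X Y xi eta = fpair X Y eta xi" by (simp add: twpair_def fpair_def mult.commute)

text \<open>Evaluating the second tensor factor, and the first one, by a functional.\<close>

definition sliceR where "sliceR X Y ps = tlift X Y X (%x y. scal X (ps y) x)"
definition sliceL where "sliceL X Y ph = tlift X Y Y (%x y. scal Y (ph x) y)"

lemma scal_bilinear:
 assumes "vspace X"
 shows "c : carr X ==> scal X (a + b) c = scal X a c + scal X b c" "scal X (a * b) c = scal X a (scal X b c)"
  "scal X a (c + d) = scal X a c + scal X a d" "scal X a (scal X b c) = scal X b (scal X a c)"
proof -
 interpret vector_space "scal X" using assms by (simp add: vspace_def)
 show "scal X (a + b) c = scal X a c + scal X b c" "scal X (a * b) c = scal X a (scal X b c)"
  "scal X a (c + d) = scal X a c + scal X a d" "scal X a (scal X b c) = scal X b (scal X a c)"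
  by (simp_all add: scale_left_distrib scale_right_distrib mult.commute)
qed

lemma slice_bilinear:
 assumes X: "vspace X" and Y: "vspace Y"
 shows "linf Y ps ==> bilinear_map X Y X (%x y. scal X (ps y) x)"
  and "linf X ph ==> bilinear_map X Y Y (%x y. scal Y (ph x) y)" using vspace_scal[OF X] vspace_scal[OF Y]
 by (simp_all add: bilinear_map_def linear_map_def ground_def scal_bilinear[OF X] scal_bilinear[OF Y])

lemma sliceR:
 assumes X: "vspace X" and Y: "vspace Y" and p: "linf Y ps"
 shows sliceR_Hom: "sliceR X Y ps : Hom (X >< Y) X"
  and sliceR_fpair: "linf X xi ==> t : carr (X >< Y) ==> xi (sliceR X Y ps$t) = fpair X Y xi ps t"
proof -
 note b = slice_bilinear(1)[OF X Y p]
 show h: "sliceR X Y ps : Hom (X >< Y) X" unfolding sliceR_def by (rule tlift_Hom[OF X Y X b])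
 assume xi: "linf X xi" and t: "t : carr (X >< Y)"
 show "xi (sliceR X Y ps$t) = fpair X Y xi ps t"
 proof (rule tensor_linear_eqI[OF X Y linear_comp[OF Hom_linear[OF h] xi] fpair_linear[OF X Y xi p] _ t])
  fix x y assume "x : carr X" "y : carr Y"
  then show "xi (sliceR X Y ps$(pure X Y x y)) = fpair X Y xi ps (pure X Y x y)"
   by (simp add: sliceR_def tlift_pure[OF X Y X b] fpair_pure[OF X Y xi p] linear_ground_simps(2)[OF xi] mult.commute)
 qed
qed

lemma sliceL:
 assumes X: "vspace X" and Y: "vspace Y" and p: "linf X ph"
 shows sliceL_Hom: "sliceL X Y ph : Hom (X >< Y) Y"
  and sliceL_fpair: "linf Y xi ==> t : carr (X >< Y) ==> xi (sliceL X Y ph$t) = fpair X Y ph xi t"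
proof -
 note b = slice_bilinear(2)[OF X Y p]
 show h: "sliceL X Y ph : Hom (X >< Y) Y" unfolding sliceL_def by (rule tlift_Hom[OF X Y Y b])
 assume xi: "linf Y xi" and t: "t : carr (X >< Y)"
 show "xi (sliceL X Y ph$t) = fpair X Y ph xi t"
 proof (rule tensor_linear_eqI[OF X Y linear_comp[OF Hom_linear[OF h] xi] fpair_linear[OF X Y p xi] _ t])
  fix x y assume "x : carr X" "y : carr Y"
  then show "xi (sliceL X Y ph$(pure X Y x y)) = fpair X Y ph xi (pure X Y x y)"
   by (simp add: sliceL_def tlift_pure[OF X Y Y b] fpair_pure[OF X Y p xi] linear_ground_simps(2)[OF xi])
 qed
qed

lemma linear_sum_list:
 assumes X: "vspace X" and f: "linear_map X Y f" and h: "!!a. a : set L ==> h a : carr X"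
 shows "sum_list (map h L) : carr X" "f (sum_list (map h L)) = sum_list (map (%a. f (h a)) L)"
proof -
 have add: "f (a + b) = f a + f b" if "a : carr X" "b : carr X" for a b using f that by (simp add: linear_map_def)
 have 0: "f 0 = 0" using add[OF vspace_zero[OF X] vspace_zero[OF X]] by simp
 have "sum_list (map h L) : carr X & f (sum_list (map h L)) = sum_list (map (%a. f (h a)) L)"
  using h by (induction L) (simp_all add: 0 vspace_zero[OF X] vspace_add[OF X] add)
 then show "sum_list (map h L) : carr X" "f (sum_list (map h L)) = sum_list (map (%a. f (h a)) L)" by auto
qed

lemma tensor_list:
 assumes X: "vspace X" and Y: "vspace Y" and t: "t : carr (X >< Y)"
 shows "\<exists>L \<in> lists (carr X \<times> carr Y). t = sum_list (map (%(x, y). pure X Y x y) L)" using X Y t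
proof (induction t rule: tensor_induct)
 case zero
 show ?case by (rule bexI[of _ "[]"]) auto
next
 case (pure x y)
 then show ?case by (intro bexI[of _ "[(x, y)]"]) auto
next
 case (add s t)
 then obtain L L' where "L : lists (carr X \<times> carr Y)" "L' : lists (carr X \<times> carr Y)"
  "s = sum_list (map (%(x, y). pure X Y x y) L)" "t = sum_list (map (%(x, y). pure X Y x y) L')" by auto
 then show ?case by (intro bexI[of _ "L @ L'"]) auto
qed

text \<open>A sum of pure tensors that vanishes under all functionals on the first factor is zero: a dependent
first factor is eliminated, and independent ones have dual functionals.\<close>

lemma pure_sums_zero:
 fixes X :: "('k::field, 'a::ab_group_add) vs" and Y :: "('k, 'b::ab_group_add) vs"
 assumes X: "vspace X" and Y: "vspace Y"
 shows "L : lists (carr X \<times> carr Y) ==>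
  (!!xi. linf X xi ==> sum_list (map (%(x, y). scal Y (xi x) y) L) = 0) ==>
  sum_list (map (%(x, y). pure X Y x y) L) = 0"
proof (induction "length L" arbitrary: L)
 case 0
 then show ?case by simp
next
 case (Suc n)
 interpret Y: vector_space "scal Y" using Y by (simp add: vspace_def)
 interpret X: vector_space "scal X" using X by (simp add: vspace_def)
 interpret T: vector_space "scal (X >< Y)" using vT[of X Y] by (simp add: vspace_def)
 obtain x y L' where L: "L = (x, y)#L'" "length L' = n" using Suc.hyps(2) by (cases L) auto
 have x: "x : carr X" and y: "y : carr Y" and L': "L' : lists (carr X \<times> carr Y)" using Suc.prems(1) L by auto
 have p1: "pure X Y (a - scal X c b) z = pure X Y a z - scal (X >< Y) c (pure X Y b z)"
  if "a : carr X" "b : carr X" "z : carr Y" for a b c z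
 proof -
  have "pure X Y ((a - scal X c b) + scal X c b) z = pure X Y (a - scal X c b) z + pure X Y (scal X c b) z"
   using pure_linear1[OF X Y that(3)] vspace_diff[OF X that(1) vspace_scal[OF X that(2)]] vspace_scal[OF X that(2)] unfolding linear_map_def by blast
  moreover have "pure X Y (scal X c b) z = scal (X >< Y) c (pure X Y b z)" using pure_linear1[OF X Y that(3)] that(2) by (simp add: linear_map_def)
  ultimately show ?thesis by simp
 qed
 have p0: "pure X Y 0 z = 0" "pure X Y w 0 = 0" if "z : carr Y" "w : carr X" for z w
  using linear_ground_0 pure_linear1[OF X Y that(1)] pure_linear2[OF X Y that(2)] vspace_zero[OF X] vspace_zero[OF Y]
  unfolding linear_map_def by (metis add.right_neutral add_cancel_left_right)+
 show ?case
 proof (cases "x = 0")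
  case True
  have "sum_list (map (%(x, y). pure X Y x y) L') = 0"
  proof (rule Suc.hyps(1)[OF L(2)[symmetric] L'])
   fix xi assume xi: "linf X xi"
   show "sum_list (map (%(x, y). scal Y (xi x) y) L') = 0" using Suc.prems(2)[OF xi] by (simp add: L True linear_ground_0[OF X xi])
  qed
  then show ?thesis using p0(1)[OF y x] by (simp add: L True)
 next
  case False
  then obtain xi where xi: "linf X xi" "xi x ~= 0" using separating_functional[OF X] by blast
  define r where "r a = xi a / xi x" for a
  define K where "K = map (%(a, b). (a - scal X (r a) x, b)) L'"
  have "scal Y (xi x) y + sum_list (map (%(a, b). scal Y (xi a) b) L') = 0" using Suc.prems(2)[OF xi(1)] by (simp add: L)
  moreover have "sum_list (map (%(a, b). scal Y (xi a) b) L') = scal Y (xi x) (sum_list (map (%(a, b). scal Y (r a) b) L'))"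
   using xi(2) by (induction L') (auto simp: r_def Y.scale_right_distrib)
  ultimately have "scal Y (xi x) (y + sum_list (map (%(a, b). scal Y (r a) b) L')) = 0" by (simp add: Y.scale_right_distrib)
  then have ys: "y + sum_list (map (%(a, b). scal Y (r a) b) L') = 0" using xi(2) by simp
  then have ys': "sum_list (map (%(a, b). scal Y (r a) b) L') = - y" by (metis add_eq_0_iff)
  have "sum_list (map (%(x, y). pure X Y x y) K) = 0"
  proof (rule Suc.hyps(1))
   show "n = length K" by (simp add: K_def L)
   show "K : lists (carr X \<times> carr Y)" using L' vspace_diff[OF X _ vspace_scal[OF X x]] unfolding K_def by fastforce
   fix \<zeta> assume z: "linf X \<zeta>"
   have "sum_list (map (%(x, y). scal Y (\<zeta> x) y) K) =
     sum_list (map (%(x, y). scal Y (\<zeta> x) y) L') - scal Y (\<zeta> x) (sum_list (map (%(a, b). scal Y (r a) b) L'))" using L' unfolding K_def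
    by (induction L' rule: list.induct) (auto simp: linear_ground_diff[OF X z _ x] Y.scale_left_diff_distrib Y.scale_right_distrib mult.commute)
   also have "... = sum_list (map (%(x, y). scal Y (\<zeta> x) y) L') + scal Y (\<zeta> x) y" by (simp add: ys' Y.scale_minus_right)
   also have "... = 0" using Suc.prems(2)[OF z] by (simp add: L add.commute)
   finally show "sum_list (map (%(x, y). scal Y (\<zeta> x) y) K) = 0" .
  qed
  moreover have "sum_list (map (%(x, y). pure X Y x y) K) =
    sum_list (map (%(x, y). pure X Y x y) L') - pure X Y x (sum_list (map (%(a, b). scal Y (r a) b) L'))"
  proof -
   have px: "pure X Y x (scal Y c b) = scal (X >< Y) c (pure X Y x b)" if "b : carr Y" for c b
    using pure_linear2[OF X Y x] that by (simp add: linear_map_def)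
   have "sum_list (map (%(x, y). pure X Y x y) K) =
     sum_list (map (%p. (case p of (a, b) => pure X Y a b) - pure X Y x (case p of (a, b) => scal Y (r a) b)) L')" unfolding K_def map_map
   proof (intro arg_cong[of _ _ sum_list] map_cong refl)
    fix p assume "p : set L'"
    then obtain a b where "p = (a, b)" "a : carr X" "b : carr Y" using L' by fastforce
    then show "((%(x, y). pure X Y x y) \<circ> (%(a, b). (a - scal X (r a) x, b))) p =
      (case p of (a, b) => pure X Y a b) - pure X Y x (case p of (a, b) => scal Y (r a) b)" by (simp only: o_def prod.case p1 x px)
   qed
   also have "... = sum_list (map (%(x, y). pure X Y x y) L') - sum_list (map (%p. pure X Y x (case p of (a, b) => scal Y (r a) b)) L')"
    by (rule sum_list_subtractf)
   also have "sum_list (map (%p. pure X Y x (case p of (a, b) => scal Y (r a) b)) L') =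
     pure X Y x (sum_list (map (%(a, b). scal Y (r a) b) L'))"
    by (rule linear_sum_list(2)[OF Y pure_linear2[OF X Y x], symmetric]) (use L' vspace_scal[OF Y] in fastforce)
   finally show ?thesis .
  qed
  moreover have "pure X Y x y + pure X Y x (- y) = 0"
   using pure_linear2[OF X Y x] y vspace_scal[OF Y y, of "-1"] p0(2)[OF y x] unfolding linear_map_def
   by (metis Y.scale_minus_left Y.scale_one add.right_inverse)
  ultimately show ?thesis using ys' by (simp only: L list.map sum_list.Cons prod.case) (metis add.commute eq_iff_diff_eq_0)
 qed
qed

lemma fpair_separates:
 assumes X: "vspace X" and Y: "vspace Y" and t: "t : carr (X >< Y)" and s: "s : carr (X >< Y)"
  and eq: "!!xi eta. linf X xi ==> linf Y eta ==> fpair X Y xi eta t = fpair X Y xi eta s"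
 shows "t = s"
proof -
 note T = vT[of X Y]
 interpret T: vector_space "scal (X >< Y)" using T by (simp add: vspace_def)
 have d: "t - s : carr (X >< Y)" using vspace_diff[OF T t s] .
 obtain L where L: "L : lists (carr X \<times> carr Y)" "t - s = sum_list (map (%(x, y). pure X Y x y) L)" using tensor_list[OF X Y d] by blast
 have "sum_list (map (%(x, y). pure X Y x y) L) = 0"
 proof (rule pure_sums_zero[OF X Y L(1)])
  fix xi assume xi: "linf X xi"
  note h = sliceL_Hom[OF X Y xi]
  have "sliceL X Y xi$(sum_list (map (%(x, y). pure X Y x y) L)) =
    sum_list (map (%p. sliceL X Y xi$(case p of (x, y) => pure X Y x y)) L)"
   by (rule linear_sum_list(2)[OF T Hom_linear[OF h]]) (use L(1) pT in fastforce)
  also have "... = sum_list (map (%(x, y). scal Y (xi x) y) L)" by (intro arg_cong[of _ _ sum_list] map_cong refl)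
    (use L(1) in \<open>auto simp: sliceL_def tlift_pure[OF X Y Y slice_bilinear(2)[OF X Y xi]]\<close>)
  finally have "sum_list (map (%(x, y). scal Y (xi x) y) L) = sliceL X Y xi$(sum_list (map (%(x, y). pure X Y x y) L))" by (rule sym)
  then have "sum_list (map (%(x, y). scal Y (xi x) y) L) = sliceL X Y xi$(t - s)" by (simp only: L(2))
  also have "... = 0"
  proof (rule functionals_separate[OF Y Hom_in[OF h d] vspace_zero[OF Y]])
   fix eta assume eta: "linf Y eta"
   have "eta (sliceL X Y xi$(t - s)) = fpair X Y xi eta (t - s)" by (rule sliceL_fpair[OF X Y xi eta d])
   also have "... = 0" using linear_ground_diff[OF T fpair_linear[OF X Y xi eta] t s, of 1] eq[OF xi eta] by simp
   finally show "eta (sliceL X Y xi$(t - s)) = eta 0" by (simp add: linear_ground_0[OF Y eta])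
  qed
  finally show "sum_list (map (%(x, y). scal Y (xi x) y) L) = 0" .
 qed
 then show ?thesis using L(2) by simp
qed

definition pairs :: "('k::field, 'a::ab_group_add) vs => ('k, 'b::ab_group_add) vs => ('a => 'b => 'k) => bool" where
 "pairs X A i <-> vspace X & vspace A & bilinear_map X A ground i &
   (\<forall>x\<in>carr X. \<forall>x'\<in>carr X. (\<forall>a\<in>carr A. i x a = i x' a) --> x = x')"

lemma pairsD:
 assumes "pairs X A i"
 shows pairs_vs: "vspace X" "vspace A" and pairs_left: "a : carr A ==> linf X (%x. i x a)"
  and pairs_right: "x : carr X ==> linf A (i x)"
  and pairs_eqI: "x : carr X ==> x' : carr X ==> (!!a. a : carr A ==> i x a = i x' a) ==> x = x'"
 using assms by (auto simp: pairs_def bilinear_map_def)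

lemma pairs_dual: "vspace X ==> pairs X (dual X) ev_at"
proof -
 assume X: "vspace X"
 have "x = x'" if "x : carr X" "x' : carr X" and e: "\<forall>a\<in>carr (dual X). a x = a x'" for x x'
 proof (rule functionals_separate[OF X that(1,2)])
  fix xi assume xi: "linf X xi"
  have "app (mk X ground xi) : carr (dual X)" by (rule Hom_dual[OF mk_Hom[OF X xi]])
  then show "xi x = xi x'" using e that by (metis mk_app)
 qed
 then show ?thesis using X vspace_dual[OF X] by (auto simp: pairs_def bilinear_map_def ev_at_def linear_ground_iff dual_def)
qed

lemma subspace_vs: "subspace_of U X ==> vspace X ==> vspace U" by (simp add: subspace_of_def vspace_def)

lemma pairs_sub:
 assumes X: "vspace X" and U: "subspace_of U (dual X)"
 shows "pairs U X (%f. f)" and "nondegenerate U X ==> pairs X U ev_at"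
proof -
 have vU: "vspace U" by (rule subspace_vs[OF U vspace_dual[OF X]])
 have sub: "f : carr (dual X)" if "f : carr U" for f using U that by (auto simp: subspace_of_def)
 have sc: "scal U = (%c f x. c * f x)" using U by (simp add: subspace_of_def dual_def)
 have l: "linf X f" if "f : carr U" for f using sub[OF that] by (simp add: dual_carr)
 have e: "linf U (%f. f x)" for x by (simp add: linear_ground_iff sc)
 show "pairs U X (%f. f)" unfolding pairs_def bilinear_map_def by (auto simp: X vU intro: l e dual_eqI[OF sub sub])
 show "nondegenerate U X ==> pairs X U ev_at" unfolding pairs_def bilinear_map_def nondegenerate_def ev_at_def by (auto simp: X vU l e)
qed

lemma pairs_separate:
 assumes i: "pairs X A i" and j: "pairs Y B j" and t: "t : carr (X >< Y)" and s: "s : carr (X >< Y)"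
  and eq: "!!a b. a : carr A ==> b : carr B ==> fpair X Y (%x. i x a) (%y. j y b) t = fpair X Y (%x. i x a) (%y. j y b) s"
 shows "t = s"
proof -
 note X = pairs_vs(1)[OF i] and Y = pairs_vs(1)[OF j]
 have 1: "fpair X Y xi (%y. j y b) t = fpair X Y xi (%y. j y b) s" if xi: "linf X xi" and b: "b : carr B" for xi b
 proof -
  note h = sliceR_Hom[OF X Y pairs_left[OF j b]] and f = sliceR_fpair[OF X Y pairs_left[OF j b]]
  have "sliceR X Y (%y. j y b)$t = sliceR X Y (%y. j y b)$s" by (rule pairs_eqI[OF i Hom_in[OF h t] Hom_in[OF h s]])
    (simp add: f[OF pairs_left[OF i] t] f[OF pairs_left[OF i] s] eq b)
  then show ?thesis using f[OF xi t] f[OF xi s] by simp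
 qed
 show ?thesis
 proof (rule fpair_separates[OF X Y t s])
  fix xi eta assume xi: "linf X xi" and eta: "linf Y eta"
  note h = sliceL_Hom[OF X Y xi] and f = sliceL_fpair[OF X Y xi]
  have "sliceL X Y xi$t = sliceL X Y xi$s" by (rule pairs_eqI[OF j Hom_in[OF h t] Hom_in[OF h s]])
    (simp add: f[OF pairs_left[OF j] t] f[OF pairs_left[OF j] s] 1[OF xi])
  then show "fpair X Y xi eta t = fpair X Y xi eta s" using f[OF eta t] f[OF eta s] by simp
 qed
qed

lemma dual_simps: "scal (dual X) = (%c f x. c * f x)" by (simp add: dual_def)

lemma linear_into_dual:
 assumes D: "vspace D" and d: "!!x. x : carr X ==> g x : carr (dual D)" and X: "vspace X"
  and l: "!!d. d : carr D ==> linf X (%x. g x d)"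
 shows "linear_map X (dual D) g"
proof -
 have out: "g x e = 0" if "x : carr X" "e ~: carr D" for x e using d[OF that(1)] that(2) by (simp add: dual_carr)
 have "g (x + y) e = g x e + g y e" if "x : carr X" "y : carr X" for x y e
  using l[of e] out[of _ e] vspace_add[OF X that] that by (cases "e : carr D") (simp_all add: linear_ground_iff)
 moreover have "g (scal X c x) e = c * g x e" if "x : carr X" for c x e
  using l[of e] out[of _ e] vspace_scal[OF X that] that by (cases "e : carr D") (simp_all add: linear_ground_iff)
 ultimately show ?thesis using d unfolding linear_map_def[of X "dual D"] by (simp add: dual_simps fun_eq_iff)
qed

lemma form_tlift:
 assumes Z: "vspace Z" and W: "vspace W" and b: "bilinear_map Z W ground g"
 shows "app (tlift Z W ground g) : carr (dual (Z >< W))"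
  "z : carr Z ==> w : carr W ==> (tlift Z W ground g)$(pure Z W z w) = g z w"
 using tlift_Hom[OF Z W vspace_ground b] tlift_pure[OF Z W vspace_ground b] by (auto simp: Hom_dual)

lemma form_linear:
 assumes Z: "vspace Z" and W: "vspace W" and X: "vspace X"
  and b: "!!x. x : carr X ==> bilinear_map Z W ground (g x)"
  and l: "!!z w. z : carr Z ==> w : carr W ==> linf X (%x. g x z w)"
 shows "linear_map X (dual (Z >< W)) (%x. app (tlift Z W ground (g x)))"
proof (rule linear_into_dual[OF vT _ X])
 show "app (tlift Z W ground (g x)) : carr (dual (Z >< W))" if "x : carr X" for x by (rule form_tlift[OF Z W b[OF that]])
 show "linf X (%x. (tlift Z W ground (g x))$d)" if "d : carr (Z >< W)" for d
  using bilinear_tlift1[OF Z W X vspace_ground b l] that by (simp add: bilinear_map_def)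
qed

lemma form_bilinear:
 assumes Z: "vspace Z" and W: "vspace W" and X: "vspace X" and Y: "vspace Y"
  and b: "!!x y. x : carr X ==> y : carr Y ==> bilinear_map Z W ground (g x y)"
  and l: "!!z w. z : carr Z ==> w : carr W ==> bilinear_map X Y ground (%x y. g x y z w)"
 shows "bilinear_map X Y (dual (Z >< W)) (%x y. app (tlift Z W ground (g x y)))" unfolding bilinear_map_def using b l
 by (auto intro!: form_linear[OF Z W] simp: X Y bilinear_map_def)

lemma temb:
 assumes i: "pairs X A i" and j: "pairs Y B j"
 shows temb_Hom: "temb X Y A B i j : Hom (X >< Y) (dual (A >< B))"
  and temb_app: "t : carr (X >< Y) ==> a : carr A ==> b : carr B ==>
   (temb X Y A B i j$t) (pure A B a b) = fpair X Y (%x. i x a) (%y. j y b) t"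
  and temb_inj: "inj_on (app (temb X Y A B i j)) (carr (X >< Y))"
proof -
 note vs = pairs_vs(2)[OF i] pairs_vs(2)[OF j] pairs_vs(1)[OF i] pairs_vs(1)[OF j]
 have b: "bilinear_map X Y (dual (A >< B)) (%x y. fpair A B (i x) (j y))" unfolding fpair_def
  by (rule form_bilinear[OF vs]) (simp_all add: bilinear_mult pairs_left[OF i] pairs_left[OF j] pairs_right[OF i] pairs_right[OF j])
 show h: "temb X Y A B i j : Hom (X >< Y) (dual (A >< B))" unfolding temb_def by (rule tlift_Hom[OF vs(3,4) vspace_dual[OF vT] b])
 show app: "(temb X Y A B i j$t) (pure A B a b) = fpair X Y (%x. i x a) (%y. j y b) t"
  if t: "t : carr (X >< Y)" and a: "a : carr A" "b : carr B" for t a b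
 proof (rule tensor_linear_eqI[OF vs(3,4) _ fpair_linear[OF vs(3,4)] _ t])
  have "linf (dual (A >< B)) (%f. f (pure A B a b))" by (simp add: linear_ground_iff dual_simps)
  from linear_comp[OF Hom_linear[OF h] this]
  show "linf (X >< Y) (%t. (temb X Y A B i j$t) (pure A B a b))" .
  fix x y assume "x : carr X" "y : carr Y"
  then show "(temb X Y A B i j$(pure X Y x y)) (pure A B a b) = fpair X Y (%x. i x a) (%y. j y b) (pure X Y x y)"
   using a by (simp add: temb_def tlift_pure[OF vs(3,4) vspace_dual[OF vT] b] fpair_pure vs pairs_left[OF i] pairs_left[OF j] pairs_right[OF i] pairs_right[OF j])
 qed (use a in \<open>simp_all add: pairs_left[OF i] pairs_left[OF j]\<close>)
 show "inj_on (app (temb X Y A B i j)) (carr (X >< Y))"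
 proof (rule inj_onI)
  fix t s assume ts: "t : carr (X >< Y)" "s : carr (X >< Y)" and eq: "temb X Y A B i j$t = temb X Y A B i j$s"
  show "t = s"
  proof (rule pairs_separate[OF i j ts])
   fix a b assume "a : carr A" "b : carr B"
   from app[OF ts(1) this] app[OF ts(2) this]
   show "fpair X Y (%x. i x a) (%y. j y b) t = fpair X Y (%x. i x a) (%y. j y b) s" by (simp only: eq)
  qed
 qed
qed

lemma induced_Hom:
 assumes E: "E : Hom T D" "inj_on (app E) (carr T)" and F: "F : Hom S D" and T: "vspace T" and S: "vspace S"
  and l: "lands (E, F)"
 shows "induced (E, F) : Hom S T" and "s : carr S ==> E$(induced (E, F)$s) = F$s"
proof -
 note src = Hom_src[OF E(1)] Hom_src[OF F]
 let ?g = "%s. inv_into (carr T) (app E) (F$s)"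
 have g: "?g s : carr T" "E$(?g s) = F$s" if "s : carr S" for s
 proof -
  have "F$s : app E ` carr T" using subsetD[OF l[unfolded lands.simps src] imageI[OF that]] .
  then show "?g s : carr T" "E$(?g s) = F$s" by (rule inv_into_into, rule f_inv_into_f)
 qed
 have lin: "linear_map S T ?g" unfolding linear_map_def
 proof (intro conjI ballI allI)
  fix s s' assume s: "s : carr S" "s' : carr S"
  note g' = g[OF vspace_add[OF S s]]
  show "?g (s + s') = ?g s + ?g s'"
  proof (rule inj_onD[OF E(2) _ g'(1) vspace_add[OF T g(1)[OF s(1)] g(1)[OF s(2)]]])
   show "E$(?g (s + s')) = E$(?g s + ?g s')"
    unfolding g'(2) Hom_add[OF E(1) g(1)[OF s(1)] g(1)[OF s(2)]] g(2)[OF s(1)] g(2)[OF s(2)] by (rule Hom_add[OF F s])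
  qed
 next
  fix c s assume s: "s : carr S"
  note g' = g[OF vspace_scal[OF S s]]
  show "?g (scal S c s) = scal T c (?g s)"
  proof (rule inj_onD[OF E(2) _ g'(1) vspace_scal[OF T g(1)[OF s]]])
   show "E$(?g (scal S c s)) = E$(scal T c (?g s))" unfolding g'(2) Hom_scal[OF E(1) g(1)[OF s]] g(2)[OF s] by (rule Hom_scal[OF F s])
  qed
 qed (simp add: g)
 show "induced (E, F) : Hom S T" unfolding induced.simps src by (rule mk_Hom[OF S lin])
 show "s : carr S ==> E$(induced (E, F)$s) = F$s" unfolding induced.simps src by (simp add: mk_app g)
qed

lemma induced_Iso:
 assumes E: "E : Hom T D" "inj_on (app E) (carr T)" and F: "F : Hom S D" and T: "vspace T" and S: "vspace S"
  and b: "bijective (E, F)"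
 shows "induced (E, F) : Iso S T" and "s : carr S ==> E$(induced (E, F)$s) = F$s"
proof -
 note src = Hom_src[OF E(1)] Hom_src[OF F]
 have b': "bij_betw (app F) (carr S) (app E ` carr T)" using b by (simp add: src)
 then have l: "lands (E, F)" by (simp add: src bij_betw_def)
 note h = induced_Hom[OF E F T S l]
 have "bij_betw (app (induced (E, F))) (carr S) (carr T)"
 proof (rule bij_betw_imageI)
  show "inj_on (app (induced (E, F))) (carr S)" using bij_betw_imp_inj_on[OF b'] h(2) unfolding inj_on_def by metis
  show "app (induced (E, F)) ` carr S = carr T"
  proof
   show "app (induced (E, F)) ` carr S \<subseteq> carr T" using Hom_in[OF h(1)] by blast
   show "carr T \<subseteq> app (induced (E, F)) ` carr S"
   proof
    fix t assume t: "t : carr T"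
    then obtain s where s: "s : carr S" "E$t = F$s" using b' unfolding bij_betw_def by (metis imageE imageI)
    have "t = induced (E, F)$s" by (rule inj_onD[OF E(2) _ t Hom_in[OF h(1) s(1)]]) (simp only: s(2) h(2)[OF s(1)])
    then show "t : app (induced (E, F)) ` carr S" using s by blast
   qed
  qed
 qed
 then show "induced (E, F) : Iso S T" using h(1) by (simp add: Iso_def)
 show "s : carr S ==> E$(induced (E, F)$s) = F$s" by (rule h(2))
qed

lemma fpair_param:
 assumes X: "vspace X" and Y: "vspace Y" and t: "t : carr (X >< Y)"
 shows "bilinear_map X A ground f ==> vspace A ==> linf Y ps ==> linf A (%a. fpair X Y (%x. f x a) ps t)"
  and "bilinear_map Y B ground g ==> vspace B ==> linf X ph ==> linf B (%b. fpair X Y ph (%y. g y b) t)"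
proof -
 assume f: "bilinear_map X A ground f" and A: "vspace A" and p: "linf Y ps"
 show "linf A (%a. fpair X Y (%x. f x a) ps t)" by (rule mk_linear_cong[OF A sliceR_fpair[OF X Y p _ t]])
   (use f Hom_in[OF sliceR_Hom[OF X Y p] t] in \<open>simp_all add: bilinear_map_def\<close>)
next
 assume g: "bilinear_map Y B ground g" and B: "vspace B" and p: "linf X ph"
 show "linf B (%b. fpair X Y ph (%y. g y b) t)" by (rule mk_linear_cong[OF B sliceL_fpair[OF X Y p _ t]])
   (use g Hom_in[OF sliceL_Hom[OF X Y p] t] in \<open>simp_all add: bilinear_map_def\<close>)
qed

section \<open>Dual braidings and dual structure on elements\<close>

lemma fpair_of_map:
 assumes P: "vspace P" and Q: "vspace Q" and X: "vspace X" and Y: "vspace Y" and F: "F : Hom (P >< Q) (X >< Y)"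
  and l: "linf X ph" "linf Y ps"
 shows "p : carr P ==> linf Q (%q. fpair X Y ph ps (F$(pure P Q p q)))"
  and "q : carr Q ==> linf P (%p. fpair X Y ph ps (F$(pure P Q p q)))"
 using linear_comp[OF linear_comp[OF pure_linear2[OF P Q] Hom_linear[OF F]] fpair_linear[OF X Y l]]
  linear_comp[OF linear_comp[OF pure_linear1[OF P Q] Hom_linear[OF F]] fpair_linear[OF X Y l]] by blast+

text \<open>An identity between tensors that holds after contraction with a separating family of functionals holds
after contraction with every functional, as the other leg is compared vector by vector.\<close>

lemma functional_separation:
 assumes i: "pairs X A i" and Y: "vspace Y" "linf Y ps" and Y': "vspace Y'" "linear_map Y' ground ps'"
  and xi: "linf X xi"
 shows "t1 : carr (X >< Y) ==> s1 : carr (Y' >< X) ==> (!!a. a : carr A ==> fpair X Y (%x. i x a) ps t1 = fpair Y' X ps' (%x. i x a) s1) ==>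
   fpair X Y xi ps t1 = fpair Y' X ps' xi s1"
  and "t2 : carr (X >< Y) ==> s2 : carr (X >< Y') ==> (!!a. a : carr A ==> fpair X Y (%x. i x a) ps t2 = fpair X Y' (%x. i x a) ps' s2) ==>
   fpair X Y xi ps t2 = fpair X Y' xi ps' s2"
  and "t3 : carr (Y >< X) ==> s3 : carr (Y' >< X) ==> (!!a. a : carr A ==> fpair Y X ps (%x. i x a) t3 = fpair Y' X ps' (%x. i x a) s3) ==>
   fpair Y X ps xi t3 = fpair Y' X ps' xi s3"
proof -
 note X = pairs_vs(1)[OF i]
 note r = sliceR[OF X Y] sliceL[OF Y(1) X Y(2)] sliceR[OF X Y'] sliceL[OF Y'(1) X Y'(2)]
 have sep: "x = x'" if "x : carr X" "x' : carr X" "!!a. a : carr A ==> i x a = i x' a" for x x' by (rule pairs_eqI[OF i that])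
 show "fpair X Y xi ps t = fpair Y' X ps' xi s"
  if t: "t : carr (X >< Y)" and s: "s : carr (Y' >< X)" and "!!a. a : carr A ==> fpair X Y (%x. i x a) ps t = fpair Y' X ps' (%x. i x a) s" for t s
 proof -
  have "sliceR X Y ps$t = sliceL Y' X ps'$s"
   by (rule sep[OF Hom_in[OF r(1) t] Hom_in[OF r(7) s]]) (simp add: r(2)[OF pairs_left[OF i] t] r(8)[OF pairs_left[OF i] s] that(3))
  then show ?thesis using r(2)[OF xi t] r(8)[OF xi s] by simp
 qed
 show "fpair X Y xi ps t = fpair X Y' xi ps' s"
  if t: "t : carr (X >< Y)" and s: "s : carr (X >< Y')" and "!!a. a : carr A ==> fpair X Y (%x. i x a) ps t = fpair X Y' (%x. i x a) ps' s" for t s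
 proof -
  have "sliceR X Y ps$t = sliceR X Y' ps'$s"
   by (rule sep[OF Hom_in[OF r(1) t] Hom_in[OF r(5) s]]) (simp add: r(2)[OF pairs_left[OF i] t] r(6)[OF pairs_left[OF i] s] that(3))
  then show ?thesis using r(2)[OF xi t] r(6)[OF xi s] by simp
 qed
 show "fpair Y X ps xi t = fpair Y' X ps' xi s"
  if t: "t : carr (Y >< X)" and s: "s : carr (Y' >< X)" and "!!a. a : carr A ==> fpair Y X ps (%x. i x a) t = fpair Y' X ps' (%x. i x a) s" for t s
 proof -
  have "sliceL Y X ps$t = sliceL Y' X ps'$s"
   by (rule sep[OF Hom_in[OF r(3) t] Hom_in[OF r(7) s]]) (simp add: r(4)[OF pairs_left[OF i] t] r(8)[OF pairs_left[OF i] s] that(3))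
  then show ?thesis using r(4)[OF xi t] r(8)[OF xi s] by simp
 qed
qed

text \<open>Bijectivity onto the embedded tensor product makes the induced map an isomorphism, and its defining
formula, given for separating functionals, extends to all functionals.\<close>

lemma mateL:
 assumes i: "pairs X W i" and j: "pairs Y Z j" and F: "Ph : Hom (Y >< W) (W >< Y)" and b: "bijective (mateL X Y Z W i j Ph)"
 shows mateL_Iso: "induced (mateL X Y Z W i j Ph) : Iso (X >< Y) (Y >< X)"
  and mateL_fpair: "x : carr X ==> y : carr Y ==> w : carr W ==> linf Y xi ==>
   fpair Y X xi (%x'. i x' w) (induced (mateL X Y Z W i j Ph)$(pure X Y x y)) = fpair W Y (i x) xi (Ph$(pure Y W y w))"
proof -
 note vs = pairs_vs[OF i] pairs_vs[OF j]
 let ?g = "%x y z w. fpair W Y (i x) (%y'. j y' z) (Ph$(pure Y W y w))"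
 let ?F = "tlift X Y (dual (Z >< W)) (%x y. app (tlift Z W ground (?g x y)))"
 let ?E = "temb Y X Z W j i"
 have eq: "mateL X Y Z W i j Ph = (?E, ?F)" by (simp add: mateL_def twpair_fpair)
 have ib: "bilinear_map W X ground (%w x. i x w)" "bilinear_map Y Z ground j" using i j bilinear_swap by (auto simp: pairs_def)
 have in1: "Ph$(pure Y W y w) : carr (W >< Y)" if "y : carr Y" "w : carr W" for y w using Hom_in[OF F pT[OF that]] .
 have b1: "bilinear_map Z W ground (?g x y)" if "x : carr X" "y : carr Y" for x y unfolding bilinear_map_def using that
  by (auto intro: fpair_of_map(1)[OF vs(3,2,2,3) F] fpair_param(2)[OF vs(2,3) in1 ib(2) vs(4)] pairs_right[OF i] pairs_left[OF j])
 have b2: "bilinear_map X Y ground (%x y. ?g x y z w)" if "z : carr Z" "w : carr W" for z w unfolding bilinear_map_def using that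
  by (auto intro: fpair_of_map(2)[OF vs(3,2,2,3) F] fpair_param(1)[OF vs(2,3) in1 ib(1) vs(1)] pairs_right[OF i] pairs_left[OF j])
 note bb = form_bilinear[OF vs(4,2,1,3) b1 b2]
 have Fh: "?F : Hom (X >< Y) (dual (Z >< W))" by (rule tlift_Hom[OF vs(1,3) vspace_dual[OF vT] bb])
 note I = induced_Iso[OF temb_Hom[OF j i] temb_inj[OF j i] Fh vT vT b[unfolded eq], folded eq]
 show "induced (mateL X Y Z W i j Ph) : Iso (X >< Y) (Y >< X)" by (rule I(1))
 assume x: "x : carr X" and y: "y : carr Y" and w: "w : carr W" and xi: "linf Y xi"
 have t: "induced (mateL X Y Z W i j Ph)$(pure X Y x y) : carr (Y >< X)" by (rule Hom_in[OF Iso_Hom[OF I(1)] pT[OF x y]])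
 show "fpair Y X xi (%x'. i x' w) (induced (mateL X Y Z W i j Ph)$(pure X Y x y)) = fpair W Y (i x) xi (Ph$(pure Y W y w))"
 proof (rule functional_separation(1)[OF j vs(1) pairs_left[OF i w] vs(2) pairs_right[OF i x] xi t in1[OF y w]])
  fix z assume z: "z : carr Z"
  have "fpair Y X (%y'. j y' z) (%x'. i x' w) (induced (mateL X Y Z W i j Ph)$(pure X Y x y)) = (?F$(pure X Y x y)) (pure Z W z w)"
   unfolding I(2)[OF pT[OF x y], symmetric] by (rule temb_app[OF j i t z w, symmetric])
  also have "... = ?g x y z w"
   by (rule trans[OF fun_cong[OF tlift_pure[OF vs(1,3) vspace_dual[OF vT] bb x y]] form_tlift(2)[OF vs(4,2) b1[OF x y] z w]])
  finally show "fpair Y X (%y'. j y' z) (%x'. i x' w) (induced (mateL X Y Z W i j Ph)$(pure X Y x y)) = ?g x y z w" .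
 qed
qed

lemma mateR:
 assumes i: "pairs X W i" and j: "pairs Y Z j" and F: "Ph : Hom (Z >< X) (X >< Z)" and b: "bijective (mateR X Y Z W i j Ph)"
 shows mateR_Iso: "induced (mateR X Y Z W i j Ph) : Iso (X >< Y) (Y >< X)"
  and mateR_fpair: "x : carr X ==> y : carr Y ==> z : carr Z ==> linf X xi ==>
   fpair Y X (%y'. j y' z) xi (induced (mateR X Y Z W i j Ph)$(pure X Y x y)) = fpair X Z xi (j y) (Ph$(pure Z X z x))"
proof -
 note vs = pairs_vs[OF i] pairs_vs[OF j]
 let ?g = "%x y z w. fpair X Z (%x'. i x' w) (j y) (Ph$(pure Z X z x))"
 let ?F = "tlift X Y (dual (Z >< W)) (%x y. app (tlift Z W ground (?g x y)))"
 let ?E = "temb Y X Z W j i"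
 have eq: "mateR X Y Z W i j Ph = (?E, ?F)" by (simp add: mateR_def twpair_fpair)
 have ib: "bilinear_map X W ground i" "bilinear_map Z Y ground (%z y. j y z)" using i j bilinear_swap by (auto simp: pairs_def)
 have in1: "Ph$(pure Z X z x) : carr (X >< Z)" if "x : carr X" "z : carr Z" for x z using Hom_in[OF F pT[OF that(2,1)]] .
 have b1: "bilinear_map Z W ground (?g x y)" if "x : carr X" "y : carr Y" for x y unfolding bilinear_map_def using that
  by (auto intro: fpair_of_map(2)[OF vs(4,1,1,4) F] fpair_param(1)[OF vs(1,4) in1 ib(1) vs(2)] pairs_left[OF i] pairs_right[OF j])
 have b2: "bilinear_map X Y ground (%x y. ?g x y z w)" if "z : carr Z" "w : carr W" for z w unfolding bilinear_map_def using that
  by (auto intro: fpair_of_map(1)[OF vs(4,1,1,4) F] fpair_param(2)[OF vs(1,4) in1 ib(2) vs(3)] pairs_left[OF i] pairs_right[OF j])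
 note bb = form_bilinear[OF vs(4,2,1,3) b1 b2]
 have Fh: "?F : Hom (X >< Y) (dual (Z >< W))" by (rule tlift_Hom[OF vs(1,3) vspace_dual[OF vT] bb])
 note I = induced_Iso[OF temb_Hom[OF j i] temb_inj[OF j i] Fh vT vT b[unfolded eq], folded eq]
 show "induced (mateR X Y Z W i j Ph) : Iso (X >< Y) (Y >< X)" by (rule I(1))
 assume x: "x : carr X" and y: "y : carr Y" and z: "z : carr Z" and xi: "linf X xi"
 have t: "induced (mateR X Y Z W i j Ph)$(pure X Y x y) : carr (Y >< X)" by (rule Hom_in[OF Iso_Hom[OF I(1)] pT[OF x y]])
 show "fpair Y X (%y'. j y' z) xi (induced (mateR X Y Z W i j Ph)$(pure X Y x y)) = fpair X Z xi (j y) (Ph$(pure Z X z x))"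
 proof (rule functional_separation(1)[OF i vs(4) pairs_right[OF j y] vs(3) pairs_left[OF j z] xi in1[OF x z] t, symmetric])
  fix w assume w: "w : carr W"
  have "fpair Y X (%y'. j y' z) (%x'. i x' w) (induced (mateR X Y Z W i j Ph)$(pure X Y x y)) = (?F$(pure X Y x y)) (pure Z W z w)"
   unfolding I(2)[OF pT[OF x y], symmetric] by (rule temb_app[OF j i t z w, symmetric])
  also have "... = ?g x y z w"
   by (rule trans[OF fun_cong[OF tlift_pure[OF vs(1,3) vspace_dual[OF vT] bb x y]] form_tlift(2)[OF vs(4,2) b1[OF x y] z w]])
  finally show "?g x y z w = fpair Y X (%y'. j y' z) (%x'. i x' w) (induced (mateR X Y Z W i j Ph)$(pure X Y x y))" by (rule sym)
 qed
qed

lemma Psi_UU: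
 assumes i: "pairs U H (%f. f)" and F: "Ps : Hom (H >< H) (H >< H)" and b: "bijective (Psi_UU H U Ps)"
 shows Psi_UU_Iso: "induced (Psi_UU H U Ps) : Iso (U >< U) (U >< U)"
  and Psi_UU_fpair: "f : carr U ==> g : carr U ==> a : carr H ==> b : carr H ==>
   fpair U U (%f'. f' b) (%g'. g' a) (induced (Psi_UU H U Ps)$(pure U U f g)) = fpair H H g f (Ps$(pure H H a b))"
proof -
 note vs = pairs_vs[OF i]
 let ?g = "%f g b a. fpair H H g f (Ps$(pure H H a b))"
 let ?F = "tlift U U (dual (H >< H)) (%f g. app (tlift H H ground (?g f g)))"
 let ?E = "temb U U H H (%f. f) (%f. f)"
 have eq: "Psi_UU H U Ps = (?E, ?F)" by (simp add: Psi_UU_def twpair_fpair)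
 have ib: "bilinear_map H U ground (%a f. f a)" using i bilinear_swap by (auto simp: pairs_def)
 have in1: "Ps$(pure H H a b) : carr (H >< H)" if "a : carr H" "b : carr H" for a b using Hom_in[OF F pT[OF that]] .
 have b1: "bilinear_map H H ground (?g f g)" if "f : carr U" "g : carr U" for f g unfolding bilinear_map_def using that
  by (auto intro: fpair_of_map[OF vs(2,2,2,2) F] pairs_right[OF i])
 have b2: "bilinear_map U U ground (%f g. ?g f g b a)" if "b : carr H" "a : carr H" for b a unfolding bilinear_map_def using that
  by (auto intro: fpair_param[OF vs(2,2) in1 ib vs(1)] pairs_right[OF i])
 note bb = form_bilinear[OF vs(2,2,1,1) b1 b2]
 have Fh: "?F : Hom (U >< U) (dual (H >< H))" by (rule tlift_Hom[OF vs(1,1) vspace_dual[OF vT] bb])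
 note I = induced_Iso[OF temb_Hom[OF i i] temb_inj[OF i i] Fh vT vT b[unfolded eq], folded eq]
 show "induced (Psi_UU H U Ps) : Iso (U >< U) (U >< U)" by (rule I(1))
 fix b
 assume f: "f : carr U" and g: "g : carr U" and a: "a : carr H" and b: "b : carr H"
 have t: "induced (Psi_UU H U Ps)$(pure U U f g) : carr (U >< U)" by (rule Hom_in[OF Iso_Hom[OF I(1)] pT[OF f g]])
 have "fpair U U (%f'. f' b) (%g'. g' a) (induced (Psi_UU H U Ps)$(pure U U f g)) = (?F$(pure U U f g)) (pure H H b a)"
  unfolding I(2)[OF pT[OF f g], symmetric] by (rule temb_app[OF i i t b a, symmetric])
 also have "... = ?g f g b a"
  by (rule trans[OF fun_cong[OF tlift_pure[OF vs(1,1) vspace_dual[OF vT] bb f g]] form_tlift(2)[OF vs(2,2) b1[OF f g] b a]])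
 finally show "fpair U U (%f'. f' b) (%g'. g' a) (induced (Psi_UU H U Ps)$(pure U U f g)) = ?g f g b a" .
qed

lemma dual_comult:
 assumes i: "pairs U H (%f. f)" and F: "Ps : Hom (H >< H) (H >< H)" and m: "m : Hom (H >< H) H" and l: "lands (dual_comult H m Ps U)"
 shows dual_comult_Hom: "induced (dual_comult H m Ps U) : Hom U (U >< U)"
  and dual_comult_fpair: "f : carr U ==> a : carr H ==> b : carr H ==>
   fpair U U (%f'. f' b) (%g'. g' a) (induced (dual_comult H m Ps U)$f) = f (m$(Ps$(pure H H a b)))"
proof -
 note vs = pairs_vs[OF i]
 let ?E = "tlift U U (dual (H >< H)) (%f g. fpair H H g f)"
 let ?F = "mk U (dual (H >< H)) (%f. app (mk (H >< H) ground (%t. f (m$(Ps$t)))))"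
 have eq: "dual_comult H m Ps U = (?E, ?F)" by (simp add: dual_comult_def) (simp add: twpair_fpair[abs_def])
 have mp: "linear_map (H >< H) H (%t. m$(Ps$t))" by (rule linear_comp[OF Hom_linear[OF F] Hom_linear[OF m]])
 have Fl: "linear_map U (dual (H >< H)) (%f. app (mk (H >< H) ground (%t. f (m$(Ps$t)))))"
 proof (rule linear_into_dual[OF vT _ vs(1)])
  show "app (mk (H >< H) ground (%t. f (m$(Ps$t)))) : carr (dual (H >< H))" if "f : carr U" for f
   by (rule Hom_dual[OF mk_Hom[OF vT linear_comp[OF mp pairs_right[OF i that]]]])
  show "linf U (%f. mk (H >< H) ground (%t. f (m$(Ps$t)))$d)" if d: "d : carr (H >< H)" for d
   using pairs_left[OF i Hom_in[OF m Hom_in[OF F d]]] by (simp add: mk_app d)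
 qed
 have Fh: "?F : Hom U (dual (H >< H))" by (rule mk_Hom[OF vs(1) Fl])
 have b: "bilinear_map U U (dual (H >< H)) (%f g. fpair H H g f)" unfolding fpair_def
 proof (rule form_bilinear[OF vs(2,2,1,1)])
  show "bilinear_map H H ground (%x y. g x * f y)" if "f : carr U" "g : carr U" for f g
   by (rule bilinear_mult[OF pairs_right[OF i that(2)] pairs_right[OF i that(1)]])
  show "bilinear_map U U ground (%f g. g x * f y)" if "x : carr H" "y : carr H" for x y
   using bilinear_mult[OF pairs_left[OF i that(2)] pairs_left[OF i that(1)]] by (simp only: mult.commute)
 qed
 have Eh: "?E : Hom (U >< U) (dual (H >< H))" by (rule tlift_Hom[OF vs(1,1) vspace_dual[OF vT] b])
 have app: "(?E$t) (pure H H a b) = fpair U U (%f. f b) (%g. g a) t"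
  if t: "t : carr (U >< U)" and a: "a : carr H" "b : carr H" for t a b
 proof (rule tensor_linear_eqI[OF vs(1,1) _ fpair_linear[OF vs(1,1)] _ t])
  have "linf (dual (H >< H)) (%f. f (pure H H a b))" by (simp add: linear_ground_iff dual_simps)
  from linear_comp[OF Hom_linear[OF Eh] this]
  show "linf (U >< U) (%t. (?E$t) (pure H H a b))" .
  fix f g assume "f : carr U" "g : carr U"
  then show "(?E$(pure U U f g)) (pure H H a b) = fpair U U (%f. f b) (%g. g a) (pure U U f g)"
   using a by (simp add: tlift_pure[OF vs(1,1) vspace_dual[OF vT] b] fpair_pure vs pairs_left[OF i] pairs_right[OF i] mult.commute)
 qed (use a in \<open>simp_all add: pairs_left[OF i]\<close>)
 have inj: "inj_on (app ?E) (carr (U >< U))"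
 proof (rule inj_onI)
  fix t s assume ts: "t : carr (U >< U)" "s : carr (U >< U)" and eq: "?E$t = ?E$s"
  show "t = s"
  proof (rule pairs_separate[OF i i ts])
   fix a b assume ab: "a : carr H" "b : carr H"
   from app[OF ts(1) ab(2,1)] app[OF ts(2) ab(2,1)]
   show "fpair U U (%x. x a) (%y. y b) t = fpair U U (%x. x a) (%y. y b) s" by (simp only: eq)
  qed
 qed
 note I = induced_Hom[OF Eh inj Fh vT vs(1) l[unfolded eq], folded eq]
 show "induced (dual_comult H m Ps U) : Hom U (U >< U)" by (rule I(1))
 assume f: "f : carr U" and a: "a : carr H" and b: "b : carr H"
 have "fpair U U (%f'. f' b) (%g'. g' a) (induced (dual_comult H m Ps U)$f) = (?F$f) (pure H H a b)"
  unfolding I(2)[OF f, symmetric] by (rule app[OF Hom_in[OF I(1) f] a b, symmetric])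
 then show "fpair U U (%f'. f' b) (%g'. g' a) (induced (dual_comult H m Ps U)$f) = f (m$(Ps$(pure H H a b)))" by (simp add: mk_app f pT a b)
qed

lemma dual_mult:
 fixes U :: "('k::field, 'h::ab_group_add => 'k) vs"
 assumes i: "pairs U H (%f. f)" and F: "Psi : Hom (H >< H) (H >< H)" "Psi = linv Ps" and D: "De : Hom H (H >< H)"
  and U: "unital_dual_subalgebra H De ep Ps U"
 shows "\<exists>my \<in> Hom (U >< U) U. \<forall>f\<in>carr U. \<forall>g\<in>carr U. \<forall>a\<in>carr H. (my$(pure U U f g)) a = fpair H H g f (Psi$(De$a))"
proof -
 note vs = pairs_vs[OF i]
 have ib: "bilinear_map H U ground (%a f. f a)" using i bilinear_swap by (auto simp: pairs_def)
 have in1: "Psi$(De$a) : carr (H >< H)" if "a : carr H" for a using Hom_in[OF F(1) Hom_in[OF D that]] .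
 have sub: "f : carr (dual H)" if "f : carr U" for f using U that by (auto simp: unital_dual_subalgebra_def subspace_of_def)
 have sc: "scal U = scal (dual H)" using U by (simp add: unital_dual_subalgebra_def subspace_of_def)
 let ?d = "dual_mult H De Ps"
 have d: "?d f g a = fpair H H g f (Psi$(De$a))" if "a : carr H" for f g a using that by (simp add: dual_mult_def mk_app twpair_fpair F(2))
 have din: "?d f g : carr U" if "f : carr U" "g : carr U" for f g using U that by (simp add: unital_dual_subalgebra_def)
 have lU: "linear_map X U g" if "linear_map X (dual H) g" "!!x. x : carr X ==> g x : carr U" for X :: "('k, 'h => 'k) vs" and g
  using that by (simp add: linear_map_def sc)
 have b: "bilinear_map U U U ?d" unfolding bilinear_map_def by (auto intro!: lU din linear_into_dual[OF vs(2) sub[OF din] vs(1)] simp: d)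
   (auto intro!: fpair_param[OF vs(2,2) in1 ib vs(1)] simp: d pairs_right[OF i])
 show ?thesis by (rule bexI[OF _ tlift_Hom[OF vs(1,1,1) b]]) (simp add: tlift_pure[OF vs(1,1,1) b] d)
qed

section \<open>Coactions and actions on elements\<close>

lemma form_coaction:
 assumes i: "pairs X Z i" and j: "pairs Y W j" and V: "vspace V"
  and b: "!!v. v : carr V ==> bilinear_map Z W ground (g v)"
  and l: "!!z w. z : carr Z ==> w : carr W ==> linf V (%v. g v z w)"
  and P: "P = (temb X Y Z W i j, mk V (dual (Z >< W)) (%v. app (tlift Z W ground (g v))))" and lands: "lands P"
 shows form_coaction_Hom: "induced P : Hom V (X >< Y)"
  and form_coaction_fpair: "v : carr V ==> z : carr Z ==> w : carr W ==>
   fpair X Y (%x. i x z) (%y. j y w) (induced P$v) = g v z w"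
proof -
 note vs = pairs_vs[OF i] pairs_vs[OF j]
 have F: "mk V (dual (Z >< W)) (%v. app (tlift Z W ground (g v))) : Hom V (dual (Z >< W))" by (rule mk_Hom[OF V form_linear[OF vs(2,4) V b l]])
 note I = induced_Hom[OF temb_Hom[OF i j] temb_inj[OF i j] F vT V lands[unfolded P], folded P]
 show "induced P : Hom V (X >< Y)" by (rule I(1))
 assume v: "v : carr V" and zw: "z : carr Z" "w : carr W"
 have "fpair X Y (%x. i x z) (%y. j y w) (induced P$v) = (temb X Y Z W i j$(induced P$v)) (pure Z W z w)"
  by (rule temb_app[OF i j Hom_in[OF I(1) v] zw, symmetric])
 also have "... = g v z w" unfolding I(2)[OF v] mk_app[OF v] by (rule form_tlift(2)[OF vs(2,4) b[OF v] zw])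
 finally show "fpair X Y (%x. i x z) (%y. j y w) (induced P$v) = g v z w" .
qed

lemma ev_Hom:
 assumes i: "pairs U H (%f. f)"
 shows "ev U H : Hom (U >< H) ground" "ev' H U : Hom (H >< U) ground"
  and "f : carr U ==> a : carr H ==> ev U H$(pure U H f a) = f a"
  and "f : carr U ==> a : carr H ==> ev' H U$(pure H U a f) = f a"
proof -
 note vs = pairs_vs[OF i]
 have b: "bilinear_map U H ground (%f a. f a)" using i by (simp add: pairs_def)
 then have b': "bilinear_map H U ground (%a f. f a)" using bilinear_swap by blast
 show "ev U H : Hom (U >< H) ground" "ev' H U : Hom (H >< U) ground"
  "f : carr U ==> a : carr H ==> ev U H$(pure U H f a) = f a"
  "f : carr U ==> a : carr H ==> ev' H U$(pure H U a f) = f a" unfolding ev_def ev'_def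
  using tlift_Hom[OF vs vspace_ground b] tlift_Hom[OF vs(2,1) vspace_ground b']
   tlift_pure[OF vs vspace_ground b] tlift_pure[OF vs(2,1) vspace_ground b'] by simp_all
qed

lemma rhoR_bq:
 assumes V: "vspace V" and i: "pairs H U ev_at" "pairs U H (%f. f)" and B: "linv (induced (Psi_UH H U Ps)) : Hom (H >< U) (U >< H)"
  and rh: "rh : Hom V (V >< H)" and l: "lands (rhoR_bq H V U Ps rh)"
 shows rhoR_bq_Hom: "induced (rhoR_bq H V U Ps rh) : Hom V (V >< H)"
  and rhoR_bq_fpair: "v : carr V ==> f : carr U ==> linf V xi ==>
   fpair V H xi f (induced (rhoR_bq H V U Ps rh)$v) =
   fpair V H xi (%h. ev U H $ (linv (induced (Psi_UH H U Ps)) $ (pure H U h f))) (rh$v)"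
proof -
 note vs = pairs_vs[OF i(1)]
 note d = pairs_dual[OF V]
 let ?k = "%h f. ev U H $ (linv (induced (Psi_UH H U Ps)) $ (pure H U h f))"
 note K = linear_comp[OF Hom_linear[OF B] Hom_linear[OF ev_Hom(1)[OF i(2)]]]
 have k1: "linf H (%h. ?k h f)" if "f : carr U" for f by (rule linear_comp[OF pure_linear1[OF vs that] K])
 have k2: "linf U (?k h)" if "h : carr H" for h by (rule linear_comp[OF pure_linear2[OF vs that] K])
 have k: "bilinear_map H U ground ?k" using k1 k2 by (simp add: bilinear_map_def)
 have e: "bilinear_map V (dual V) ground (%v e. e v)" using d by (simp add: pairs_def bilinear_map_def ev_at_def)
 have el: "linf V e" if "e : carr (dual V)" for e using that by (simp add: dual_carr)
 have b: "bilinear_map (dual V) U ground (%e f. fpair V H e (%h. ?k h f) (rh$v))" if "v : carr V" for v unfolding bilinear_map_def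
  using fpair_param[OF V vs(1) Hom_in[OF rh that]] e k vspace_dual[OF V] vs(2) k1 el by blast
 have lv: "linf V (%v. fpair V H e (%h. ?k h f) (rh$v))" if "e : carr (dual V)" "f : carr U" for e f
  by (rule linear_comp[OF Hom_linear[OF rh] fpair_linear[OF V vs(1) el[OF that(1)] k1[OF that(2)]]])
 have I1: "induced (rhoR_bq H V U Ps rh) : Hom V (V >< H)" by (rule form_coaction_Hom[OF d i(1) V b lv rhoR_bq_def l])
 have I2: "fpair V H e f (induced (rhoR_bq H V U Ps rh)$v) = fpair V H e (%h. ?k h f) (rh$v)" if "v : carr V" "e : carr (dual V)" "f : carr U" for v e f
  by (rule form_coaction_fpair[OF d i(1) V b lv rhoR_bq_def l, unfolded ev_at_def]) (use that in simp_all)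
 show "induced (rhoR_bq H V U Ps rh) : Hom V (V >< H)" by (rule I1)
 assume v: "v : carr V" and f: "f : carr U" and xi: "linf V xi"
 show "fpair V H xi f (induced (rhoR_bq H V U Ps rh)$v) = fpair V H xi (%h. ?k h f) (rh$v)"
  by (rule functional_separation(2)[OF d vs(1) _ vs(1) k1[OF f] xi Hom_in[OF I1 v] Hom_in[OF rh v]])
   (use I2[OF v _ f] pairs_right[OF i(2) f] in \<open>simp_all add: ev_at_def\<close>)
qed

lemma rhoL_bq:
 assumes V: "vspace V" and i: "pairs H U ev_at" "pairs U H (%f. f)" and B: "linv (induced (Psi_HU H U Ps)) : Hom (U >< H) (H >< U)"
  and rh: "rh : Hom V (H >< V)" and l: "lands (rhoL_bq H V U Ps rh)"
 shows rhoL_bq_Hom: "induced (rhoL_bq H V U Ps rh) : Hom V (H >< V)"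
  and rhoL_bq_fpair: "v : carr V ==> f : carr U ==> linf V xi ==>
   fpair H V f xi (induced (rhoL_bq H V U Ps rh)$v) =
   fpair H V (%h. ev' H U $ (linv (induced (Psi_HU H U Ps)) $ (pure U H f h))) xi (rh$v)"
proof -
 note vs = pairs_vs[OF i(1)]
 note d = pairs_dual[OF V]
 let ?k = "%h f. ev' H U $ (linv (induced (Psi_HU H U Ps)) $ (pure U H f h))"
 note K = linear_comp[OF Hom_linear[OF B] Hom_linear[OF ev_Hom(2)[OF i(2)]]]
 have k1: "linf H (%h. ?k h f)" if "f : carr U" for f by (rule linear_comp[OF pure_linear2[OF vs(2,1) that] K])
 have k2: "linf U (?k h)" if "h : carr H" for h by (rule linear_comp[OF pure_linear1[OF vs(2,1) that] K])
 have k: "bilinear_map H U ground ?k" using k1 k2 by (simp add: bilinear_map_def)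
 have e: "bilinear_map V (dual V) ground (%v e. e v)" using d by (simp add: pairs_def bilinear_map_def ev_at_def)
 have el: "linf V e" if "e : carr (dual V)" for e using that by (simp add: dual_carr)
 have b: "bilinear_map U (dual V) ground (%f e. fpair H V (%h. ?k h f) e (rh$v))" if "v : carr V" for v unfolding bilinear_map_def
  using fpair_param[OF vs(1) V Hom_in[OF rh that]] e k vspace_dual[OF V] vs(2) k1 el by blast
 have lv: "linf V (%v. fpair H V (%h. ?k h f) e (rh$v))" if "f : carr U" "e : carr (dual V)" for e f
  by (rule linear_comp[OF Hom_linear[OF rh] fpair_linear[OF vs(1) V k1[OF that(1)] el[OF that(2)]]])
 have I1: "induced (rhoL_bq H V U Ps rh) : Hom V (H >< V)" by (rule form_coaction_Hom[OF i(1) d V b lv rhoL_bq_def l])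
 have I2: "fpair H V f e (induced (rhoL_bq H V U Ps rh)$v) = fpair H V (%h. ?k h f) e (rh$v)" if "v : carr V" "e : carr (dual V)" "f : carr U" for v e f
  by (rule form_coaction_fpair[OF i(1) d V b lv rhoL_bq_def l, unfolded ev_at_def]) (use that in simp_all)
 show "induced (rhoL_bq H V U Ps rh) : Hom V (H >< V)" by (rule I1)
 assume v: "v : carr V" and f: "f : carr U" and xi: "linf V xi"
 show "fpair H V f xi (induced (rhoL_bq H V U Ps rh)$v) = fpair H V (%h. ?k h f) xi (rh$v)"
  by (rule functional_separation(3)[OF d vs(1) _ vs(1) k1[OF f] xi Hom_in[OF I1 v] Hom_in[OF rh v]])
   (use I2[OF v _ f] pairs_right[OF i(2) f] in \<open>simp_all add: ev_at_def\<close>)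
qed

lemma rhoR_of:
 assumes V: "vspace V" and i: "pairs U H (%f. f)" and P: "linv PsHV : Hom (V >< H) (H >< V)"
  and nv: "nv : Hom (H >< V) V" and l: "lands (rhoR_of H V U PsHV nv)"
 shows rhoR_of_Hom: "induced (rhoR_of H V U PsHV nv) : Hom V (V >< U)"
  and rhoR_of_fpair: "v : carr V ==> a : carr H ==> linf V xi ==>
   fpair V U xi (%f. f a) (induced (rhoR_of H V U PsHV nv)$v) = xi (nv$(linv PsHV$(pure V H v a)))"
proof -
 note vs = pairs_vs[OF i]
 note d = pairs_dual[OF V]
 note L = linear_comp[OF Hom_linear[OF P] Hom_linear[OF nv]]
 have in1: "nv$(linv PsHV$(pure V H v a)) : carr V" if "v : carr V" "a : carr H" for v a using Hom_in[OF nv Hom_in[OF P pT[OF that]]] .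
 have el: "linf V e" if "e : carr (dual V)" for e using that by (simp add: dual_carr)
 have le: "linf (dual V) (%e. e v)" if "v : carr V" for v using pairs_right[OF d that] by (simp add: ev_at_def)
 have b: "bilinear_map (dual V) H ground (%e a. e (nv$(linv PsHV$(pure V H v a))))" if "v : carr V" for v unfolding bilinear_map_def
  using linear_comp[OF linear_comp[OF pure_linear2[OF V vs(2) that] L] el] le[OF in1[OF that]] by simp
 have lv: "linf V (%v. e (nv$(linv PsHV$(pure V H v a))))" if "e : carr (dual V)" "a : carr H" for e a
  by (rule linear_comp[OF linear_comp[OF pure_linear1[OF V vs(2) that(2)] L] el[OF that(1)]])
 have I1: "induced (rhoR_of H V U PsHV nv) : Hom V (V >< U)" by (rule form_coaction_Hom[OF d i V b lv rhoR_of_def l])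
 have I2: "fpair V U e (%f. f a) (induced (rhoR_of H V U PsHV nv)$v) = e (nv$(linv PsHV$(pure V H v a)))" if "v : carr V" "e : carr (dual V)" "a : carr H" for v e a
  by (rule form_coaction_fpair[OF d i V b lv rhoR_of_def l, unfolded ev_at_def]) (use that in simp_all)
 show "induced (rhoR_of H V U PsHV nv) : Hom V (V >< U)" by (rule I1)
 assume v: "v : carr V" and a: "a : carr H" and xi: "linf V xi"
 note h = sliceR[OF V vs(1) pairs_left[OF i a]]
 have "sliceR V U (%f. f a)$(induced (rhoR_of H V U PsHV nv)$v) = nv$(linv PsHV$(pure V H v a))"
  by (rule pairs_eqI[OF d Hom_in[OF h(1) Hom_in[OF I1 v]] in1[OF v a]])
   (use h(2)[OF _ Hom_in[OF I1 v]] el I2[OF v _ a] in \<open>simp add: ev_at_def\<close>)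
 then show "fpair V U xi (%f. f a) (induced (rhoR_of H V U PsHV nv)$v) = xi (nv$(linv PsHV$(pure V H v a)))" using h(2)[OF xi Hom_in[OF I1 v]] by simp
qed

lemma rhoL_of:
 assumes V: "vspace V" and i: "pairs U H (%f. f)" and P: "linv PsVH : Hom (H >< V) (V >< H)"
  and nv: "nv : Hom (V >< H) V" and l: "lands (rhoL_of H V U PsVH nv)"
 shows rhoL_of_Hom: "induced (rhoL_of H V U PsVH nv) : Hom V (U >< V)"
  and rhoL_of_fpair: "v : carr V ==> a : carr H ==> linf V xi ==>
   fpair U V (%f. f a) xi (induced (rhoL_of H V U PsVH nv)$v) = xi (nv$(linv PsVH$(pure H V a v)))"
proof -
 note vs = pairs_vs[OF i]
 note d = pairs_dual[OF V]
 note L = linear_comp[OF Hom_linear[OF P] Hom_linear[OF nv]]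
 have in1: "nv$(linv PsVH$(pure H V a v)) : carr V" if "v : carr V" "a : carr H" for v a using Hom_in[OF nv Hom_in[OF P pT[OF that(2,1)]]] .
 have el: "linf V e" if "e : carr (dual V)" for e using that by (simp add: dual_carr)
 have le: "linf (dual V) (%e. e v)" if "v : carr V" for v using pairs_right[OF d that] by (simp add: ev_at_def)
 have b: "bilinear_map H (dual V) ground (%a e. e (nv$(linv PsVH$(pure H V a v))))" if "v : carr V" for v unfolding bilinear_map_def
  using linear_comp[OF linear_comp[OF pure_linear1[OF vs(2) V that] L] el] le[OF in1[OF that]] by simp
 have lv: "linf V (%v. e (nv$(linv PsVH$(pure H V a v))))" if "a : carr H" "e : carr (dual V)" for e a
  by (rule linear_comp[OF linear_comp[OF pure_linear2[OF vs(2) V that(1)] L] el[OF that(2)]])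
 have I1: "induced (rhoL_of H V U PsVH nv) : Hom V (U >< V)" by (rule form_coaction_Hom[OF i d V b lv rhoL_of_def l])
 have I2: "fpair U V (%f. f a) e (induced (rhoL_of H V U PsVH nv)$v) = e (nv$(linv PsVH$(pure H V a v)))" if "v : carr V" "e : carr (dual V)" "a : carr H" for v e a
  by (rule form_coaction_fpair[OF i d V b lv rhoL_of_def l, unfolded ev_at_def]) (use that in simp_all)
 show "induced (rhoL_of H V U PsVH nv) : Hom V (U >< V)" by (rule I1)
 assume v: "v : carr V" and a: "a : carr H" and xi: "linf V xi"
 note h = sliceL[OF vs(1) V pairs_left[OF i a]]
 have "sliceL U V (%f. f a)$(induced (rhoL_of H V U PsVH nv)$v) = nv$(linv PsVH$(pure H V a v))"
  by (rule pairs_eqI[OF d Hom_in[OF h(1) Hom_in[OF I1 v]] in1[OF v a]])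
   (use h(2)[OF _ Hom_in[OF I1 v]] el I2[OF v _ a] in \<open>simp add: ev_at_def\<close>)
 then show "fpair U V (%f. f a) xi (induced (rhoL_of H V U PsVH nv)$v) = xi (nv$(linv PsVH$(pure H V a v)))" using h(2)[OF xi Hom_in[OF I1 v]] by simp
qed

lemma assoc'_Hom:
 assumes X: "vspace X" and Y: "vspace Y" and Z: "vspace Z"
 shows "assoc' X Y Z : Hom (X >< Y >< Z) ((X >< Y) >< Z)"
  and "x : carr X ==> y : carr Y ==> z : carr Z ==>
   assoc' X Y Z$(pure X (Y >< Z) x (pure Y Z y z)) = pure (X >< Y) Z (pure X Y x y) z"
proof -
 note a = assoc_Hom[OF X Y Z]
 obtain g where g: "g : Hom (X >< Y >< Z) ((X >< Y) >< Z)"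
  "!!x y z. x : carr X ==> y : carr Y ==> z : carr Z ==>
   g$(pure X (Y >< Z) x (pure Y Z y z)) = pure (X >< Y) Z (pure X Y x y) z" using assoc_inverse_ex[OF X Y Z] by blast
 have ga: "g$(assoc X Y Z$t) = t" if t: "t : carr ((X >< Y) >< Z)" for t
 proof (rule tensor_linear_eqI[OF vT Z linear_comp[OF Hom_linear[OF a(1)] Hom_linear[OF g(1)]] _ _ t])
  show "linear_map ((X >< Y) >< Z) ((X >< Y) >< Z) (%t. t)" by (simp add: linear_map_def)
  fix s z assume s: "s : carr (X >< Y)" and z: "z : carr Z"
  show "g$(assoc X Y Z$(pure (X >< Y) Z s z)) = pure (X >< Y) Z s z"
   by (rule tensor_linear_eqI[OF X Y linear_comp[OF linear_comp[OF pure_linear1[OF vT Z z] Hom_linear[OF a(1)]] Hom_linear[OF g(1)]]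
      pure_linear1[OF vT Z z] _ s]) (simp add: a(2) g(2) z)
 qed
 have ag: "assoc X Y Z$(g$t) = t" if t: "t : carr (X >< Y >< Z)" for t
 proof (rule tensor_linear_eqI[OF X vT linear_comp[OF Hom_linear[OF g(1)] Hom_linear[OF a(1)]] _ _ t])
  show "linear_map (X >< Y >< Z) (X >< Y >< Z) (%t. t)" by (simp add: linear_map_def)
  fix x s assume s: "s : carr (Y >< Z)" and x: "x : carr X"
  show "assoc X Y Z$(g$(pure X (Y >< Z) x s)) = pure X (Y >< Z) x s"
   by (rule tensor_linear_eqI[OF Y Z linear_comp[OF linear_comp[OF pure_linear2[OF X vT x] Hom_linear[OF g(1)]] Hom_linear[OF a(1)]]
      pure_linear2[OF X vT x] _ s]) (simp add: a(2) g(2) x)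
 qed
 have iso: "assoc X Y Z : Iso ((X >< Y) >< Z) (X >< Y >< Z)" unfolding Iso_def using a(1) ga ag Hom_in[OF a(1)] Hom_in[OF g(1)]
  by (auto intro!: bij_betw_byWitness[where f' = "app g"])
 show "assoc' X Y Z : Hom (X >< Y >< Z) ((X >< Y) >< Z)" by (rule Iso_Hom[OF linv_Iso(1)[OF vT iso]])
 show "x : carr X ==> y : carr Y ==> z : carr Z ==>
   assoc' X Y Z$(pure X (Y >< Z) x (pure Y Z y z)) = pure (X >< Y) Z (pure X Y x y) z"
  using linv_Iso(2)[OF vT iso, of "pure (X >< Y) Z (pure X Y x y) z"] by (simp add: a(2) pT)
qed

lemma induced_eq:
 assumes E: "E : Hom T D" "inj_on (app E) (carr T)" and F: "F : Hom S D" and S: "vspace S" and N: "N : Hom S T"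
  and eq: "!!s. s : carr S ==> F$s = E$(N$s)"
 shows "lands (E, F)" "induced (E, F) = N"
proof -
 note src = Hom_src[OF E(1)] Hom_src[OF F]
 show "lands (E, F)" using eq Hom_in[OF N] by (auto simp: src)
 have 1: "inv_into (carr T) (app E) (F$s) = N$s" if "s : carr S" for s unfolding eq[OF that] by (rule inv_into_f_f[OF E(2) Hom_in[OF N that]])
 have "induced (E, F) = mk S T (app N)" by (simp add: src mk_def 1 cong: if_cong)
 also have "... = N" using N by (auto simp: mk_def Hom_def intro!: lmap.equality)
 finally show "induced (E, F) = N" .
qed

definition actL where
 "actL H V U ch rh = runit V oo (Id V ** ev' H U) oo assoc V H U oo (ch ** Id U) oo assoc' H V U oo (Id H ** rh)"

definition actR where
 "actR H V U ch rh = lunit V oo (ev U H ** Id V) oo assoc' U H V oo (Id U ** ch) oo assoc U V H oo (rh ** Id H)"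

text \<open>As W separates V, it is enough to know the value of each e in W on the result.\<close>

lemma induced_on_functionals:
 assumes X: "vspace X" and Y: "vspace Y" and V: "vspace V" and w: "pairs W V (%e. e)" "pairs V W ev_at"
  and N: "N : Hom (X >< Y) V"
  and G: "!!x y e. x : carr X ==> y : carr Y ==> e : carr W ==> G x y e = e (N$(pure X Y x y))"
  and P: "P = (mk V (dual W) (%v. app (mk W ground (%e. e v))), tlift X Y (dual W) (%x y. app (mk W ground (G x y))))"
 shows "lands P & induced P = N"
proof -
 note vW = pairs_vs(1)[OF w(1)]
 have l: "linf V e" if "e : carr W" for e by (rule pairs_right[OF w(1) that])
 have el: "linf W (%e. e v)" if "v : carr V" for v by (rule pairs_left[OF w(1) that])
 let ?E = "mk V (dual W) (%v. app (mk W ground (%e. e v)))"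
 have El: "linear_map V (dual W) (%v. app (mk W ground (%e. e v)))"
  by (rule linear_into_dual[OF vW Hom_dual[OF mk_Hom[OF vW el]] V]) (simp_all add: mk_app l)
 have E: "?E : Hom V (dual W)" by (rule mk_Hom[OF V El])
 have Einj: "inj_on (app ?E) (carr V)"
 proof (rule inj_onI)
  fix v v' assume v: "v : carr V" "v' : carr V" and eq: "?E$v = ?E$v'"
  show "v = v'"
  proof (rule pairs_eqI[OF w(2) v])
   fix e assume "e : carr W"
   then show "ev_at v e = ev_at v' e" using fun_cong[OF eq, of e] v by (simp add: mk_app ev_at_def)
  qed
 qed
 let ?f = "%a v. app (mk W ground (G a v))"
 have fE: "?f a v = ?E$(N$(pure X Y a v))" if "a : carr X" "v : carr Y" for a v
  using that by (simp add: mk_app Hom_in[OF N pT]) (simp add: mk_def fun_eq_iff G)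
 have fb: "bilinear_map X Y (dual W) ?f" unfolding bilinear_map_def
 proof (intro conjI ballI)
  show "linear_map Y (dual W) (?f a)" if "a : carr X" for a
   by (rule mk_linear_cong[OF Y fE[symmetric] linear_comp[OF linear_comp[OF pure_linear2[OF X Y that] Hom_linear[OF N]] Hom_linear[OF E]]])
    (use that in simp_all)
  show "linear_map X (dual W) (%a. ?f a v)" if "v : carr Y" for v
   by (rule mk_linear_cong[OF X fE[symmetric] linear_comp[OF linear_comp[OF pure_linear1[OF X Y that] Hom_linear[OF N]] Hom_linear[OF E]]])
    (use that in simp_all)
 qed
 note Fh = tlift_Hom[OF X Y vspace_dual[OF vW] fb] and Fp = tlift_pure[OF X Y vspace_dual[OF vW] fb]
 have Ft: "tlift X Y (dual W) ?f$t = ?E$(N$t)" if "t : carr (X >< Y)" for t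
  by (rule tensor_linear_eqI[OF X Y Hom_linear[OF Fh] linear_comp[OF Hom_linear[OF N] Hom_linear[OF E]] _ that])
   (simp only: Fp fE)
 show ?thesis unfolding P using induced_eq[OF E Einj Fh vT N Ft] by blast
qed

text \<open>Both sides are bilinear in the coaction of v and in the image of the pair e, a under the braiding of W
with H. On pure tensors they agree by the formula for that braiding, so the new action is the one
obtained from the coaction of U, and W disappears.\<close>

lemma nuL_bq:
 assumes V: "vspace V" and i: "pairs U H (%f. f)" and w: "pairs W V (%e. e)" "pairs V W ev_at"
  and P: "linv PsHV : Hom (V >< H) (H >< V)" and nv: "nv : Hom (H >< V) V" and rh: "rh : Hom V (V >< U)"
  and ch: "ch : Hom (H >< V) (V >< H)" and \<omega>: "induced (Psi2_WH H V U W PsHV) : Hom (W >< H) (H >< W)"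
  and r: "!!v a xi. v : carr V ==> a : carr H ==> linf V xi ==> fpair V U xi (%f. f a) (rh$v) = xi (nv$(linv PsHV$(pure V H v a)))"
  and o: "!!e a v f. e : carr W ==> a : carr H ==> v : carr V ==> f : carr U ==>
   fpair H W f (%e'. e' v) (induced (Psi2_WH H V U W PsHV)$(pure W H e a)) = fpair V H e f (ch$(pure H V a v))"
 shows "lands (nuL_bq H V U W PsHV nv)" "induced (nuL_bq H V U W PsHV nv) = actL H V U ch rh"
  and "actL H V U ch rh : Hom (H >< V) V"
proof -
 note vs = pairs_vs[OF i]
 note vW = pairs_vs(1)[OF w(1)]
 let ?\<omega> = "induced (Psi2_WH H V U W PsHV)"
 note T = vT
 note e = ev_Hom[OF i]
 have l: "linf V e" if "e : carr W" for e by (rule pairs_right[OF w(1) that])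
 have f: "linf H f" if "f : carr U" for f by (rule pairs_right[OF i that])
 have fl: "linf U (%f. f a)" if "a : carr H" for a by (rule pairs_left[OF i that])
 have el: "linf W (%e. e v)" if "v : carr V" for v by (rule pairs_left[OF w(1) that])
 \<comment> \<open>the action obtained from the coaction\<close>
 note t1 = tensor_lmap_Hom[OF vs(2) V vs(2) T Id_Hom[OF vs(2)] rh]
  and t2 = assoc'_Hom[OF vs(2) V vs(1)]
  and t3 = tensor_lmap_Hom[OF T vs(1) T vs(1) ch Id_Hom[OF vs(1)]]
  and t4 = assoc_Hom[OF V vs(2) vs(1)]
  and t5 = tensor_lmap_Hom[OF V T V vspace_ground Id_Hom[OF V] e(2)]
  and t6 = runit_Hom[OF V]
 note n2 = comp_Hom[OF T t1(1) t2(1)] note n3 = comp_Hom[OF T n2 t3(1)] note n4 = comp_Hom[OF T n3 t4(1)] note n5 = comp_Hom[OF T n4 t5(1)]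
 note k3 = comp_Hom[OF T t2(1) t3(1)] note k4 = comp_Hom[OF T k3 t4(1)] note k5 = comp_Hom[OF T k4 t5(1)]
 note r5 = comp_Hom[OF T t4(1) t5(1)] note c4 = comp_Hom[OF T r5 t6]
 note capp = comp_app[OF t1(1)] comp_app[OF n2] comp_app[OF n3] comp_app[OF n4] comp_app[OF n5]
  comp_app[OF t2(1)] comp_app[OF k3] comp_app[OF k4] comp_app[OF k5] comp_app[OF t4(1)] comp_app[OF r5]
 show N: "actL H V U ch rh : Hom (H >< V) V" using comp_Hom[OF T n5 t6] by (simp add: actL_def)
 let ?R = "runit V oo (Id V ** ev' H U) oo assoc V H U"
 let ?K = "runit V oo (Id V ** ev' H U) oo assoc V H U oo (ch ** Id U) oo assoc' H V U"
 have K: "?K : Hom (H >< V >< U) V" by (rule comp_Hom[OF T k5 t6])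
 have R: "xi (?R$(pure (V >< H) U t f)) = fpair V H xi f t"
  if xi: "linf V xi" and f': "f : carr U" and t: "t : carr (V >< H)" for xi f t
 proof (rule tensor_linear_eqI[OF V vs(2) linear_comp[OF linear_comp[OF pure_linear1[OF T vs(1) f'] Hom_linear[OF c4]] xi] fpair_linear[OF V vs(2) xi f[OF f']] _ t])
  fix v h assume vh: "v : carr V" "h : carr H"
  have "?R$(pure (V >< H) U (pure V H v h) f) = scal V (f h) v" using vh f' by (simp add: capp t4(2) t5(2) Id_app e(4) runit_pure V pT)
  then show "xi (?R$(pure (V >< H) U (pure V H v h) f)) = fpair V H xi f (pure V H v h)"
   using vh by (simp add: fpair_pure[OF V vs(2) xi f[OF f']] linear_ground_simps(2)[OF xi] mult.commute)
 qed
 have Kp: "xi (?K$(pure H (V >< U) a (pure V U v f))) = fpair V H xi f (ch$(pure H V a v))"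
  if xi: "linf V xi" and f': "f : carr U" and "a : carr H" "v : carr V" for xi f a v
 proof -
  have "?K$(pure H (V >< U) a (pure V U v f)) = ?R$(pure (V >< H) U (ch$(pure H V a v)) f)"
   using that by (simp add: capp t2(2) t3(2) Id_app pT Hom_in[OF ch])
  then show ?thesis using R[OF xi f' Hom_in[OF ch pT]] that by simp
 qed
 have Np: "actL H V U ch rh$(pure H V a v) = ?K$(pure H (V >< U) a (rh$v))" if "a : carr H" "v : carr V" for a v
  using that by (simp add: actL_def capp pT t1(2) Id_app Hom_in[OF rh])
 \<comment> \<open>the map defining the action on functionals\<close>
 note s1 = tensor_lmap_Hom[OF V T V T Id_Hom[OF V] \<omega>]
  and s2 = assoc'_Hom[OF V vs(2) vW]
  and s3 = tensor_lmap_Hom[OF T vW T vW P Id_Hom[OF vW]]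
  and s4 = tensor_lmap_Hom[OF T vW V vW nv Id_Hom[OF vW]]
  and s5 = ev_Hom(2)[OF w(1)]
 note l3 = comp_Hom[OF T s2(1) s3(1)] note l4 = comp_Hom[OF T l3 s4(1)]
 note g2 = comp_Hom[OF T s1(1) s2(1)] note g3 = comp_Hom[OF T g2 s3(1)] note g4 = comp_Hom[OF T g3 s4(1)]
 note sapp = comp_app[OF s1(1)] comp_app[OF s2(1)] comp_app[OF l3] comp_app[OF l4] comp_app[OF g2] comp_app[OF g3] comp_app[OF g4]
 let ?L = "ev' V W oo (nv ** Id W) oo (linv PsHV ** Id W) oo assoc' V H W"
 have L: "?L : Hom (V >< H >< W) ground" by (rule comp_Hom[OF T l4 s5])
 have Lp: "?L$(pure V (H >< W) v (pure H W a e)) = fpair V U e (%f. f a) (rh$v)"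
  if "v : carr V" "a : carr H" "e : carr W" for v a e using that by (simp add: sapp s2(2) s3(2) s4(2) Id_app pT
    Hom_in[OF P] Hom_in[OF nv] r l ev_Hom(4)[OF w(1)])
 let ?d = "%r t. tlift V U ground (%v f. fpair H W f (%e. e v) t)$r"
 have db: "bilinear_map V U ground (%v f. fpair H W f (%e. e v) t)" if t: "t : carr (H >< W)" for t
 proof -
  have b: "bilinear_map H U ground (%a f. f a)" "bilinear_map W V ground (%e v. e v)" using i w bilinear_swap by (auto simp: pairs_def)
  show ?thesis unfolding bilinear_map_def using fpair_param(1)[OF vs(2) vW t b(1) vs(1) el] fpair_param(2)[OF vs(2) vW t b(2) V f] by simp
 qed
 have dl: "linf (H >< W) (%t. fpair H W f' (%e. e v) t)" if "v : carr V" "f' : carr U" for v f'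
  using fpair_linear[OF vs(2) vW f[OF that(2)] el[OF that(1)]] .
 have d: "bilinear_map (V >< U) (H >< W) ground ?d" by (rule bilinear_tlift1[OF V vs(1) T vspace_ground db dl])
 have dp: "?d (pure V U v f') t = fpair H W f' (%e. e v) t" if "v : carr V" "f' : carr U" "t : carr (H >< W)" for v f' t
  by (rule tlift_pure[OF V vs(1) vspace_ground db[OF that(3)] that(1,2)])
 have d2: "?d r (pure H W a e) = fpair V U e (%f. f a) r" if r': "r : carr (V >< U)" and ae: "a : carr H" "e : carr W" for r a e
 proof (rule tensor_linear_eqI[OF V vs(1) _ fpair_linear[OF V vs(1) l[OF ae(2)] fl[OF ae(1)]] _ r'])
  show "linf (V >< U) (%r. ?d r (pure H W a e))" using d ae by (simp add: bilinear_map_def pT)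
  fix v f' assume "v : carr V" "f' : carr U"
  then show "?d (pure V U v f') (pure H W a e) = fpair V U e (%f. f a) (pure V U v f')"
   using ae by (simp add: dp pT fpair_pure vs V vW f el fl l mult.commute)
 qed
 have L2: "?L$(pure V (H >< W) v t) = ?d (rh$v) t" if v: "v : carr V" and t: "t : carr (H >< W)" for v t
 proof (rule tensor_linear_eqI[OF vs(2) vW linear_comp[OF pure_linear2[OF V T v] Hom_linear[OF L]] _ _ t])
  show "linf (H >< W) (?d (rh$v))" using d Hom_in[OF rh v] by (simp add: bilinear_map_def)
  show "?L$(pure V (H >< W) v (pure H W a e)) = ?d (rh$v) (pure H W a e)" if "a : carr H" "e : carr W" for a e
   by (simp only: Lp[OF v that] d2[OF Hom_in[OF rh v] that])
 qed
 have d3: "?d r (?\<omega>$(pure W H e a)) = e (?K$(pure H (V >< U) a r))"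
  if r': "r : carr (V >< U)" and ae: "a : carr H" "e : carr W" for r a e
 proof (rule tensor_linear_eqI[OF V vs(1) _ linear_comp[OF linear_comp[OF pure_linear2[OF vs(2) T ae(1)] Hom_linear[OF K]] l[OF ae(2)]] _ r'])
  have t: "?\<omega>$(pure W H e a) : carr (H >< W)" by (rule Hom_in[OF \<omega> pT[OF ae(2,1)]])
  then show "linf (V >< U) (%r. ?d r (?\<omega>$(pure W H e a)))" using d by (simp add: bilinear_map_def)
  fix v f' assume vf: "v : carr V" "f' : carr U"
  show "?d (pure V U v f') (?\<omega>$(pure W H e a)) = e (?K$(pure H (V >< U) a (pure V U v f')))"
   unfolding dp[OF vf t] o[OF ae(2,1) vf] Kp[OF l[OF ae(2)] vf(2) ae(1) vf(1)] ..
 qed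
 let ?G = "%a v e. (ev' V W oo (nv ** Id W) oo (linv PsHV ** Id W) oo assoc' V H W oo (Id V ** ?\<omega>))$(pure V (W >< H) v (pure W H e a))"
 have G: "?G a v e = e (actL H V U ch rh$(pure H V a v))" if a: "a : carr H" and v: "v : carr V" and e': "e : carr W" for a v e
 proof -
  have t: "?\<omega>$(pure W H e a) : carr (H >< W)" by (rule Hom_in[OF \<omega> pT[OF e' a]])
  have "?G a v e = ?L$(pure V (H >< W) v (?\<omega>$(pure W H e a)))" using a v e' t by (simp add: sapp s1(2) Id_app pT)
  then show ?thesis unfolding L2[OF v t] d3[OF Hom_in[OF rh v] a e'] Np[OF a v] .
 qed
 show "lands (nuL_bq H V U W PsHV nv)" "induced (nuL_bq H V U W PsHV nv) = actL H V U ch rh"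
  using induced_on_functionals[OF vs(2) V V w N G nuL_bq_def] by simp_all
qed

lemma nuR_bq:
 assumes V: "vspace V" and i: "pairs U H (%f. f)" and w: "pairs W V (%e. e)" "pairs V W ev_at"
  and P: "linv PsVH : Hom (H >< V) (V >< H)" and nv: "nv : Hom (V >< H) V" and rh: "rh : Hom V (U >< V)"
  and ch: "ch : Hom (V >< H) (H >< V)" and \<omega>: "induced (Psi2_HW H V U W PsVH) : Hom (H >< W) (W >< H)"
  and r: "!!v a xi. v : carr V ==> a : carr H ==> linf V xi ==> fpair U V (%f. f a) xi (rh$v) = xi (nv$(linv PsVH$(pure H V a v)))"
  and o: "!!e a v f. e : carr W ==> a : carr H ==> v : carr V ==> f : carr U ==>
   fpair W H (%e'. e' v) f (induced (Psi2_HW H V U W PsVH)$(pure H W a e)) = fpair H V f e (ch$(pure V H v a))"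
 shows "lands (nuR_bq H V U W PsVH nv)" "induced (nuR_bq H V U W PsVH nv) = actR H V U ch rh"
  and "actR H V U ch rh : Hom (V >< H) V"
proof -
 note vs = pairs_vs[OF i]
 note vW = pairs_vs(1)[OF w(1)]
 let ?\<omega> = "induced (Psi2_HW H V U W PsVH)"
 note T = vT
 note e = ev_Hom[OF i]
 have l: "linf V e" if "e : carr W" for e by (rule pairs_right[OF w(1) that])
 have f: "linf H f" if "f : carr U" for f by (rule pairs_right[OF i that])
 have fl: "linf U (%f. f a)" if "a : carr H" for a by (rule pairs_left[OF i that])
 have el: "linf W (%e. e v)" if "v : carr V" for v by (rule pairs_left[OF w(1) that])
 note t1 = tensor_lmap_Hom[OF V vs(2) T vs(2) rh Id_Hom[OF vs(2)]]
  and t2 = assoc_Hom[OF vs(1) V vs(2)]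
  and t3 = tensor_lmap_Hom[OF vs(1) T vs(1) T Id_Hom[OF vs(1)] ch]
  and t4 = assoc'_Hom[OF vs(1) vs(2) V]
  and t5 = tensor_lmap_Hom[OF T V vspace_ground V e(1) Id_Hom[OF V]]
  and t6 = lunit_Hom[OF V]
 note n2 = comp_Hom[OF T t1(1) t2(1)] note n3 = comp_Hom[OF T n2 t3(1)] note n4 = comp_Hom[OF T n3 t4(1)] note n5 = comp_Hom[OF T n4 t5(1)]
 note k3 = comp_Hom[OF T t2(1) t3(1)] note k4 = comp_Hom[OF T k3 t4(1)] note k5 = comp_Hom[OF T k4 t5(1)]
 note r5 = comp_Hom[OF T t4(1) t5(1)] note c4 = comp_Hom[OF T r5 t6]
 note capp = comp_app[OF t1(1)] comp_app[OF n2] comp_app[OF n3] comp_app[OF n4] comp_app[OF n5]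
  comp_app[OF t2(1)] comp_app[OF k3] comp_app[OF k4] comp_app[OF k5] comp_app[OF t4(1)] comp_app[OF r5]
 show N: "actR H V U ch rh : Hom (V >< H) V" using comp_Hom[OF T n5 t6] by (simp add: actR_def)
 let ?R = "lunit V oo (ev U H ** Id V) oo assoc' U H V"
 let ?K = "lunit V oo (ev U H ** Id V) oo assoc' U H V oo (Id U ** ch) oo assoc U V H"
 have K: "?K : Hom ((U >< V) >< H) V" by (rule comp_Hom[OF T k5 t6])
 have R: "xi (?R$(pure U (H >< V) f t)) = fpair H V f xi t"
  if xi: "linf V xi" and f': "f : carr U" and t: "t : carr (H >< V)" for xi f t
 proof (rule tensor_linear_eqI[OF vs(2) V linear_comp[OF linear_comp[OF pure_linear2[OF vs(1) T f'] Hom_linear[OF c4]] xi] fpair_linear[OF vs(2) V f[OF f'] xi] _ t])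
  fix h v assume vh: "h : carr H" "v : carr V"
  have "?R$(pure U (H >< V) f (pure H V h v)) = scal V (f h) v" using vh f' by (simp add: capp t4(2) t5(2) Id_app e(3) lunit_pure V pT)
  then show "xi (?R$(pure U (H >< V) f (pure H V h v))) = fpair H V f xi (pure H V h v)"
   using vh by (simp add: fpair_pure[OF vs(2) V f[OF f'] xi] linear_ground_simps(2)[OF xi])
 qed
 have Kp: "xi (?K$(pure (U >< V) H (pure U V f v) a)) = fpair H V f xi (ch$(pure V H v a))"
  if xi: "linf V xi" and f': "f : carr U" and "a : carr H" "v : carr V" for xi f a v
 proof -
  have "?K$(pure (U >< V) H (pure U V f v) a) = ?R$(pure U (H >< V) f (ch$(pure V H v a)))"
   using that by (simp add: capp t2(2) t3(2) Id_app pT Hom_in[OF ch])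
  then show ?thesis using R[OF xi f' Hom_in[OF ch pT]] that by simp
 qed
 have Np: "actR H V U ch rh$(pure V H v a) = ?K$(pure (U >< V) H (rh$v) a)" if "a : carr H" "v : carr V" for a v
  using that by (simp add: actR_def capp pT t1(2) Id_app Hom_in[OF rh])
 note s1 = tensor_lmap_Hom[OF T V T V \<omega> Id_Hom[OF V]]
  and s2 = assoc_Hom[OF vW vs(2) V]
  and s3 = tensor_lmap_Hom[OF vW T vW T Id_Hom[OF vW] P]
  and s4 = tensor_lmap_Hom[OF vW T vW V Id_Hom[OF vW] nv]
  and s5 = ev_Hom(1)[OF w(1)]
 note l3 = comp_Hom[OF T s2(1) s3(1)] note l4 = comp_Hom[OF T l3 s4(1)]
 note g2 = comp_Hom[OF T s1(1) s2(1)] note g3 = comp_Hom[OF T g2 s3(1)] note g4 = comp_Hom[OF T g3 s4(1)]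
 note sapp = comp_app[OF s1(1)] comp_app[OF s2(1)] comp_app[OF l3] comp_app[OF l4] comp_app[OF g2] comp_app[OF g3] comp_app[OF g4]
 let ?L = "ev W V oo (Id W ** nv) oo (Id W ** linv PsVH) oo assoc W H V"
 have L: "?L : Hom ((W >< H) >< V) ground" by (rule comp_Hom[OF T l4 s5])
 have Lp: "?L$(pure (W >< H) V (pure W H e a) v) = fpair U V (%f. f a) e (rh$v)"
  if "v : carr V" "a : carr H" "e : carr W" for v a e using that by (simp add: sapp s2(2) s3(2) s4(2) Id_app pT
    Hom_in[OF P] Hom_in[OF nv] r l ev_Hom(3)[OF w(1)])
 let ?d = "%r t. tlift U V ground (%f v. fpair W H (%e. e v) f t)$r"
 have db: "bilinear_map U V ground (%f v. fpair W H (%e. e v) f t)" if t: "t : carr (W >< H)" for t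
 proof -
  have b: "bilinear_map W V ground (%e v. e v)" "bilinear_map H U ground (%a f. f a)" using i w bilinear_swap by (auto simp: pairs_def)
  show ?thesis unfolding bilinear_map_def using fpair_param(1)[OF vW vs(2) t b(1) V f] fpair_param(2)[OF vW vs(2) t b(2) vs(1) el] by simp
 qed
 have dl: "linf (W >< H) (%t. fpair W H (%e. e v) f' t)" if "f' : carr U" "v : carr V" for v f'
  using fpair_linear[OF vW vs(2) el[OF that(2)] f[OF that(1)]] .
 have d: "bilinear_map (U >< V) (W >< H) ground ?d" by (rule bilinear_tlift1[OF vs(1) V T vspace_ground db dl])
 have dp: "?d (pure U V f' v) t = fpair W H (%e. e v) f' t" if "v : carr V" "f' : carr U" "t : carr (W >< H)" for v f' t
  by (rule tlift_pure[OF vs(1) V vspace_ground db[OF that(3)] that(2,1)])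
 have d2: "?d r (pure W H e a) = fpair U V (%f. f a) e r" if r': "r : carr (U >< V)" and ae: "a : carr H" "e : carr W" for r a e
 proof (rule tensor_linear_eqI[OF vs(1) V _ fpair_linear[OF vs(1) V fl[OF ae(1)] l[OF ae(2)]] _ r'])
  show "linf (U >< V) (%r. ?d r (pure W H e a))" using d ae by (simp add: bilinear_map_def pT)
  fix f' v assume "f' : carr U" "v : carr V"
  then show "?d (pure U V f' v) (pure W H e a) = fpair U V (%f. f a) e (pure U V f' v)"
   using ae by (simp add: dp pT fpair_pure vs V vW f el fl l mult.commute)
 qed
 have L2: "?L$(pure (W >< H) V t v) = ?d (rh$v) t" if v: "v : carr V" and t: "t : carr (W >< H)" for v t
 proof (rule tensor_linear_eqI[OF vW vs(2) linear_comp[OF pure_linear1[OF T V v] Hom_linear[OF L]] _ _ t])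
  show "linf (W >< H) (?d (rh$v))" using d Hom_in[OF rh v] by (simp add: bilinear_map_def)
  show "?L$(pure (W >< H) V (pure W H e a) v) = ?d (rh$v) (pure W H e a)" if "e : carr W" "a : carr H" for a e
   by (simp only: Lp[OF v that(2,1)] d2[OF Hom_in[OF rh v] that(2,1)])
 qed
 have d3: "?d r (?\<omega>$(pure H W a e)) = e (?K$(pure (U >< V) H r a))"
  if r': "r : carr (U >< V)" and ae: "a : carr H" "e : carr W" for r a e
 proof (rule tensor_linear_eqI[OF vs(1) V _ linear_comp[OF linear_comp[OF pure_linear1[OF T vs(2) ae(1)] Hom_linear[OF K]] l[OF ae(2)]] _ r'])
  have t: "?\<omega>$(pure H W a e) : carr (W >< H)" by (rule Hom_in[OF \<omega> pT[OF ae]])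
  then show "linf (U >< V) (%r. ?d r (?\<omega>$(pure H W a e)))" using d by (simp add: bilinear_map_def)
  fix f' v assume vf: "f' : carr U" "v : carr V"
  show "?d (pure U V f' v) (?\<omega>$(pure H W a e)) = e (?K$(pure (U >< V) H (pure U V f' v) a))"
   unfolding dp[OF vf(2,1) t] o[OF ae(2,1) vf(2,1)] Kp[OF l[OF ae(2)] vf(1) ae(1) vf(2)] ..
 qed
 let ?G = "%v a e. (ev W V oo (Id W ** nv) oo (Id W ** linv PsVH) oo assoc W H V oo (?\<omega> ** Id V))$(pure (H >< W) V (pure H W a e) v)"
 have G: "?G v a e = e (actR H V U ch rh$(pure V H v a))" if v: "v : carr V" and a: "a : carr H" and e': "e : carr W" for a v e
 proof -
  have t: "?\<omega>$(pure H W a e) : carr (W >< H)" by (rule Hom_in[OF \<omega> pT[OF a e']])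
  have "?G v a e = ?L$(pure (W >< H) V (?\<omega>$(pure H W a e)) v)" using a v e' t by (simp add: sapp s1(2) Id_app pT)
  then show ?thesis unfolding L2[OF v t] d3[OF Hom_in[OF rh v] a e'] Np[OF a v] .
 qed
 show "lands (nuR_bq H V U W PsVH nv)" "induced (nuR_bq H V U W PsVH nv) = actR H V U ch rh"
  using induced_on_functionals[OF V vs(2) V w N G nuR_bq_def] by simp_all
qed

section \<open>From element formulas to arrows\<close>

locale dual_frames = paired_words S pr for S :: "'s => ('k::field, 'z::ab_group_add) vs" and pr +
 fixes X :: "('k, 'a::ab_group_add) vs" and Y :: "('k, 'b::ab_group_add) vs"
  and A :: "('k, 'a, 's, 'z) frame" and B :: "('k, 'b, 's, 'z) frame" and x y :: 's and i :: "'a => 'b => 'k"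
 assumes frames: "tpx A X" "tpx B Y" and words: "wd A = [x]" "wd B = [y]"
  and dual: "dual_sorts x y" and pairing: "pairs X Y i"
  and pr_i: "!!a b. a : carr (S x) ==> b : carr (S y) ==> pr a b = i (pt A [a]) (pt B [b])"
begin

lemmas [simp] = words

lemma tps: "tp A" "tp B" "sp A = X" "sp B = Y" using frames by (simp_all add: tpx_def)

lemma pts: "a : carr (S x) ==> pt A [a] : carr X" "b : carr (S y) ==> pt B [b] : carr Y"
 using tp_pt[OF tps(1), of "[a]"] tp_pt[OF tps(2), of "[b]"] tps by simp_all

lemma i_linear: "b : carr (S y) ==> linf X (%p. i p (pt B [b]))" "a : carr (S x) ==> linf Y (i (pt A [a]))"
 using pairs_left[OF pairing] pairs_right[OF pairing] pts by simp_all

lemma ev_rp: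
 assumes "f : Hom (X >< Y) ground" "!!a b. a : carr X ==> b : carr Y ==> f$(pure X Y a b) = i a b"
 shows "rp (tens True A B) fG f (ev x y)"
proof -
 have h: "hom (ev x y) [x, y] []" using ev_arrow[OF dual] by (simp add: hom_def)
 have "xi (f$(pt (tens True A B) xs)) = afn (ev x y) (pull fG xi) xs"
  if xi: "linf ground xi" and xs: "xs : points [x, y]" for xi xs
 proof -
  obtain a b where ab: "xs = [a, b]" "a : carr (S x)" "b : carr (S y)" using xs by (auto dest!: points_ConsD)
  have "pt (tens True A B) [a, b] = pure X Y (pt A [a]) (pt B [b])" using pt_tens[of "[a]" A "[b]" B True] ab by (simp add: jn_def tps)
  moreover have "pull fG xi : forms []" using tp_pull[OF tp_fG, of xi] xi by simp
  moreover have "xi (pr a b) = pr a b * xi 1" using linear_ground_simps(2)[OF xi, of 1 "pr a b"] by simp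
  ultimately show ?thesis using ab by (simp add: assms(2) pts pr_i[symmetric] ev_def pull_def)
 qed
 then show ?thesis using assms(1) h tp_tens[OF tps(1,2), of True] tp_fG by (simp add: rp_def wd_tens jn_def tps)
qed

lemma ev_rp':
 assumes "f : Hom (Y >< X) ground" "!!a b. a : carr X ==> b : carr Y ==> f$(pure Y X b a) = i a b"
 shows "rp (tens False B A) fG f (ev x y)"
proof -
 have h: "hom (ev x y) [x, y] []" using ev_arrow[OF dual] by (simp add: hom_def)
 have "xi (f$(pt (tens False B A) xs)) = afn (ev x y) (pull fG xi) xs"
  if xi: "linf ground xi" and xs: "xs : points [x, y]" for xi xs
 proof -
  obtain a b where ab: "xs = [a, b]" "a : carr (S x)" "b : carr (S y)" using xs by (auto dest!: points_ConsD)
  have "pt (tens False B A) [a, b] = pure Y X (pt B [b]) (pt A [a])" using pt_tens[of "[b]" B "[a]" A False] ab by (simp add: jn_def tps)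
  moreover have "pull fG xi : forms []" using tp_pull[OF tp_fG, of xi] xi by simp
  moreover have "xi (pr a b) = pr a b * xi 1" using linear_ground_simps(2)[OF xi, of 1 "pr a b"] by simp
  ultimately show ?thesis using ab by (simp add: assms(2) pts pr_i[symmetric] ev_def pull_def)
 qed
 then show ?thesis using assms(1) h tp_tens[OF tps(2,1), of False] tp_fG by (simp add: rp_def wd_tens jn_def tps)
qed

lemma mate_word:
 assumes f: "hom f [x, z] [z, x]" and g: "hom g [z, y] [y, z]"
  and eq: "!!a c b T. a : carr (S x) ==> c : carr (S z) ==> b : carr (S y) ==> T : forms [z] ==>
   afn f (%xs. if xs : points [z, x] then T [hd xs] * pr (xs ! 1) b else 0) [a, c] =
   afn g (%xs. if xs : points [y, z] then pr a (hd xs) * T [xs ! 1] else 0) [c, b]"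
 shows "are_mates f y (ev x y) z g x p q T"
proof -
 note fg = f[unfolded hom_def] g[unfolded hom_def]
 note [simp] = fg ev_arrow[OF dual]
 have "wh [] f [y] >> wh [z] (ev x y) [] = wh [x] g [] >> wh [] (ev x y) [z]"
 proof (rule arrow_eqI)
  fix T xs assume "T : forms (acod (wh [] f [y] >> wh [z] (ev x y) []))" "xs : points (adom (wh [] f [y] >> wh [z] (ev x y) []))"
  then have T: "T : forms [z]" and "xs : points [x, z, y]" by simp_all
  then obtain a c b where xs: "xs = [a, c, b]" "a : carr (S x)" "c : carr (S z)" "b : carr (S y)" by (auto dest!: points_ConsD)
  have E1: "W (ev x y) [z] [] T : forms [z, x, y]" using W_form[of "ev x y" "[z]" "[]" T] by simp
  have E2: "W (ev x y) [] [z] T : forms [x, y, z]" using W_form[of "ev x y" "[]" "[z]" T] by simp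
  have v1: "(%ys. W (ev x y) [z] [] T (ys @ [b])) = (%xs. if xs : points [z, x] then T [hd xs] * pr (xs ! 1) b else 0)"
  proof
   fix ys
   show "W (ev x y) [z] [] T (ys @ [b]) = (if ys : points [z, x] then T [hd ys] * pr (ys ! 1) b else 0)"
   proof (cases "ys : points [z, x]")
    case True
    then obtain c' a' where "ys = [c', a']" "c' : carr (S z)" "a' : carr (S x)" by (auto dest!: points_ConsD)
    then show ?thesis using W_ev_app[of T "[z]" "[]" "[c']" a' x b y "[]"] T xs by simp
   next
    case False
    then have "ys @ [b] ~: points [z, x, y]" using points_append_iff1[of "[b]" "[y]" ys "[z, x]"] xs by simp
    then show ?thesis using forms_out[OF E1] False by simp
   qed
  qed
  have v2: "(%ys. W (ev x y) [] [z] T (a#ys)) = (%xs. if xs : points [y, z] then pr a (hd xs) * T [xs ! 1] else 0)"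
  proof
   fix ys
   show "W (ev x y) [] [z] T (a#ys) = (if ys : points [y, z] then pr a (hd ys) * T [ys ! 1] else 0)"
   proof (cases "ys : points [y, z]")
    case True
    then obtain b' c' where "ys = [b', c']" "b' : carr (S y)" "c' : carr (S z)" by (auto dest!: points_ConsD)
    then show ?thesis using W_ev_app[of T "[]" "[z]" "[]" a x b' y "[c']"] T xs by simp
   next
    case False
    then have "a#ys ~: points [x, y, z]" using points_append_iff2[of "[a]" "[x]" ys "[y, z]"] xs by simp
    then show ?thesis using forms_out[OF E2] False by simp
   qed
  qed
  have "W f [] [y] (W (ev x y) [z] [] T) ([] @ [a, c] @ [b]) = afn f (%ys. W (ev x y) [z] [] T ([] @ ys @ [b])) [a, c]"
   by (rule W_app) (use E1 xs in simp_all)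
  moreover have "W g [x] [] (W (ev x y) [] [z] T) ([a] @ [c, b] @ []) = afn g (%ys. W (ev x y) [] [z] T ([a] @ ys @ [])) [c, b]"
   by (rule W_app) (use E2 xs in simp_all)
  ultimately show "afn (wh [] f [y] >> wh [z] (ev x y) []) T xs = afn (wh [x] g [] >> wh [] (ev x y) [z]) T xs"
   using eq[OF xs(2-4) T] by (simp add: comp_def wh_def xs(1) v1 v2)
 qed simp_all
 from chain_cong[OF this, of p q T] show ?thesis by (simp add: chain)
qed

lemma pull_pair:
 assumes Q: "tpx Q Z" "wd Q = [z]" and T: "T : forms [z]"
 shows "b : carr (S y) ==> pull (tens True Q A) (fpair Z X (exf Q T) (%p. i p (pt B [b]))) =
   (%xs. if xs : points [z, x] then T [hd xs] * pr (xs ! 1) b else 0)"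
  and "b : carr (S y) ==> pull (tens False A Q) (fpair X Z (%p. i p (pt B [b])) (exf Q T)) =
   (%xs. if xs : points [z, x] then T [hd xs] * pr (xs ! 1) b else 0)"
  and "a : carr (S x) ==> pull (tens True B Q) (fpair Y Z (i (pt A [a])) (exf Q T)) =
   (%xs. if xs : points [y, z] then pr a (hd xs) * T [xs ! 1] else 0)"
  and "a : carr (S x) ==> pull (tens False Q B) (fpair Z Y (exf Q T) (i (pt A [a]))) =
   (%xs. if xs : points [y, z] then pr a (hd xs) * T [xs ! 1] else 0)"
proof -
 have tq: "tp Q" "sp Q = Z" "vspace Z" using Q by (auto simp: tpx_def tp_vs)
 have vXY: "vspace X" "vspace Y" using tp_vs[OF tps(1)] tp_vs[OF tps(2)] tps by simp_all
 have el: "linf Z (exf Q T)" using exf_linear[OF tq(1), of T] T tq Q by simp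
 have ep: "exf Q T (pt Q [c]) = T [c]" "pt Q [c] : carr Z" if "c : carr (S z)" for c
  using exf_pt[OF tq(1), of T "[c]"] tp_pt[OF tq(1), of "[c]"] T tq Q that by simp_all
 note pp = fpair_pure[OF tq(3) vXY(1) el] fpair_pure[OF vXY(1) tq(3) _ el] fpair_pure[OF tq(3) vXY(2) el] fpair_pure[OF vXY(2) tq(3) _ el]
 have pj: "a : carr (S x) ==> c : carr (S z) ==> pt (tens True Q A) [c, a] = pure Z X (pt Q [c]) (pt A [a])"
  "a : carr (S x) ==> c : carr (S z) ==> pt (tens False A Q) [c, a] = pure X Z (pt A [a]) (pt Q [c])"
  "b : carr (S y) ==> c : carr (S z) ==> pt (tens True B Q) [b, c] = pure Y Z (pt B [b]) (pt Q [c])"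
  "b : carr (S y) ==> c : carr (S z) ==> pt (tens False Q B) [b, c] = pure Z Y (pt Q [c]) (pt B [b])" for a b c
  using pt_tens[of "[c]" Q "[a]" A True] pt_tens[of "[a]" A "[c]" Q False]
   pt_tens[of "[b]" B "[c]" Q True] pt_tens[of "[c]" Q "[b]" B False] Q tq by (simp_all add: jn_def tps)
 show "pull (tens True Q A) (fpair Z X (exf Q T) (%p. i p (pt B [b]))) =
   (%xs. if xs : points [z, x] then T [hd xs] * pr (xs ! 1) b else 0)"
  "pull (tens False A Q) (fpair X Z (%p. i p (pt B [b])) (exf Q T)) =
   (%xs. if xs : points [z, x] then T [hd xs] * pr (xs ! 1) b else 0)" if "b : carr (S y)"
  using that Q by (auto simp: pull_def wd_tens jn_def pp i_linear pts ep pj pr_i mult.commute dest!: points_ConsD intro!: ext)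
 show "pull (tens True B Q) (fpair Y Z (i (pt A [a])) (exf Q T)) =
   (%xs. if xs : points [y, z] then pr a (hd xs) * T [xs ! 1] else 0)"
  "pull (tens False Q B) (fpair Z Y (exf Q T) (i (pt A [a]))) =
   (%xs. if xs : points [y, z] then pr a (hd xs) * T [xs ! 1] else 0)" if "a : carr (S x)"
  using that Q by (auto simp: pull_def wd_tens jn_def pp i_linear pts ep pj pr_i mult.commute dest!: points_ConsD intro!: ext)
qed

lemma mate_T:
 assumes Q: "tpx Q Z" "wd Q = [z]" and f: "rp (tens True A Q) (tens True Q A) M f" and g: "rp (tens True Q B) (tens True B Q) Ph g"
  and eq: "!!p c r xi. p : carr X ==> c : carr Z ==> r : carr Y ==> linf Z xi ==>
   fpair Z X xi (%p'. i p' r) (M$(pure X Z p c)) = fpair Y Z (i p) xi (Ph$(pure Z Y c r))"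
 shows "are_mates f y (ev x y) z g x p q T"
proof (rule mate_word)
 show "hom f [x, z] [z, x]" "hom g [z, y] [y, z]" using rp_hom[OF f] rp_hom[OF g] Q by (simp_all add: wd_tens jn_def)
 have tq: "tp Q" "sp Q = Z" "vspace Z" using Q by (auto simp: tpx_def tp_vs)
 have vXY: "vspace X" "vspace Y" using tp_vs[OF tps(1)] tp_vs[OF tps(2)] tps by simp_all
 fix a c b T assume a: "a : carr (S x)" and c: "c : carr (S z)" and b: "b : carr (S y)" and T: "T : forms [z]"
 have el: "linf Z (exf Q T)" using exf_linear[OF tq(1), of T] T tq Q by simp
 have cz: "pt Q [c] : carr Z" using tp_pt[OF tq(1), of "[c]"] tq Q c by simp
 have p1: "pt (tens True A Q) [a, c] = pure X Z (pt A [a]) (pt Q [c])" and p2: "pt (tens True Q B) [c, b] = pure Z Y (pt Q [c]) (pt B [b])"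
  using pt_tens[of "[a]" A "[c]" Q True] pt_tens[of "[c]" Q "[b]" B True] a b c Q tq by (simp_all add: jn_def tps)
 have "afn f (pull (tens True Q A) (fpair Z X (exf Q T) (%p. i p (pt B [b])))) [a, c] =
   fpair Z X (exf Q T) (%p. i p (pt B [b])) (M$(pure X Z (pt A [a]) (pt Q [c])))" unfolding p1[symmetric] by (rule rp_app[OF f, symmetric])
   (use a c Q tq fpair_linear[OF tq(3) vXY(1) el i_linear(1)[OF b]] in \<open>simp_all add: wd_tens jn_def tps\<close>)
 moreover have "afn g (pull (tens True B Q) (fpair Y Z (i (pt A [a])) (exf Q T))) [c, b] =
   fpair Y Z (i (pt A [a])) (exf Q T) (Ph$(pure Z Y (pt Q [c]) (pt B [b])))" unfolding p2[symmetric] by (rule rp_app[OF g, symmetric])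
   (use b c Q tq fpair_linear[OF vXY(2) tq(3) i_linear(2)[OF a] el] in \<open>simp_all add: wd_tens jn_def tps\<close>)
 ultimately show "afn f (%xs. if xs : points [z, x] then T [hd xs] * pr (xs ! 1) b else 0) [a, c] =
   afn g (%xs. if xs : points [y, z] then pr a (hd xs) * T [xs ! 1] else 0) [c, b]"
  unfolding pull_pair(1)[OF Q T b] pull_pair(3)[OF Q T a] using eq[OF pts(1)[OF a] cz pts(2)[OF b] el] by simp
qed

lemma mate_F:
 assumes Q: "tpx Q Z" "wd Q = [z]" and f: "rp (tens False Q A) (tens False A Q) M f" and g: "rp (tens False B Q) (tens False Q B) Ph g"
  and eq: "!!p c r xi. p : carr X ==> c : carr Z ==> r : carr Y ==> linf Z xi ==>
   fpair X Z (%p'. i p' r) xi (M$(pure Z X c p)) = fpair Z Y xi (i p) (Ph$(pure Y Z r c))"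
 shows "are_mates f y (ev x y) z g x p q T"
proof (rule mate_word)
 show "hom f [x, z] [z, x]" "hom g [z, y] [y, z]" using rp_hom[OF f] rp_hom[OF g] Q by (simp_all add: wd_tens jn_def)
 have tq: "tp Q" "sp Q = Z" "vspace Z" using Q by (auto simp: tpx_def tp_vs)
 have vXY: "vspace X" "vspace Y" using tp_vs[OF tps(1)] tp_vs[OF tps(2)] tps by simp_all
 fix a c b T assume a: "a : carr (S x)" and c: "c : carr (S z)" and b: "b : carr (S y)" and T: "T : forms [z]"
 have el: "linf Z (exf Q T)" using exf_linear[OF tq(1), of T] T tq Q by simp
 have cz: "pt Q [c] : carr Z" using tp_pt[OF tq(1), of "[c]"] tq Q c by simp
 have p1: "pt (tens False Q A) [a, c] = pure Z X (pt Q [c]) (pt A [a])" and p2: "pt (tens False B Q) [c, b] = pure Y Z (pt B [b]) (pt Q [c])"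
  using pt_tens[of "[c]" Q "[a]" A False] pt_tens[of "[b]" B "[c]" Q False] a b c Q tq by (simp_all add: jn_def tps)
 have "afn f (pull (tens False A Q) (fpair X Z (%p. i p (pt B [b])) (exf Q T))) [a, c] =
   fpair X Z (%p. i p (pt B [b])) (exf Q T) (M$(pure Z X (pt Q [c]) (pt A [a])))" unfolding p1[symmetric] by (rule rp_app[OF f, symmetric])
   (use a c Q tq fpair_linear[OF vXY(1) tq(3) i_linear(1)[OF b] el] in \<open>simp_all add: wd_tens jn_def tps\<close>)
 moreover have "afn g (pull (tens False Q B) (fpair Z Y (exf Q T) (i (pt A [a])))) [c, b] =
   fpair Z Y (exf Q T) (i (pt A [a])) (Ph$(pure Y Z (pt B [b]) (pt Q [c])))" unfolding p2[symmetric] by (rule rp_app[OF g, symmetric])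
   (use b c Q tq fpair_linear[OF tq(3) vXY(2) el i_linear(2)[OF a]] in \<open>simp_all add: wd_tens jn_def tps\<close>)
 ultimately show "afn f (%xs. if xs : points [z, x] then T [hd xs] * pr (xs ! 1) b else 0) [a, c] =
   afn g (%xs. if xs : points [y, z] then pr a (hd xs) * T [xs ! 1] else 0) [c, b]"
  unfolding pull_pair(2)[OF Q T b] pull_pair(4)[OF Q T a] using eq[OF pts(1)[OF a] cz pts(2)[OF b] el] by simp
qed

lemma transp_rpI:
 assumes f: "rp A1 A2 f F" and g: "rp B2 B1 g G"
  and w: "wd A1 = replicate m x" "wd A2 = replicate n x" "wd B1 = replicate m y" "wd B2 = replicate n y"
  and l: "!!ys. ys : points (replicate n y) ==> linf (sp A2) (al ys)"
   "!!xs. xs : points (replicate m x) ==> linf (sp B1) (be xs)"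
  and v: "!!xs ys. xs : points (replicate n x) ==> ys : points (replicate n y) ==> al ys (pt A2 xs) = nest xs ys"
   "!!xs ys. xs : points (replicate m x) ==> ys : points (replicate m y) ==> be xs (pt B1 ys) = nest ys xs"
  and eq: "!!xs ys. xs : points (replicate m x) ==> ys : points (replicate n y) ==> al ys (f$(pt A1 xs)) = be xs (g$(pt B2 ys))"
 shows "transp x y F G"
proof (rule transpI[OF dual])
 show "hom F (replicate m x) (replicate n x)" "hom G (replicate n y) (replicate m y)" using rp_hom[OF f] rp_hom[OF g] w by simp_all
 fix xs ys assume xs: "xs : points (replicate m x)" and ys: "ys : points (replicate n y)"
 have "nestL x n ys = pull A2 (al ys)" using v(1) ys w by (auto simp: nestL_def pull_def fun_eq_iff)
 moreover have "nestL y m xs = pull B1 (be xs)" using v(2) xs w by (auto simp: nestL_def pull_def fun_eq_iff)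
 ultimately show "afn F (nestL x n ys) xs = afn G (nestL y m xs) ys"
  using rp_app[OF f l(1)[OF ys], of xs] rp_app[OF g l(2)[OF xs], of ys] eq[OF xs ys] xs ys w by simp
qed

end

context dual_frames begin

lemma tens_pt:
 "xs : points [x, x] ==> pt (tens o' A A) xs = pure X X (pt A [if o' then xs ! 0 else xs ! 1]) (pt A [if o' then xs ! 1 else xs ! 0])"
 "ys : points [y, y] ==> pt (tens o' B B) ys = pure Y Y (pt B [if o' then ys ! 0 else ys ! 1]) (pt B [if o' then ys ! 1 else ys ! 0])"
proof -
 show "pt (tens o' A A) xs = pure X X (pt A [if o' then xs ! 0 else xs ! 1]) (pt A [if o' then xs ! 1 else xs ! 0])" if "xs : points [x, x]"
 proof -
  obtain a b where "xs = [a, b]" "a : carr (S x)" "b : carr (S x)" using \<open>xs : points [x, x]\<close> by (auto dest!: points_ConsD)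
  then show ?thesis using pt_tens[of "[a]" A "[b]" A True] pt_tens[of "[b]" A "[a]" A False] by (cases o') (simp_all add: jn_def tps)
 qed
 show "pt (tens o' B B) ys = pure Y Y (pt B [if o' then ys ! 0 else ys ! 1]) (pt B [if o' then ys ! 1 else ys ! 0])" if "ys : points [y, y]"
 proof -
  obtain a b where "ys = [a, b]" "a : carr (S y)" "b : carr (S y)" using \<open>ys : points [y, y]\<close> by (auto dest!: points_ConsD)
  then show ?thesis using pt_tens[of "[a]" B "[b]" B True] pt_tens[of "[b]" B "[a]" B False] by (cases o') (simp_all add: jn_def tps)
 qed
qed

lemma points2: "xs : points [u, u] ==> xs ! 0 : carr (S u) & xs ! 1 : carr (S u) & xs = [xs ! 0, xs ! 1]" by (auto dest!: points_ConsD)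

lemma vXY: "vspace X" "vspace Y" using tp_vs[OF tps(1)] tp_vs[OF tps(2)] tps by simp_all

abbreviation "pairX o' ys == fpair X X (%p. i p (pt B [if o' then ys ! 1 else ys ! 0])) (%p. i p (pt B [if o' then ys ! 0 else ys ! 1]))"
abbreviation "pairY o' xs == fpair Y Y (i (pt A [if o' then xs ! 1 else xs ! 0])) (i (pt A [if o' then xs ! 0 else xs ! 1]))"

lemma pairX:
 assumes ys: "ys : points [y, y]"
 shows "linf (X >< X) (pairX o' ys)"
  and "xs : points [x, x] ==> pairX o' ys (pt (tens o' A A) xs) = nest xs ys"
proof -
 note ys' = points2[OF ys]
 show "linf (X >< X) (pairX o' ys)" by (rule fpair_linear[OF vXY(1,1)]) (use i_linear ys' in auto)
 assume xs: "xs : points [x, x]"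
 note xs' = points2[OF xs]
 obtain a b c d where ab: "xs = [a, b]" "ys = [c, d]" "a : carr (S x)" "b : carr (S x)" "c : carr (S y)" "d : carr (S y)" using xs' ys' by metis
 show "pairX o' ys (pt (tens o' A A) xs) = nest xs ys"
  using ab by (cases o') (simp_all add: tens_pt fpair_pure vXY i_linear pts nest_def pr_i mult.commute)
qed

lemma pairY:
 assumes xs: "xs : points [x, x]"
 shows "linf (Y >< Y) (pairY o' xs)"
  and "ys : points [y, y] ==> pairY o' xs (pt (tens o' B B) ys) = nest ys xs"
proof -
 note xs' = points2[OF xs]
 show "linf (Y >< Y) (pairY o' xs)" by (rule fpair_linear[OF vXY(2,2)]) (use i_linear xs' in auto)
 assume ys: "ys : points [y, y]"
 note ys' = points2[OF ys]
 obtain a b c d where ab: "xs = [a, b]" "ys = [c, d]" "a : carr (S x)" "b : carr (S x)" "c : carr (S y)" "d : carr (S y)" using xs' ys' by metis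
 have "pr d a = pr a d" "pr c b = pr b c" by (rule pr_sym)+
 then show "pairY o' xs (pt (tens o' B B) ys) = nest ys xs"
  using ab by (cases o') (simp_all add: tens_pt fpair_pure vXY i_linear pts nest_def pr_i mult.commute)
qed

lemma single:
 assumes "ys : points [y]" "xs : points [x]"
 shows "linf X (%p. i p (pt B ys))" "linf Y (i (pt A xs))"
  "i (pt A xs) (pt B ys) = nest xs ys" "nest ys xs = nest xs ys"
proof -
 obtain a b where ab: "xs = [a]" "ys = [b]" "a : carr (S x)" "b : carr (S y)" using assms by (auto dest!: points_ConsD)
 show "linf X (%p. i p (pt B ys))" "linf Y (i (pt A xs))"
  "i (pt A xs) (pt B ys) = nest xs ys" "nest ys xs = nest xs ys" using ab i_linear pr_sym[of b a] by (simp_all add: nest_def pr_i)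
qed

lemma transp_22:
 assumes f: "rp (tens o' A A) (tens o' A A) f F" and g: "rp (tens o' B B) (tens o' B B) g G"
  and eq: "!!p q a b. p : carr X ==> q : carr X ==> a : carr Y ==> b : carr Y ==>
   fpair X X (%p. i p b) (%p. i p a) (f$(pure X X p q)) = fpair Y Y (i q) (i p) (g$(pure Y Y a b))"
 shows "transp x y F G"
proof (rule transp_rpI[OF f g, where m = 2 and n = 2 and al = "pairX o'" and be = "pairY o'"])
 fix xs ys assume "xs : points (replicate 2 x)" "ys : points (replicate 2 y)"
 then have xy: "xs : points [x, x]" "ys : points [y, y]" by (simp_all add: numeral_2_eq_2)
 then show "pairX o' ys (f$(pt (tens o' A A) xs)) = pairY o' xs (g$(pt (tens o' B B) ys))"
  using points2[OF xy(1)] points2[OF xy(2)] by (cases o') (simp_all add: tens_pt eq pts)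
qed (simp_all add: wd_tens jn_def numeral_2_eq_2 tps pairX pairY)

lemma transp_21:
 assumes f: "rp (tens o' A A) A f F" and g: "rp B (tens o' B B) g G"
  and eq: "!!p q a. p : carr X ==> q : carr X ==> a : carr Y ==> i (f$(pure X X p q)) a = fpair Y Y (i q) (i p) (g$a)"
 shows "transp x y F G"
proof (rule transp_rpI[OF f g, where m = 2 and n = 1 and al = "%ys p. i p (pt B ys)" and be = "pairY o'"])
 fix xs ys assume "xs : points (replicate 2 x)" "ys : points (replicate 1 y)"
 then have xy: "xs : points [x, x]" "ys : points [y]" by (simp_all add: numeral_2_eq_2)
 have "pt B ys : carr Y" using tp_pt[OF tps(2), of ys] xy tps by simp
 then show "i (f$(pt (tens o' A A) xs)) (pt B ys) = pairY o' xs (g$(pt B ys))" using xy points2[OF xy(1)] by (cases o') (simp_all add: tens_pt eq pts)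
next
 fix ys assume "ys : points (replicate 1 y)"
 then obtain b where "ys = [b]" "b : carr (S y)" by (auto dest!: points_ConsD)
 then show "linf (sp A) (%p. i p (pt B ys))" using i_linear tps by simp
qed (simp_all add: wd_tens jn_def numeral_2_eq_2 tps pairY single)

lemma transp_12:
 assumes f: "rp A (tens o' A A) f F" and g: "rp (tens o' B B) B g G"
  and eq: "!!p a b. p : carr X ==> a : carr Y ==> b : carr Y ==> fpair X X (%p. i p b) (%p. i p a) (f$p) = i p (g$(pure Y Y a b))"
 shows "transp x y F G"
proof (rule transp_rpI[OF f g, where m = 1 and n = 2 and al = "pairX o'" and be = "%xs. i (pt A xs)"])
 fix xs ys assume "xs : points (replicate 1 x)" "ys : points (replicate 2 y)"
 then have xy: "xs : points [x]" "ys : points [y, y]" by (simp_all add: numeral_2_eq_2)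
 have "pt A xs : carr X" using tp_pt[OF tps(1), of xs] xy tps by simp
 then show "pairX o' ys (f$(pt A xs)) = i (pt A xs) (g$(pt (tens o' B B) ys))" using xy points2[OF xy(2)] by (cases o') (simp_all add: tens_pt eq pts)
next
 fix xs assume "xs : points (replicate 1 x)"
 then obtain b where "xs = [b]" "b : carr (S x)" by (auto dest!: points_ConsD)
 then show "linf (sp B) (i (pt A xs))" using i_linear tps by simp
qed (simp_all add: wd_tens jn_def numeral_2_eq_2 tps pairX single)

lemma nest_Nil: "nest [] [] = 1" by (simp add: nest_def)

lemma linear_ground_id: "linf ground (%c. c)" by (simp add: linear_ground_iff)

lemma transp_01:
 assumes f: "rp fG A f F" and g: "rp B fG g G" and eq: "!!a. a : carr Y ==> i (f$1) a = g$a"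
 shows "transp x y F G"
proof (rule transp_rpI[OF f g, where m = 0 and n = 1 and al = "%ys p. i p (pt B ys)" and be = "%_ c. c"])
 fix xs ys assume "xs : points (replicate 0 x)" "ys : points (replicate 1 y)"
 then have xy: "ys : points [y]" by simp
 have "pt B ys : carr Y" using tp_pt[OF tps(2), of ys] xy tps by simp
 then show "i (f$(pt fG xs)) (pt B ys) = g$(pt B ys)" by (simp add: eq)
next
 fix ys assume "ys : points (replicate 1 y)"
 then obtain b where "ys = [b]" "b : carr (S y)" by (auto dest!: points_ConsD)
 then show "linf (sp A) (%p. i p (pt B ys))" using i_linear tps by simp
qed (simp_all add: linear_ground_id single nest_Nil)

lemma transp_10:
 assumes f: "rp A fG f F" and g: "rp fG B g G" and eq: "!!p. p : carr X ==> f$p = i p (g$1)"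
 shows "transp x y F G"
proof (rule transp_rpI[OF f g, where m = 1 and n = 0 and al = "%_ c. c" and be = "%xs. i (pt A xs)"])
 fix xs ys assume "xs : points (replicate 1 x)" "ys : points (replicate 0 y)"
 then have xy: "xs : points [x]" by simp
 have "pt A xs : carr X" using tp_pt[OF tps(1), of xs] xy tps by simp
 then show "f$(pt A xs) = i (pt A xs) (g$(pt fG ys))" by (simp add: eq)
next
 fix xs assume "xs : points (replicate 1 x)"
 then obtain b where "xs = [b]" "b : carr (S x)" by (auto dest!: points_ConsD)
 then show "linf (sp B) (i (pt A xs))" using i_linear tps by simp
qed (simp_all add: linear_ground_id single nest_Nil)

end

datatype srt = sH | sV | sU

locale duality =
 fixes H :: "('k::field, 'h::ab_group_add) vs" and V :: "('k, 'v::ab_group_add) vs" and U :: "('k, 'h => 'k) vs"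
 assumes vH: "vspace H" and vV: "vspace V" and sub: "subspace_of U (dual H)" and nondeg: "nondegenerate U H"
begin

lemma vU: "vspace U" by (rule subspace_vs[OF sub vspace_dual[OF vH]])

text \<open>Three copies inside one product space, as all sorts must share a type.\<close>

definition S :: "srt => ('k, 'h \<times> 'v \<times> ('h => 'k)) vs" where
 "S s = \<lparr>carr = (case s of sH => carr H \<times> {0} \<times> {0} | sV => {0} \<times> carr V \<times> {0} | sU => {0} \<times> {0} \<times> carr U),
   scal = (%c (h, v, f). (scal H c h, scal V c v, scal U c f))\<rparr>"

definition pr :: "'h \<times> 'v \<times> ('h => 'k) => 'h \<times> 'v \<times> ('h => 'k) => 'k" where
 "pr = (%(h, v, f) (h', v', f'). f h' + f' h)"

lemma vspace_S: "vspace (S s)"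
proof -
 interpret H: vector_space "scal H" using vH by (simp add: vspace_def)
 interpret V: vector_space "scal V" using vV by (simp add: vspace_def)
 interpret U: vector_space "scal U" using vU by (simp add: vspace_def)
 have "vector_space (scal (S s))" by unfold_locales (auto simp: S_def H.scale_right_distrib V.scale_right_distrib U.scale_right_distrib
    H.scale_left_distrib V.scale_left_distrib U.scale_left_distrib)
 moreover from this interpret Z: vector_space "scal (S s)" .
 have "Z.subspace (carr (S s))" using vspace_zero[OF vH] vspace_zero[OF vV] vspace_zero[OF vU] vspace_add[OF vH] vspace_add[OF vV] vspace_add[OF vU]
   vspace_scal[OF vH] vspace_scal[OF vV] vspace_scal[OF vU] by (intro Z.subspaceI) (cases s; auto simp: S_def zero_prod_def simp del: zero_fun_def)+
 ultimately show ?thesis by (simp add: vspace_def)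
qed

sublocale tensor_words S by unfold_locales (rule vspace_S)

sublocale paired_words S pr by unfold_locales (auto simp: pr_def add.commute)

definition "hf = \<lparr>sp = H, wd = [sH], pt = (%xs. fst (hd xs))\<rparr>"
definition "vf = \<lparr>sp = V, wd = [sV], pt = (%xs. fst (snd (hd xs)))\<rparr>"
definition "uf = \<lparr>sp = U, wd = [sU], pt = (%xs. snd (snd (hd xs)))\<rparr>"

lemma frames3: "tpx hf H" "tpx vf V" "tpx uf U"
proof -
 have "tp hf" unfolding hf_def by (rule tp_base[OF vH]) (auto simp: S_def linear_map_def bij_betw_def inj_on_def image_iff)
 moreover have "tp vf" unfolding vf_def
  by (rule tp_base[OF vV, of "%z. fst (snd z)"]) (auto simp: S_def linear_map_def bij_betw_def inj_on_def image_iff)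
 moreover have "tp uf" unfolding uf_def
  by (rule tp_base[OF vU, of "%z. snd (snd z)"]) (auto simp: S_def linear_map_def bij_betw_def inj_on_def image_iff)
 ultimately show "tpx hf H" "tpx vf V" "tpx uf U" by (simp_all add: tpx_def hf_def vf_def uf_def)
qed

lemma words3: "wd hf = [sH]" "wd vf = [sV]" "wd uf = [sU]" by (simp_all add: hf_def vf_def uf_def)

lemma pairings: "pairs U H (%f. f)" "pairs H U ev_at" using pairs_sub[OF vH sub] nondeg by simp_all

lemma U_linear: "f : carr U ==> f 0 = 0" using linear_ground_0[OF vH pairs_right[OF pairings(1)]] .

lemma dual_sorts_UH: "dual_sorts sU sH"
proof -
 have sc: "scal U c f = (%h. c * f h)" for c f using sub by (simp add: subspace_of_def dual_simps)
 have 1: "linf H f" if "f : carr U" for f by (rule pairs_right[OF pairings(1) that])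
 have 2: "f = 0" if f: "f : carr U" and z: "!!h. h : carr H ==> f h = 0" for f by (rule pairs_eqI[OF pairings(1) f vspace_zero[OF vU]]) (simp add: z)
 have 3: "h = 0" if h: "h : carr H" and z: "!!f. f : carr U ==> f h = 0" for h
  by (rule pairs_eqI[OF pairings(2) h vspace_zero[OF vH]]) (simp add: z U_linear ev_at_def)
 show ?thesis unfolding dual_sorts_def
  using 1 by (auto simp: S_def pr_def linear_ground_iff U_linear sc zero_prod_def intro!: 2 3 simp del: zero_fun_def)
qed

lemma pr_val:
 assumes "a : carr (S sU)" "b : carr (S sH)"
 shows "pr a b = pt uf [a] (pt hf [b])" "pr b a = pt uf [a] (pt hf [b])" using assms by (auto simp: S_def pr_def uf_def hf_def U_linear)

sublocale trans S H V hf vf sH sV by unfold_locales (simp_all add: frames3 words3)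

sublocale UH: dual_frames S pr U H uf hf sU sH "%f a. f a" by unfold_locales (simp_all add: frames3 words3 dual_sorts_UH pairings pr_val)

sublocale HU: dual_frames S pr H U hf uf sH sU ev_at
 by unfold_locales (simp_all add: frames3 words3 dual_sorts_sym[OF dual_sorts_UH] pairings pr_val ev_at_def)

lemma iso_arrow:
 assumes A: "tpx A X" and B: "tpx B Y" and f: "f : Iso X Y"
 obtains F G where "rp A B f F" "rp B A (linv f) G" "F >> G = ida (wd A)" "G >> F = ida (wd B)"
proof -
 have "tp A" "tp B" "sp A = X" "sp B = Y" using A B by (auto simp: tpx_def)
 then obtain F where F: "rp A B f F" using rp_ex[of A B f] Iso_Hom[OF f] by auto
 obtain G where "rp B A (linv f) G" "F >> G = ida (wd A)" "G >> F = ida (wd B)"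
  using rp_linv[OF F] f \<open>sp A = X\<close> \<open>sp B = Y\<close> by auto
 with F show ?thesis by (rule that)
qed

lemma hom_arrow:
 assumes A: "tpx A X" and B: "tpx B Y" and f: "f : Hom X Y"
 obtains F where "rp A B f F" using assms rp_ex[of A B f] by (auto simp: tpx_def)

end

section \<open>Comodules and modules over the twisted bialgebra\<close>

lemma contractR:
 assumes V: "vspace V" and X: "vspace X" and Y: "vspace Y" and k: "ka : Hom (X >< Y) ground"
  and xi: "linf V xi" and y: "y : carr Y" and t: "t : carr (V >< X)"
 shows "xi ((runit V oo (Id V ** ka) oo assoc V X Y)$(pure (V >< X) Y t y)) = fpair V X xi (%x. ka$(pure X Y x y)) t"
proof -
 note T = vT
 note t4 = assoc_Hom[OF V X Y] and t5 = tensor_lmap_Hom[OF V T V vspace_ground Id_Hom[OF V] k] and t6 = runit_Hom[OF V]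
 note r5 = comp_Hom[OF T t4(1) t5(1)] note c4 = comp_Hom[OF T r5 t6]
 note l = linear_comp[OF pure_linear1[OF X Y y] Hom_linear[OF k]]
 show ?thesis
 proof (rule tensor_linear_eqI[OF V X linear_comp[OF linear_comp[OF pure_linear1[OF T Y y] Hom_linear[OF c4]] xi] fpair_linear[OF V X xi l] _ t])
  fix v x assume vx: "v : carr V" "x : carr X"
  have "(runit V oo (Id V ** ka) oo assoc V X Y)$(pure (V >< X) Y (pure V X v x) y) = scal V (ka$(pure X Y x y)) v"
   using vx y by (simp add: comp_app[OF r5] comp_app[OF t4(1)] t4(2) t5(2) Id_app runit_pure V pT)
  then show "xi ((runit V oo (Id V ** ka) oo assoc V X Y)$(pure (V >< X) Y (pure V X v x) y)) = fpair V X xi (%x. ka$(pure X Y x y)) (pure V X v x)"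
   using vx by (simp add: fpair_pure[OF V X xi l] linear_ground_simps(2)[OF xi] mult.commute)
 qed
qed

lemma contractL:
 assumes V: "vspace V" and X: "vspace X" and Y: "vspace Y" and k: "ka : Hom (Y >< X) ground"
  and xi: "linf V xi" and y: "y : carr Y" and t: "t : carr (X >< V)"
 shows "xi ((lunit V oo (ka ** Id V) oo assoc' Y X V)$(pure Y (X >< V) y t)) = fpair X V (%x. ka$(pure Y X y x)) xi t"
proof -
 note T = vT
 note t4 = assoc'_Hom[OF Y X V] and t5 = tensor_lmap_Hom[OF T V vspace_ground V k Id_Hom[OF V]] and t6 = lunit_Hom[OF V]
 note r5 = comp_Hom[OF T t4(1) t5(1)] note c4 = comp_Hom[OF T r5 t6]
 note l = linear_comp[OF pure_linear2[OF Y X y] Hom_linear[OF k]]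
 show ?thesis
 proof (rule tensor_linear_eqI[OF X V linear_comp[OF linear_comp[OF pure_linear2[OF Y T y] Hom_linear[OF c4]] xi] fpair_linear[OF X V l xi] _ t])
  fix x v assume vx: "x : carr X" "v : carr V"
  have "(lunit V oo (ka ** Id V) oo assoc' Y X V)$(pure Y (X >< V) y (pure X V x v)) = scal V (ka$(pure Y X y x)) v"
   using vx y by (simp add: comp_app[OF r5] comp_app[OF t4(1)] t4(2) t5(2) Id_app lunit_pure V pT)
  then show "xi ((lunit V oo (ka ** Id V) oo assoc' Y X V)$(pure Y (X >< V) y (pure X V x v))) = fpair X V (%x. ka$(pure Y X y x)) xi (pure X V x v)"
   using vx by (simp add: fpair_pure[OF X V l xi] linear_ground_simps(2)[OF xi])
 qed
qed

definition conR where "conR V X Y ka rh = runit V oo (Id V ** ka) oo assoc V X Y oo (rh ** Id Y)"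
definition conL where "conL V X Y ka rh = lunit V oo (ka ** Id V) oo assoc' Y X V oo (Id Y ** rh)"

lemma conR:
 assumes V: "vspace V" and X: "vspace X" and Y: "vspace Y" and k: "ka : Hom (X >< Y) ground" and r: "rh : Hom V (V >< X)"
 shows "conR V X Y ka rh : Hom (V >< Y) V"
  and "linf V xi ==> v : carr V ==> y : carr Y ==>
   xi (conR V X Y ka rh$(pure V Y v y)) = fpair V X xi (%x. ka$(pure X Y x y)) (rh$v)"
proof -
 note T = vT
 note t3 = tensor_lmap_Hom[OF V Y T Y r Id_Hom[OF Y]]
  and t4 = assoc_Hom[OF V X Y] and t5 = tensor_lmap_Hom[OF V T V vspace_ground Id_Hom[OF V] k] and t6 = runit_Hom[OF V]
 note r4 = comp_Hom[OF T t3(1) t4(1)] note r5 = comp_Hom[OF T r4 t5(1)] note s5 = comp_Hom[OF T t4(1) t5(1)]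
 show "conR V X Y ka rh : Hom (V >< Y) V" using comp_Hom[OF T r5 t6] by (simp add: conR_def)
 assume xi: "linf V xi" and v: "v : carr V" and y: "y : carr Y"
 have "conR V X Y ka rh$(pure V Y v y) = (runit V oo (Id V ** ka) oo assoc V X Y)$(pure (V >< X) Y (rh$v) y)"
  using v y by (simp add: conR_def comp_app[OF r5] comp_app[OF r4] comp_app[OF t3(1)] comp_app[OF t4(1)] comp_app[OF s5] t3(2) Id_app pT Hom_in[OF r])
 then show "xi (conR V X Y ka rh$(pure V Y v y)) = fpair V X xi (%x. ka$(pure X Y x y)) (rh$v)"
  using contractR[OF V X Y k xi y Hom_in[OF r v]] by simp
qed

lemma conL:
 assumes V: "vspace V" and X: "vspace X" and Y: "vspace Y" and k: "ka : Hom (Y >< X) ground" and r: "rh : Hom V (X >< V)"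
 shows "conL V X Y ka rh : Hom (Y >< V) V"
  and "linf V xi ==> v : carr V ==> y : carr Y ==>
   xi (conL V X Y ka rh$(pure Y V y v)) = fpair X V (%x. ka$(pure Y X y x)) xi (rh$v)"
proof -
 note T = vT
 note t3 = tensor_lmap_Hom[OF Y V Y T Id_Hom[OF Y] r]
  and t4 = assoc'_Hom[OF Y X V] and t5 = tensor_lmap_Hom[OF T V vspace_ground V k Id_Hom[OF V]] and t6 = lunit_Hom[OF V]
 note r4 = comp_Hom[OF T t3(1) t4(1)] note r5 = comp_Hom[OF T r4 t5(1)] note s5 = comp_Hom[OF T t4(1) t5(1)]
 show "conL V X Y ka rh : Hom (Y >< V) V" using comp_Hom[OF T r5 t6] by (simp add: conL_def)
 assume xi: "linf V xi" and v: "v : carr V" and y: "y : carr Y"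
 have "conL V X Y ka rh$(pure Y V y v) = (lunit V oo (ka ** Id V) oo assoc' Y X V)$(pure Y (X >< V) y (rh$v))"
  using v y by (simp add: conL_def comp_app[OF r5] comp_app[OF r4] comp_app[OF t3(1)] comp_app[OF t4(1)] comp_app[OF s5] t3(2) Id_app pT Hom_in[OF r])
 then show "xi (conL V X Y ka rh$(pure Y V y v)) = fpair X V (%x. ka$(pure Y X y x)) xi (rh$v)"
  using contractL[OF V X Y k xi y Hom_in[OF r v]] by simp
qed

context duality begin

lemma evs_rp:
 shows "rp (lT uf hf) fG (Defs.ev U H) (ev sU sH)" "rp (lT hf uf) fG (ev' H U) (ev sH sU)"
  "rp (lF hf uf) fG (ev' H U) (ev sU sH)" "rp (lF uf hf) fG (Defs.ev U H) (ev sH sU)"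
 using ev_Hom[OF pairings(1)] by (auto intro!: UH.ev_rp HU.ev_rp UH.ev_rp' HU.ev_rp' simp: ev_at_def)

lemma double_mate_T:
 assumes b: "braiding H Ps" and l: "left_braided H Ps V Ph"
  and bij: "bijective (Psi_UU H U Ps)" "bijective (Psi_UV H V U Ph)" "bijective (Psi2_HV H V U Ph)"
 obtains s si a ai t ti k ki g gi where
  "rp (lT hf hf) (lT hf hf) Ps s" "rp (lT hf hf) (lT hf hf) (linv Ps) si" "rp (lT hf vf) (lT vf hf) Ph a" "rp (lT vf hf) (lT hf vf) (linv Ph) ai"
  "rp (lT hf vf) (lT vf hf) (induced (Psi2_HV H V U Ph)) k" "induced (Psi2_HV H V U Ph) : Iso (H >< V) (V >< H)"
  "double_mate S pr sU sH sV a ai t ti k ki s si g gi"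
proof -
 note tt = tpx_tens[where o' = True]
 let ?\<theta> = "induced (Psi_UV H V U Ph)" and ?ph = "induced (Psi2_HV H V U Ph)" and ?\<gamma> = "induced (Psi_UU H U Ps)"
 have iPsi: "Ps : Iso (H >< H) (H >< H)" using b by (simp add: braiding_def)
 have iPhi: "Ph : Iso (H >< V) (V >< H)" using l by (simp add: left_braided_def)
 note lPhi = Iso_Hom[OF linv_Iso(1)[OF vT iPhi]]
 note dV = pairs_dual[OF vV]
 note th = mateL[OF pairings(1) dV lPhi bij(2)[unfolded Psi_UV_def], folded Psi_UV_def]
 note lth = Iso_Hom[OF linv_Iso(1)[OF vT th(1)]]
 note ph = mateL[OF pairings(2) dV lth bij(3)[unfolded Psi2_HV_def], folded Psi2_HV_def]
 note ga = Psi_UU[OF pairings(1) Iso_Hom[OF iPsi] bij(1)]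
 obtain s si where s: "rp (lT hf hf) (lT hf hf) Ps s" "rp (lT hf hf) (lT hf hf) (linv Ps) si"
  "s >> si = ida (wd (lT hf hf))" "si >> s = ida (wd (lT hf hf))" using iso_arrow[OF tt[OF frames3(1,1)] tt[OF frames3(1,1)] iPsi] by blast
 obtain a ai where a: "rp (lT hf vf) (lT vf hf) Ph a" "rp (lT vf hf) (lT hf vf) (linv Ph) ai"
  "a >> ai = ida (wd (lT hf vf))" "ai >> a = ida (wd (lT vf hf))" using iso_arrow[OF tt[OF frames3(1,2)] tt[OF frames3(2,1)] iPhi] by blast
 obtain t ti where t: "rp (lT uf vf) (lT vf uf) ?\<theta> t" "rp (lT vf uf) (lT uf vf) (linv ?\<theta>) ti"
  "t >> ti = ida (wd (lT uf vf))" "ti >> t = ida (wd (lT vf uf))" using iso_arrow[OF tt[OF frames3(3,2)] tt[OF frames3(2,3)] th(1)] by blast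
 obtain k ki where k: "rp (lT hf vf) (lT vf hf) ?ph k" "rp (lT vf hf) (lT hf vf) (linv ?ph) ki"
  "k >> ki = ida (wd (lT hf vf))" "ki >> k = ida (wd (lT vf hf))" using iso_arrow[OF tt[OF frames3(1,2)] tt[OF frames3(2,1)] ph(1)] by blast
 obtain g gi where g: "rp (lT uf uf) (lT uf uf) ?\<gamma> g" "rp (lT uf uf) (lT uf uf) (linv ?\<gamma>) gi"
  "g >> gi = ida (wd (lT uf uf))" "gi >> g = ida (wd (lT uf uf))" using iso_arrow[OF tt[OF frames3(3,3)] tt[OF frames3(3,3)] ga(1)] by blast
 have homs: "hom a [sH, sV] [sV, sH]" "hom ai [sV, sH] [sH, sV]" "hom t [sU, sV] [sV, sU]" "hom ti [sV, sU] [sU, sV]"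
  "hom k [sH, sV] [sV, sH]" "hom ki [sV, sH] [sH, sV]" "hom g [sU, sU] [sU, sU]" "hom gi [sU, sU] [sU, sU]"
  "hom s [sH, sH] [sH, sH]" "hom si [sH, sH] [sH, sH]"
  using s(1,2)[THEN rp_hom] a(1,2)[THEN rp_hom] t(1,2)[THEN rp_hom] k(1,2)[THEN rp_hom] g(1,2)[THEN rp_hom] by (simp_all add: wd_tens jn_def words3)
 have invs: "a >> ai = ida [sH, sV]" "ai >> a = ida [sV, sH]" "t >> ti = ida [sU, sV]" "ti >> t = ida [sV, sU]"
  "k >> ki = ida [sH, sV]" "ki >> k = ida [sV, sH]" "g >> gi = ida [sU, sU]" "gi >> g = ida [sU, sU]"
  "s >> si = ida [sH, sH]" "si >> s = ida [sH, sH]" using s(3,4) a(3,4) t(3,4) k(3,4) g(3,4) by (simp_all add: wd_tens jn_def words3)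
 have mate: "are_mates t sH (ev sU sH) sV ai sU p q T" for p q T by (rule UH.mate_T[OF frames3(2) words3(2) t(1) a(2)]) (rule th(2))
 have mate': "are_mates k sU (ev sH sU) sV ti sH p q T" for p q T by (rule HU.mate_T[OF frames3(2) words3(2) k(1) t(2)]) (rule ph(2))
 have tr: "transp sU sH g s" by (rule UH.transp_22[OF g(1) s(1)]) (rule ga(2))
 have br: "braid_slides s sV a sH p q T" for p q T using braid_T[OF s(1) a(1)] l by (simp add: left_braided_def)
 have "double_mate S pr sU sH sV a ai t ti k ki s si g gi"
  by (intro double_mate.intro double_mate_axioms.intro paired_words_axioms) (rule dual_sorts_UH homs invs mate mate' tr br)+
 with s(1,2) a(1,2) k(1) ph(1) show ?thesis by (rule that)
qed

lemma double_mate_F: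
 assumes b: "braiding H Ps" and l: "right_braided H Ps V Ph"
  and bij: "bijective (Psi_UU H U Ps)" "bijective (Psi_VU H V U Ph)" "bijective (Psi2_VH H V U Ph)"
 obtains s si a ai t ti k ki g gi where
  "rp (lF hf hf) (lF hf hf) Ps s" "rp (lF hf hf) (lF hf hf) (linv Ps) si" "rp (lF vf hf) (lF hf vf) Ph a" "rp (lF hf vf) (lF vf hf) (linv Ph) ai"
  "rp (lF vf hf) (lF hf vf) (induced (Psi2_VH H V U Ph)) k" "induced (Psi2_VH H V U Ph) : Iso (V >< H) (H >< V)"
  "double_mate S pr sU sH sV a ai t ti k ki s si g gi"
proof -
 note tt = tpx_tens[where o' = False]
 let ?\<theta> = "induced (Psi_VU H V U Ph)" and ?ph = "induced (Psi2_VH H V U Ph)" and ?\<gamma> = "induced (Psi_UU H U Ps)"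
 have iPsi: "Ps : Iso (H >< H) (H >< H)" using b by (simp add: braiding_def)
 have iPhi: "Ph : Iso (V >< H) (H >< V)" using l by (simp add: right_braided_def)
 note lPhi = Iso_Hom[OF linv_Iso(1)[OF vT iPhi]]
 note dV = pairs_dual[OF vV]
 note th = mateR[OF dV pairings(1) lPhi bij(2)[unfolded Psi_VU_def], folded Psi_VU_def]
 note lth = Iso_Hom[OF linv_Iso(1)[OF vT th(1)]]
 note ph = mateR[OF dV pairings(2) lth bij(3)[unfolded Psi2_VH_def], folded Psi2_VH_def]
 note ga = Psi_UU[OF pairings(1) Iso_Hom[OF iPsi] bij(1)]
 obtain s si where s: "rp (lF hf hf) (lF hf hf) Ps s" "rp (lF hf hf) (lF hf hf) (linv Ps) si"
  "s >> si = ida (wd (lF hf hf))" "si >> s = ida (wd (lF hf hf))" using iso_arrow[OF tt[OF frames3(1,1)] tt[OF frames3(1,1)] iPsi] by blast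
 obtain a ai where a: "rp (lF vf hf) (lF hf vf) Ph a" "rp (lF hf vf) (lF vf hf) (linv Ph) ai"
  "a >> ai = ida (wd (lF vf hf))" "ai >> a = ida (wd (lF hf vf))" using iso_arrow[OF tt[OF frames3(2,1)] tt[OF frames3(1,2)] iPhi] by blast
 obtain t ti where t: "rp (lF vf uf) (lF uf vf) ?\<theta> t" "rp (lF uf vf) (lF vf uf) (linv ?\<theta>) ti"
  "t >> ti = ida (wd (lF vf uf))" "ti >> t = ida (wd (lF uf vf))" using iso_arrow[OF tt[OF frames3(2,3)] tt[OF frames3(3,2)] th(1)] by blast
 obtain k ki where k: "rp (lF vf hf) (lF hf vf) ?ph k" "rp (lF hf vf) (lF vf hf) (linv ?ph) ki"
  "k >> ki = ida (wd (lF vf hf))" "ki >> k = ida (wd (lF hf vf))" using iso_arrow[OF tt[OF frames3(2,1)] tt[OF frames3(1,2)] ph(1)] by blast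
 obtain g gi where g: "rp (lF uf uf) (lF uf uf) ?\<gamma> g" "rp (lF uf uf) (lF uf uf) (linv ?\<gamma>) gi"
  "g >> gi = ida (wd (lF uf uf))" "gi >> g = ida (wd (lF uf uf))" using iso_arrow[OF tt[OF frames3(3,3)] tt[OF frames3(3,3)] ga(1)] by blast
 have homs: "hom a [sH, sV] [sV, sH]" "hom ai [sV, sH] [sH, sV]" "hom t [sU, sV] [sV, sU]" "hom ti [sV, sU] [sU, sV]"
  "hom k [sH, sV] [sV, sH]" "hom ki [sV, sH] [sH, sV]" "hom g [sU, sU] [sU, sU]" "hom gi [sU, sU] [sU, sU]"
  "hom s [sH, sH] [sH, sH]" "hom si [sH, sH] [sH, sH]"
  using s(1,2)[THEN rp_hom] a(1,2)[THEN rp_hom] t(1,2)[THEN rp_hom] k(1,2)[THEN rp_hom] g(1,2)[THEN rp_hom] by (simp_all add: wd_tens jn_def words3)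
 have invs: "a >> ai = ida [sH, sV]" "ai >> a = ida [sV, sH]" "t >> ti = ida [sU, sV]" "ti >> t = ida [sV, sU]"
  "k >> ki = ida [sH, sV]" "ki >> k = ida [sV, sH]" "g >> gi = ida [sU, sU]" "gi >> g = ida [sU, sU]"
  "s >> si = ida [sH, sH]" "si >> s = ida [sH, sH]" using s(3,4) a(3,4) t(3,4) k(3,4) g(3,4) by (simp_all add: wd_tens jn_def words3)
 have mate: "are_mates t sH (ev sU sH) sV ai sU p q T" for p q T by (rule UH.mate_F[OF frames3(2) words3(2) t(1) a(2)]) (rule th(2))
 have mate': "are_mates k sU (ev sH sU) sV ti sH p q T" for p q T by (rule HU.mate_F[OF frames3(2) words3(2) k(1) t(2)]) (rule ph(2))
 have tr: "transp sU sH g s" by (rule UH.transp_22[OF g(1) s(1)]) (rule ga(2))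
 have br: "braid_slides s sV a sH p q T" for p q T using braid_F[OF s(1) a(1)] l by (simp add: right_braided_def)
 have "double_mate S pr sU sH sV a ai t ti k ki s si g gi"
  by (intro double_mate.intro double_mate_axioms.intro paired_words_axioms) (rule dual_sorts_UH homs invs mate mate' tr br)+
 with s(1,2) a(1,2) k(1) ph(1) show ?thesis by (rule that)
qed

lemma separated_eqI:
 assumes "vspace X" "vspace Y" and Z: "vspace Z" and f: "f : Hom (X >< Y) Z" and g: "g : Hom (X >< Y) Z"
  and eq: "!!xi x y. linf Z xi ==> x : carr X ==> y : carr Y ==> xi (f$(pure X Y x y)) = xi (g$(pure X Y x y))"
 shows "f = g" by (rule tensor_Hom_eqI[OF assms(1,2) f g], rule functionals_separate[OF Z])
  (simp_all add: Hom_in[OF f] Hom_in[OF g] pT eq)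

lemma coact_twisted_T:
 assumes r: "rp vf (lT vf hf) rh r" "rp vf (lT vf hf) rh' r'" "rp (lT hf uf) (lT uf hf) be b"
  and eq: "!!v f xi. v : carr V ==> f : carr U ==> linf V xi ==>
   fpair V H xi f (rh'$v) = fpair V H xi (%h. Defs.ev U H$(be$(pure H U h f))) (rh$v)"
 shows "transported r' sU (ev sH sU) sV r b (ev sU sH) p q T"
proof -
 note [simp] = r[THEN rp_hom, unfolded hom_def wd_tens jn_def] ev_arrow[OF dual_sorts_UH] ev_arrow[OF dual_sorts_sym[OF dual_sorts_UH]]
 note e = ev_Hom[OF pairings(1)]
 have rh: "rh : Hom V (V >< H)" "rh' : Hom V (V >< H)" and be: "be : Hom (H >< U) (U >< H)" using r[THEN rp_Hom] frames3 by (simp_all add: tpx_def)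
 note eb = comp_Hom[OF vT be e(1)]
 note c = conR[OF vV vH vU e(2) rh(2)] conR[OF vV vH vU eb rh(1)]
 have "conR V H U (ev' H U) rh' = conR V H U (Defs.ev U H oo be) rh"
 proof (rule separated_eqI[OF vV vU vV c(1,3)])
  fix xi v f assume xi: "linf V xi" and v: "v : carr V" and f: "f : carr U"
  have cong: "fpair V H xi ka t = fpair V H xi ka' t" if "!!h. h : carr H ==> ka h = ka' h" "linf H ka" "linf H ka'" "t : carr (V >< H)" for ka ka' t
   by (rule tensor_linear_eqI[OF vV vH fpair_linear fpair_linear _ that(4)]) (simp_all add: vV vH xi that fpair_pure)
  note lH = linear_comp[OF pure_linear1[OF vH vU f]]
  show "xi (conR V H U (ev' H U) rh'$(pure V U v f)) = xi (conR V H U (Defs.ev U H oo be) rh$(pure V U v f))"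
   unfolding c(2)[OF xi v f] c(4)[OF xi v f]
   using eq[OF v f xi] cong[OF _ lH[OF Hom_linear[OF e(2)]] pairs_right[OF pairings(1) f] Hom_in[OF rh(2) v]]
    cong[OF _ lH[OF Hom_linear[OF eb]] lH[OF linear_comp[OF Hom_linear[OF be] Hom_linear[OF e(1)]]] Hom_in[OF rh(1) v]]
   by (simp add: e f comp_app[OF be] pT)
 qed
 moreover have "conR V H U (ev' H U) rh' = conR V H U (Defs.ev U H oo be) rh <->
   (\<forall>p q T. transported r' sU (ev sH sU) sV r b (ev sU sH) p q T)"
  unfolding conR_def by (rule rp_eqI, (rule r frames3 evs_rp rulesT)+, simp add: tr_simps)
 ultimately show ?thesis by simp
qed

lemma coact_of_T:
 assumes r: "rp vf (lT vf uf) rh r" "rp (lT hf vf) vf nv n" "rp (lT vf hf) (lT hf vf) Phi ai"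
  and eq: "!!v a xi. v : carr V ==> a : carr H ==> linf V xi ==>
   fpair V U xi (%f. f a) (rh$v) = xi (nv$(Phi$(pure V H v a)))"
 shows "W r p (sH#q) (W (ev sU sH) (sV#p) q T) = W ai p q (W n p q T)"
proof -
 note [simp] = r[THEN rp_hom, unfolded hom_def wd_tens jn_def] ev_arrow[OF dual_sorts_UH] ev_arrow[OF dual_sorts_sym[OF dual_sorts_UH]]
 note e = ev_Hom[OF pairings(1)]
 have rh: "rh : Hom V (V >< U)" and nv: "nv : Hom (H >< V) V" and ai: "Phi : Hom (V >< H) (H >< V)"
  using r[THEN rp_Hom] frames3 by (simp_all add: tpx_def)
 note c = conR[OF vV vU vH e(1) rh]
 note n = comp_Hom[OF vT ai nv]
 have "conR V U H (Defs.ev U H) rh = nv oo Phi"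
 proof (rule separated_eqI[OF vV vH vV c(1) n])
  fix xi v a assume xi: "linf V xi" and v: "v : carr V" and a: "a : carr H"
  note lU = linear_comp[OF pure_linear1[OF vU vH a] Hom_linear[OF e(1)]]
  have "fpair V U xi (%f. Defs.ev U H$(pure U H f a)) (rh$v) = fpair V U xi (%f. f a) (rh$v)"
   by (rule tensor_linear_eqI[OF vV vU fpair_linear fpair_linear _ Hom_in[OF rh v]])
    (simp_all add: vV vU xi lU pairs_left[OF pairings(1) a] fpair_pure e a)
  then show "xi (conR V U H (Defs.ev U H) rh$(pure V H v a)) = xi ((nv oo Phi)$(pure V H v a))"
   unfolding c(2)[OF xi v a] using eq[OF v a xi] by (simp add: comp_app[OF ai] pT v a)
 qed
 moreover have "conR V U H (Defs.ev U H) rh = nv oo Phi <->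
   (\<forall>p q T. W r p (sH#q) (W (ev sU sH) (sV#p) q T) = W ai p q (W n p q T))"
  unfolding conR_def by (rule rp_eqI, (rule r frames3 evs_rp rulesT)+, simp add: tr_simps)
 ultimately show ?thesis by simp
qed

lemma act_word_T:
 assumes r: "rp vf (lT vf uf) rh r" "rp (lT hf vf) (lT vf hf) ch k" and n: "rp (lT hf vf) vf (actL H V U ch rh) n"
 shows "W n p q T = W r (sH#p) q (W k p (sU#q) (W (ev sH sU) (sV#p) q T))"
proof -
 note [simp] = r[THEN rp_hom, unfolded hom_def wd_tens jn_def] n[THEN rp_hom, unfolded hom_def wd_tens jn_def]
  ev_arrow[OF dual_sorts_UH] ev_arrow[OF dual_sorts_sym[OF dual_sorts_UH]]
 have "actL H V U ch rh = actL H V U ch rh <->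
   (\<forall>p q T. W n p q T = W r (sH#p) q (W k p (sU#q) (W (ev sH sU) (sV#p) q T)))"
  by (rule rp_eqI[OF n], unfold actL_def, (rule r frames3 evs_rp rulesT)+, simp add: tr_simps)
 then show ?thesis by simp
qed

lemma coact_twisted_F:
 assumes r: "rp vf (lF hf vf) rh r" "rp vf (lF hf vf) rh' r'" "rp (lF uf hf) (lF hf uf) be b"
  and eq: "!!v f xi. v : carr V ==> f : carr U ==> linf V xi ==>
   fpair H V f xi (rh'$v) = fpair H V (%h. ev' H U$(be$(pure U H f h))) xi (rh$v)"
 shows "transported r' sU (ev sH sU) sV r b (ev sU sH) p q T"
proof -
 note [simp] = r[THEN rp_hom, unfolded hom_def wd_tens jn_def] ev_arrow[OF dual_sorts_UH] ev_arrow[OF dual_sorts_sym[OF dual_sorts_UH]]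
 note e = ev_Hom[OF pairings(1)]
 have rh: "rh : Hom V (H >< V)" "rh' : Hom V (H >< V)" and be: "be : Hom (U >< H) (H >< U)" using r[THEN rp_Hom] frames3 by (simp_all add: tpx_def)
 note eb = comp_Hom[OF vT be e(2)]
 note c = conL[OF vV vH vU e(1) rh(2)] conL[OF vV vH vU eb rh(1)]
 have "conL V H U (Defs.ev U H) rh' = conL V H U (ev' H U oo be) rh"
 proof (rule separated_eqI[OF vU vV vV c(1,3)])
  fix xi f v assume xi: "linf V xi" and f: "f : carr U" and v: "v : carr V"
  have cong: "fpair H V ka xi t = fpair H V ka' xi t" if "!!h. h : carr H ==> ka h = ka' h" "linf H ka" "linf H ka'" "t : carr (H >< V)" for ka ka' t
   by (rule tensor_linear_eqI[OF vH vV fpair_linear fpair_linear _ that(4)]) (simp_all add: vV vH xi that fpair_pure)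
  note lH = linear_comp[OF pure_linear2[OF vU vH f]]
  show "xi (conL V H U (Defs.ev U H) rh'$(pure U V f v)) = xi (conL V H U (ev' H U oo be) rh$(pure U V f v))"
   unfolding c(2)[OF xi v f] c(4)[OF xi v f]
   using eq[OF v f xi] cong[OF _ lH[OF Hom_linear[OF e(1)]] pairs_right[OF pairings(1) f] Hom_in[OF rh(2) v]]
    cong[OF _ lH[OF Hom_linear[OF eb]] lH[OF linear_comp[OF Hom_linear[OF be] Hom_linear[OF e(2)]]] Hom_in[OF rh(1) v]]
   by (simp add: e f comp_app[OF be] pT)
 qed
 moreover have "conL V H U (Defs.ev U H) rh' = conL V H U (ev' H U oo be) rh <->
   (\<forall>p q T. transported r' sU (ev sH sU) sV r b (ev sU sH) p q T)"
  unfolding conL_def by (rule rp_eqI, (rule r frames3 evs_rp rulesF)+, simp add: tr_simps)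
 ultimately show ?thesis by simp
qed

lemma coact_of_F:
 assumes r: "rp vf (lF uf vf) rh r" "rp (lF vf hf) vf nv n" "rp (lF hf vf) (lF vf hf) Phi ai"
  and eq: "!!v a xi. v : carr V ==> a : carr H ==> linf V xi ==>
   fpair U V (%f. f a) xi (rh$v) = xi (nv$(Phi$(pure H V a v)))"
 shows "W r p (sH#q) (W (ev sU sH) (sV#p) q T) = W ai p q (W n p q T)"
proof -
 note [simp] = r[THEN rp_hom, unfolded hom_def wd_tens jn_def] ev_arrow[OF dual_sorts_UH] ev_arrow[OF dual_sorts_sym[OF dual_sorts_UH]]
 note e = ev_Hom[OF pairings(1)]
 have rh: "rh : Hom V (U >< V)" and nv: "nv : Hom (V >< H) V" and ai: "Phi : Hom (H >< V) (V >< H)"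
  using r[THEN rp_Hom] frames3 by (simp_all add: tpx_def)
 note c = conL[OF vV vU vH e(2) rh]
 note n = comp_Hom[OF vT ai nv]
 have "conL V U H (ev' H U) rh = nv oo Phi"
 proof (rule separated_eqI[OF vH vV vV c(1) n])
  fix xi a v assume xi: "linf V xi" and a: "a : carr H" and v: "v : carr V"
  note lU = linear_comp[OF pure_linear2[OF vH vU a] Hom_linear[OF e(2)]]
  have "fpair U V (%f. ev' H U$(pure H U a f)) xi (rh$v) = fpair U V (%f. f a) xi (rh$v)"
   by (rule tensor_linear_eqI[OF vU vV fpair_linear fpair_linear _ Hom_in[OF rh v]])
    (simp_all add: vV vU xi lU pairs_left[OF pairings(1) a] fpair_pure e a)
  then show "xi (conL V U H (ev' H U) rh$(pure H V a v)) = xi ((nv oo Phi)$(pure H V a v))"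
   unfolding c(2)[OF xi v a] using eq[OF v a xi] by (simp add: comp_app[OF ai] pT v a)
 qed
 moreover have "conL V U H (ev' H U) rh = nv oo Phi <->
   (\<forall>p q T. W r p (sH#q) (W (ev sU sH) (sV#p) q T) = W ai p q (W n p q T))"
  unfolding conL_def by (rule rp_eqI, (rule r frames3 evs_rp rulesF)+, simp add: tr_simps)
 ultimately show ?thesis by simp
qed

lemma act_word_F:
 assumes r: "rp vf (lF uf vf) rh r" "rp (lF vf hf) (lF hf vf) ch k" and n: "rp (lF vf hf) vf (actR H V U ch rh) n"
 shows "W n p q T = W r (sH#p) q (W k p (sU#q) (W (ev sH sU) (sV#p) q T))"
proof -
 note [simp] = r[THEN rp_hom, unfolded hom_def wd_tens jn_def] n[THEN rp_hom, unfolded hom_def wd_tens jn_def]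
  ev_arrow[OF dual_sorts_UH] ev_arrow[OF dual_sorts_sym[OF dual_sorts_UH]]
 have "actR H V U ch rh = actR H V U ch rh <->
   (\<forall>p q T. W n p q T = W r (sH#p) q (W k p (sU#q) (W (ev sH sU) (sV#p) q T)))"
  by (rule rp_eqI[OF n], unfold actR_def, (rule r frames3 evs_rp rulesF)+, simp add: tr_simps)
 then show ?thesis by simp
qed

end

lemma twists:
 assumes "vspace H"
 shows "braided_coalgebra H De ep Ps ==> twist_comult De Ps (-2) = linv Ps oo linv Ps oo De & twist_comult De Ps 2 = Ps oo Ps oo De &
   braided_coalgebra H (twist_comult De Ps (-2)) ep Ps"
  and "braided_unital_algebra H m u Ps ==> twist_mult m Ps (-2) = (m oo linv Ps) oo linv Ps & twist_mult m Ps 2 = (m oo Ps) oo Ps &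
   braided_unital_algebra H (twist_mult m Ps (-2)) u Ps"
  and "braided_bialgebra H m u De ep Ps ==>
   braided_bialgebra H (twist_mult m Ps 2) u (twist_comult De Ps (-2)) ep Ps &
   braided_bialgebra H (twist_mult m Ps (-2)) u (twist_comult De Ps 2) ep Ps"
proof -
 have C: "twist_comult De Ps (-2) = linv Ps oo linv Ps oo De & twist_comult De Ps 2 = Ps oo Ps oo De" if "braided_coalgebra H De ep Ps"
 proof -
  have "Ps : Iso (H >< H) (H >< H)" "De : Hom H (H >< H)" using that by (simp_all add: braided_coalgebra_def braiding_def coalgebra_def)
  then show ?thesis using twist_by_two(1,2)[OF vT _ _ assms] by blast
 qed
 have A: "twist_mult m Ps (-2) = (m oo linv Ps) oo linv Ps & twist_mult m Ps 2 = (m oo Ps) oo Ps" if "braided_unital_algebra H m u Ps"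
 proof -
  have "Ps : Iso (H >< H) (H >< H)" "m : Hom (H >< H) H" using that by (simp_all add: braided_unital_algebra_def braided_algebra_def braiding_def algebra_def)
  then show ?thesis using twist_by_two(3,4)[OF vT] by blast
 qed
 show "twist_comult De Ps (-2) = linv Ps oo linv Ps oo De & twist_comult De Ps 2 = Ps oo Ps oo De &
   braided_coalgebra H (twist_comult De Ps (-2)) ep Ps" if "braided_coalgebra H De ep Ps"
  using C[OF that] braided_coalgebra_twist[OF that] braided_coalgebra_twist[of H "linv Ps oo De" ep Ps] by simp
 show "twist_mult m Ps (-2) = (m oo linv Ps) oo linv Ps & twist_mult m Ps 2 = (m oo Ps) oo Ps &
   braided_unital_algebra H (twist_mult m Ps (-2)) u Ps" if "braided_unital_algebra H m u Ps"
  using A[OF that] braided_unital_algebra_twist[OF that] braided_unital_algebra_twist[of H "m oo linv Ps" u Ps] by simp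
 show "braided_bialgebra H (twist_mult m Ps 2) u (twist_comult De Ps (-2)) ep Ps &
   braided_bialgebra H (twist_mult m Ps (-2)) u (twist_comult De Ps 2) ep Ps" if b: "braided_bialgebra H m u De ep Ps"
 proof -
  have "braided_coalgebra H De ep Ps" "braided_unital_algebra H m u Ps" using b by (simp_all add: braided_bialgebra_def)
  note CA = C[OF this(1)] A[OF this(2)]
  show ?thesis using CA braided_bialgebra_twist[OF b] braided_bialgebra_twist[of H "m oo linv Ps" u "Ps oo De" ep Ps]
   braided_bialgebra_twist[of H "m oo Ps" u "linv Ps oo De" ep Ps] by simp
 qed
qed

context duality begin

text \<open>The data are turned into arrows, \<open>double_comodule\<close> is applied to them, and its conclusions are read
as the axioms for V with the new braiding and coaction.\<close>

lemma comodule_T: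
 fixes Ph Ps rh
 defines "ph == induced (Psi2_HV H V U Ph)" and "rh' == induced (rhoR_bq H V U Ps rh)"
 assumes C: "braided_right_comodule H De ep Ps V Ph rh" and U: "unital_dual_subalgebra H De ep Ps U"
  and bij: "bijective (Psi_UU H U Ps)" "bijective (Psi_UH H U Ps)" "bijective (Psi_UV H V U Ph)" "bijective (Psi2_HV H V U Ph)"
  and lands: "lands (rhoR_bq H V U Ps rh)"
 shows "braided_right_comodule H (twist_comult De Ps (-2)) ep Ps V ph rh'"
  and "braided_right_comodule_algebra H m u De ep Ps V mV PsV Ph rh ==> lands (dual_comult H m Ps U) ==>
   braided_right_comodule_algebra H (twist_mult m Ps 2) u (twist_comult De Ps (-2)) ep Ps V mV PsV ph rh'"
proof -
 note tt = tpx_tens[where o' = True]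
 note C' = C[unfolded braided_right_comodule_def]
 have co: "braided_coalgebra H De ep Ps" and lb: "left_braided H Ps V Ph" and rh: "rh : Hom V (V >< H)"
  and cc: "compat_comult1 H V Ph De ep" using C' by blast+
 have br: "braiding H Ps" and De: "De : Hom H (H >< H)" and ep: "ep : Hom H ground" using co by (simp_all add: braided_coalgebra_def coalgebra_def)
 have iPsi: "Ps : Iso (H >< H) (H >< H)" using br by (simp add: braiding_def)
 note lPsi = Iso_Hom[OF linv_Iso(1)[OF vT iPsi]]
 obtain s si a ai t ti k ki g gi where r0: "rp (lT hf hf) (lT hf hf) Ps s" "rp (lT hf hf) (lT hf hf) (linv Ps) si"
  "rp (lT hf vf) (lT vf hf) Ph a" "rp (lT vf hf) (lT hf vf) (linv Ph) ai" "rp (lT hf vf) (lT vf hf) ph k"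
  and iph: "ph : Iso (H >< V) (V >< H)" and dm: "double_mate S pr sU sH sV a ai t ti k ki s si g gi"
  using double_mate_T[OF br lb bij(1,3,4)] unfolding ph_def by metis
 interpret D: double_mate S pr sU sH sV a ai t ti k ki s si g gi by (rule dm)
 note be = mateL[OF pairings(1) pairs_dual[OF vH] lPsi bij(2)[unfolded Psi_UV_def], folded Psi_UV_def]
 obtain b bi where b: "rp (lT uf hf) (lT hf uf) (induced (Psi_UH H U Ps)) b" "rp (lT hf uf) (lT uf hf) (linv (induced (Psi_UH H U Ps))) bi"
  "b >> bi = ida (wd (lT uf hf))" using iso_arrow[OF tt[OF frames3(3,1)] tt[OF frames3(1,3)] be(1)] by metis
 have lb': "linv (induced (Psi_UH H U Ps)) : Hom (H >< U) (U >< H)" by (rule Iso_Hom[OF linv_Iso(1)[OF vT be(1)]])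
 note rq = rhoR_bq[OF vV pairings(2,1) lb' rh lands, folded rh'_def]
 obtain d where d: "rp hf (lT hf hf) De d" by (rule hom_arrow[OF frames3(1) tt[OF frames3(1,1)] De])
 obtain c where c: "rp hf fG ep c" by (rule hom_arrow[OF frames3(1) tpx_fG ep])
 obtain r where r: "rp vf (lT vf hf) rh r" by (rule hom_arrow[OF frames3(2) tt[OF frames3(2,1)] rh])
 obtain r' where r': "rp vf (lT vf hf) rh' r'" by (rule hom_arrow[OF frames3(2) tt[OF frames3(2,1)] rq(1)])
 obtain my where my: "my : Hom (U >< U) U" "!!f g a. f : carr U ==> g : carr U ==> a : carr H ==> (my$(pure U U f g)) a = fpair H H g f (linv Ps$(De$a))"
  using dual_mult[OF pairings(1) lPsi refl De U] by blast
 obtain mu where mu: "rp (lT uf uf) uf my mu" by (rule hom_arrow[OF tt[OF frames3(3,3)] frames3(3) my(1)])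
 have eU: "app ep : carr U" using U by (simp add: unital_dual_subalgebra_def)
 obtain et where et: "rp fG uf (pto U (app ep)) et" by (rule hom_arrow[OF tpx_fG frames3(3) pto_Hom[OF vU eU]])
 note hs = r0[THEN rp_hom] b(1,2)[THEN rp_hom] d[THEN rp_hom] c[THEN rp_hom] r[THEN rp_hom] r'[THEN rp_hom] mu[THEN rp_hom] et[THEN rp_hom]
 note homs = hs[unfolded wd_tens jn_def words3, simplified]
 have tmu: "transp sU sH mu (d >> si)" by (rule UH.transp_21[OF mu rp_comp[OF r0(2) d]]) (simp add: my(2) comp_app[OF De])
 have tet: "transp sU sH et c" by (rule UH.transp_01[OF et c]) (simp add: pto_app scal_one[OF vU])
 have bm: "W b p (sH#q) (W (ev sU sH) (sH#p) q T) = W si (sU#p) q (W (ev sU sH) p (sH#q) T)" for p q T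
  by (rule UH.mate_T[OF frames3(1) words3(1) b(1) r0(2)]) (rule be(2))
 interpret D: double_comodule S pr sU sH sV a ai t ti k ki s si g gi r r' d c mu et b bi
 proof (intro double_comodule.intro[OF dm] double_comodule_axioms.intro)
  show "comult_slides a d sV sH p q T" for p q T using comult_T[OF d r0(3)] cc by (simp add: compat_comult1_def)
  show "counit_slides a c sV p q T" for p q T using counit_T[OF c r0(3)] cc by (simp add: compat_comult1_def)
  show "coact_coassoc r sH d sV p q T" for p q T using coassoc_T[OF d r] C' by blast
  show "coact_counital r c sV p q T" for p q T using coact_counit_T[OF c r] C' by blast
  show "coact_braids a r sH s sV p q T" for p q T using coact_braid_T[OF r0(1,3) r] C' by blast
  show "transported r' sU (ev sH sU) sV r bi (ev sU sH) p q T" for p q T by (rule coact_twisted_T[OF r r' b(2)]) (rule rq(2))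
  show "b >> bi = ida [sU, sH]" using b(3) by (simp add: wd_tens jn_def words3)
 qed (rule homs tmu tet bm)+
 note tw = twists[OF vH]
 have d'': "rp hf (lT hf hf) (twist_comult De Ps (-2)) ((d >> si) >> si)" using rp_comp[OF r0(2) rp_comp[OF r0(2) d]] tw(1)[OF co] by simp
 have lb2: "left_braided H Ps V ph" unfolding left_braided_def using vV iph braid_T[OF r0(1,5)] D.braid'' by blast
 have cc2: "compat_comult1 H V ph (twist_comult De Ps (-2)) ep"
  unfolding compat_comult1_def using comult_T[OF d'' r0(5)] counit_T[OF c r0(5)] D.comult'' D.counit'' by blast
 show com: "braided_right_comodule H (twist_comult De Ps (-2)) ep Ps V ph rh'" unfolding braided_right_comodule_def
  using tw(1)[OF co] lb2 cc2 rq(1) coassoc_T[OF d'' r'] coact_counit_T[OF c r'] coact_braid_T[OF r0(1,5) r'] D.coassoc'' D.coact_counit'' D.coact_braid'' by blast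
 assume A: "braided_right_comodule_algebra H m u De ep Ps V mV PsV Ph rh" and ld: "lands (dual_comult H m Ps U)"
 note A' = A[unfolded braided_right_comodule_algebra_def]
 have bb: "braided_bialgebra H m u De ep Ps" and bV: "braided_algebra V mV PsV" and cm: "compat_mult1 H V Ph m"
  and cV: "compat_mult2 H V Ph mV" and rm: "!!e. is_unit V mV e ==> rh$e = (pure V H e u)" using A' by blast+
 have ba: "braided_unital_algebra H m u Ps" using bb by (simp add: braided_bialgebra_def)
 then have m: "m : Hom (H >< H) H" and uu: "is_unit H m u" by (simp_all add: braided_unital_algebra_def braided_algebra_def algebra_def)
 have u: "u : carr H" using uu by (simp add: is_unit_def)
 have mV: "mV : Hom (V >< V) V" using bV by (simp add: braided_algebra_def algebra_def)
 note de = dual_comult[OF pairings(1) Iso_Hom[OF iPsi] m ld]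
 obtain mm where mm: "rp (lT hf hf) hf m mm" by (rule hom_arrow[OF tt[OF frames3(1,1)] frames3(1) m])
 obtain un where un: "rp fG hf (pto H u) un" by (rule hom_arrow[OF tpx_fG frames3(1) pto_Hom[OF vH u]])
 obtain n where n: "rp (lT vf vf) vf mV n" by (rule hom_arrow[OF tt[OF frames3(2,2)] frames3(2) mV])
 obtain dd where dd: "rp uf (lT uf uf) (induced (dual_comult H m Ps U)) dd" by (rule hom_arrow[OF frames3(3) tt[OF frames3(3,3)] de(1)])
 obtain eu where eu: "rp uf fG (mk U ground (%f. f u)) eu" by (rule hom_arrow[OF frames3(3) tpx_fG mk_Hom[OF vU pairs_left[OF pairings(1) u]]])
 note hs = mm[THEN rp_hom] un[THEN rp_hom] n[THEN rp_hom] dd[THEN rp_hom] eu[THEN rp_hom]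
 note homs = hs[unfolded wd_tens jn_def words3, simplified]
 have tde: "transp sU sH dd (s >> mm)" by (rule UH.transp_12[OF dd rp_comp[OF mm r0(1)]]) (simp add: de(2) comp_app[OF Iso_Hom[OF iPsi]] pT)
 have teu: "transp sU sH eu un" by (rule UH.transp_10[OF eu un]) (simp add: mk_app pto_app scal_one[OF vH])
 interpret D: double_comodule_algebra S pr sU sH sV a ai t ti k ki s si g gi r r' d c mu et b bi mm un n dd eu
 proof (intro double_comodule_algebra.intro[OF D.double_comodule_axioms] double_comodule_algebra_axioms.intro)
  show "mult_slides mm sV a sH p q T" for p q T using mult_T[OF mm r0(3)] cm by (simp add: compat_mult1_def)
  show "unit_slides un sV a p q T" for p q T using unit_T[OF u un r0(3)] cm uu by (simp add: compat_mult1_def)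
  show "multV_slides n sH a sV p q T" for p q T using multV_T[OF n r0(3)] cV by (simp add: compat_mult2_def)
  show "coact_multiplicative n r sV sH a mm p q T" for p q T using coact_mult_T[OF mm r0(3) n r] A' by blast
 qed (rule homs tde teu)+
 have m'': "rp (lT hf hf) hf (twist_mult m Ps 2) (s >> (s >> mm))" using rp_comp[OF rp_comp[OF mm r0(1)] r0(1)] tw(2)[OF ba] by simp
 note bb2 = tw(3)[OF bb]
 have uu2: "is_unit H (twist_mult m Ps 2) u" using bb2 by (simp add: braided_bialgebra_def braided_unital_algebra_def)
 have cm2: "compat_mult1 H V ph (twist_mult m Ps 2)" unfolding compat_mult1_def
  using mult_T[OF m'' r0(5)] D.mult'' unit_T[OF u un r0(5)] D.unit'' is_unit_unique[OF uu2] by blast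
 have unitV: "(\<forall>w\<in>carr H. ph$(pure H V w e) = (pure V H e w)) & rh'$e = (pure V H e u)" if e: "is_unit V mV e" for e
 proof -
  have eV: "e : carr V" using e by (simp add: is_unit_def)
  obtain j where j: "rp fG vf (pto V e) j" by (rule hom_arrow[OF tpx_fG frames3(2) pto_Hom[OF vV eV]])
  have jh: "hom j [] [sV]" using j[THEN rp_hom] by (simp add: words3)
  have j1: "unitV_slides j sH a p q T" for p q T using unitV_T[OF eV j r0(3)] cV e by (simp add: compat_mult2_def)
  have j2: "W j p q (W r p q T) = W j p q (W un (sV#p) q T)" for p q T using coact_unit_T[OF u eV un j r] rm[OF e] by blast
  show ?thesis using unitV_T[OF eV j r0(5)] D.unitV''[OF jh j1] coact_unit_T[OF u eV un j r'] D.coact_unit''[OF jh j1 j2] by blast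
 qed
 have cV2: "compat_mult2 H V ph mV" unfolding compat_mult2_def using multV_T[OF n r0(5)] D.multV'' unitV by blast
 show "braided_right_comodule_algebra H (twist_mult m Ps 2) u (twist_comult De Ps (-2)) ep Ps V mV PsV ph rh'"
  unfolding braided_right_comodule_algebra_def using bb2 bV lb2 cm2 cV2 cc2 com coact_mult_T[OF m'' r0(5) n r'] D.coact_mult'' unitV by blast
qed

lemma module_T:
 fixes Ph Ps nv and Z :: "('k, 'v => 'k) vs"
 defines "ph == induced (Psi2_HV H V U Ph)" and "nv' == induced (nuL_bq H V U Z Ph nv)"
 assumes C: "braided_left_module H m u Ps V Ph nv"
  and bij: "bijective (Psi_UU H U Ps)" "bijective (Psi_UV H V U Ph)" "bijective (Psi2_HV H V U Ph)"
  and ld: "lands (dual_comult H m Ps U)" and lands: "lands (rhoR_of H V U Ph nv)"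
  and Z: "subspace_of Z (dual V)" "nondegenerate Z V" "bijective (Psi2_WH H V U Z Ph)"
 shows "lands (nuL_bq H V U Z Ph nv)" and "braided_left_module H (twist_mult m Ps (-2)) u Ps V ph nv'"
  and "braided_left_module_algebra H m u De ep Ps V mV PsV Ph nv ==> unital_dual_subalgebra H De ep Ps U ==>
   braided_left_module_algebra H (twist_mult m Ps (-2)) u (twist_comult De Ps 2) ep Ps V mV PsV ph nv'"
proof -
 note tt = tpx_tens[where o' = True]
 note C' = C[unfolded braided_left_module_def]
 have ba: "braided_unital_algebra H m u Ps" and lb: "left_braided H Ps V Ph" and nv: "nv : Hom (H >< V) V"
  and cm: "compat_mult1 H V Ph m" using C' by blast+
 have br: "braiding H Ps" and m: "m : Hom (H >< H) H" and uu: "is_unit H m u"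
  using ba by (simp_all add: braided_unital_algebra_def braided_algebra_def algebra_def)
 have u: "u : carr H" using uu by (simp add: is_unit_def)
 have iPsi: "Ps : Iso (H >< H) (H >< H)" using br by (simp add: braiding_def)
 note lPsi = Iso_Hom[OF linv_Iso(1)[OF vT iPsi]]
 have "Ph : Iso (H >< V) (V >< H)" using lb by (simp add: left_braided_def)
 note lPhi = Iso_Hom[OF linv_Iso(1)[OF vT this]]
 obtain s si a ai t ti k ki g gi where r0: "rp (lT hf hf) (lT hf hf) Ps s" "rp (lT hf hf) (lT hf hf) (linv Ps) si"
  "rp (lT hf vf) (lT vf hf) Ph a" "rp (lT vf hf) (lT hf vf) (linv Ph) ai" "rp (lT hf vf) (lT vf hf) ph k"
  and iph: "ph : Iso (H >< V) (V >< H)" and dm: "double_mate S pr sU sH sV a ai t ti k ki s si g gi"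
  using double_mate_T[OF br lb bij] unfolding ph_def by metis
 interpret D: double_mate S pr sU sH sV a ai t ti k ki s si g gi by (rule dm)
 define rh where "rh = induced (rhoR_of H V U Ph nv)"
 note ro = rhoR_of[OF vV pairings(1) lPhi nv lands, folded rh_def]
 note pZ = pairs_sub(1)[OF vV Z(1)] pairs_sub(2)[OF vV Z(1,2)]
 note om = mateL[OF pZ(1) pairings(2) Iso_Hom[OF iph, unfolded ph_def] Z(3)[unfolded Psi2_WH_def], folded Psi2_WH_def ph_def]
 have om2: "fpair H Z f (%e'. e' v) (induced (Psi2_WH H V U Z Ph)$(pure Z H e a)) = fpair V H e f (ph$(pure H V a v))"
  if "e : carr Z" "a : carr H" "v : carr V" "f : carr U" for e a v f by (rule om(2)[OF that(1,2,3) pairs_right[OF pairings(1) that(4)]])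
 note nu = nuL_bq[OF vV pairings(1) pZ lPhi nv ro(1) Iso_Hom[OF iph] Iso_Hom[OF om(1)] ro(2) om2, folded nv'_def]
 show "lands (nuL_bq H V U Z Ph nv)" by (rule nu(1))
 have nv': "nv' : Hom (H >< V) V" using nu(2,3) by simp
 note de = dual_comult[OF pairings(1) Iso_Hom[OF iPsi] m ld]
 obtain mm where mm: "rp (lT hf hf) hf m mm" by (rule hom_arrow[OF tt[OF frames3(1,1)] frames3(1) m])
 obtain un where un: "rp fG hf (pto H u) un" by (rule hom_arrow[OF tpx_fG frames3(1) pto_Hom[OF vH u]])
 obtain r where r: "rp vf (lT vf uf) rh r" by (rule hom_arrow[OF frames3(2) tt[OF frames3(2,3)] ro(1)])
 obtain nn where nn: "rp (lT hf vf) vf nv nn" by (rule hom_arrow[OF tt[OF frames3(1,2)] frames3(2) nv])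
 obtain nn' where nn': "rp (lT hf vf) vf nv' nn'" by (rule hom_arrow[OF tt[OF frames3(1,2)] frames3(2) nv'])
 obtain dd where dd: "rp uf (lT uf uf) (induced (dual_comult H m Ps U)) dd" by (rule hom_arrow[OF frames3(3) tt[OF frames3(3,3)] de(1)])
 obtain eu where eu: "rp uf fG (mk U ground (%f. f u)) eu" by (rule hom_arrow[OF frames3(3) tpx_fG mk_Hom[OF vU pairs_left[OF pairings(1) u]]])
 note hs = mm[THEN rp_hom] un[THEN rp_hom] r[THEN rp_hom] nn[THEN rp_hom] nn'[THEN rp_hom] dd[THEN rp_hom] eu[THEN rp_hom]
 note homs = hs[unfolded wd_tens jn_def words3, simplified]
 have tde: "transp sU sH dd (s >> mm)" by (rule UH.transp_12[OF dd rp_comp[OF mm r0(1)]]) (simp add: de(2) comp_app[OF Iso_Hom[OF iPsi]] pT)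
 have teu: "transp sU sH eu un" by (rule UH.transp_10[OF eu un]) (simp add: mk_app pto_app scal_one[OF vH])
 interpret D: double_module S pr sU sH sV a ai t ti k ki s si g gi nn r mm un dd eu
 proof (intro double_module.intro[OF dm] double_module_axioms.intro)
  show "act_braids nn sH a s sV p q T" for p q T using act_braid_T[OF r0(1,3) nn] C' by blast
  show "mult_slides mm sV a sH p q T" for p q T using mult_T[OF mm r0(3)] cm by (simp add: compat_mult1_def)
  show "unit_slides un sV a p q T" for p q T using unit_T[OF u un r0(3)] cm uu by (simp add: compat_mult1_def)
  show "act_assoc nn sH mm sV p q T" for p q T using act_assoc_T[OF mm nn] C' by blast
  show "act_unital un sV nn p q T" for p q T using act_unit_T[OF u un nn] C' by blast
  show "W r p (sH#q) (W (ev sU sH) (sV#p) q T) = W ai p q (W nn p q T)" for p q T by (rule coact_of_T[OF r nn r0(4)]) (rule ro(2))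
 qed (rule homs tde teu)+
 have na: "W nn' p q T = W D.A.act p q T" for p q T unfolding D.act_formula by (rule act_word_T[OF r r0(5)]) (use nn' nu(2) in simp)
 note tw = twists[OF vH]
 have m'': "rp (lT hf hf) hf (twist_mult m Ps (-2)) (si >> (si >> mm))" using rp_comp[OF rp_comp[OF mm r0(2)] r0(2)] tw(2)[OF ba] by simp
 have uu2: "is_unit H (twist_mult m Ps (-2)) u" using tw(2)[OF ba] unfolding braided_unital_algebra_def by blast
 have lb2: "left_braided H Ps V ph" unfolding left_braided_def using vV iph braid_T[OF r0(1,5)] D.braid'' by blast
 have cm2: "compat_mult1 H V ph (twist_mult m Ps (-2))" unfolding compat_mult1_def
  using mult_T[OF m'' r0(5)] D.mult'' unit_T[OF u un r0(5)] D.unit'' is_unit_unique[OF uu2] by blast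
 have mod: "\<forall>p q T. act_assoc nn' sH (si >> (si >> mm)) sV p q T"
  "\<forall>p q T. act_unital un sV nn' p q T"
  "\<forall>p q T. act_braids nn' sH k s sV p q T" unfolding na using D.act_assoc'' D.act_unit'' D.act_braid'' by blast+
 show mdl: "braided_left_module H (twist_mult m Ps (-2)) u Ps V ph nv'" unfolding braided_left_module_def
  using tw(2)[OF ba] lb2 cm2 nv' act_assoc_T[OF m'' nn'] act_unit_T[OF u un nn'] act_braid_T[OF r0(1,5) nn'] mod by blast
 assume A: "braided_left_module_algebra H m u De ep Ps V mV PsV Ph nv" and U: "unital_dual_subalgebra H De ep Ps U"
 note A' = A[unfolded braided_left_module_algebra_def]
 have bb: "braided_bialgebra H m u De ep Ps" and bV: "braided_algebra V mV PsV" and cc: "compat_comult1 H V Ph De ep"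
  and cV: "compat_mult2 H V Ph mV" and rm: "!!e. is_unit V mV e ==> \<forall>h\<in>carr H. nv$(pure H V h e) = scal V (ep$h) e" using A' by blast+
 have co: "braided_coalgebra H De ep Ps" using bb by (simp add: braided_bialgebra_def)
 then have De: "De : Hom H (H >< H)" and ep: "ep : Hom H ground" by (simp_all add: braided_coalgebra_def coalgebra_def)
 have mV: "mV : Hom (V >< V) V" using bV by (simp add: braided_algebra_def algebra_def)
 obtain d where d: "rp hf (lT hf hf) De d" by (rule hom_arrow[OF frames3(1) tt[OF frames3(1,1)] De])
 obtain c where c: "rp hf fG ep c" by (rule hom_arrow[OF frames3(1) tpx_fG ep])
 obtain n where n: "rp (lT vf vf) vf mV n" by (rule hom_arrow[OF tt[OF frames3(2,2)] frames3(2) mV])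
 obtain my where my: "my : Hom (U >< U) U" "!!f g a. f : carr U ==> g : carr U ==> a : carr H ==> (my$(pure U U f g)) a = fpair H H g f (linv Ps$(De$a))"
  using dual_mult[OF pairings(1) lPsi refl De U] by blast
 obtain mu where mu: "rp (lT uf uf) uf my mu" by (rule hom_arrow[OF tt[OF frames3(3,3)] frames3(3) my(1)])
 have eU: "app ep : carr U" using U by (simp add: unital_dual_subalgebra_def)
 obtain et where et: "rp fG uf (pto U (app ep)) et" by (rule hom_arrow[OF tpx_fG frames3(3) pto_Hom[OF vU eU]])
 note hs = d[THEN rp_hom] c[THEN rp_hom] n[THEN rp_hom] mu[THEN rp_hom] et[THEN rp_hom]
 note homs = hs[unfolded wd_tens jn_def words3, simplified]
 have tmu: "transp sU sH mu (d >> si)" by (rule UH.transp_21[OF mu rp_comp[OF r0(2) d]]) (simp add: my(2) comp_app[OF De])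
 have tet: "transp sU sH et c" by (rule UH.transp_01[OF et c]) (simp add: pto_app scal_one[OF vU])
 interpret D: double_module_algebra S pr sU sH sV a ai t ti k ki s si g gi nn r mm un dd eu d c n mu et
 proof (intro double_module_algebra.intro[OF D.double_module_axioms] double_module_algebra_axioms.intro)
  show "comult_slides a d sV sH p q T" for p q T using comult_T[OF d r0(3)] cc by (simp add: compat_comult1_def)
  show "counit_slides a c sV p q T" for p q T using counit_T[OF c r0(3)] cc by (simp add: compat_comult1_def)
  show "multV_slides n sH a sV p q T" for p q T using multV_T[OF n r0(3)] cV by (simp add: compat_mult2_def)
  show "act_multiplicative n sH nn d sV a p q T" for p q T using act_mult_T[OF d r0(3) n nn] A' by blast
 qed (rule homs tmu tet)+
 have d'': "rp hf (lT hf hf) (twist_comult De Ps 2) ((d >> s) >> s)" using rp_comp[OF r0(1) rp_comp[OF r0(1) d]] tw(1)[OF co] by simp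
 have cc2: "compat_comult1 H V ph (twist_comult De Ps 2) ep"
  unfolding compat_comult1_def using comult_T[OF d'' r0(5)] counit_T[OF c r0(5)] D.comult'' D.counit'' by blast
 have unitV: "(\<forall>w\<in>carr H. ph$(pure H V w e) = (pure V H e w)) & (\<forall>h\<in>carr H. nv'$(pure H V h e) = scal V (ep$h) e)" if e: "is_unit V mV e" for e
 proof -
  have eV: "e : carr V" using e by (simp add: is_unit_def)
  obtain j where j: "rp fG vf (pto V e) j" by (rule hom_arrow[OF tpx_fG frames3(2) pto_Hom[OF vV eV]])
  have jh: "hom j [] [sV]" using j[THEN rp_hom] by (simp add: words3)
  have j1: "unitV_slides j sH a p q T" for p q T using unitV_T[OF eV j r0(3)] cV e by (simp add: compat_mult2_def)
  have j2: "W j (sH#p) q (W nn p q T) = W c p q (W j p q T)" for p q T using act_unitV_T[OF eV j nn c] rm[OF e] by blast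
  have "\<forall>p q T. W j (sH#p) q (W nn' p q T) = W c p q (W j p q T)" unfolding na using D.act_unitV''[OF jh j1 j2] by blast
  then show ?thesis using unitV_T[OF eV j r0(5)] D.unitV''[OF jh j1] act_unitV_T[OF eV j nn' c] by blast
 qed
 have cV2: "compat_mult2 H V ph mV" unfolding compat_mult2_def using multV_T[OF n r0(5)] D.multV'' unitV by blast
 have am: "\<forall>p q T. act_multiplicative n sH nn' ((d >> s) >> s) sV k p q T" unfolding na using D.act_mult'' by blast
 show "braided_left_module_algebra H (twist_mult m Ps (-2)) u (twist_comult De Ps 2) ep Ps V mV PsV ph nv'" unfolding braided_left_module_algebra_def
  using tw(3)[OF bb] bV lb2 cm2 cV2 cc2 mdl act_mult_T[OF d'' r0(5) n nn'] am unitV by blast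
qed

lemma comodule_F:
 fixes Ph Ps rh
 defines "ph == induced (Psi2_VH H V U Ph)" and "rh' == induced (rhoL_bq H V U Ps rh)"
 assumes C: "braided_left_comodule H De ep Ps V Ph rh" and U: "unital_dual_subalgebra H De ep Ps U"
  and bij: "bijective (Psi_UU H U Ps)" "bijective (Psi_HU H U Ps)" "bijective (Psi_VU H V U Ph)" "bijective (Psi2_VH H V U Ph)"
  and lands: "lands (rhoL_bq H V U Ps rh)"
 shows "braided_left_comodule H (twist_comult De Ps (-2)) ep Ps V ph rh'"
  and "braided_left_comodule_algebra H m u De ep Ps V mV PsV Ph rh ==> lands (dual_comult H m Ps U) ==>
   braided_left_comodule_algebra H (twist_mult m Ps 2) u (twist_comult De Ps (-2)) ep Ps V mV PsV ph rh'"
proof -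
 note tt = tpx_tens[where o' = False]
 note C' = C[unfolded braided_left_comodule_def]
 have co: "braided_coalgebra H De ep Ps" and lb: "right_braided H Ps V Ph" and rh: "rh : Hom V (H >< V)"
  and cc: "compat_comult2 V H Ph De ep" using C' by blast+
 have br: "braiding H Ps" and De: "De : Hom H (H >< H)" and ep: "ep : Hom H ground" using co by (simp_all add: braided_coalgebra_def coalgebra_def)
 have iPsi: "Ps : Iso (H >< H) (H >< H)" using br by (simp add: braiding_def)
 note lPsi = Iso_Hom[OF linv_Iso(1)[OF vT iPsi]]
 obtain s si a ai t ti k ki g gi where r0: "rp (lF hf hf) (lF hf hf) Ps s" "rp (lF hf hf) (lF hf hf) (linv Ps) si"
  "rp (lF vf hf) (lF hf vf) Ph a" "rp (lF hf vf) (lF vf hf) (linv Ph) ai" "rp (lF vf hf) (lF hf vf) ph k"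
  and iph: "ph : Iso (V >< H) (H >< V)" and dm: "double_mate S pr sU sH sV a ai t ti k ki s si g gi"
  using double_mate_F[OF br lb bij(1,3,4)] unfolding ph_def by metis
 interpret D: double_mate S pr sU sH sV a ai t ti k ki s si g gi by (rule dm)
 note be = mateR[OF pairs_dual[OF vH] pairings(1) lPsi bij(2)[unfolded Psi_VU_def], folded Psi_VU_def]
 obtain b bi where b: "rp (lF hf uf) (lF uf hf) (induced (Psi_HU H U Ps)) b" "rp (lF uf hf) (lF hf uf) (linv (induced (Psi_HU H U Ps))) bi"
  "b >> bi = ida (wd (lF hf uf))" using iso_arrow[OF tt[OF frames3(1,3)] tt[OF frames3(3,1)] be(1)] by metis
 have lb': "linv (induced (Psi_HU H U Ps)) : Hom (U >< H) (H >< U)" by (rule Iso_Hom[OF linv_Iso(1)[OF vT be(1)]])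
 note rq = rhoL_bq[OF vV pairings(2,1) lb' rh lands, folded rh'_def]
 obtain d where d: "rp hf (lF hf hf) De d" by (rule hom_arrow[OF frames3(1) tt[OF frames3(1,1)] De])
 obtain c where c: "rp hf fG ep c" by (rule hom_arrow[OF frames3(1) tpx_fG ep])
 obtain r where r: "rp vf (lF hf vf) rh r" by (rule hom_arrow[OF frames3(2) tt[OF frames3(1,2)] rh])
 obtain r' where r': "rp vf (lF hf vf) rh' r'" by (rule hom_arrow[OF frames3(2) tt[OF frames3(1,2)] rq(1)])
 obtain my where my: "my : Hom (U >< U) U" "!!f g a. f : carr U ==> g : carr U ==> a : carr H ==> (my$(pure U U f g)) a = fpair H H g f (linv Ps$(De$a))"
  using dual_mult[OF pairings(1) lPsi refl De U] by blast
 obtain mu where mu: "rp (lF uf uf) uf my mu" by (rule hom_arrow[OF tt[OF frames3(3,3)] frames3(3) my(1)])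
 have eU: "app ep : carr U" using U by (simp add: unital_dual_subalgebra_def)
 obtain et where et: "rp fG uf (pto U (app ep)) et" by (rule hom_arrow[OF tpx_fG frames3(3) pto_Hom[OF vU eU]])
 note hs = r0[THEN rp_hom] b(1,2)[THEN rp_hom] d[THEN rp_hom] c[THEN rp_hom] r[THEN rp_hom] r'[THEN rp_hom] mu[THEN rp_hom] et[THEN rp_hom]
 note homs = hs[unfolded wd_tens jn_def words3, simplified]
 have tmu: "transp sU sH mu (d >> si)" by (rule UH.transp_21[OF mu rp_comp[OF r0(2) d]]) (simp add: my(2) comp_app[OF De])
 have tet: "transp sU sH et c" by (rule UH.transp_01[OF et c]) (simp add: pto_app scal_one[OF vU])
 have bm: "W b p (sH#q) (W (ev sU sH) (sH#p) q T) = W si (sU#p) q (W (ev sU sH) p (sH#q) T)" for p q T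
  by (rule UH.mate_F[OF frames3(1) words3(1) b(1) r0(2)]) (rule be(2))
 interpret D: double_comodule S pr sU sH sV a ai t ti k ki s si g gi r r' d c mu et b bi
 proof (intro double_comodule.intro[OF dm] double_comodule_axioms.intro)
  show "comult_slides a d sV sH p q T" for p q T using comult_F[OF d r0(3)] cc by (simp add: compat_comult2_def)
  show "counit_slides a c sV p q T" for p q T using counit_F[OF c r0(3)] cc by (simp add: compat_comult2_def)
  show "coact_coassoc r sH d sV p q T" for p q T using coassoc_F[OF d r] C' by blast
  show "coact_counital r c sV p q T" for p q T using coact_counit_F[OF c r] C' by blast
  show "coact_braids a r sH s sV p q T" for p q T using coact_braid_F[OF r0(1,3) r] C' by blast
  show "transported r' sU (ev sH sU) sV r bi (ev sU sH) p q T" for p q T by (rule coact_twisted_F[OF r r' b(2)]) (rule rq(2))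
  show "b >> bi = ida [sU, sH]" using b(3) by (simp add: wd_tens jn_def words3)
 qed (rule homs tmu tet bm)+
 note tw = twists[OF vH]
 have d'': "rp hf (lF hf hf) (twist_comult De Ps (-2)) ((d >> si) >> si)" using rp_comp[OF r0(2) rp_comp[OF r0(2) d]] tw(1)[OF co] by simp
 have lb2: "right_braided H Ps V ph" unfolding right_braided_def using vV iph braid_F[OF r0(1,5)] D.braid'' by blast
 have cc2: "compat_comult2 V H ph (twist_comult De Ps (-2)) ep"
  unfolding compat_comult2_def using comult_F[OF d'' r0(5)] counit_F[OF c r0(5)] D.comult'' D.counit'' by blast
 show com: "braided_left_comodule H (twist_comult De Ps (-2)) ep Ps V ph rh'" unfolding braided_left_comodule_def
  using tw(1)[OF co] lb2 cc2 rq(1) coassoc_F[OF d'' r'] coact_counit_F[OF c r'] coact_braid_F[OF r0(1,5) r'] D.coassoc'' D.coact_counit'' D.coact_braid'' by blast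
 assume A: "braided_left_comodule_algebra H m u De ep Ps V mV PsV Ph rh" and ld: "lands (dual_comult H m Ps U)"
 note A' = A[unfolded braided_left_comodule_algebra_def]
 have bb: "braided_bialgebra H m u De ep Ps" and bV: "braided_algebra V mV PsV" and cm: "compat_mult2 V H Ph m"
  and cV: "compat_mult1 V H Ph mV" and rm: "!!e. is_unit V mV e ==> rh$e = (pure H V u e)" using A' by blast+
 have ba: "braided_unital_algebra H m u Ps" using bb by (simp add: braided_bialgebra_def)
 then have m: "m : Hom (H >< H) H" and uu: "is_unit H m u" by (simp_all add: braided_unital_algebra_def braided_algebra_def algebra_def)
 have u: "u : carr H" using uu by (simp add: is_unit_def)
 have mV: "mV : Hom (V >< V) V" using bV by (simp add: braided_algebra_def algebra_def)
 note de = dual_comult[OF pairings(1) Iso_Hom[OF iPsi] m ld]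
 obtain mm where mm: "rp (lF hf hf) hf m mm" by (rule hom_arrow[OF tt[OF frames3(1,1)] frames3(1) m])
 obtain un where un: "rp fG hf (pto H u) un" by (rule hom_arrow[OF tpx_fG frames3(1) pto_Hom[OF vH u]])
 obtain n where n: "rp (lF vf vf) vf mV n" by (rule hom_arrow[OF tt[OF frames3(2,2)] frames3(2) mV])
 obtain dd where dd: "rp uf (lF uf uf) (induced (dual_comult H m Ps U)) dd" by (rule hom_arrow[OF frames3(3) tt[OF frames3(3,3)] de(1)])
 obtain eu where eu: "rp uf fG (mk U ground (%f. f u)) eu" by (rule hom_arrow[OF frames3(3) tpx_fG mk_Hom[OF vU pairs_left[OF pairings(1) u]]])
 note hs = mm[THEN rp_hom] un[THEN rp_hom] n[THEN rp_hom] dd[THEN rp_hom] eu[THEN rp_hom]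
 note homs = hs[unfolded wd_tens jn_def words3, simplified]
 have tde: "transp sU sH dd (s >> mm)" by (rule UH.transp_12[OF dd rp_comp[OF mm r0(1)]]) (simp add: de(2) comp_app[OF Iso_Hom[OF iPsi]] pT)
 have teu: "transp sU sH eu un" by (rule UH.transp_10[OF eu un]) (simp add: mk_app pto_app scal_one[OF vH])
 interpret D: double_comodule_algebra S pr sU sH sV a ai t ti k ki s si g gi r r' d c mu et b bi mm un n dd eu
 proof (intro double_comodule_algebra.intro[OF D.double_comodule_axioms] double_comodule_algebra_axioms.intro)
  show "mult_slides mm sV a sH p q T" for p q T using mult_F[OF mm r0(3)] cm by (simp add: compat_mult2_def)
  show "unit_slides un sV a p q T" for p q T using unit_F[OF u un r0(3)] cm uu by (simp add: compat_mult2_def)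
  show "multV_slides n sH a sV p q T" for p q T using multV_F[OF n r0(3)] cV by (simp add: compat_mult1_def)
  show "coact_multiplicative n r sV sH a mm p q T" for p q T using coact_mult_F[OF mm r0(3) n r] A' by blast
 qed (rule homs tde teu)+
 have m'': "rp (lF hf hf) hf (twist_mult m Ps 2) (s >> (s >> mm))" using rp_comp[OF rp_comp[OF mm r0(1)] r0(1)] tw(2)[OF ba] by simp
 note bb2 = tw(3)[OF bb]
 have uu2: "is_unit H (twist_mult m Ps 2) u" using bb2 by (simp add: braided_bialgebra_def braided_unital_algebra_def)
 have cm2: "compat_mult2 V H ph (twist_mult m Ps 2)" unfolding compat_mult2_def
  using mult_F[OF m'' r0(5)] D.mult'' unit_F[OF u un r0(5)] D.unit'' is_unit_unique[OF uu2] by blast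
 have unitV: "(\<forall>w\<in>carr H. ph$(pure V H e w) = (pure H V w e)) & rh'$e = (pure H V u e)" if e: "is_unit V mV e" for e
 proof -
  have eV: "e : carr V" using e by (simp add: is_unit_def)
  obtain j where j: "rp fG vf (pto V e) j" by (rule hom_arrow[OF tpx_fG frames3(2) pto_Hom[OF vV eV]])
  have jh: "hom j [] [sV]" using j[THEN rp_hom] by (simp add: words3)
  have j1: "unitV_slides j sH a p q T" for p q T using unitV_F[OF eV j r0(3)] cV e by (simp add: compat_mult1_def)
  have j2: "W j p q (W r p q T) = W j p q (W un (sV#p) q T)" for p q T using coact_unit_F[OF u eV un j r] rm[OF e] by blast
  show ?thesis using unitV_F[OF eV j r0(5)] D.unitV''[OF jh j1] coact_unit_F[OF u eV un j r'] D.coact_unit''[OF jh j1 j2] by blast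
 qed
 have cV2: "compat_mult1 V H ph mV" unfolding compat_mult1_def using multV_F[OF n r0(5)] D.multV'' unitV by blast
 show "braided_left_comodule_algebra H (twist_mult m Ps 2) u (twist_comult De Ps (-2)) ep Ps V mV PsV ph rh'"
  unfolding braided_left_comodule_algebra_def using bb2 bV lb2 cm2 cV2 cc2 com coact_mult_F[OF m'' r0(5) n r'] D.coact_mult'' unitV by blast
qed

lemma module_F:
 fixes Ph Ps nv and Z :: "('k, 'v => 'k) vs"
 defines "ph == induced (Psi2_VH H V U Ph)" and "nv' == induced (nuR_bq H V U Z Ph nv)"
 assumes C: "braided_right_module H m u Ps V Ph nv"
  and bij: "bijective (Psi_UU H U Ps)" "bijective (Psi_VU H V U Ph)" "bijective (Psi2_VH H V U Ph)"
  and ld: "lands (dual_comult H m Ps U)" and lands: "lands (rhoL_of H V U Ph nv)"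
  and Z: "subspace_of Z (dual V)" "nondegenerate Z V" "bijective (Psi2_HW H V U Z Ph)"
 shows "lands (nuR_bq H V U Z Ph nv)" and "braided_right_module H (twist_mult m Ps (-2)) u Ps V ph nv'"
  and "braided_right_module_algebra H m u De ep Ps V mV PsV Ph nv ==> unital_dual_subalgebra H De ep Ps U ==>
   braided_right_module_algebra H (twist_mult m Ps (-2)) u (twist_comult De Ps 2) ep Ps V mV PsV ph nv'"
proof -
 note tt = tpx_tens[where o' = False]
 note C' = C[unfolded braided_right_module_def]
 have ba: "braided_unital_algebra H m u Ps" and lb: "right_braided H Ps V Ph" and nv: "nv : Hom (V >< H) V"
  and cm: "compat_mult2 V H Ph m" using C' by blast+
 have br: "braiding H Ps" and m: "m : Hom (H >< H) H" and uu: "is_unit H m u"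
  using ba by (simp_all add: braided_unital_algebra_def braided_algebra_def algebra_def)
 have u: "u : carr H" using uu by (simp add: is_unit_def)
 have iPsi: "Ps : Iso (H >< H) (H >< H)" using br by (simp add: braiding_def)
 note lPsi = Iso_Hom[OF linv_Iso(1)[OF vT iPsi]]
 have "Ph : Iso (V >< H) (H >< V)" using lb by (simp add: right_braided_def)
 note lPhi = Iso_Hom[OF linv_Iso(1)[OF vT this]]
 obtain s si a ai t ti k ki g gi where r0: "rp (lF hf hf) (lF hf hf) Ps s" "rp (lF hf hf) (lF hf hf) (linv Ps) si"
  "rp (lF vf hf) (lF hf vf) Ph a" "rp (lF hf vf) (lF vf hf) (linv Ph) ai" "rp (lF vf hf) (lF hf vf) ph k"
  and iph: "ph : Iso (V >< H) (H >< V)" and dm: "double_mate S pr sU sH sV a ai t ti k ki s si g gi"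
  using double_mate_F[OF br lb bij] unfolding ph_def by metis
 interpret D: double_mate S pr sU sH sV a ai t ti k ki s si g gi by (rule dm)
 define rh where "rh = induced (rhoL_of H V U Ph nv)"
 note ro = rhoL_of[OF vV pairings(1) lPhi nv lands, folded rh_def]
 note pZ = pairs_sub(1)[OF vV Z(1)] pairs_sub(2)[OF vV Z(1,2)]
 note om = mateR[OF pairings(2) pZ(1) Iso_Hom[OF iph, unfolded ph_def] Z(3)[unfolded Psi2_HW_def], folded Psi2_HW_def ph_def]
 have om2: "fpair Z H (%e'. e' v) f (induced (Psi2_HW H V U Z Ph)$(pure H Z a e)) = fpair H V f e (ph$(pure V H v a))"
  if "e : carr Z" "a : carr H" "v : carr V" "f : carr U" for e a v f by (rule om(2)[OF that(2,1,3) pairs_right[OF pairings(1) that(4)]])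
 note nu = nuR_bq[OF vV pairings(1) pZ lPhi nv ro(1) Iso_Hom[OF iph] Iso_Hom[OF om(1)] ro(2) om2, folded nv'_def]
 show "lands (nuR_bq H V U Z Ph nv)" by (rule nu(1))
 have nv': "nv' : Hom (V >< H) V" using nu(2,3) by simp
 note de = dual_comult[OF pairings(1) Iso_Hom[OF iPsi] m ld]
 obtain mm where mm: "rp (lF hf hf) hf m mm" by (rule hom_arrow[OF tt[OF frames3(1,1)] frames3(1) m])
 obtain un where un: "rp fG hf (pto H u) un" by (rule hom_arrow[OF tpx_fG frames3(1) pto_Hom[OF vH u]])
 obtain r where r: "rp vf (lF uf vf) rh r" by (rule hom_arrow[OF frames3(2) tt[OF frames3(3,2)] ro(1)])
 obtain nn where nn: "rp (lF vf hf) vf nv nn" by (rule hom_arrow[OF tt[OF frames3(2,1)] frames3(2) nv])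
 obtain nn' where nn': "rp (lF vf hf) vf nv' nn'" by (rule hom_arrow[OF tt[OF frames3(2,1)] frames3(2) nv'])
 obtain dd where dd: "rp uf (lF uf uf) (induced (dual_comult H m Ps U)) dd" by (rule hom_arrow[OF frames3(3) tt[OF frames3(3,3)] de(1)])
 obtain eu where eu: "rp uf fG (mk U ground (%f. f u)) eu" by (rule hom_arrow[OF frames3(3) tpx_fG mk_Hom[OF vU pairs_left[OF pairings(1) u]]])
 note hs = mm[THEN rp_hom] un[THEN rp_hom] r[THEN rp_hom] nn[THEN rp_hom] nn'[THEN rp_hom] dd[THEN rp_hom] eu[THEN rp_hom]
 note homs = hs[unfolded wd_tens jn_def words3, simplified]
 have tde: "transp sU sH dd (s >> mm)" by (rule UH.transp_12[OF dd rp_comp[OF mm r0(1)]]) (simp add: de(2) comp_app[OF Iso_Hom[OF iPsi]] pT)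
 have teu: "transp sU sH eu un" by (rule UH.transp_10[OF eu un]) (simp add: mk_app pto_app scal_one[OF vH])
 interpret D: double_module S pr sU sH sV a ai t ti k ki s si g gi nn r mm un dd eu
 proof (intro double_module.intro[OF dm] double_module_axioms.intro)
  show "act_braids nn sH a s sV p q T" for p q T using act_braid_F[OF r0(1,3) nn] C' by blast
  show "mult_slides mm sV a sH p q T" for p q T using mult_F[OF mm r0(3)] cm by (simp add: compat_mult2_def)
  show "unit_slides un sV a p q T" for p q T using unit_F[OF u un r0(3)] cm uu by (simp add: compat_mult2_def)
  show "act_assoc nn sH mm sV p q T" for p q T using act_assoc_F[OF mm nn] C' by blast
  show "act_unital un sV nn p q T" for p q T using act_unit_F[OF u un nn] C' by blast
  show "W r p (sH#q) (W (ev sU sH) (sV#p) q T) = W ai p q (W nn p q T)" for p q T by (rule coact_of_F[OF r nn r0(4)]) (rule ro(2))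
 qed (rule homs tde teu)+
 have na: "W nn' p q T = W D.A.act p q T" for p q T unfolding D.act_formula by (rule act_word_F[OF r r0(5)]) (use nn' nu(2) in simp)
 note tw = twists[OF vH]
 have m'': "rp (lF hf hf) hf (twist_mult m Ps (-2)) (si >> (si >> mm))" using rp_comp[OF rp_comp[OF mm r0(2)] r0(2)] tw(2)[OF ba] by simp
 have uu2: "is_unit H (twist_mult m Ps (-2)) u" using tw(2)[OF ba] unfolding braided_unital_algebra_def by blast
 have lb2: "right_braided H Ps V ph" unfolding right_braided_def using vV iph braid_F[OF r0(1,5)] D.braid'' by blast
 have cm2: "compat_mult2 V H ph (twist_mult m Ps (-2))" unfolding compat_mult2_def
  using mult_F[OF m'' r0(5)] D.mult'' unit_F[OF u un r0(5)] D.unit'' is_unit_unique[OF uu2] by blast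
 have mod: "\<forall>p q T. act_assoc nn' sH (si >> (si >> mm)) sV p q T"
  "\<forall>p q T. act_unital un sV nn' p q T"
  "\<forall>p q T. act_braids nn' sH k s sV p q T" unfolding na using D.act_assoc'' D.act_unit'' D.act_braid'' by blast+
 show mdl: "braided_right_module H (twist_mult m Ps (-2)) u Ps V ph nv'" unfolding braided_right_module_def
  using tw(2)[OF ba] lb2 cm2 nv' act_assoc_F[OF m'' nn'] act_unit_F[OF u un nn'] act_braid_F[OF r0(1,5) nn'] mod by blast
 assume A: "braided_right_module_algebra H m u De ep Ps V mV PsV Ph nv" and U: "unital_dual_subalgebra H De ep Ps U"
 note A' = A[unfolded braided_right_module_algebra_def]
 have bb: "braided_bialgebra H m u De ep Ps" and bV: "braided_algebra V mV PsV" and cc: "compat_comult2 V H Ph De ep"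
  and cV: "compat_mult1 V H Ph mV" and rm: "!!e. is_unit V mV e ==> \<forall>h\<in>carr H. nv$(pure V H e h) = scal V (ep$h) e" using A' by blast+
 have co: "braided_coalgebra H De ep Ps" using bb by (simp add: braided_bialgebra_def)
 then have De: "De : Hom H (H >< H)" and ep: "ep : Hom H ground" by (simp_all add: braided_coalgebra_def coalgebra_def)
 have mV: "mV : Hom (V >< V) V" using bV by (simp add: braided_algebra_def algebra_def)
 obtain d where d: "rp hf (lF hf hf) De d" by (rule hom_arrow[OF frames3(1) tt[OF frames3(1,1)] De])
 obtain c where c: "rp hf fG ep c" by (rule hom_arrow[OF frames3(1) tpx_fG ep])
 obtain n where n: "rp (lF vf vf) vf mV n" by (rule hom_arrow[OF tt[OF frames3(2,2)] frames3(2) mV])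
 obtain my where my: "my : Hom (U >< U) U" "!!f g a. f : carr U ==> g : carr U ==> a : carr H ==> (my$(pure U U f g)) a = fpair H H g f (linv Ps$(De$a))"
  using dual_mult[OF pairings(1) lPsi refl De U] by blast
 obtain mu where mu: "rp (lF uf uf) uf my mu" by (rule hom_arrow[OF tt[OF frames3(3,3)] frames3(3) my(1)])
 have eU: "app ep : carr U" using U by (simp add: unital_dual_subalgebra_def)
 obtain et where et: "rp fG uf (pto U (app ep)) et" by (rule hom_arrow[OF tpx_fG frames3(3) pto_Hom[OF vU eU]])
 note hs = d[THEN rp_hom] c[THEN rp_hom] n[THEN rp_hom] mu[THEN rp_hom] et[THEN rp_hom]
 note homs = hs[unfolded wd_tens jn_def words3, simplified]
 have tmu: "transp sU sH mu (d >> si)" by (rule UH.transp_21[OF mu rp_comp[OF r0(2) d]]) (simp add: my(2) comp_app[OF De])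
 have tet: "transp sU sH et c" by (rule UH.transp_01[OF et c]) (simp add: pto_app scal_one[OF vU])
 interpret D: double_module_algebra S pr sU sH sV a ai t ti k ki s si g gi nn r mm un dd eu d c n mu et
 proof (intro double_module_algebra.intro[OF D.double_module_axioms] double_module_algebra_axioms.intro)
  show "comult_slides a d sV sH p q T" for p q T using comult_F[OF d r0(3)] cc by (simp add: compat_comult2_def)
  show "counit_slides a c sV p q T" for p q T using counit_F[OF c r0(3)] cc by (simp add: compat_comult2_def)
  show "multV_slides n sH a sV p q T" for p q T using multV_F[OF n r0(3)] cV by (simp add: compat_mult1_def)
  show "act_multiplicative n sH nn d sV a p q T" for p q T using act_mult_F[OF d r0(3) n nn] A' by blast
 qed (rule homs tmu tet)+
 have d'': "rp hf (lF hf hf) (twist_comult De Ps 2) ((d >> s) >> s)" using rp_comp[OF r0(1) rp_comp[OF r0(1) d]] tw(1)[OF co] by simp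
 have cc2: "compat_comult2 V H ph (twist_comult De Ps 2) ep"
  unfolding compat_comult2_def using comult_F[OF d'' r0(5)] counit_F[OF c r0(5)] D.comult'' D.counit'' by blast
 have unitV: "(\<forall>w\<in>carr H. ph$(pure V H e w) = (pure H V w e)) & (\<forall>h\<in>carr H. nv'$(pure V H e h) = scal V (ep$h) e)" if e: "is_unit V mV e" for e
 proof -
  have eV: "e : carr V" using e by (simp add: is_unit_def)
  obtain j where j: "rp fG vf (pto V e) j" by (rule hom_arrow[OF tpx_fG frames3(2) pto_Hom[OF vV eV]])
  have jh: "hom j [] [sV]" using j[THEN rp_hom] by (simp add: words3)
  have j1: "unitV_slides j sH a p q T" for p q T using unitV_F[OF eV j r0(3)] cV e by (simp add: compat_mult1_def)
  have j2: "W j (sH#p) q (W nn p q T) = W c p q (W j p q T)" for p q T using act_unitV_F[OF eV j nn c] rm[OF e] by blast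
  have "\<forall>p q T. W j (sH#p) q (W nn' p q T) = W c p q (W j p q T)" unfolding na using D.act_unitV''[OF jh j1 j2] by blast
  then show ?thesis using unitV_F[OF eV j r0(5)] D.unitV''[OF jh j1] act_unitV_F[OF eV j nn' c] by blast
 qed
 have cV2: "compat_mult1 V H ph mV" unfolding compat_mult1_def using multV_F[OF n r0(5)] D.multV'' unitV by blast
 have am: "\<forall>p q T. act_multiplicative n sH nn' ((d >> s) >> s) sV k p q T" unfolding na using D.act_mult'' by blast
 show "braided_right_module_algebra H (twist_mult m Ps (-2)) u (twist_comult De Ps 2) ep Ps V mV PsV ph nv'"
  unfolding braided_right_module_algebra_def using tw(3)[OF bb] bV lb2 cm2 cV2 cc2 mdl act_mult_F[OF d'' r0(5) n nn'] am unitV by blast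
qed

end

text \<open>The sum of all subcoalgebras is spanned by functionals on H, so it lies in the dual of H.\<close>

lemma circ_subcoalgebra_dual:
 fixes H :: "('k::field, 'h::ab_group_add) vs"
 assumes H: "vspace H" and U: "circ_subcoalgebra H m u Ps U"
 shows "subspace_of U (dual H)" "lands (dual_comult H m Ps U)"
proof -
 interpret D: vector_space "scal (dual H)" using vspace_dual[OF H] by (simp add: vspace_def)
 have "D.span (\<Union>{carr C | C. dual_coalgebra H m u Ps C}) \<subseteq> carr (dual H)"
  by (rule D.span_minimal) (use vspace_dual[OF H] in \<open>auto simp: dual_coalgebra_def subspace_of_def vspace_def\<close>)
 then show "subspace_of U (dual H)" using U by (auto simp: circ_subcoalgebra_def subspace_of_def circ_dual_def)
 show "lands (dual_comult H m Ps U)" using U by (simp add: circ_subcoalgebra_def)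
qed

theorem corollary5p7:
  fixes H :: "('k::field, 'h::ab_group_add) vs" and V :: "('k, 'v::ab_group_add) vs"
    and U :: "('k, 'h \<Rightarrow> 'k) vs" and W :: "('k, 'v \<Rightarrow> 'k) vs"
    and m :: "('k, ('k, 'h, 'h) tensor, 'h) lmap" and u :: 'h
    and \<Delta> :: "('k, 'h, ('k, 'h, 'h) tensor) lmap" and \<epsilon> :: "('k, 'h, 'k) lmap"
    and \<Psi>\<^sub>H\<^sub>H :: "('k, ('k, 'h, 'h) tensor, ('k, 'h, 'h) tensor) lmap"
    and m\<^sub>V :: "('k, ('k, 'v, 'v) tensor, 'v) lmap"
    and \<Psi>\<^sub>V\<^sub>V :: "('k, ('k, 'v, 'v) tensor, ('k, 'v, 'v) tensor) lmap"
    and \<Psi>\<^sub>H\<^sub>V :: "('k, ('k, 'h, 'v) tensor, ('k, 'v, 'h) tensor) lmap"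
    and \<Psi>\<^sub>V\<^sub>H :: "('k, ('k, 'v, 'h) tensor, ('k, 'h, 'v) tensor) lmap"
    and \<rho>\<^sub>R :: "('k, 'v, ('k, 'v, 'h) tensor) lmap" and \<rho>\<^sub>L :: "('k, 'v, ('k, 'h, 'v) tensor) lmap"
    and \<nu>\<^sub>L :: "('k, ('k, 'h, 'v) tensor, 'v) lmap" and \<nu>\<^sub>R :: "('k, ('k, 'v, 'h) tensor, 'v) lmap"
  shows
    "(\<comment> \<open>(i)\<close>
      braided_coalgebra H \<Delta> \<epsilon> \<Psi>\<^sub>H\<^sub>H \<and> braided_right_comodule H \<Delta> \<epsilon> \<Psi>\<^sub>H\<^sub>H V \<Psi>\<^sub>H\<^sub>V \<rho>\<^sub>R \<and>
      unital_dual_subalgebra H \<Delta> \<epsilon> \<Psi>\<^sub>H\<^sub>H U \<and> nondegenerate U H \<and>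
      bijective (Psi_UU H U \<Psi>\<^sub>H\<^sub>H) \<and> bijective (Psi_UH H U \<Psi>\<^sub>H\<^sub>H) \<and> bijective (Psi_UV H V U \<Psi>\<^sub>H\<^sub>V) \<and>
      bijective (Psi2_HV H V U \<Psi>\<^sub>H\<^sub>V) \<and> lands (rhoR_bq H V U \<Psi>\<^sub>H\<^sub>H \<rho>\<^sub>R)
      \<longrightarrow>
      braided_right_comodule H (twist_comult \<Delta> \<Psi>\<^sub>H\<^sub>H (-2)) \<epsilon> \<Psi>\<^sub>H\<^sub>H
        V (induced (Psi2_HV H V U \<Psi>\<^sub>H\<^sub>V)) (induced (rhoR_bq H V U \<Psi>\<^sub>H\<^sub>H \<rho>\<^sub>R)) \<and>
      (braided_bialgebra H m u \<Delta> \<epsilon> \<Psi>\<^sub>H\<^sub>H \<and>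
       braided_right_comodule_algebra H m u \<Delta> \<epsilon> \<Psi>\<^sub>H\<^sub>H V m\<^sub>V \<Psi>\<^sub>V\<^sub>V \<Psi>\<^sub>H\<^sub>V \<rho>\<^sub>R \<and>
       standard_left_dual H m u \<Delta> \<epsilon> \<Psi>\<^sub>H\<^sub>H U
       \<longrightarrow>
       braided_right_comodule_algebra
         H (twist_mult m \<Psi>\<^sub>H\<^sub>H 2) u (twist_comult \<Delta> \<Psi>\<^sub>H\<^sub>H (-2)) \<epsilon> \<Psi>\<^sub>H\<^sub>H
         V m\<^sub>V \<Psi>\<^sub>V\<^sub>V (induced (Psi2_HV H V U \<Psi>\<^sub>H\<^sub>V)) (induced (rhoR_bq H V U \<Psi>\<^sub>H\<^sub>H \<rho>\<^sub>R))))
     \<and>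
     (\<comment> \<open>(ii)\<close>
      braided_unital_algebra H m u \<Psi>\<^sub>H\<^sub>H \<and> braided_left_module H m u \<Psi>\<^sub>H\<^sub>H V \<Psi>\<^sub>H\<^sub>V \<nu>\<^sub>L \<and>
      circ_subcoalgebra H m u \<Psi>\<^sub>H\<^sub>H U \<and> nondegenerate U H \<and>
      bijective (Psi_UU H U \<Psi>\<^sub>H\<^sub>H) \<and> bijective (Psi_UV H V U \<Psi>\<^sub>H\<^sub>V) \<and>
      lands (rhoR_of H V U \<Psi>\<^sub>H\<^sub>V \<nu>\<^sub>L) \<and> bijective (Psi2_HV H V U \<Psi>\<^sub>H\<^sub>V) \<and>
      subspace_of W (dual V) \<and> nondegenerate W V \<and> bijective (Psi2_WH H V U W \<Psi>\<^sub>H\<^sub>V)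
      \<longrightarrow>
      lands (nuL_bq H V U W \<Psi>\<^sub>H\<^sub>V \<nu>\<^sub>L) \<and>
      braided_left_module H (twist_mult m \<Psi>\<^sub>H\<^sub>H (-2)) u \<Psi>\<^sub>H\<^sub>H
        V (induced (Psi2_HV H V U \<Psi>\<^sub>H\<^sub>V)) (induced (nuL_bq H V U W \<Psi>\<^sub>H\<^sub>V \<nu>\<^sub>L)) \<and>
      (braided_bialgebra H m u \<Delta> \<epsilon> \<Psi>\<^sub>H\<^sub>H \<and>
       braided_left_module_algebra H m u \<Delta> \<epsilon> \<Psi>\<^sub>H\<^sub>H V m\<^sub>V \<Psi>\<^sub>V\<^sub>V \<Psi>\<^sub>H\<^sub>V \<nu>\<^sub>L \<and>
       standard_left_dual H m u \<Delta> \<epsilon> \<Psi>\<^sub>H\<^sub>H U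
       \<longrightarrow>
       braided_left_module_algebra
         H (twist_mult m \<Psi>\<^sub>H\<^sub>H (-2)) u (twist_comult \<Delta> \<Psi>\<^sub>H\<^sub>H 2) \<epsilon> \<Psi>\<^sub>H\<^sub>H
         V m\<^sub>V \<Psi>\<^sub>V\<^sub>V (induced (Psi2_HV H V U \<Psi>\<^sub>H\<^sub>V)) (induced (nuL_bq H V U W \<Psi>\<^sub>H\<^sub>V \<nu>\<^sub>L))))
     \<and>
     (\<comment> \<open>(i')\<close>
      braided_coalgebra H \<Delta> \<epsilon> \<Psi>\<^sub>H\<^sub>H \<and> braided_left_comodule H \<Delta> \<epsilon> \<Psi>\<^sub>H\<^sub>H V \<Psi>\<^sub>V\<^sub>H \<rho>\<^sub>L \<and>
      unital_dual_subalgebra H \<Delta> \<epsilon> \<Psi>\<^sub>H\<^sub>H U \<and> nondegenerate U H \<and>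
      bijective (Psi_UU H U \<Psi>\<^sub>H\<^sub>H) \<and> bijective (Psi_HU H U \<Psi>\<^sub>H\<^sub>H) \<and> bijective (Psi_VU H V U \<Psi>\<^sub>V\<^sub>H) \<and>
      bijective (Psi2_VH H V U \<Psi>\<^sub>V\<^sub>H) \<and> lands (rhoL_bq H V U \<Psi>\<^sub>H\<^sub>H \<rho>\<^sub>L)
      \<longrightarrow>
      braided_left_comodule H (twist_comult \<Delta> \<Psi>\<^sub>H\<^sub>H (-2)) \<epsilon> \<Psi>\<^sub>H\<^sub>H
        V (induced (Psi2_VH H V U \<Psi>\<^sub>V\<^sub>H)) (induced (rhoL_bq H V U \<Psi>\<^sub>H\<^sub>H \<rho>\<^sub>L)) \<and>
      (braided_bialgebra H m u \<Delta> \<epsilon> \<Psi>\<^sub>H\<^sub>H \<and>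
       braided_left_comodule_algebra H m u \<Delta> \<epsilon> \<Psi>\<^sub>H\<^sub>H V m\<^sub>V \<Psi>\<^sub>V\<^sub>V \<Psi>\<^sub>V\<^sub>H \<rho>\<^sub>L \<and>
       standard_right_dual H m u \<Delta> \<epsilon> \<Psi>\<^sub>H\<^sub>H U
       \<longrightarrow>
       braided_left_comodule_algebra
         H (twist_mult m \<Psi>\<^sub>H\<^sub>H 2) u (twist_comult \<Delta> \<Psi>\<^sub>H\<^sub>H (-2)) \<epsilon> \<Psi>\<^sub>H\<^sub>H
         V m\<^sub>V \<Psi>\<^sub>V\<^sub>V (induced (Psi2_VH H V U \<Psi>\<^sub>V\<^sub>H)) (induced (rhoL_bq H V U \<Psi>\<^sub>H\<^sub>H \<rho>\<^sub>L))))
     \<and>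
     (\<comment> \<open>(ii')\<close>
      braided_unital_algebra H m u \<Psi>\<^sub>H\<^sub>H \<and> braided_right_module H m u \<Psi>\<^sub>H\<^sub>H V \<Psi>\<^sub>V\<^sub>H \<nu>\<^sub>R \<and>
      circ_subcoalgebra H m u \<Psi>\<^sub>H\<^sub>H U \<and> nondegenerate U H \<and>
      bijective (Psi_UU H U \<Psi>\<^sub>H\<^sub>H) \<and> bijective (Psi_VU H V U \<Psi>\<^sub>V\<^sub>H) \<and>
      lands (rhoL_of H V U \<Psi>\<^sub>V\<^sub>H \<nu>\<^sub>R) \<and> bijective (Psi2_VH H V U \<Psi>\<^sub>V\<^sub>H) \<and>
      subspace_of W (dual V) \<and> nondegenerate W V \<and> bijective (Psi2_HW H V U W \<Psi>\<^sub>V\<^sub>H)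
      \<longrightarrow>
      lands (nuR_bq H V U W \<Psi>\<^sub>V\<^sub>H \<nu>\<^sub>R) \<and>
      braided_right_module H (twist_mult m \<Psi>\<^sub>H\<^sub>H (-2)) u \<Psi>\<^sub>H\<^sub>H
        V (induced (Psi2_VH H V U \<Psi>\<^sub>V\<^sub>H)) (induced (nuR_bq H V U W \<Psi>\<^sub>V\<^sub>H \<nu>\<^sub>R)) \<and>
      (braided_bialgebra H m u \<Delta> \<epsilon> \<Psi>\<^sub>H\<^sub>H \<and>
       braided_right_module_algebra H m u \<Delta> \<epsilon> \<Psi>\<^sub>H\<^sub>H V m\<^sub>V \<Psi>\<^sub>V\<^sub>V \<Psi>\<^sub>V\<^sub>H \<nu>\<^sub>R \<and>
       standard_right_dual H m u \<Delta> \<epsilon> \<Psi>\<^sub>H\<^sub>H U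
       \<longrightarrow>
       braided_right_module_algebra
         H (twist_mult m \<Psi>\<^sub>H\<^sub>H (-2)) u (twist_comult \<Delta> \<Psi>\<^sub>H\<^sub>H 2) \<epsilon> \<Psi>\<^sub>H\<^sub>H
         V m\<^sub>V \<Psi>\<^sub>V\<^sub>V (induced (Psi2_VH H V U \<Psi>\<^sub>V\<^sub>H)) (induced (nuR_bq H V U W \<Psi>\<^sub>V\<^sub>H \<nu>\<^sub>R))))"
proof (intro conjI impI, goal_cases)
 case 1
  then have "vspace H" "vspace V" "subspace_of U (dual H)" "nondegenerate U H"
   by (simp_all add: braided_right_comodule_def unital_dual_subalgebra_def left_braided_def braided_coalgebra_def coalgebra_def)
  then interpret duality H V U by unfold_locales
  show ?case by (rule comodule_T(1)) (use 1 in blast)+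
next
 case 2
  then have "vspace H" "vspace V" "subspace_of U (dual H)" "nondegenerate U H"
   by (simp_all add: braided_right_comodule_def unital_dual_subalgebra_def left_braided_def braided_coalgebra_def coalgebra_def)
  then interpret duality H V U by unfold_locales
  show ?case by (rule comodule_T(2)) (use 2 in \<open>unfold standard_left_dual_def, blast\<close>)+
next
 case 3
  then have "vspace H" "vspace V" "circ_subcoalgebra H m u \<Psi>\<^sub>H\<^sub>H U" "nondegenerate U H"
   by (simp_all add: braided_left_module_def left_braided_def braided_unital_algebra_def braided_algebra_def algebra_def)
  note U = this(3) circ_subcoalgebra_dual[OF this(1,3)]
  interpret duality H V U using \<open>vspace H\<close> \<open>vspace V\<close> U(2) \<open>nondegenerate U H\<close> by unfold_locales
  show ?case by (rule module_T(1)) (use 3 U in blast)+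
next
 case 4
  then have "vspace H" "vspace V" "circ_subcoalgebra H m u \<Psi>\<^sub>H\<^sub>H U" "nondegenerate U H"
   by (simp_all add: braided_left_module_def left_braided_def braided_unital_algebra_def braided_algebra_def algebra_def)
  note U = this(3) circ_subcoalgebra_dual[OF this(1,3)]
  interpret duality H V U using \<open>vspace H\<close> \<open>vspace V\<close> U(2) \<open>nondegenerate U H\<close> by unfold_locales
  show ?case by (rule module_T(2)) (use 4 U in blast)+
next
 case 5
  then have "vspace H" "vspace V" "circ_subcoalgebra H m u \<Psi>\<^sub>H\<^sub>H U" "nondegenerate U H"
   by (simp_all add: braided_left_module_def left_braided_def braided_unital_algebra_def braided_algebra_def algebra_def)
  note U = this(3) circ_subcoalgebra_dual[OF this(1,3)]
  interpret duality H V U using \<open>vspace H\<close> \<open>vspace V\<close> U(2) \<open>nondegenerate U H\<close> by unfold_locales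
  show ?case by (rule module_T(3)) (use 5 U in \<open>unfold standard_left_dual_def, blast\<close>)+
next
 case 6
  then have "vspace H" "vspace V" "subspace_of U (dual H)" "nondegenerate U H"
   by (simp_all add: braided_left_comodule_def unital_dual_subalgebra_def right_braided_def braided_coalgebra_def coalgebra_def)
  then interpret duality H V U by unfold_locales
  show ?case by (rule comodule_F(1)) (use 6 in blast)+
next
 case 7
  then have "vspace H" "vspace V" "subspace_of U (dual H)" "nondegenerate U H"
   by (simp_all add: braided_left_comodule_def unital_dual_subalgebra_def right_braided_def braided_coalgebra_def coalgebra_def)
  then interpret duality H V U by unfold_locales
  show ?case by (rule comodule_F(2)) (use 7 in \<open>unfold standard_right_dual_def, blast\<close>)+
next
 case 8
  then have "vspace H" "vspace V" "circ_subcoalgebra H m u \<Psi>\<^sub>H\<^sub>H U" "nondegenerate U H"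
   by (simp_all add: braided_right_module_def right_braided_def braided_unital_algebra_def braided_algebra_def algebra_def)
  note U = this(3) circ_subcoalgebra_dual[OF this(1,3)]
  interpret duality H V U using \<open>vspace H\<close> \<open>vspace V\<close> U(2) \<open>nondegenerate U H\<close> by unfold_locales
  show ?case by (rule module_F(1)) (use 8 U in blast)+
next
 case 9
  then have "vspace H" "vspace V" "circ_subcoalgebra H m u \<Psi>\<^sub>H\<^sub>H U" "nondegenerate U H"
   by (simp_all add: braided_right_module_def right_braided_def braided_unital_algebra_def braided_algebra_def algebra_def)
  note U = this(3) circ_subcoalgebra_dual[OF this(1,3)]
  interpret duality H V U using \<open>vspace H\<close> \<open>vspace V\<close> U(2) \<open>nondegenerate U H\<close> by unfold_locales
  show ?case by (rule module_F(2)) (use 9 U in blast)+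
next
 case 10
  then have "vspace H" "vspace V" "circ_subcoalgebra H m u \<Psi>\<^sub>H\<^sub>H U" "nondegenerate U H"
   by (simp_all add: braided_right_module_def right_braided_def braided_unital_algebra_def braided_algebra_def algebra_def)
  note U = this(3) circ_subcoalgebra_dual[OF this(1,3)]
  interpret duality H V U using \<open>vspace H\<close> \<open>vspace V\<close> U(2) \<open>nondegenerate U H\<close> by unfold_locales
  show ?case by (rule module_F(3)) (use 10 U in \<open>unfold standard_right_dual_def, blast\<close>)+
qed

end
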